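(* Let $f\in L^2(\Omega)$ be time-independent and $\frac14\le\alpha<1$. There exists a constant $M_g>0$, independent of the initial data and of the time step $k$, such that for every $k>0$ and all initial data $(\omega^i,q^i)\in H^\alpha_p(\Omega)\times\mathbb R$, $i=0,1$, there is an integer $N_1=N_1(k)$ such that the solution of the mr-SAV-BDF2 scheme for the continuously stratified QG model (see context) satisfies $$\|\nabla V^n\|_G^2\le R_1^2\quad\text{for all } n\ge N_1,\qquad R_1^2:=M_g\big[R_0^{18}+\|f\|^2+1\big],$$ where $V^n=[\omega^n,\omega^{n-1}]^T$.
   Context: $\Omega=[0,2\pi]\times[0,2\pi]\times[0,1]$ with coordinates $(x,y,z)$; constants $\nu>0$, $\gamma>0$, $F>0$, $\beta\in\mathbb R$. $\|\cdot\|$ is the $L^2(\Omega)$ norm. $\nabla_H=[\partial_x,\partial_y]^T$, $\nabla_H^\perp=[\partial_y,-\partial_x]^T$, $\Delta_H=\partial_x^2+\partial_y^2$, $\Delta$ is the full 3D Laplacian. $H^1_{p0}(\Omega)$ is the space of $H^1(\Omega)$ functions that are periodic in $x$ and $y$ and vanish at $z=0,1$; $H^{-1}_p$ is its dual; $H^\alpha_p$ is the fractional Sobolev space $H^\alpha$ of functions on $\Omega$ periodic in $x,y$. To each vorticity $\omega$ corresponds the stream function $\psi$ solving $\omega=-(\Delta_H\psi+F^2\partial_z^2\psi)$, $\psi$ periodic in $x,y$ and $\psi=0$ at $z=0,1$. Scheme (time step $k>0$, $n\ge1$), with $\overline\phi^{n+1}=2\phi^n-\phi^{n-1}$ and $\delta_t\phi^{n+1}=\frac{3\phi^{n+1}-4\phi^n+\phi^{n-1}}{2k}$: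 find $\omega^{n+1}\in H^1_{p0}(\Omega)$, $q^{n+1}\in\mathbb R$ such that $$\delta_t\omega^{n+1}-\nu\Delta\omega^{n+1}+q^{n+1}\big[\nabla_H^\perp\overline\psi^{n+1}\cdot\nabla_H\overline\omega^{n+1}+\beta\,\partial_x\overline\psi^{n+1}\big]=f,$$ $$\delta_tq^{n+1}+\gamma q^{n+1}-\big\langle\nabla_H^\perp\overline\psi^{n+1}\cdot\nabla_H\overline\omega^{n+1}+\beta\,\partial_x\overline\psi^{n+1},\omega^{n+1}\big\rangle=\gamma,$$ the first equation in $H^{-1}_p$, with $\nabla_H^\perp\overline\psi\cdot\nabla_H\overline\omega=\nabla_H\cdot(\nabla_H^\perp\overline\psi\,\overline\omega)\in H^{-1}_p$ and $\langle\cdot,\cdot\rangle$ the $H^{-1}_p$–$H^1_{p0}$ duality. $G$-norm: with $G=\frac14\begin{bmatrix}5&-2\\-2&1\end{bmatrix}$, $\|[v_1,v_2]^T\|_G^2=\frac54\|v_1\|^2-(v_1,v_2)+\frac14\|v_2\|^2$, and $\nabla V^n=[\nabla\omega^n,\nabla\omega^{n-1}]^T$. The constant $R_0$: $R_0^2=C_g\big(\frac{1}{c_0\nu}\|f\|^2+\gamma\big)$, where $c_0$ is the smallest eigenvalue of $-\Delta$ on $H^1_{p0}(\Omega)$ and $C_g=\frac1{b_0}\max\{1,\frac{48}{\mu c_l}\}$ with $\mu=\frac12\min\{c_0\nu,\gamma\}$, $b_0=\min\{1,\frac{\mu c_l}{24}\}$, $c_l$ the inverse of the largest eigenvalue of $G$.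 (With this $R_0$, every solution of the scheme satisfies $\|V^n\|_G^2+|[q^n,q^{n-1}]^T|_G^2\le R_0^2$ for all sufficiently large $n$.) *)

theory Defs
  imports "HOL-Analysis.Analysis"
begin

section \<open>Sobolev spaces on open subsets of three-space\<close>

definition L2 :: "(real^3) set \<Rightarrow> (real^3 \<Rightarrow> 'a::euclidean_space) set" where
  "L2 U = {u. u \<in> borel_measurable (lebesgue_on U) \<and>
              integrable (lebesgue_on U) (\<lambda>p. (norm (u p))\<^sup>2)}"

definition pd :: "3 \<Rightarrow> (real^3 \<Rightarrow> real) \<Rightarrow> real^3 \<Rightarrow> real" where
  "pd i \<phi> p = frechet_derivative \<phi> (at p) (axis i 1)"

primrec Ck :: "nat \<Rightarrow> (real^3 \<Rightarrow> real) \<Rightarrow> bool" where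
  "Ck 0 \<phi> \<longleftrightarrow> continuous_on UNIV \<phi>"
| "Ck (Suc m) \<phi> \<longleftrightarrow> (\<forall>p. \<phi> differentiable (at p)) \<and> (\<forall>i. Ck m (pd i \<phi>))"

definition smooth :: "(real^3 \<Rightarrow> real) \<Rightarrow> bool" where
  "smooth \<phi> \<longleftrightarrow> (\<forall>m. Ck m \<phi>)"

definition test_function :: "(real^3) set \<Rightarrow> (real^3 \<Rightarrow> real) \<Rightarrow> bool" where
  "test_function U \<phi> \<longleftrightarrow>
     smooth \<phi> \<and> compact (closure {p. \<phi> p \<noteq> 0}) \<and> closure {p. \<phi> p \<noteq> 0} \<subseteq> U"

definition weak_pderiv ::
  "(real^3) set \<Rightarrow> 3 \<Rightarrow> (real^3 \<Rightarrow> real) \<Rightarrow> (real^3 \<Rightarrow> real) \<Rightarrow> bool" where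
  "weak_pderiv U i u g \<longleftrightarrow>
     (\<forall>\<phi>. test_function U \<phi> \<longrightarrow>
        (\<integral>p. u p * pd i \<phi> p \<partial>lebesgue_on U) = - (\<integral>p. g p * \<phi> p \<partial>lebesgue_on U))"

definition H1 :: "(real^3) set \<Rightarrow> (real^3 \<Rightarrow> real) set" where
  "H1 U = {u \<in> L2 U. \<forall>i. \<exists>g \<in> L2 U. weak_pderiv U i u g}"

text \<open>The fractional Sobolev (Sobolev--Slobodeckij) space of order \<open>s\<close>, for \<open>0 < s < 1\<close>:
  the Gagliardo seminorm is finite (the exponent is the dimension plus \<open>2 s\<close>).\<close>

definition Hfrac :: "real \<Rightarrow> (real^3) set \<Rightarrow> (real^3 \<Rightarrow> real) set" where
  "Hfrac s U = {u \<in> L2 U.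
     integrable (lebesgue_on U \<Otimes>\<^sub>M lebesgue_on U)
       (\<lambda>(p, p'). (u p - u p')\<^sup>2 / dist p p' powr (3 + 2 * s))}"


section \<open>The periodic channel\<close>

text \<open>The coordinates \<open>x, y, z\<close> of a point \<open>p\<close> are \<open>p $ 1, p $ 2, p $ 3\<close>.
  \<open>Omega\<close> is the interior of the closed box of the model; the boundary is a null set, so all
  integrals agree.\<close>

definition Omega :: "(real^3) set" where
  "Omega = {p. 0 < p $ 1 \<and> p $ 1 < 2 * pi \<and> 0 < p $ 2 \<and> p $ 2 < 2 * pi \<and> 0 < p $ 3 \<and> p $ 3 < 1}"

definition strip :: "(real^3) set" where
  "strip = {p. 0 < p $ 3 \<and> p $ 3 < 1}"

definition slab :: "real \<Rightarrow> (real^3) set" where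
  "slab R = {p \<in> strip. \<bar>p $ 1\<bar> < R \<and> \<bar>p $ 2\<bar> < R}"

text \<open>Periodic functions live on the whole strip, and belong to a periodic Sobolev space if they
  have the Sobolev regularity on every bounded piece of the strip, so that there is no jump across
  the lateral faces of \<open>Omega\<close>. This makes sense for every order, also when there are no traces.\<close>

definition periodic_xy :: "(real^3 \<Rightarrow> real) \<Rightarrow> bool" where
  "periodic_xy u \<longleftrightarrow>
     (AE p in lebesgue_on strip. u (p + axis 1 (2 * pi)) = u p \<and> u (p + axis 2 (2 * pi)) = u p)"

definition H1p :: "(real^3 \<Rightarrow> real) set" where
  "H1p = {u. periodic_xy u \<and> (\<forall>R>0. u \<in> H1 (slab R))}"

definition Hp :: "real \<Rightarrow> (real^3 \<Rightarrow> real) set" where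
  "Hp s = {u. periodic_xy u \<and> (\<forall>R>0. u \<in> Hfrac s (slab R))}"


section \<open>Norms, weak gradients and traces on the box\<close>

definition ip :: "(real^3 \<Rightarrow> 'a::euclidean_space) \<Rightarrow> (real^3 \<Rightarrow> 'a) \<Rightarrow> real" where
  "ip u v = (\<integral>p. u p \<bullet> v p \<partial>lebesgue_on Omega)"

definition L2norm :: "(real^3 \<Rightarrow> 'a::euclidean_space) \<Rightarrow> real" where
  "L2norm u = sqrt (ip u u)"

text \<open>A representative of the weak derivative; it is unique up to null sets.\<close>

definition wpd :: "3 \<Rightarrow> (real^3 \<Rightarrow> real) \<Rightarrow> real^3 \<Rightarrow> real" where
  "wpd i u = (SOME g. g \<in> L2 Omega \<and> weak_pderiv Omega i u g)"

definition grad :: "(real^3 \<Rightarrow> real) \<Rightarrow> real^3 \<Rightarrow> real^3" where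
  "grad u p = (\<chi> i. wpd i u p)"

definition gradH :: "(real^3 \<Rightarrow> real) \<Rightarrow> real^3 \<Rightarrow> real^2" where
  "gradH u p = vector [wpd 1 u p, wpd 2 u p]"

definition gradH_perp :: "(real^3 \<Rightarrow> real) \<Rightarrow> real^3 \<Rightarrow> real^2" where
  "gradH_perp u p = vector [wpd 2 u p, - wpd 1 u p]"

text \<open>\<open>has_trace c u g\<close>: the trace of \<open>u\<close> on the face \<open>z = c\<close> (\<open>c\<close> is \<open>0\<close> or \<open>1\<close>) is \<open>g\<close>. The
  trace operator is the continuous extension to \<open>H1 Omega\<close> of the restriction to the face of
  functions that are smooth up to the boundary.\<close>

definition has_trace :: "real \<Rightarrow> (real^3 \<Rightarrow> real) \<Rightarrow> (real \<times> real \<Rightarrow> real) \<Rightarrow> bool" where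
  "has_trace c u g \<longleftrightarrow>
     (\<exists>\<phi>. (\<forall>m::nat. smooth (\<phi> m)) \<and>
        (\<lambda>m. L2norm (\<lambda>p. \<phi> m p - u p)) \<longlonglongrightarrow> 0 \<and>
        (\<forall>i. (\<lambda>m. L2norm (\<lambda>p. pd i (\<phi> m) p - wpd i u p)) \<longlonglongrightarrow> 0) \<and>
        (\<lambda>m. \<integral>(x, y). (\<phi> m (vector [x, y, c]) - g (x, y))\<^sup>2
               \<partial>lebesgue_on ({0..2 * pi} \<times> {0..2 * pi})) \<longlonglongrightarrow> 0)"

definition H1p0 :: "(real^3 \<Rightarrow> real) set" where
  "H1p0 = {u \<in> H1p. has_trace 0 u (\<lambda>_. 0) \<and> has_trace 1 u (\<lambda>_. 0)}"


section \<open>The scheme\<close>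

text \<open>Elements of the dual of \<open>H1p0\<close> are represented by their action on \<open>\<phi> \<in> H1p0\<close>: an
  \<open>L2\<close> function \<open>g\<close> acts by \<open>ip g \<phi>\<close>, the Laplacian of \<open>u\<close> by \<open>- ip (grad u) (grad \<phi>)\<close>, and
  the horizontal divergence of a field \<open>V\<close> by \<open>divH V \<phi>\<close>.\<close>

definition divH :: "(real^3 \<Rightarrow> real^2) \<Rightarrow> (real^3 \<Rightarrow> real) \<Rightarrow> real" where
  "divH V \<phi> = - ip V (gradH \<phi>)"

definition stream_function :: "real \<Rightarrow> (real^3 \<Rightarrow> real) \<Rightarrow> (real^3 \<Rightarrow> real) \<Rightarrow> bool" where
  "stream_function F w \<psi> \<longleftrightarrow> \<psi> \<in> H1p0 \<and>
     (\<forall>\<phi> \<in> H1p0. ip w \<phi> = ip (gradH \<psi>) (gradH \<phi>) + F\<^sup>2 * ip (wpd 3 \<psi>) (wpd 3 \<phi>))"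

definition advection ::
  "real \<Rightarrow> (real^3 \<Rightarrow> real) \<Rightarrow> (real^3 \<Rightarrow> real) \<Rightarrow> (real^3 \<Rightarrow> real) \<Rightarrow> real" where
  "advection \<beta> \<psi> w \<phi> = divH (\<lambda>p. w p *\<^sub>R gradH_perp \<psi> p) \<phi> + \<beta> * ip (wpd 1 \<psi>) \<phi>"

text \<open>The extrapolation and the difference quotient at time level \<open>n + 1\<close>, for \<open>n \<ge> 1\<close>.\<close>

definition extrap :: "(nat \<Rightarrow> real^3 \<Rightarrow> real) \<Rightarrow> nat \<Rightarrow> real^3 \<Rightarrow> real" where
  "extrap u n p = 2 * u n p - u (n - 1) p"

definition bdf2 :: "real \<Rightarrow> (nat \<Rightarrow> real) \<Rightarrow> nat \<Rightarrow> real" where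
  "bdf2 k a n = (3 * a (n + 1) - 4 * a n + a (n - 1)) / (2 * k)"

definition mr_SAV_BDF2 ::
  "real \<Rightarrow> real \<Rightarrow> real \<Rightarrow> real \<Rightarrow> (real^3 \<Rightarrow> real) \<Rightarrow> real \<Rightarrow>
   (nat \<Rightarrow> real^3 \<Rightarrow> real) \<Rightarrow> (nat \<Rightarrow> real^3 \<Rightarrow> real) \<Rightarrow> (nat \<Rightarrow> real) \<Rightarrow> bool" where
  "mr_SAV_BDF2 \<nu> \<gamma> F \<beta> f k \<omega> \<psi> q \<longleftrightarrow>
     (\<forall>n. stream_function F (\<omega> n) (\<psi> n)) \<and>
     (\<forall>n\<ge>1.
        \<omega> (n + 1) \<in> H1p0 \<and>
        (\<forall>\<phi> \<in> H1p0.
           ip (\<lambda>p. bdf2 k (\<lambda>m. \<omega> m p) n) \<phi>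
           + \<nu> * ip (grad (\<omega> (n + 1))) (grad \<phi>)
           + q (n + 1) * advection \<beta> (extrap \<psi> n) (extrap \<omega> n) \<phi>
           = ip f \<phi>) \<and>
        bdf2 k q n + \<gamma> * q (n + 1)
          - advection \<beta> (extrap \<psi> n) (extrap \<omega> n) (\<omega> (n + 1)) = \<gamma>)"


section \<open>The G-norm and the constants\<close>

definition Gmat :: "real^2^2" where
  "Gmat = (1 / 4) *\<^sub>R vector [vector [5, - 2], vector [- 2, 1]]"

text \<open>The square of the norm of the pair \<open>[v\<^sub>1, v\<^sub>2]\<close> induced by \<open>Gmat\<close>.\<close>

definition Gnorm_sq ::
  "(real^3 \<Rightarrow> 'a::euclidean_space) \<Rightarrow> (real^3 \<Rightarrow> 'a) \<Rightarrow> real" where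
  "Gnorm_sq v\<^sub>1 v\<^sub>2 = 5 / 4 * (L2norm v\<^sub>1)\<^sup>2 - ip v\<^sub>1 v\<^sub>2 + 1 / 4 * (L2norm v\<^sub>2)\<^sup>2"

definition laplace_eigenvalue :: "real \<Rightarrow> bool" where
  "laplace_eigenvalue l \<longleftrightarrow>
     (\<exists>u \<in> H1p0. L2norm u \<noteq> 0 \<and> (\<forall>\<phi> \<in> H1p0. ip (grad u) (grad \<phi>) = l * ip u \<phi>))"

definition c0 :: real where
  "c0 = (LEAST l. laplace_eigenvalue l)"

definition cl :: real where
  "cl = inverse (GREATEST l. \<exists>v. v \<noteq> 0 \<and> Gmat *v v = l *\<^sub>R v)"

definition mu :: "real \<Rightarrow> real \<Rightarrow> real" where
  "mu \<nu> \<gamma> = 1 / 2 * min (c0 * \<nu>) \<gamma>"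

definition b0 :: "real \<Rightarrow> real \<Rightarrow> real" where
  "b0 \<nu> \<gamma> = min 1 (mu \<nu> \<gamma> * cl / 24)"

definition Cg :: "real \<Rightarrow> real \<Rightarrow> real" where
  "Cg \<nu> \<gamma> = 1 / b0 \<nu> \<gamma> * max 1 (48 / (mu \<nu> \<gamma> * cl))"

definition R0 :: "real \<Rightarrow> real \<Rightarrow> (real^3 \<Rightarrow> real) \<Rightarrow> real" where
  "R0 \<nu> \<gamma> f = sqrt (Cg \<nu> \<gamma> * (1 / (c0 * \<nu>) * (L2norm f)\<^sup>2 + \<gamma>))"

end

theory Submission
  imports Defs
begin

text \<open>The scheme is tested with \<open>\<omega>\<^sup>n\<^sup>+\<^sup>1\<close>, where the nonlinear terms of the two equations cancel, and with
  the increment \<open>d = \<omega>\<^sup>n\<^sup>+\<^sup>1 - \<omega>\<^sup>n\<close>, so that no second derivatives of the vorticity are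
  needed. The first choice gives a bounded absorbing set in \<open>L\<^sup>2\<close> and a bound for the gradient on
  average over unit time. In the second, the nonlinear term is at most
  \<open>C (1 + \<parallel>\<nabla>\<omega>\<^sup>n\<parallel>\<^sup>2 + \<parallel>\<nabla>\<omega>\<^sup>n\<^sup>-\<^sup>1\<parallel>\<^sup>2) \<parallel>d\<parallel>\<close>, because the velocity is
  bounded: its Fourier coefficients are summable, as \<open>|\<kappa>|\<^sup>-\<^sup>4\<close> is summable over the
  three-dimensional lattice. A discrete uniform Gronwall argument then bounds the gradient, with a
  constant that depends on \<open>f\<close> but not on \<open>k\<close>. Membership in \<open>H1p0\<close> enters only through
  integration by parts against smooth periodic functions, and the density of the trigonometric basis
  comes from polynomial approximation.\<close>

subsection \<open>Smooth functions\<close>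

text \<open>Testing with the increment costs a term that is quadratic in the gradient: one factor
  bounds the velocity in the supremum norm, the other is the gradient of \<open>\<omega>\<close>
  left after integration by parts. Absorbing the increment squares this bound, so the squared
  gradient \<open>y\<close> may grow at a rate of order \<open>y\<close> itself. This is harmless as
  long as \<open>k * y\<close> has bounded sums over unit time. The obstacle is the two-step
  difference quotient. It produces the squared increments \<open>D\<close> of two consecutive
  levels, and the quantity that satisfies a growth inequality is
  \<open>y + D / (2 * \<nu> * k)\<close>, whose second term has no pointwise bound uniform in
  \<open>k\<close>. Its average over unit time does have one: each \<open>k * y\<close> is bounded
  by the energy of one step, so the source \<open>k\<^sup>2 * y\<^sup>2\<close> of the increments is
  at most a constant times \<open>k * y\<close>, and the sum of \<open>D\<close> over unit time is
  bounded. Averaging then yields a level inside the window from which the growth inequality can be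
  started.\<close>

lemma pd_eqI: "(\<phi> has_derivative f') (at p) \<Longrightarrow> pd i \<phi> p = f' (axis i 1)"
  unfolding pd_def using frechet_derivative_at by metis

lemma differentiable_pd:
  "\<phi> differentiable (at p) \<Longrightarrow> (\<phi> has_derivative frechet_derivative \<phi> (at p)) (at p)"
  by (simp add: frechet_derivative_works)

lemma pd_add:
  assumes "\<phi> differentiable (at p)" "\<theta> differentiable (at p)"
  shows "pd i (\<lambda>p. \<phi> p + \<theta> p) p = pd i \<phi> p + pd i \<theta> p"
  using pd_eqI[OF has_derivative_add[OF differentiable_pd differentiable_pd], OF assms]
  by (simp add: pd_def)

lemma pd_mult:
  assumes "\<phi> differentiable (at p)" "\<theta> differentiable (at p)"
  shows "pd i (\<lambda>p. \<phi> p * \<theta> p) p = \<phi> p * pd i \<theta> p + pd i \<phi> p * \<theta> p"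
  using pd_eqI[OF has_derivative_mult[OF differentiable_pd differentiable_pd], OF assms]
  by (simp add: pd_def)

lemma pd_component:
  fixes a :: "real \<Rightarrow> real" and p :: "real^3"
  assumes "(a has_real_derivative a') (at (p $ j))"
  shows "((\<lambda>p. a (p $ j)) has_derivative (\<lambda>h. a' * h $ j)) (at p)"
    and "pd i (\<lambda>p. a (p $ j)) p = (if i = j then a' else 0)"
proof -
  have "((\<lambda>p. p $ j) has_derivative (\<lambda>h. h $ j)) (at p)"
    by (rule bounded_linear.has_derivative[OF bounded_linear_vec_nth has_derivative_ident])
  from has_derivative_compose[OF this, of a "(*) a'"] assms
  show *: "((\<lambda>p. a (p $ j)) has_derivative (\<lambda>h. a' * h $ j)) (at p)"
    by (simp add: has_field_derivative_def)
  show "pd i (\<lambda>p. a (p $ j)) p = (if i = j then a' else 0)"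
    using pd_eqI[OF *, of i] by (auto simp: axis_def)
qed

text \<open>\<open>Ck\<close> asks for continuity only of the derivatives of the last order, so the
  descent rests on differentiable functions being continuous.\<close>

lemma Ck_SucD: "Ck (Suc m) \<phi> \<Longrightarrow> Ck m \<phi>"
proof (induction m arbitrary: \<phi>)
  case 0
  then show ?case
    by (auto intro!: continuous_at_imp_continuous_on differentiable_imp_continuous_within)
next
  case (Suc m)
  then show ?case by (metis Ck.simps(2))
qed

lemma Ck_const: "Ck m (\<lambda>p. c)"
proof (induction m arbitrary: c)
  case (Suc m)
  have "pd i (\<lambda>p. c) = (\<lambda>p. 0)" for i
    using pd_eqI[OF has_derivative_const] by (intro ext) auto
  then show ?case using Suc by simp
qed simp

lemma Ck_add: "Ck m \<phi> \<Longrightarrow> Ck m \<theta> \<Longrightarrow> Ck m (\<lambda>p. \<phi> p + \<theta> p)"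
proof (induction m arbitrary: \<phi> \<theta>)
  case 0
  then show ?case by (auto intro: continuous_intros)
next
  case (Suc m)
  then have "pd i (\<lambda>p. \<phi> p + \<theta> p) = (\<lambda>p. pd i \<phi> p + pd i \<theta> p)" for i
    by (intro ext pd_add) auto
  then show ?case using Suc by (auto intro!: derivative_intros)
qed

lemma Ck_mult: "Ck m \<phi> \<Longrightarrow> Ck m \<theta> \<Longrightarrow> Ck m (\<lambda>p. \<phi> p * \<theta> p)"
proof (induction m arbitrary: \<phi> \<theta>)
  case 0
  then show ?case by (auto intro: continuous_intros)
next
  case (Suc m)
  then have "pd i (\<lambda>p. \<phi> p * \<theta> p) = (\<lambda>p. \<phi> p * pd i \<theta> p + pd i \<phi> p * \<theta> p)" for i
    by (intro ext pd_mult) auto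
  moreover have "Ck m (\<lambda>p. \<phi> p * pd i \<theta> p + pd i \<phi> p * \<theta> p)" for i
    using Suc.prems Ck_SucD[OF Suc.prems(1)] Ck_SucD[OF Suc.prems(2)]
    by (intro Ck_add Suc.IH) auto
  ultimately show ?case using Suc.prems by (auto intro!: derivative_intros)
qed

lemma smooth_const [simp, intro]: "smooth (\<lambda>p. c)"
  unfolding smooth_def using Ck_const by blast

lemma smooth_add [intro]: "smooth \<phi> \<Longrightarrow> smooth \<theta> \<Longrightarrow> smooth (\<lambda>p. \<phi> p + \<theta> p)"
  unfolding smooth_def using Ck_add by blast

lemma smooth_mult [intro]: "smooth \<phi> \<Longrightarrow> smooth \<theta> \<Longrightarrow> smooth (\<lambda>p. \<phi> p * \<theta> p)"
  unfolding smooth_def using Ck_mult by blast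

lemma smooth_diff [intro]: "smooth \<phi> \<Longrightarrow> smooth \<theta> \<Longrightarrow> smooth (\<lambda>p. \<phi> p - \<theta> p)"
  using smooth_add[of \<phi> "\<lambda>p. (-1) * \<theta> p"] smooth_mult[of "\<lambda>p. -1" \<theta>] by simp

lemma smooth_sum: "(\<And>i. i \<in> A \<Longrightarrow> smooth (\<phi> i)) \<Longrightarrow> smooth (\<lambda>p. \<Sum>i\<in>A. \<phi> i p)"
  by (induction A rule: infinite_finite_induct) auto

lemma smooth_prod: "(\<And>i. i \<in> A \<Longrightarrow> smooth (\<phi> i)) \<Longrightarrow> smooth (\<lambda>p. \<Prod>i\<in>A. \<phi> i p)"
  by (induction A rule: infinite_finite_induct) auto

lemma smooth_differentiable: "smooth \<phi> \<Longrightarrow> \<phi> differentiable (at p)"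
  unfolding smooth_def by (metis Ck.simps(2))

lemma smooth_pd [intro]: "smooth \<phi> \<Longrightarrow> smooth (pd i \<phi>)"
  unfolding smooth_def by (metis Ck.simps(2))

lemma smoothI:
  assumes "\<And>p. \<phi> differentiable (at p)" "\<And>i. smooth (pd i \<phi>)"
  shows "smooth \<phi>"
proof -
  have "Ck (Suc m) \<phi>" for m using assms unfolding smooth_def by simp
  then show ?thesis unfolding smooth_def using Ck_SucD by blast
qed

lemma smooth_continuous: "smooth \<phi> \<Longrightarrow> continuous_on A \<phi>"
  unfolding smooth_def using continuous_on_subset by (metis Ck.simps(1) subset_UNIV)

lemma smooth_pd_simps:
  assumes "smooth \<phi>" "smooth \<theta>"
  shows "pd i (\<lambda>p. \<phi> p + \<theta> p) = (\<lambda>p. pd i \<phi> p + pd i \<theta> p)"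
    and "pd i (\<lambda>p. \<phi> p * \<theta> p) = (\<lambda>p. \<phi> p * pd i \<theta> p + pd i \<phi> p * \<theta> p)"
  by (intro ext pd_add pd_mult smooth_differentiable assms)+

lemma pd_const [simp]: "pd i (\<lambda>p. c) = (\<lambda>p. 0)"
  using pd_eqI[OF has_derivative_const] by (intro ext) auto

lemma pd_cmult: "smooth \<phi> \<Longrightarrow> pd i (\<lambda>p. c * \<phi> p) = (\<lambda>p. c * pd i \<phi> p)"
  by (subst smooth_pd_simps(2)) auto

lemma pd_sum:
  "(\<And>i. i \<in> A \<Longrightarrow> smooth (\<phi> i)) \<Longrightarrow> pd j (\<lambda>p. \<Sum>i\<in>A. \<phi> i p) = (\<lambda>p. \<Sum>i\<in>A. pd j (\<phi> i) p)"
proof (induction A rule: infinite_finite_induct)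
  case (insert x F)
  then show ?case by (simp add: smooth_pd_simps smooth_sum)
qed auto

text \<open>The sequence \<open>D\<close> lists the derivatives of a function of one variable.\<close>

lemma smooth_of_derivs:
  fixes D :: "nat \<Rightarrow> real \<Rightarrow> real"
  assumes "\<And>n x. (D n has_real_derivative D (Suc n) x) (at x)"
  shows "smooth (\<lambda>p. D n (p $ j))"
proof -
  have "Ck m (\<lambda>p. D n (p $ j))" for m
  proof (induction m arbitrary: n)
    case 0
    have "continuous_on UNIV (D n)"
      using assms DERIV_isCont continuous_at_imp_continuous_on by blast
    then show ?case
      by (auto intro!: continuous_on_compose2[of UNIV "D n"] continuous_intros)
  next
    case (Suc m)
    have "pd i (\<lambda>p. D n (p $ j)) = (if i = j then (\<lambda>p. D (Suc n) (p $ j)) else (\<lambda>p. 0))" for i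
      using pd_component(2)[OF assms] by auto
    moreover have "(\<lambda>p. D n (p $ j)) differentiable (at p)" for p
      using pd_component(1)[OF assms] unfolding differentiable_def by blast
    ultimately show ?case using Suc Ck_const by auto
  qed
  then show ?thesis unfolding smooth_def by blast
qed

lemma smooth_of_derivs_affine:
  fixes D :: "nat \<Rightarrow> real \<Rightarrow> real"
  assumes "\<And>n x. (D n has_real_derivative D (Suc n) x) (at x)"
  shows "smooth (\<lambda>p. D n (c * p $ j + d))"
proof -
  have "((\<lambda>x. c ^ n * D n (c * x + d)) has_real_derivative c ^ Suc n * D (Suc n) (c * x + d)) (at x)" for n x
    by (rule DERIV_cong[OF DERIV_cmult[OF DERIV_chain2[OF assms]]])
       (auto intro!: derivative_eq_intros)
  from smooth_of_derivs[of "\<lambda>n x. c ^ n * D n (c * x + d)", OF this, of n j]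
  have "smooth (\<lambda>p. c ^ n * D n (c * p $ j + d))" .
  then have *: "smooth (\<lambda>p. (1 / c ^ n) * (c ^ n * D n (c * p $ j + d)))" by (rule smooth_mult[OF smooth_const])
  \<comment> \<open>The factor \<open>c ^ n\<close> can be divided out only for nonzero
    \<open>c\<close>; for \<open>c = 0\<close> the function is constant.\<close>
  show ?thesis
  proof (cases "c = 0")
    case False
    then show ?thesis using * by simp
  qed auto
qed

section \<open>Smooth bumps and steps of one variable\<close>

definition expflat :: "real poly \<Rightarrow> real \<Rightarrow> real" where
  "expflat q x = (if x > 0 then poly q (1 / x) * exp (- (1 / x)) else 0)"

lemma poly_over_exp_tendsto_0:
  fixes q :: "real poly"
  shows "((\<lambda>t. poly q t * exp (- t)) \<longlongrightarrow> 0) at_top"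
proof -
  have "((\<lambda>t. \<Sum>i\<le>degree q. coeff q i * (t ^ i / exp t)) \<longlongrightarrow> (\<Sum>i\<le>degree q. coeff q i * 0)) at_top"
    by (intro tendsto_intros tendsto_power_div_exp_0)
  then show ?thesis
    by (simp add: poly_altdef sum_distrib_right exp_minus divide_inverse mult.assoc)
qed

text \<open>With \<open>t = 1 / x\<close>, differentiating \<open>q(t) exp(-t)\<close> replaces
  \<open>q\<close> by \<open>t^2 (q - q')\<close>. The family is thus closed under differentiation,
  and iterating this one rule lists all derivatives. At 0 the right difference quotient has the same
  form, with the polynomial \<open>t q(t)\<close>, and tends to 0.\<close>

lemma expflat_deriv:
  "(expflat q has_real_derivative expflat ([:0, 0, 1:] * (q - pderiv q)) x) (at x)"
proof (cases x "0 :: real" rule: linorder_cases)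
  case less
  have "((\<lambda>_. 0) has_real_derivative 0) (at x)" by simp
  moreover have "\<forall>\<^sub>F y in nhds x. expflat q y = 0"
    using eventually_nhds_in_open[of "{..<0}" x] less
    by (auto elim!: eventually_mono simp: expflat_def)
  ultimately show ?thesis using less
    by (subst DERIV_cong_ev[OF refl _ refl, where g = "\<lambda>_. 0"]) (auto simp: expflat_def)
next
  case greater
  have "((\<lambda>x. poly q (1 / x) * exp (- (1 / x))) has_real_derivative
      poly (pderiv q) (1 / x) * (- (1 / x\<^sup>2)) * exp (- (1 / x)) +
      poly q (1 / x) * (exp (- (1 / x)) * (1 / x\<^sup>2))) (at x)"
    using greater
    by (auto intro!: derivative_eq_intros DERIV_chain2[OF poly_DERIV] simp: power2_eq_square)
  moreover have "\<forall>\<^sub>F y in nhds x. expflat q y = poly q (1 / y) * exp (- (1 / y))"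
    using eventually_nhds_in_open[of "{0<..}" x] greater
    by (auto elim!: eventually_mono simp: expflat_def)
  ultimately show ?thesis using greater
    by (subst DERIV_cong_ev[OF refl _ refl, where g = "\<lambda>x. poly q (1 / x) * exp (- (1 / x))"])
       (auto simp: expflat_def power2_eq_square algebra_simps elim!: DERIV_cong)
next
  case equal
  have "((\<lambda>h. expflat q h / h) \<longlongrightarrow> 0) (at_right 0)"
  proof -
    have "((\<lambda>h::real. poly (pCons 0 q) (inverse h) * exp (- inverse h)) \<longlongrightarrow> 0) (at_right 0)"
      by (rule filterlim_compose[OF poly_over_exp_tendsto_0 filterlim_inverse_at_top_right])
    then show ?thesis
      by (rule Lim_transform_eventually)
         (auto simp: eventually_at_filter expflat_def field_simps)
  qed
  moreover have "((\<lambda>h. expflat q h / h) \<longlongrightarrow> 0) (at_left 0)"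
    by (rule tendsto_eventually) (auto simp: eventually_at_filter expflat_def)
  ultimately have "((\<lambda>h. expflat q h / h) \<longlongrightarrow> 0) (at 0)"
    using filterlim_split_at by blast
  then show ?thesis using equal by (simp add: DERIV_def expflat_def)
qed

text \<open>The classical bump \<open>exp (- 1 / x - 1 / (1 - x))\<close> on (0, 1), extended by 0;
  its normalised antiderivative is the smooth step.\<close>

definition ebump :: "real \<Rightarrow> real" where
  "ebump x = expflat 1 x * expflat 1 (1 - x)"

lemma smooth_ebump: "smooth (\<lambda>p. ebump (c * p $ j + d))"
proof -
  define D where "D n = expflat (((\<lambda>q. [:0, 0, 1:] * (q - pderiv q)) ^^ n) 1)" for n
  have D: "(D n has_real_derivative D (Suc n) x) (at x)" for n x
    unfolding D_def using expflat_deriv by simp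
  have "smooth (\<lambda>p. D 0 (c * p $ j + d))" "smooth (\<lambda>p. D 0 ((- c) * p $ j + (1 - d)))"
    by (rule smooth_of_derivs_affine[where D = D and n = 0, OF D])+
  moreover have "(- c) * x + (1 - d) = 1 - (c * x + d)" for x :: real by simp
  ultimately show ?thesis
    unfolding ebump_def D_def by (intro smooth_mult) (simp_all add: algebra_simps)
qed

text \<open>\<open>smooth\<close> speaks only of functions on \<open>real^3\<close>, so the
  smoothness of the one-variable functions is recorded through all compositions with an affine
  function of one coordinate. The derivative \<open>S'\<close> is carried along because the
  derivative of a cutoff appears explicitly in the periodic integration by parts.\<close>

definition smooth_transition :: "(real \<Rightarrow> real) \<Rightarrow> (real \<Rightarrow> real) \<Rightarrow> bool" where
  "smooth_transition S S' \<longleftrightarrow>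
    (\<forall>x. (x \<le> 0 \<longrightarrow> S x = 0) \<and> (x \<ge> 1 \<longrightarrow> S x = 1) \<and> 0 \<le> S x \<and> S x \<le> 1 \<and>
      (S has_real_derivative S' x) (at x) \<and> (x \<le> 0 \<or> x \<ge> 1 \<longrightarrow> S' x = 0)) \<and>
    (\<forall>c d j. smooth (\<lambda>p. S (c * p $ j + d)) \<and> smooth (\<lambda>p. S' (c * p $ j + d)))"

lemma smooth_transitionD:
  assumes "smooth_transition S S'"
  shows "x \<le> 0 \<Longrightarrow> S x = 0" "x \<ge> 1 \<Longrightarrow> S x = 1" "0 \<le> S x" "S x \<le> 1"
    "(S has_real_derivative S' x) (at x)" "x \<le> 0 \<or> x \<ge> 1 \<Longrightarrow> S' x = 0"
    "smooth (\<lambda>p. S (c * p $ j + d))" "smooth (\<lambda>p. S' (c * p $ j + d))"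
  using assms unfolding smooth_transition_def by blast+

lemma smooth_transition_exists: "\<exists>S S'. smooth_transition S S'"
proof -
  have cont: "isCont ebump x" for x
    unfolding ebump_def by (intro isCont_mult DERIV_isCont[OF expflat_deriv]
       isCont_o2[where f="\<lambda>x. 1 - x" and g="expflat 1"] continuous_intros)
  obtain G where G: "\<And>x. (G has_real_derivative ebump x) (at x)"
    using einterval_antiderivative[of "-\<infinity>" "\<infinity>" ebump] cont
    by (auto simp: has_real_derivative_iff_has_vector_derivative)
  have nn: "ebump x \<ge> 0" for x unfolding ebump_def expflat_def by simp
  have z: "ebump x = 0" if "x \<le> 0 \<or> x \<ge> 1" for x using that unfolding ebump_def expflat_def by auto
  have mono: "G a \<le> G b" if "a \<le> b" for a b
    using DERIV_nonneg_imp_nondecreasing[OF that, of G] G nn by blast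
  have lt: "G 0 < G 1"
  proof (rule DERIV_pos_imp_increasing_open[where f = G and a = 0 and b = 1])
    fix x :: real assume "0 < x" "x < 1"
    then show "\<exists>y. (G has_real_derivative y) (at x) \<and> 0 < y"
      using G[of x] by (intro exI[of _ "ebump x"] conjI) (auto simp: ebump_def expflat_def)
  next
    show "continuous_on {0..1} G"
      using G DERIV_isCont continuous_at_imp_continuous_on by blast
  qed simp
  \<comment> \<open>Outside (0, 1) the bump vanishes, so the mean value theorem makes the
    antiderivative constant on each side.\<close>
  have c0: "G x = G 0" if "x \<le> 0" for x
   proof -
    show ?thesis
    proof (cases "x = 0")
      case False
      then have "x < 0" using that by simp
      from MVT2[OF this, of G ebump] G obtain t where "t < 0" "G 0 - G x = (0 - x) * ebump t" by blast
      then show ?thesis using z[of t] by simp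
    qed simp
  qed
  have c1: "G x = G 1" if "x \<ge> 1" for x
  proof (cases "x = 1")
    case False
    then have "1 < x" using that by simp
    from MVT2[OF this, of G ebump] G obtain t where "1 < t" "G x - G 1 = (x - 1) * ebump t" by blast
    then show ?thesis using z[of t] by simp
  qed simp
  define S where "S x = (G x - G 0) / (G 1 - G 0)" for x
  define S' where "S' x = ebump x / (G 1 - G 0)" for x
  have SD: "(S has_real_derivative S' x) (at x)" for x
    unfolding S_def S'_def using lt by (auto intro!: derivative_eq_intros G)
  have sS': "smooth (\<lambda>p. S' (c * p $ j + d))" for c d j
    unfolding S'_def using smooth_mult[OF smooth_ebump smooth_const] by (simp add: divide_inverse)
  have "smooth (\<lambda>p. S (c * p $ j + d))" for c d j
  proof (rule smoothI)
    have D: "((\<lambda>x. S (c * x + d)) has_real_derivative c * S' (c * x + d)) (at x)" for x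
      by (rule DERIV_cong[OF DERIV_chain2[OF SD]]) (auto intro!: derivative_eq_intros)
    show "(\<lambda>p. S (c * p $ j + d)) differentiable (at p)" for p
      using pd_component(1)[OF D] by (auto simp: differentiable_def)
    have "pd i (\<lambda>p. S (c * p $ j + d)) = (if i = j then (\<lambda>p. c * S' (c * p $ j + d)) else (\<lambda>p. 0))" for i
      using pd_component(2)[OF D] by auto
    then show "smooth (pd i (\<lambda>p. S (c * p $ j + d)))" for i
      using sS' by auto
  qed
  moreover have "S x = 0" if "x \<le> 0" for x using c0[OF that] by (simp add: S_def)
  moreover have "S x = 1" if "x \<ge> 1" for x using c1[OF that] lt by (simp add: S_def)
  moreover have "0 \<le> S x" for x
    using mono[of 0 x] c0[of x] lt by (cases "x \<le> 0") (auto simp: S_def)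
  moreover have "S x \<le> 1" for x
    using mono[of x 1] c1[of x] lt by (cases "x \<le> 1") (auto simp: S_def)
  moreover have "S' x = 0" if "x \<le> 0 \<or> x \<ge> 1" for x using z[OF that] by (simp add: S'_def)
  ultimately have "smooth_transition S S'" unfolding smooth_transition_def using SD sS' by blast
  then show ?thesis by blast
qed

subsection \<open>Cutoffs and square integrable functions\<close>

text \<open>The margin \<open>1 / (n + 1)\<close> at both ends is explicit so that supports fit into
  closed boxes inside an open domain. Convergence is pointwise with bound 1, which is what dominated
  convergence asks for.\<close>

definition smooth_cutoff :: "real \<Rightarrow> real \<Rightarrow> (nat \<Rightarrow> real \<Rightarrow> real) \<Rightarrow> bool" where
  "smooth_cutoff a b \<eta> \<longleftrightarrow> (\<forall>n j. smooth (\<lambda>p. \<eta> n (p $ j))) \<and>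
    (\<forall>n t. 0 \<le> \<eta> n t \<and> \<eta> n t \<le> 1 \<and>
      (\<eta> n t \<noteq> 0 \<longrightarrow> a + 1 / real (Suc n) \<le> t \<and> t \<le> b - 1 / real (Suc n))) \<and>
    (\<forall>t. a < t \<and> t < b \<longrightarrow> (\<lambda>n. \<eta> n t) \<longlonglongrightarrow> 1)"

lemma smooth_cutoffD:
  assumes "smooth_cutoff a b \<eta>"
  shows "smooth (\<lambda>p. \<eta> n (p $ j))" "0 \<le> \<eta> n t" "\<eta> n t \<le> 1"
    "\<eta> n t \<noteq> 0 \<Longrightarrow> a + 1 / real (Suc n) \<le> t" "\<eta> n t \<noteq> 0 \<Longrightarrow> t \<le> b - 1 / real (Suc n)"
    "a < t \<Longrightarrow> t < b \<Longrightarrow> (\<lambda>n. \<eta> n t) \<longlonglongrightarrow> 1"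
  using assms unfolding smooth_cutoff_def by blast+

lemma smooth_cutoff_exists: "\<exists>\<eta>. smooth_cutoff a b \<eta>"
proof -
  obtain S S' where "smooth_transition S S'" using smooth_transition_exists by blast
  note S = smooth_transitionD[OF this]
  \<comment> \<open>With \<open>N = n + 1\<close> the factors are \<open>S (N * (t - a) - 1)\<close>
    and \<open>S (N * (b - t) - 1)\<close>: each vanishes up to distance \<open>1 / N\<close> from
    its end and equals 1 from distance \<open>2 / N\<close> on.\<close>
  define \<eta> where "\<eta> n t = S (real (Suc n) * t + (- real (Suc n) * a - 1))
    * S ((- real (Suc n)) * t + (real (Suc n) * b - 1))" for n t
  have "smooth (\<lambda>p. \<eta> n (p $ j))" for n j unfolding \<eta>_def by (intro smooth_mult S)
  moreover have "0 \<le> \<eta> n t" for n t unfolding \<eta>_def using S(3) by simp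
  moreover have "\<eta> n t \<le> 1" for n t unfolding \<eta>_def using S(3,4) by (simp add: mult_le_one)
  moreover have "a + 1 / Suc n \<le> t \<and> t \<le> b - 1 / Suc n" if "\<eta> n t \<noteq> 0" for n t
    proof -
      define x y where "x = real (Suc n) * t + (- real (Suc n) * a - 1)"
        and "y = (- real (Suc n)) * t + (real (Suc n) * b - 1)"
      have "S x \<noteq> 0" "S y \<noteq> 0" using that unfolding \<eta>_def x_def y_def by auto
      then have "x > 0" "y > 0" using S(1) not_less by blast+
      then have *: "1 \<le> (t - a) * real (Suc n)" "1 \<le> (b - t) * real (Suc n)"
        unfolding x_def y_def right_diff_distrib left_diff_distrib
        by (simp_all only: mult.commute[of "real (Suc n)"] mult_minus_left mult_minus_right)
      have "1 / Suc n \<le> t - a" "1 / Suc n \<le> b - t"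
        by (subst pos_divide_le_eq; use * in simp)+
      then show ?thesis by simp
    qed
  moreover have "(\<lambda>n. \<eta> n t) \<longlonglongrightarrow> 1" if t: "a < t" "t < b" for t
    proof (rule tendsto_eventually)
      obtain N :: nat where N: "N > 2 / (t - a)" "N > 2 / (b - t)"
        using reals_Archimedean2[of "max (2 / (t - a)) (2 / (b - t))"] by auto
      have "\<eta> n t = 1" if "n \<ge> N" for n
      proof -
        have "real (Suc n) * (t - a) \<ge> 2"
        proof -
          have "2 \<le> real N * (t - a)" using N(1) t by (simp add: pos_divide_less_eq less_imp_le)
          also have "\<dots> \<le> real (Suc n) * (t - a)" using that t by (intro mult_right_mono) auto
          finally show ?thesis .
        qed
        moreover have "real (Suc n) * (b - t) \<ge> 2"
        proof -
          have "2 \<le> real N * (b - t)" using N(2) t by (simp add: pos_divide_less_eq less_imp_le)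
          also have "\<dots> \<le> real (Suc n) * (b - t)" using that t by (intro mult_right_mono) auto
          finally show ?thesis .
        qed
        ultimately show ?thesis unfolding \<eta>_def
          by (subst (1 2) S(2)) (auto simp: algebra_simps)
      qed
      then show "\<forall>\<^sub>F n in sequentially. \<eta> n t = 1" by (auto simp: eventually_sequentially)
    qed
  ultimately have "smooth_cutoff a b \<eta>" unfolding smooth_cutoff_def by blast
  then show ?thesis by blast
qed

section \<open>The box, the strip and the slabs\<close>

definition side :: "3 \<Rightarrow> real" where
  "side j = (if j = 3 then 1 else 2 * pi)"

lemma Omega_box: "Omega = box 0 (\<chi> j. side j)"
  by (auto simp: Omega_def mem_box_cart side_def forall_3)

lemma Omega_iff: "p \<in> Omega \<longleftrightarrow> (\<forall>j. 0 < p $ j \<and> p $ j < side j)"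
  by (simp add: Omega_box mem_box_cart)

lemma open_Omega: "open Omega" by (simp add: Omega_box open_box)
lemma bounded_Omega: "bounded Omega" by (simp add: Omega_box bounded_box)

lemma open_strip: "open strip"
proof -
  have "strip = (\<lambda>p. p $ 3) -` {0<..<1}" by (auto simp: strip_def)
  then show ?thesis using open_vimage_vec_nth[of "{0<..<1::real}" "3 :: 3"] by simp
qed

lemma slab_iff: "p \<in> slab R \<longleftrightarrow> 0 < p $ 3 \<and> p $ 3 < 1 \<and> \<bar>p $ 1\<bar> < R \<and> \<bar>p $ 2\<bar> < R"
  by (auto simp: slab_def strip_def)

lemma open_slab: "open (slab R)"
proof -
  have *: "slab R = strip \<inter> (\<lambda>p. p $ 1) -` {-R<..<R} \<inter> (\<lambda>p. p $ 2) -` {-R<..<R}"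
    by (auto simp: slab_def abs_less_iff)
  show ?thesis
    unfolding * by (intro open_Int open_strip open_vimage_vec_nth open_greaterThanLessThan)
qed

lemma bounded_slab: "bounded (slab R)"
proof (rule bounded_subset[OF bounded_box])
  show "slab R \<subseteq> box (\<chi> j. if j = 3 then 0 else - R) (\<chi> j. if j = 3 then 1 else R)"
    by (auto simp: slab_iff mem_box_cart forall_3)
qed

text \<open>The radius 16 leaves room beyond one period, which is less than 8, so that cutoffs that
  extend past the face at \<open>2 * pi\<close> are still test functions on this slab.\<close>

lemma Omega_subset_slab: "Omega \<subseteq> slab 16"
proof
  fix p assume "p \<in> Omega"
  then show "p \<in> slab 16" using pi_less_4 by (auto simp: slab_iff Omega_def)
qed

lemma lebesgue_on_open: "open U \<Longrightarrow> U \<in> sets lebesgue" by (simp add: lebesgue_openin)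

lemma continuous_imp_measurable_lebesgue_on:
  fixes f :: "real^3 \<Rightarrow> real"
  assumes "continuous_on UNIV f"
  shows "f \<in> borel_measurable (lebesgue_on U)"
  using assms by (intro measurable_restrict_space1 measurable_completion) (simp add: borel_measurable_continuous_onI)

lemma continuous_bounded_on:
  fixes f :: "real^3 \<Rightarrow> real"
  assumes "continuous_on UNIV f" "bounded U"
  obtains B where "B \<ge> 0" "\<And>p. p \<in> U \<Longrightarrow> \<bar>f p\<bar> \<le> B"
proof -
  have "compact (closure U)" using assms by simp
  then have "compact (f ` closure U)"
    using assms continuous_on_subset by (intro compact_continuous_image) auto
  then have "bounded (f ` closure U)" by (rule compact_imp_bounded)
  then obtain B where B: "\<And>y. y \<in> f ` closure U \<Longrightarrow> norm y \<le> B" by (auto simp: bounded_iff)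
  show ?thesis
  proof (rule that[of "max B 0"])
    show "\<bar>f p\<bar> \<le> max B 0" if "p \<in> U" for p
      using B[of "f p"] that closure_subset[of U] by auto
  qed simp
qed

lemma finite_measure_bounded:
  fixes U :: "(real^3) set"
  assumes "open U" "bounded U" shows "finite_measure (lebesgue_on U)"
  using assms by (intro finite_measure_lebesgue_on bounded_set_imp_lmeasurable) auto

section \<open>Square integrable functions and their inner product\<close>

lemma L2_iff:
  fixes u :: "real^3 \<Rightarrow> real"
  shows "u \<in> L2 U \<longleftrightarrow> u \<in> borel_measurable (lebesgue_on U) \<and> integrable (lebesgue_on U) (\<lambda>p. (u p)\<^sup>2)"
  by (simp add: L2_def)

lemma L2_measurable: "u \<in> L2 U \<Longrightarrow> u \<in> borel_measurable (lebesgue_on U)"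
  by (simp add: L2_def)

lemma L2_mult_integrable:
  fixes u v :: "real^3 \<Rightarrow> real"
  assumes "u \<in> L2 U" "v \<in> L2 U"
  shows "integrable (lebesgue_on U) (\<lambda>p. u p * v p)"
proof (rule Bochner_Integration.integrable_bound)
  show "integrable (lebesgue_on U) (\<lambda>p. (u p)\<^sup>2 + (v p)\<^sup>2)" using assms by (auto simp: L2_iff)
  show "(\<lambda>p. u p * v p) \<in> borel_measurable (lebesgue_on U)" using assms by (auto simp: L2_iff)
  have "\<bar>x * y\<bar> \<le> x\<^sup>2 + y\<^sup>2" for x y :: real
    using sum_squares_bound[of "\<bar>x\<bar>" "\<bar>y\<bar>"] mult_nonneg_nonneg[of "\<bar>x\<bar>" "\<bar>y\<bar>"]
    unfolding abs_mult power2_abs by linarith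
  then show "AE p in lebesgue_on U. norm (u p * v p) \<le> norm ((u p)\<^sup>2 + (v p)\<^sup>2)" by simp
qed

lemma L2_add:
  fixes u v :: "real^3 \<Rightarrow> real"
  assumes "u \<in> L2 U" "v \<in> L2 U" shows "(\<lambda>p. u p + v p) \<in> L2 U"
  using assms L2_mult_integrable[OF assms]
  by (auto simp: L2_iff power2_sum mult.assoc)

lemma L2_cmult:
  fixes u :: "real^3 \<Rightarrow> real"
  assumes "u \<in> L2 U" shows "(\<lambda>p. c * u p) \<in> L2 U"
  using assms by (auto simp: L2_iff power_mult_distrib)

lemma L2_diff:
  fixes u v :: "real^3 \<Rightarrow> real"
  assumes "u \<in> L2 U" "v \<in> L2 U" shows "(\<lambda>p. u p - v p) \<in> L2 U"
  using L2_add[OF assms(1) L2_cmult[OF assms(2), of "-1"]] by simp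

lemma L2_bounded_mult:
  fixes u v :: "real^3 \<Rightarrow> real"
  assumes "u \<in> L2 U" "v \<in> borel_measurable (lebesgue_on U)" "AE p in lebesgue_on U. \<bar>v p\<bar> \<le> B"
  shows "(\<lambda>p. v p * u p) \<in> L2 U"
  unfolding L2_iff
proof
  show m: "(\<lambda>p. v p * u p) \<in> borel_measurable (lebesgue_on U)" using assms by (auto simp: L2_iff)
  have i: "integrable (lebesgue_on U) (\<lambda>p. B\<^sup>2 * (u p)\<^sup>2)" using assms by (auto simp: L2_iff)
  have "AE p in lebesgue_on U. norm ((v p * u p)\<^sup>2) \<le> norm (B\<^sup>2 * (u p)\<^sup>2)"
    using assms(3)
  proof eventually_elim
    case (elim p)
    then have "(v p)\<^sup>2 \<le> B\<^sup>2" using abs_ge_zero by (metis abs_le_square_iff abs_of_nonneg order_trans)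
    then show ?case by (simp add: power_mult_distrib mult_right_mono)
  qed
  then show "integrable (lebesgue_on U) (\<lambda>p. (v p * u p)\<^sup>2)"
    by (rule Bochner_Integration.integrable_bound[OF i borel_measurable_power[OF m]])
qed

lemma L2_one: "open U \<Longrightarrow> bounded U \<Longrightarrow> (\<lambda>p. 1::real) \<in> L2 U"
  using finite_measure_bounded[of U] by (simp add: L2_iff finite_measure.integrable_const)

lemma L2_continuous:
  fixes f :: "real^3 \<Rightarrow> real"
  assumes "continuous_on UNIV f" "open U" "bounded U"
  shows "f \<in> L2 U"
proof -
  obtain B where "\<And>p. p \<in> U \<Longrightarrow> \<bar>f p\<bar> \<le> B" using continuous_bounded_on assms by blast
  then have "AE p in lebesgue_on U. \<bar>f p\<bar> \<le> B" by (intro AE_I2) (auto simp: space_restrict_space)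
  from L2_bounded_mult[OF L2_one[OF assms(2,3)] continuous_imp_measurable_lebesgue_on[OF assms(1)] this]
  show ?thesis by simp
qed

lemma L2_subset:
  fixes u :: "real^3 \<Rightarrow> real"
  assumes "u \<in> L2 V" "U \<subseteq> V" "open U" "open V"
  shows "u \<in> L2 U"
proof -
  have "lebesgue_on U = restrict_space (lebesgue_on V) U"
    using assms by (simp add: restrict_restrict_space Int_absorb1 lebesgue_on_open)
  moreover have "U \<in> sets (lebesgue_on V)"
    using assms by (auto simp: sets_restrict_space_iff lebesgue_on_open)
  ultimately show ?thesis using assms(1) integrable_restrict_space[of U "lebesgue_on V" "\<lambda>p. (u p)\<^sup>2"]
      integrable_mult_indicator[of U "lebesgue_on V" "\<lambda>p. (u p)\<^sup>2"]
    by (auto simp: L2_iff measurable_restrict_space1 space_restrict_space)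
qed

abbreviation "LO \<equiv> lebesgue_on Omega"

lemma ip_real: "ip u v = (\<integral>p. u p * v p \<partial>LO)" for u v :: "real^3 \<Rightarrow> real"
  by (simp add: ip_def)

lemma ip_commute: "ip u v = ip v u"
  by (simp add: ip_def inner_commute)

lemma ip_add_left:
  fixes u v w :: "real^3 \<Rightarrow> real"
  assumes "u \<in> L2 Omega" "v \<in> L2 Omega" "w \<in> L2 Omega"
  shows "ip (\<lambda>p. u p + v p) w = ip u w + ip v w"
  unfolding ip_real using L2_mult_integrable assms by (simp add: distrib_right)

lemma ip_diff_left:
  fixes u v w :: "real^3 \<Rightarrow> real"
  assumes "u \<in> L2 Omega" "v \<in> L2 Omega" "w \<in> L2 Omega"
  shows "ip (\<lambda>p. u p - v p) w = ip u w - ip v w"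
  unfolding ip_real using L2_mult_integrable assms by (simp add: left_diff_distrib)

lemma ip_cmult_left:
  fixes u w :: "real^3 \<Rightarrow> real"
  shows "ip (\<lambda>p. c * u p) w = c * ip u w"
  unfolding ip_real by (simp add: mult.assoc)

lemma ip_sum_left:
  fixes u :: "'i \<Rightarrow> real^3 \<Rightarrow> real"
  assumes "\<And>i. i \<in> A \<Longrightarrow> u i \<in> L2 Omega" "w \<in> L2 Omega"
  shows "ip (\<lambda>p. \<Sum>i\<in>A. u i p) w = (\<Sum>i\<in>A. ip (u i) w)"
  unfolding ip_real sum_distrib_right using L2_mult_integrable assms
  by (intro Bochner_Integration.integral_sum) auto

lemma ip_nonneg: "ip u u \<ge> 0" for u :: "real^3 \<Rightarrow> 'a::euclidean_space"
  unfolding ip_def by simp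

lemma L2norm_sq: "(L2norm u)\<^sup>2 = ip u u"
  by (simp add: L2norm_def ip_nonneg)

lemma L2norm_nonneg: "L2norm u \<ge> 0" by (simp add: L2norm_def ip_nonneg)

lemma ip_square_add:
  fixes u v :: "real^3 \<Rightarrow> real"
  assumes "u \<in> L2 Omega" "v \<in> L2 Omega"
  shows "ip (\<lambda>p. u p + c * v p) (\<lambda>p. u p + c * v p) = ip u u + 2 * c * ip u v + c\<^sup>2 * ip v v"
proof -
  define w where "w = (\<lambda>p. u p + c * v p)"
  have cv: "(\<lambda>p. c * v p) \<in> L2 Omega" using L2_cmult[OF assms(2)] .
  have w: "w \<in> L2 Omega" unfolding w_def by (intro L2_add assms cv)
  have 1: "ip w x = ip u x + c * ip v x" if "x \<in> L2 Omega" for x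
    using ip_add_left[OF assms(1) cv that] unfolding w_def by (simp add: ip_cmult_left)
  have "ip w w = (ip u u + c * ip v u) + c * (ip u v + c * ip v v)"
    using 1[OF w] 1[OF assms(1)] 1[OF assms(2)] ip_commute[of u w] ip_commute[of v w] by simp
  then show ?thesis unfolding w_def using ip_commute[of v u]
    by (simp add: power2_eq_square algebra_simps)
qed

lemma ip_square_diff:
  fixes u v :: "real^3 \<Rightarrow> real"
  assumes "u \<in> L2 Omega" "v \<in> L2 Omega"
  shows "ip (\<lambda>p. u p - v p) (\<lambda>p. u p - v p) = ip u u - 2 * ip u v + ip v v"
  using ip_square_add[OF assms, of "-1"] by simp

lemma ip_Cauchy_Schwarz:
  fixes u v :: "real^3 \<Rightarrow> real"
  assumes "u \<in> L2 Omega" "v \<in> L2 Omega"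
  shows "\<bar>ip u v\<bar> \<le> L2norm u * L2norm v"
proof -
  have q: "0 \<le> ip u u + 2 * c * ip u v + c\<^sup>2 * ip v v" for c
    using ip_nonneg[of "\<lambda>p. u p + c * v p"] ip_square_add[OF assms, of c] by simp
  have "(ip u v)\<^sup>2 \<le> ip u u * ip v v"
  proof (cases "ip v v = 0")
    case True
    have "ip u v = 0"
    proof (rule ccontr)
      assume "ip u v \<noteq> 0"
      \<comment> \<open>For this \<open>c\<close> the expression, which is affine in
        \<open>c\<close> when \<open>ip v v = 0\<close>, takes the value -1.\<close>
      then show False using q[of "- (ip u u + 1) / (2 * ip u v)"] True by (simp add: field_simps)
    qed
    then show ?thesis using True by simp
  next
    case False
    then have pos: "ip v v > 0" using ip_nonneg[of v] by simp
    \<comment> \<open>The quadratic is evaluated at its minimiser and multiplied by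
      \<open>ip v v\<close>.\<close>
    have "0 \<le> (ip u u + 2 * (- ip u v / ip v v) * ip u v + (- ip u v / ip v v)\<^sup>2 * ip v v) * ip v v"
      using q[of "- ip u v / ip v v"] pos by (intro mult_nonneg_nonneg) auto
    also have "\<dots> = ip u u * ip v v - (ip u v)\<^sup>2"
      using pos by (simp add: power2_eq_square field_simps)
    finally show ?thesis by simp
  qed
  then have "sqrt ((ip u v)\<^sup>2) \<le> sqrt (ip u u * ip v v)" by (rule real_sqrt_le_mono)
  then show ?thesis by (simp add: L2norm_def real_sqrt_mult)
qed

lemma ip_add_bound:
  fixes u v :: "real^3 \<Rightarrow> real"
  assumes "u \<in> L2 Omega" "v \<in> L2 Omega"
  shows "ip (\<lambda>p. u p + v p) (\<lambda>p. u p + v p) \<le> 2 * ip u u + 2 * ip v v"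
  using ip_square_add[OF assms, of 1] ip_square_diff[OF assms]
    ip_nonneg[of "\<lambda>p. u p - v p"] by simp

lemma ip_AE_0:
  fixes u :: "real^3 \<Rightarrow> real"
  assumes "u \<in> L2 Omega" "ip u u = 0"
  shows "AE p in LO. u p = 0"
proof -
  have "AE p in LO. u p * u p = 0"
    using assms integral_nonneg_eq_0_iff_AE[of LO "\<lambda>p. u p * u p"] L2_mult_integrable[OF assms(1,1)]
    by (simp add: ip_real)
  then show ?thesis by simp
qed

lemma ip_cong_AE:
  fixes u v u' v' :: "real^3 \<Rightarrow> real"
  assumes "u \<in> borel_measurable LO" "v \<in> borel_measurable LO" "u' \<in> borel_measurable LO" "v' \<in> borel_measurable LO"
    "AE p in LO. u p = u' p" "AE p in LO. v p = v' p"
  shows "ip u v = ip u' v'"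
  unfolding ip_real using assms by (intro integral_cong_AE) auto

lemma ip_tendsto:
  fixes u :: "nat \<Rightarrow> real^3 \<Rightarrow> real"
  assumes "\<And>n. u n \<in> L2 Omega" "v \<in> L2 Omega" "w \<in> L2 Omega"
    and "(\<lambda>n. ip (\<lambda>p. u n p - v p) (\<lambda>p. u n p - v p)) \<longlonglongrightarrow> 0"
  shows "(\<lambda>n. ip (u n) w) \<longlonglongrightarrow> ip v w"
proof -
  have "(\<lambda>n. L2norm (\<lambda>p. u n p - v p) * L2norm w) \<longlonglongrightarrow> sqrt 0 * L2norm w"
    unfolding L2norm_def by (intro tendsto_intros assms(4))
  then have *: "(\<lambda>n. L2norm (\<lambda>p. u n p - v p) * L2norm w) \<longlonglongrightarrow> 0" by simp
  have "(\<lambda>n. ip (\<lambda>p. u n p - v p) w) \<longlonglongrightarrow> 0"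
  proof (rule Lim_null_comparison[OF always_eventually *], rule allI)
    fix n show "norm (ip (\<lambda>p. u n p - v p) w) \<le> L2norm (\<lambda>p. u n p - v p) * L2norm w"
      using ip_Cauchy_Schwarz[OF L2_diff[OF assms(1)[of n] assms(2)] assms(3)] by simp
  qed
  then have "(\<lambda>n. ip (u n) w - ip v w) \<longlonglongrightarrow> 0" by (simp add: ip_diff_left[OF assms(1) assms(2,3)])
  then show ?thesis by (rule LIM_zero_cancel)
qed

lemma ip_tendsto_bounded:
  fixes u :: "nat \<Rightarrow> real^3 \<Rightarrow> real"
  assumes "\<And>n. u n \<in> borel_measurable LO" "v \<in> borel_measurable LO"
    and "AE p in LO. (\<lambda>n. u n p) \<longlonglongrightarrow> v p" "g \<in> L2 Omega"
    and "\<And>n. AE p in LO. \<bar>u n p - v p\<bar> \<le> \<bar>g p\<bar>"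
  shows "(\<lambda>n. ip (\<lambda>p. u n p - v p) (\<lambda>p. u n p - v p)) \<longlonglongrightarrow> 0"
proof -
  have "(\<lambda>n. \<integral>p. (u n p - v p) * (u n p - v p) \<partial>LO) \<longlonglongrightarrow> (\<integral>p. 0 \<partial>LO)"
  proof (rule integral_dominated_convergence)
    show "integrable LO (\<lambda>p. (g p)\<^sup>2)" using assms by (simp add: L2_iff)
    show "AE p in LO. (\<lambda>n. (u n p - v p) * (u n p - v p)) \<longlonglongrightarrow> 0"
      using assms(3)
    proof eventually_elim
      case (elim p)
      then have "(\<lambda>n. u n p - v p) \<longlonglongrightarrow> 0" by (simp add: LIM_zero)
      from tendsto_mult[OF this this] show ?case by simp
    qed
    show "AE p in LO. norm ((u n p - v p) * (u n p - v p)) \<le> (g p)\<^sup>2" for n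
      using assms(5)[of n]
      by eventually_elim (simp add: abs_le_square_iff power2_eq_square[symmetric])
  qed (use assms in auto)
  then show ?thesis by (simp add: ip_real)
qed

subsection \<open>Density and uniqueness of weak derivatives\<close>

definition approx_by :: "(real^3 \<Rightarrow> real) set \<Rightarrow> (real^3 \<Rightarrow> real) \<Rightarrow> bool" where
  "approx_by A u \<longleftrightarrow> (\<forall>\<epsilon>>0. \<exists>v\<in>A. ip (\<lambda>p. v p - u p) (\<lambda>p. v p - u p) < \<epsilon>)"

text \<open>The error is a squared norm, for which the triangle inequality costs a factor 2; hence a
  quarter of the tolerance for each of the two approximations.\<close>

lemma approx_by_trans:
  assumes "u \<in> L2 Omega" "A \<subseteq> L2 Omega" "B \<subseteq> L2 Omega"
    and "approx_by A u" "\<And>v. v \<in> A \<Longrightarrow> approx_by B v"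
  shows "approx_by B u"
  unfolding approx_by_def
proof (intro allI impI)
  fix \<epsilon> :: real assume "\<epsilon> > 0"
  then obtain v where v: "v \<in> A" "ip (\<lambda>p. v p - u p) (\<lambda>p. v p - u p) < \<epsilon> / 4"
    using assms(4) unfolding approx_by_def by (meson divide_pos_pos zero_less_numeral)
  then obtain w where w: "w \<in> B" "ip (\<lambda>p. w p - v p) (\<lambda>p. w p - v p) < \<epsilon> / 4"
    using assms(5) \<open>\<epsilon> > 0\<close> unfolding approx_by_def by (meson divide_pos_pos zero_less_numeral)
  have "v \<in> L2 Omega" "w \<in> L2 Omega" using v w assms by auto
  then have "ip (\<lambda>p. (w p - v p) + (v p - u p)) (\<lambda>p. (w p - v p) + (v p - u p))
    \<le> 2 * ip (\<lambda>p. w p - v p) (\<lambda>p. w p - v p) + 2 * ip (\<lambda>p. v p - u p) (\<lambda>p. v p - u p)"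
    using assms(1) by (intro ip_add_bound L2_diff)
  then have "ip (\<lambda>p. w p - u p) (\<lambda>p. w p - u p) < \<epsilon>" using v(2) w(2) by simp
  then show "\<exists>v\<in>B. ip (\<lambda>p. v p - u p) (\<lambda>p. v p - u p) < \<epsilon>" using w by blast
qed

lemma approx_by_bounded_seq:
  assumes "\<And>n. v n \<in> A" "\<And>n. v n \<in> borel_measurable LO" "u \<in> borel_measurable LO"
    and "AE p in LO. (\<lambda>n. v n p) \<longlonglongrightarrow> u p" "g \<in> L2 Omega"
    and "\<And>n. AE p in LO. \<bar>v n p - u p\<bar> \<le> \<bar>g p\<bar>"
  shows "approx_by A u"
  unfolding approx_by_def
proof (intro allI impI)
  fix \<epsilon> :: real assume "\<epsilon> > 0"
  with ip_tendsto_bounded[OF assms(2-6)]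
  have "\<forall>\<^sub>F n in sequentially. ip (\<lambda>p. v n p - u p) (\<lambda>p. v n p - u p) < \<epsilon>"
    by (rule order_tendstoD)
  then show "\<exists>v\<in>A. ip (\<lambda>p. v p - u p) (\<lambda>p. v p - u p) < \<epsilon>"
    using assms(1) eventually_happens by force
qed

lemma AE_LO_I: "(\<And>p. p \<in> Omega \<Longrightarrow> P p) \<Longrightarrow> AE p in LO. P p"
  by (intro AE_I2) (simp add: space_restrict_space)

lemma approx_by_bounded:
  assumes "u \<in> L2 Omega"
  shows "approx_by {v \<in> L2 Omega. \<exists>M\<ge>0. \<forall>p. \<bar>v p\<bar> \<le> M} u"
proof -
  define v where "v n p = max (- real n) (min (real n) (u p))" for n p
  have m: "v n \<in> borel_measurable LO" for n
    unfolding v_def using L2_measurable[OF assms] by measurable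
  have le: "\<bar>v n p\<bar> \<le> real n" for n p unfolding v_def by auto
  show ?thesis
  proof (rule approx_by_bounded_seq[where v = v and g = u])
    show "v n \<in> {v \<in> L2 Omega. \<exists>M\<ge>0. \<forall>p. \<bar>v p\<bar> \<le> M}" for n
      using L2_bounded_mult[OF L2_one[OF open_Omega bounded_Omega] m[of n], of "real n"] le by (auto intro!: exI[of _ "real n"])
    show "AE p in LO. (\<lambda>n. v n p) \<longlonglongrightarrow> u p"
    proof (rule AE_I2, rule tendsto_eventually)
      fix p obtain N :: nat where "\<bar>u p\<bar> \<le> real N" using real_arch_simple by blast
      then have "v n p = u p" if "n \<ge> N" for n using that unfolding v_def by auto
      then show "\<forall>\<^sub>F n in sequentially. v n p = u p" by (auto simp: eventually_sequentially)
    qed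
    show "AE p in LO. \<bar>v n p - u p\<bar> \<le> \<bar>u p\<bar>" for n
      by (rule AE_I2) (auto simp: v_def)
  qed (use m L2_measurable assms in auto)
qed

text \<open>Lebesgue measurability provides continuous functions that converge almost everywhere.
  Clipping them at the bound \<open>M\<close> does not change the limit and supplies the constant
  that dominates.\<close>

lemma approx_by_continuous:
  assumes "v \<in> L2 Omega" "\<And>p. \<bar>v p\<bar> \<le> M" "M \<ge> 0"
  shows "approx_by {g. continuous_on UNIV g} v"
proof -
  have "v measurable_on Omega"
    using L2_measurable[OF assms(1)] lebesgue_on_open[OF open_Omega]
    by (simp add: measurable_on_iff_borel_measurable)
  then obtain N g where N: "negligible N" and g: "\<And>n. continuous_on UNIV (g n)"
    and lim: "\<And>p. p \<notin> N \<Longrightarrow> (\<lambda>n. g n p) \<longlonglongrightarrow> (if p \<in> Omega then v p else 0)"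
    unfolding measurable_on_def by blast
  define h where "h n p = max (- M) (min M (g n p))" for n :: nat and p
  have hc: "continuous_on UNIV (h n)" for n
    unfolding h_def by (intro continuous_intros g)
  show ?thesis
  proof (rule approx_by_bounded_seq[where v = h and g = "\<lambda>p. 2 * M"])
    show "h n \<in> {g. continuous_on UNIV g}" for n using hc by simp
    show "h n \<in> borel_measurable LO" for n using hc by (rule continuous_imp_measurable_lebesgue_on)
    have "AE p in lebesgue. p \<notin> N"
      using N by (simp add: negligible_iff_null_sets AE_not_in)
    then have "AE p in LO. p \<in> Omega \<and> p \<notin> N"
      using lebesgue_on_open[OF open_Omega] by (subst AE_restrict_space_iff) auto
    then show "AE p in LO. (\<lambda>n. h n p) \<longlonglongrightarrow> v p"
    proof eventually_elim
      case (elim p)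
      then have "(\<lambda>n. h n p) \<longlonglongrightarrow> max (- M) (min M (v p))"
        unfolding h_def using lim[of p] by (intro tendsto_intros) auto
      also have "max (- M) (min M (v p)) = v p" using assms(2)[of p] by auto
      finally show ?case .
    qed
    show "AE p in LO. \<bar>h n p - v p\<bar> \<le> \<bar>2 * M\<bar>" for n
    proof (rule AE_I2)
      fix p
      have "\<bar>h n p\<bar> \<le> M" unfolding h_def using assms(3) by auto
      then show "\<bar>h n p - v p\<bar> \<le> \<bar>2 * M\<bar>" using assms(2)[of p] by linarith
    qed
    show "(\<lambda>p. 2 * M) \<in> L2 Omega" by (intro L2_continuous open_Omega bounded_Omega continuous_intros)
  qed (use L2_measurable assms in auto)
qed

lemma smooth_real_polynomial_function:
  "real_polynomial_function q \<Longrightarrow> smooth q"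
proof (induction rule: real_polynomial_function.induct)
  case (linear f)
  have *: "(f has_derivative f) (at p)" for p by (rule bounded_linear_imp_has_derivative[OF linear])
  show ?case
  proof (rule smoothI)
    show "f differentiable at p" for p using * by (auto simp: differentiable_def)
    have "pd i f = (\<lambda>p. f (axis i 1))" for i using pd_eqI[OF *] by auto
    then show "smooth (pd i f)" for i by simp
  qed
qed auto

lemma approx_by_polynomial:
  assumes "continuous_on UNIV g"
  shows "approx_by {q. real_polynomial_function q} g"
proof -
  have cpt: "compact (closure Omega)" using bounded_Omega by simp
  have "\<exists>q. real_polynomial_function q \<and> (\<forall>p\<in>closure Omega. \<bar>g p - q p\<bar> < 1 / real (Suc n))" for n
    by (rule Stone_Weierstrass_real_polynomial_function[OF cpt continuous_on_subset[OF assms subset_UNIV],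
          of "1 / real (Suc n)"]) auto
  then have "\<forall>n. \<exists>q. real_polynomial_function q \<and> (\<forall>p\<in>closure Omega. \<bar>g p - q p\<bar> < 1 / real (Suc n))"
    by blast
  then obtain q where "\<forall>n. real_polynomial_function (q n) \<and> (\<forall>p\<in>closure Omega. \<bar>g p - q n p\<bar> < 1 / real (Suc n))"
    by (rule choice[THEN exE])
  then have q: "\<And>n. real_polynomial_function (q n)"
    "\<And>n p. p \<in> closure Omega \<Longrightarrow> \<bar>g p - q n p\<bar> < 1 / Suc n" by auto
  have d: "\<bar>q n p - g p\<bar> \<le> 1 / Suc n" if "p \<in> Omega" for n p
    using q(2)[of p n] closure_subset[of Omega] that by (auto simp: abs_minus_commute)
  show ?thesis
  proof (rule approx_by_bounded_seq[where v = q and g = "\<lambda>p. 1 :: real"])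
    show "q n \<in> borel_measurable LO" for n
      by (intro continuous_imp_measurable_lebesgue_on smooth_continuous smooth_real_polynomial_function q)
    show "AE p in LO. (\<lambda>n. q n p) \<longlonglongrightarrow> g p"
    proof (rule AE_LO_I)
      fix p assume "p \<in> Omega"
      then have "\<forall>n. norm (q n p - g p) \<le> inverse (real (Suc n))" using d by (simp add: inverse_eq_divide)
      from Lim_null_comparison[OF always_eventually[OF this] LIMSEQ_inverse_real_of_nat]
      show "(\<lambda>n. q n p) \<longlonglongrightarrow> g p" by (rule LIM_zero_cancel)
    qed
    show "AE p in LO. \<bar>q n p - g p\<bar> \<le> \<bar>1\<bar>" for n
    proof (rule AE_LO_I)
      fix p assume "p \<in> Omega"
      have "1 / real (Suc n) \<le> 1" by simp
      then show "\<bar>q n p - g p\<bar> \<le> \<bar>1\<bar>" using d[OF \<open>p \<in> Omega\<close>, of n] by linarith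
    qed
    show "(\<lambda>p. 1 :: real) \<in> L2 Omega" by (intro L2_one open_Omega bounded_Omega)
  qed (use q continuous_imp_measurable_lebesgue_on[OF assms] in auto)
qed

lemma continuous_subset_L2: "continuous_on UNIV g \<Longrightarrow> g \<in> L2 Omega" for g :: "real^3 \<Rightarrow> real"
  by (rule L2_continuous[OF _ open_Omega bounded_Omega])

lemma smooth_L2: "smooth \<phi> \<Longrightarrow> \<phi> \<in> L2 Omega"
  by (intro continuous_subset_L2 smooth_continuous)

text \<open>Truncation, continuous approximation and the Weierstrass theorem are chained once. Both
  the density of test functions and that of the trigonometric basis are thereby reduced to
  approximating polynomials.\<close>

lemma approx_by_L2:
  assumes B: "B \<subseteq> L2 Omega" and q: "\<And>q. real_polynomial_function q \<Longrightarrow> approx_by B q"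
    and u: "u \<in> L2 Omega"
  shows "approx_by B u"
proof (rule approx_by_trans[OF u _ B approx_by_bounded[OF u]], blast)
  fix v :: "real^3 \<Rightarrow> real" assume "v \<in> {v \<in> L2 Omega. \<exists>M\<ge>0. \<forall>p. \<bar>v p\<bar> \<le> M}"
  then obtain M where v: "v \<in> L2 Omega" "\<And>p. \<bar>v p\<bar> \<le> M" "M \<ge> 0" by blast
  show "approx_by B v"
  proof (rule approx_by_trans[OF v(1) _ B approx_by_continuous[OF v]])
    fix g assume "g \<in> {g :: real^3 \<Rightarrow> real. continuous_on UNIV g}"
    then have g: "continuous_on UNIV g" by simp
    show "approx_by B g"
      by (rule approx_by_trans[OF continuous_subset_L2[OF g] _ B approx_by_polynomial[OF g]])
         (auto intro: smooth_L2 smooth_real_polynomial_function q)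
  qed (use continuous_subset_L2 in auto)
qed

lemma test_functionI:
  assumes "smooth \<phi>" "\<And>p. \<phi> p \<noteq> 0 \<Longrightarrow> p \<in> cbox a b" "cbox a b \<subseteq> U"
  shows "test_function U \<phi>"
proof -
  have "{p. \<phi> p \<noteq> 0} \<subseteq> cbox a b" using assms(2) by blast
  then have "closure {p. \<phi> p \<noteq> 0} \<subseteq> cbox a b" by (intro closure_minimal closed_cbox)
  moreover from this have "compact (closure {p. \<phi> p \<noteq> 0})"
    using bounded_cbox bounded_subset compact_eq_bounded_closed by blast
  ultimately show ?thesis using assms unfolding test_function_def by blast
qed

text \<open>A polynomial is multiplied by one cutoff per coordinate; the products have compact
  support in the box and converge boundedly to the polynomial.\<close>

lemma test_functions_dense:
  assumes "u \<in> L2 Omega"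
  shows "approx_by {\<phi>. test_function Omega \<phi>} u"
proof (rule approx_by_L2[OF _ _ assms])
  show "{\<phi>. test_function Omega \<phi>} \<subseteq> L2 Omega" using smooth_L2 by (auto simp: test_function_def)
  fix q :: "real^3 \<Rightarrow> real" assume "real_polynomial_function q"
  then have q: "smooth q" by (rule smooth_real_polynomial_function)
  have "\<forall>j. \<exists>\<eta>. smooth_cutoff 0 (side j) \<eta>" using smooth_cutoff_exists by blast
  then obtain \<eta> where "\<And>j. smooth_cutoff 0 (side j) (\<eta> j)" by metis
  note \<eta> = smooth_cutoffD[OF this]
  define v where "v n p = q p * (\<Prod>j\<in>UNIV. \<eta> j n (p $ j))" for n p
  have sm: "smooth (v n)" for n unfolding v_def by (intro smooth_mult smooth_prod q \<eta>)
  have P: "0 \<le> (\<Prod>j\<in>UNIV. \<eta> j n (p $ j))" "(\<Prod>j\<in>UNIV. \<eta> j n (p $ j)) \<le> 1" for n p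
    using \<eta>(2,3) by (auto intro!: prod_nonneg prod_le_1)
  show "approx_by {\<phi>. test_function Omega \<phi>} q"
  proof (rule approx_by_bounded_seq[where v = v and g = q])
    fix n
    have "test_function Omega (v n)"
    proof (rule test_functionI[OF sm])
      fix p assume "v n p \<noteq> 0"
      then have "\<eta> j n (p $ j) \<noteq> 0" for j unfolding v_def by auto
      then show "p \<in> cbox (\<chi> j. 1 / Suc n) (\<chi> j. side j - 1 / Suc n)"
        using \<eta>(4)[where n = n] \<eta>(5)[where n = n] unfolding mem_box_cart by fastforce
    next
      show "cbox (\<chi> j. 1 / Suc n) (\<chi> j. side j - 1 / Suc n) \<subseteq> Omega"
      proof
        fix p assume "p \<in> cbox (\<chi> j. 1 / Suc n) (\<chi> j. side j - 1 / Suc n)"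
        then have *: "1 / real (Suc n) \<le> p $ j" "p $ j \<le> side j - 1 / real (Suc n)" for j
          unfolding mem_box_cart by auto
        have pos: "1 / real (Suc n) > 0" by simp
        have "0 < p $ j \<and> p $ j < side j" for j using *[of j] pos by linarith
        then show "p \<in> Omega" unfolding Omega_iff by blast
      qed
    qed
    then show "v n \<in> {\<phi>. test_function Omega \<phi>}" by simp
    show "v n \<in> borel_measurable LO"
      by (intro continuous_imp_measurable_lebesgue_on smooth_continuous sm)
    show "AE p in LO. \<bar>v n p - q p\<bar> \<le> \<bar>q p\<bar>"
    proof (rule AE_I2)
      fix p
      have "v n p - q p = - (q p * (1 - (\<Prod>j\<in>UNIV. \<eta> j n (p $ j))))" by (simp add: v_def algebra_simps)
      then have "\<bar>v n p - q p\<bar> = \<bar>q p\<bar> * \<bar>1 - (\<Prod>j\<in>UNIV. \<eta> j n (p $ j))\<bar>" by (simp add: abs_mult)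
      also have "\<dots> \<le> \<bar>q p\<bar> * 1" using P[of n p] by (intro mult_left_mono) auto
      finally show "\<bar>v n p - q p\<bar> \<le> \<bar>q p\<bar>" by simp
    qed
  next
    show "AE p in LO. (\<lambda>n. v n p) \<longlonglongrightarrow> q p"
    proof (rule AE_LO_I)
      fix p assume "p \<in> Omega"
      then have "(\<lambda>n. \<eta> j n (p $ j)) \<longlonglongrightarrow> 1" for j
        using \<eta>(6) unfolding Omega_iff by blast
      then have "(\<lambda>n. q p * (\<Prod>j\<in>UNIV. \<eta> j n (p $ j))) \<longlonglongrightarrow> q p * (\<Prod>j\<in>(UNIV :: 3 set). 1)"
        by (intro tendsto_mult tendsto_const tendsto_prod)
      then show "(\<lambda>n. v n p) \<longlonglongrightarrow> q p" unfolding v_def by simp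
    qed
  qed (use q smooth_L2 L2_measurable in auto)
qed

text \<open>By orthogonality the squared distance from \<open>g\<close> to any member of
  \<open>A\<close> is at least \<open>ip g g\<close>, so it could not be made smaller than
  \<open>ip g g\<close> if that were positive.\<close>

lemma AE_0_if_orthogonal_dense:
  assumes g: "g \<in> L2 Omega" and A: "A \<subseteq> L2 Omega" "approx_by A g" and o: "\<And>v. v \<in> A \<Longrightarrow> ip g v = 0"
  shows "AE p in LO. g p = 0"
proof (rule ip_AE_0[OF g])
  show "ip g g = 0"
  proof (rule ccontr)
    assume "ip g g \<noteq> 0"
    then have "ip g g > 0" using ip_nonneg[of g] by simp
    then obtain v where v: "v \<in> A" "ip (\<lambda>p. v p - g p) (\<lambda>p. v p - g p) < ip g g"
      using A(2) unfolding approx_by_def by blast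
    then have "ip v v + ip g g < ip g g"
      using ip_square_diff[of v g] g A(1) o[OF v(1)] by (auto simp: ip_commute[of v g])
    then show False using ip_nonneg[of v] by simp
  qed
qed

lemma AE_eq_if_orthogonal_dense:
  assumes g: "g \<in> L2 Omega" "h \<in> L2 Omega" and A: "A \<subseteq> L2 Omega" "\<And>u. u \<in> L2 Omega \<Longrightarrow> approx_by A u"
    and o: "\<And>v. v \<in> A \<Longrightarrow> ip g v = ip h v"
  shows "AE p in LO. g p = h p"
proof -
  have "AE p in LO. g p - h p = 0"
    by (rule AE_0_if_orthogonal_dense[OF L2_diff[OF g] A(1) A(2)[OF L2_diff[OF g]]])
       (use o g A(1) in \<open>auto simp: ip_diff_left subset_iff\<close>)
  then show ?thesis by simp
qed

lemma weak_pderiv_unique: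
  assumes "g \<in> L2 Omega" "h \<in> L2 Omega" "weak_pderiv Omega i u g" "weak_pderiv Omega i u h"
  shows "AE p in LO. g p = h p"
proof (rule AE_eq_if_orthogonal_dense[OF assms(1,2) _ test_functions_dense])
  show "{\<phi>. test_function Omega \<phi>} \<subseteq> L2 Omega" using smooth_L2 by (auto simp: test_function_def)
  show "ip g \<phi> = ip h \<phi>" if "\<phi> \<in> {\<phi>. test_function Omega \<phi>}" for \<phi>
    using assms(3,4) that unfolding weak_pderiv_def ip_real by fastforce
qed

text \<open>\<open>wpd\<close> is a choice by \<open>SOME\<close>. This is the interface through
  which any explicitly known weak derivative replaces it, up to a null set.\<close>

lemma wpd_eq:
  assumes "g \<in> L2 Omega" "weak_pderiv Omega i u g"
  shows "wpd i u \<in> L2 Omega" "weak_pderiv Omega i u (wpd i u)" "AE p in LO. wpd i u p = g p"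
proof -
  have "wpd i u \<in> L2 Omega \<and> weak_pderiv Omega i u (wpd i u)"
    unfolding wpd_def by (rule someI[of _ g]) (use assms in blast)
  then show *: "wpd i u \<in> L2 Omega" "weak_pderiv Omega i u (wpd i u)" by auto
  show "AE p in LO. wpd i u p = g p" by (rule weak_pderiv_unique[OF *(1) assms(1) *(2) assms(2)])
qed

subsection \<open>A trigonometric basis\<close>

text \<open>Hartley's kernel, cas = cos + sin. Indexed by all integers it is a real orthogonal
  system on the circle, with a single family in place of sines and cosines, and differentiation only
  multiplies by the frequency and reverses its sign.\<close>

definition Hart :: "int \<Rightarrow> real \<Rightarrow> real" where
  "Hart m x = cos (of_int m * x) + sin (of_int m * x)"

text \<open>The sine in the vertical variable encodes the zero values on the two faces. The index
  \<open>l = 0\<close> gives the zero function, so only \<open>1 \<le> l\<close> is used.\<close>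

definition ebasis :: "int \<times> int \<times> nat \<Rightarrow> real^3 \<Rightarrow> real" where
  "ebasis = (\<lambda>(j, k, l) p. Hart j (p $ 1) * Hart k (p $ 2) * sin (real l * pi * p $ 3))"

lemma Hart_cos: "cos x * Hart m x = 1 / 2 * Hart (m + 1) x + 1 / 2 * Hart (m - 1) x"
  unfolding Hart_def of_int_add of_int_diff distrib_right left_diff_distrib
  by (simp add: cos_add sin_add cos_diff sin_diff algebra_simps)

lemma Hart_sin: "sin x * Hart m x = 1 / 2 * Hart (1 - m) x + (- 1 / 2) * Hart (- (1 + m)) x"
  unfolding Hart_def of_int_add of_int_diff of_int_minus distrib_right left_diff_distrib
  by (simp add: cos_add sin_add cos_diff sin_diff algebra_simps)

lemma Hart_trig_mult:
  "cos x * (Hart m x * A * B) = 1 / 2 * (Hart (m + 1) x * A * B) + 1 / 2 * (Hart (m - 1) x * A * B)"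
  "sin x * (Hart m x * A * B) = 1 / 2 * (Hart (1 - m) x * A * B) + (- 1 / 2) * (Hart (- (1 + m)) x * A * B)"
  "cos x * (A * Hart m x * B) = 1 / 2 * (A * Hart (m + 1) x * B) + 1 / 2 * (A * Hart (m - 1) x * B)"
  "sin x * (A * Hart m x * B) = 1 / 2 * (A * Hart (1 - m) x * B) + (- 1 / 2) * (A * Hart (- (1 + m)) x * B)"
proof -
  have r: "t * (h * A * B) = (t * h) * (A * B)" "t * (A * h * B) = (t * h) * (A * B)" for t h by simp_all
  show "cos x * (Hart m x * A * B) = 1 / 2 * (Hart (m + 1) x * A * B) + 1 / 2 * (Hart (m - 1) x * A * B)"
    "sin x * (Hart m x * A * B) = 1 / 2 * (Hart (1 - m) x * A * B) + (- 1 / 2) * (Hart (- (1 + m)) x * A * B)"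
    "cos x * (A * Hart m x * B) = 1 / 2 * (A * Hart (m + 1) x * B) + 1 / 2 * (A * Hart (m - 1) x * B)"
    "sin x * (A * Hart m x * B) = 1 / 2 * (A * Hart (1 - m) x * B) + (- 1 / 2) * (A * Hart (- (1 + m)) x * B)"
    unfolding r Hart_cos Hart_sin distrib_right by (simp_all only: mult_ac)
qed

inductive_set espan :: "(real^3 \<Rightarrow> real) set" where
  base: "1 \<le> l \<Longrightarrow> ebasis (j, k, l) \<in> espan"
| zero: "(\<lambda>p. 0) \<in> espan"
| lin: "u \<in> espan \<Longrightarrow> v \<in> espan \<Longrightarrow> (\<lambda>p. a * u p + b * v p) \<in> espan"

lemma espan_closed:
  assumes "\<And>j k l. 1 \<le> l \<Longrightarrow> (\<lambda>p. g p * ebasis (j, k, l) p) \<in> espan"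
    and "u \<in> espan"
  shows "(\<lambda>p. g p * u p) \<in> espan"
  using assms(2)
proof (induction rule: espan.induct)
  case (lin u v a b)
  have "(\<lambda>p. g p * (a * u p + b * v p)) = (\<lambda>p. a * (g p * u p) + b * (g p * v p))"
    by (auto simp: algebra_simps)
  then show ?case using espan.lin[OF lin(3,4)] by simp
qed (use assms(1) espan.zero in auto)

text \<open>Product-to-sum formulas shift the frequencies by one. In the vertical variable only the
  cosine occurs: it maps sine series to sine series, whereas a sine would turn them into cosine
  series.\<close>

lemma espan_trig:
  assumes "u \<in> espan"
  shows "(\<lambda>p. cos (p $ 1) * u p) \<in> espan" "(\<lambda>p. sin (p $ 1) * u p) \<in> espan"
    "(\<lambda>p. cos (p $ 2) * u p) \<in> espan" "(\<lambda>p. sin (p $ 2) * u p) \<in> espan"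
    "(\<lambda>p. cos (pi * p $ 3) * u p) \<in> espan"
proof -
  have comb: "g \<in> espan" if "l \<ge> 1" "l' \<ge> 1" "g = (\<lambda>p. a * ebasis (j, k, l) p + b * ebasis (j', k', l') p)"
    for g a b j k l j' k' l'
    using espan.lin[OF espan.base[OF that(1)] espan.base[OF that(2)]] that(3) by simp
  show "(\<lambda>p. cos (p $ 1) * u p) \<in> espan"
  proof (rule espan_closed[OF comb assms])
    fix j k and l :: nat
    show "(\<lambda>p. cos (p $ 1) * ebasis (j, k, l) p) =
      (\<lambda>p. 1 / 2 * ebasis (j + 1, k, l) p + 1 / 2 * ebasis (j - 1, k, l) p)"
      unfolding ebasis_def case_prod_conv by (rule ext, rule Hart_trig_mult)
  qed
  show "(\<lambda>p. sin (p $ 1) * u p) \<in> espan"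
  proof (rule espan_closed[OF comb assms])
    fix j k and l :: nat
    show "(\<lambda>p. sin (p $ 1) * ebasis (j, k, l) p) =
      (\<lambda>p. 1 / 2 * ebasis (1 - j, k, l) p + (- 1 / 2) * ebasis (- (1 + j), k, l) p)"
      unfolding ebasis_def case_prod_conv by (rule ext, rule Hart_trig_mult)
  qed
  show "(\<lambda>p. cos (p $ 2) * u p) \<in> espan"
  proof (rule espan_closed[OF comb assms])
    fix j k and l :: nat
    show "(\<lambda>p. cos (p $ 2) * ebasis (j, k, l) p) =
      (\<lambda>p. 1 / 2 * ebasis (j, k + 1, l) p + 1 / 2 * ebasis (j, k - 1, l) p)"
      unfolding ebasis_def case_prod_conv by (rule ext, rule Hart_trig_mult)
  qed
  show "(\<lambda>p. sin (p $ 2) * u p) \<in> espan"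
  proof (rule espan_closed[OF comb assms])
    fix j k and l :: nat
    show "(\<lambda>p. sin (p $ 2) * ebasis (j, k, l) p) =
      (\<lambda>p. 1 / 2 * ebasis (j, 1 - k, l) p + (- 1 / 2) * ebasis (j, - (1 + k), l) p)"
      unfolding ebasis_def case_prod_conv by (rule ext, rule Hart_trig_mult)
  qed
  show "(\<lambda>p. cos (pi * p $ 3) * u p) \<in> espan"
  proof (rule espan_closed[OF _ assms])
    fix j k and l :: nat assume l: "1 \<le> l"
    have s: "cos z * sin (real l * z) = 1 / 2 * sin (real (Suc l) * z) + 1 / 2 * sin (real (l - 1) * z)" for z
    proof -
      have "real (Suc l) * z = real l * z + z" "real (l - 1) * z = real l * z - z"
        using l by (simp_all add: algebra_simps of_nat_diff)
      then show ?thesis unfolding sin_add sin_diff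
        by (simp only: sin_add sin_diff) (simp add: algebra_simps)
    qed
    have eq: "(\<lambda>p. cos (pi * p $ 3) * ebasis (j, k, l) p) =
      (\<lambda>p. 1 / 2 * ebasis (j, k, Suc l) p + 1 / 2 * ebasis (j, k, l - 1) p)"
    proof
      fix p :: "real^3"
      have "cos (pi * p $ 3) * ebasis (j, k, l) p
        = (Hart j (p $ 1) * Hart k (p $ 2)) * (cos (pi * p $ 3) * sin (real l * (pi * p $ 3)))"
        by (simp only: ebasis_def case_prod_conv mult_ac)
      also have "\<dots> = 1 / 2 * ebasis (j, k, Suc l) p + 1 / 2 * ebasis (j, k, l - 1) p"
        unfolding s by (simp only: ebasis_def case_prod_conv distrib_left mult_ac)
      finally show "cos (pi * p $ 3) * ebasis (j, k, l) p =
        1 / 2 * ebasis (j, k, Suc l) p + 1 / 2 * ebasis (j, k, l - 1) p" .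
    qed
    show "(\<lambda>p. cos (pi * p $ 3) * ebasis (j, k, l) p) \<in> espan"
    \<comment> \<open>For \<open>l = 1\<close> the lower frequency is 0, which is not an index of a
      generator; its term vanishes.\<close>
    proof (cases "l = 1")
      case True
      have "(\<lambda>p. 1 / 2 * ebasis (j, k, Suc l) p + 0 * 0) \<in> espan"
        by (intro espan.lin espan.base espan.zero) simp
      moreover have "ebasis (j, k, l - 1) p = 0" for p using True by (simp add: ebasis_def)
      ultimately show ?thesis unfolding eq by simp
    next
      case False
      then show ?thesis using l unfolding eq by (intro espan.lin espan.base) auto
    qed
  qed
qed

section \<open>Polynomials as bounded limits of trigonometric polynomials\<close>

inductive_set trigalg :: "(real^3 \<Rightarrow> real) set" where
  const: "(\<lambda>p. c) \<in> trigalg"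
| cos1: "(\<lambda>p. cos (p $ 1)) \<in> trigalg" | sin1: "(\<lambda>p. sin (p $ 1)) \<in> trigalg"
| cos2: "(\<lambda>p. cos (p $ 2)) \<in> trigalg" | sin2: "(\<lambda>p. sin (p $ 2)) \<in> trigalg"
| cos3: "(\<lambda>p. cos (pi * p $ 3)) \<in> trigalg"
| add: "t \<in> trigalg \<Longrightarrow> s \<in> trigalg \<Longrightarrow> (\<lambda>p. t p + s p) \<in> trigalg"
| mult: "t \<in> trigalg \<Longrightarrow> s \<in> trigalg \<Longrightarrow> (\<lambda>p. t p * s p) \<in> trigalg"

lemma trigalg_espan: "t \<in> trigalg \<Longrightarrow> u \<in> espan \<Longrightarrow> (\<lambda>p. t p * u p) \<in> espan"
proof (induction arbitrary: u rule: trigalg.induct)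
  case (const c)
  then show ?case using espan.lin[OF const espan.zero, of c 0] by simp
next
  case (add t s)
  then show ?case using espan.lin[of "\<lambda>p. t p * u p" "\<lambda>p. s p * u p" 1 1] by (simp add: distrib_right)
next
  case (mult t s)
  then show ?case by (simp add: mult.assoc)
qed (use espan_trig in auto)

lemma trigalg_polynomial:
  assumes "real_polynomial_function P" "c \<in> trigalg"
  shows "(\<lambda>p. P (c p)) \<in> trigalg"
  using assms(1)
proof (induction rule: real_polynomial_function.induct)
  case (linear f)
  then obtain a where "f = (\<lambda>x. x * a)" using real_bounded_linear by blast
  then have "(\<lambda>p. f (c p)) = (\<lambda>p. c p * a)" by auto
  then show ?case using trigalg.mult[OF assms(2) trigalg.const] by simp
qed (auto intro: trigalg.intros)

text \<open>The coordinates \<open>x\<close> and \<open>y\<close> jump when they are continued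
  periodically, so uniform approximation by trigonometric polynomials is impossible. Bounded
  pointwise convergence in the open box is stable under sums and products and still yields
  approximation in mean square.\<close>

definition bounded_limit :: "(real^3 \<Rightarrow> real) set \<Rightarrow> (real^3 \<Rightarrow> real) \<Rightarrow> bool" where
  "bounded_limit A u \<longleftrightarrow> (\<exists>v B. (\<forall>n::nat. v n \<in> A) \<and> (\<forall>p\<in>Omega. (\<lambda>n. v n p) \<longlonglongrightarrow> u p) \<and>
     (\<forall>n. \<forall>p\<in>Omega. \<bar>v n p\<bar> \<le> B))"

lemma bounded_limitI:
  assumes "\<And>n::nat. v n \<in> A" "\<And>p. p \<in> Omega \<Longrightarrow> (\<lambda>n. v n p) \<longlonglongrightarrow> u p"
    "\<And>n p. p \<in> Omega \<Longrightarrow> \<bar>v n p\<bar> \<le> B"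
  shows "bounded_limit A u"
  using assms unfolding bounded_limit_def by blast

lemma bounded_limit_add: "bounded_limit trigalg u \<Longrightarrow> bounded_limit trigalg v \<Longrightarrow> bounded_limit trigalg (\<lambda>p. u p + v p)"
proof -
  assume "bounded_limit trigalg u" "bounded_limit trigalg v"
  then obtain f g B C where f: "\<And>n::nat. f n \<in> trigalg" "\<And>p. p \<in> Omega \<Longrightarrow> (\<lambda>n. f n p) \<longlonglongrightarrow> u p"
      "\<And>n p. p \<in> Omega \<Longrightarrow> \<bar>f n p\<bar> \<le> B"
    and g: "\<And>n::nat. g n \<in> trigalg" "\<And>p. p \<in> Omega \<Longrightarrow> (\<lambda>n. g n p) \<longlonglongrightarrow> v p"
      "\<And>n p. p \<in> Omega \<Longrightarrow> \<bar>g n p\<bar> \<le> C" unfolding bounded_limit_def by blast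
  show ?thesis
  proof (rule bounded_limitI[where v = "\<lambda>n p. f n p + g n p" and B = "B + C"])
    show "\<bar>f n p + g n p\<bar> \<le> B + C" if "p \<in> Omega" for n p
      using f(3)[OF that, of n] g(3)[OF that, of n] by linarith
  qed (use f g in \<open>auto intro: trigalg.intros tendsto_intros\<close>)
qed

lemma bounded_limit_mult:
  assumes t: "\<And>t s. t \<in> trigalg \<Longrightarrow> s \<in> A \<Longrightarrow> (\<lambda>p. t p * s p) \<in> A"
    and "bounded_limit trigalg u" "bounded_limit A v"
  shows "bounded_limit A (\<lambda>p. u p * v p)"
proof -
  obtain f g B C where f: "\<And>n::nat. f n \<in> trigalg" "\<And>p. p \<in> Omega \<Longrightarrow> (\<lambda>n. f n p) \<longlonglongrightarrow> u p"
      "\<And>n p. p \<in> Omega \<Longrightarrow> \<bar>f n p\<bar> \<le> B"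
    and g: "\<And>n::nat. g n \<in> A" "\<And>p. p \<in> Omega \<Longrightarrow> (\<lambda>n. g n p) \<longlonglongrightarrow> v p"
      "\<And>n p. p \<in> Omega \<Longrightarrow> \<bar>g n p\<bar> \<le> C" using assms(2,3) unfolding bounded_limit_def by blast
  show ?thesis
  proof (rule bounded_limitI[where v = "\<lambda>n p. f n p * g n p" and B = "B * C"])
    show "\<bar>f n p * g n p\<bar> \<le> B * C" if "p \<in> Omega" for n p
      using f(3)[OF that, of n] g(3)[OF that, of n] unfolding abs_mult
      by (intro mult_mono) auto
  qed (use f g t in \<open>auto intro: tendsto_intros\<close>)
qed

lemma bounded_limit_const: "bounded_limit trigalg (\<lambda>p. c)"
  by (rule bounded_limitI[where v = "\<lambda>n p. c" and B = "\<bar>c\<bar>"]) (auto intro: trigalg.intros)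

lemma polynomial_approx_seq:
  fixes h :: "nat \<Rightarrow> real \<Rightarrow> real"
  assumes "\<And>n. continuous_on {-1..1} (h n)"
  shows "\<exists>P. \<forall>n. real_polynomial_function (P n) \<and>
    (\<forall>t. \<bar>t\<bar> \<le> 1 \<longrightarrow> \<bar>h n t - P n t\<bar> \<le> inverse (real (Suc n)))"
proof (rule choice, rule allI)
  fix n
  obtain P where "real_polynomial_function P" "\<And>t. t \<in> {-1..1} \<Longrightarrow> \<bar>h n t - P t\<bar> < inverse (real (Suc n))"
    using Stone_Weierstrass_real_polynomial_function[OF compact_Icc assms[of n],
        of "inverse (real (Suc n))"] by (metis inverse_positive_iff_positive of_nat_0_less_iff zero_less_Suc)
  then show "\<exists>P. real_polynomial_function P \<and> (\<forall>t. \<bar>t\<bar> \<le> 1 \<longrightarrow> \<bar>h n t - P t\<bar> \<le> inverse (real (Suc n)))"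
    by (intro exI[of _ P] conjI allI impI less_imp_le) (auto simp: abs_le_iff)
qed

lemma inverse_Suc_le_1: "inverse (real (Suc n)) \<le> 1"
  by (simp add: inverse_le_1_iff)

lemma tendsto_of_inverse_Suc:
  fixes a b :: "nat \<Rightarrow> real"
  assumes "\<And>n. \<bar>a n - b n\<bar> \<le> inverse (real (Suc n))" "a \<longlonglongrightarrow> l"
  shows "b \<longlonglongrightarrow> l"
proof -
  have "(\<lambda>n. a n - b n) \<longlonglongrightarrow> 0"
    by (rule Lim_null_comparison[OF always_eventually LIMSEQ_inverse_real_of_nat]) (use assms(1) in simp)
  from tendsto_diff[OF assms(2) this] show ?thesis by simp
qed

lemma bounded_limit_arccos:
  assumes c: "c \<in> trigalg" "\<And>p. \<bar>c p\<bar> \<le> 1"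
  shows "bounded_limit trigalg (\<lambda>p. arccos (c p))"
proof -
  obtain P where "\<forall>n. real_polynomial_function (P n) \<and>
    (\<forall>t. \<bar>t\<bar> \<le> 1 \<longrightarrow> \<bar>arccos t - P n t\<bar> \<le> inverse (real (Suc n)))"
    using polynomial_approx_seq[of "\<lambda>n. arccos"] continuous_on_arccos' by blast
  then have P: "\<And>n. real_polynomial_function (P n)"
    "\<And>n t. \<bar>t\<bar> \<le> 1 \<Longrightarrow> \<bar>arccos t - P n t\<bar> \<le> inverse (real (Suc n))" by auto
  show ?thesis
  proof (rule bounded_limitI[where v = "\<lambda>n p. P n (c p)" and B = "pi + 1"])
    show "(\<lambda>p. P n (c p)) \<in> trigalg" for n by (rule trigalg_polynomial[OF P(1) c(1)])
    show "(\<lambda>n. P n (c p)) \<longlonglongrightarrow> arccos (c p)" for p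
      by (rule tendsto_of_inverse_Suc[OF P(2) tendsto_const]) (rule c(2))
    fix n and p :: "real^3"
    have "0 \<le> arccos (c p)" "arccos (c p) \<le> pi" using c(2)[of p] by (auto intro: arccos_lbound arccos_ubound)
    then show "\<bar>P n (c p)\<bar> \<le> pi + 1" using P(2)[OF c(2)[of p], of n] inverse_Suc_le_1[of n] by linarith
  qed
qed

text \<open>Off the zeros, the sign of \<open>sin x\<close> is \<open>sin x\<close> divided by
  \<open>sqrt (1 - (cos x)\<^sup>2)\<close>. With the denominator cut off below at
  \<open>1 / (n + 1)\<close>, the reciprocal is a continuous function of \<open>cos x\<close>, which
  the Weierstrass theorem replaces by a polynomial. The bound 2 is 1 for the regularised quotient
  plus 1 for the error.\<close>

lemma sgn_sin_approx:
  "\<exists>P. (\<forall>n::nat. real_polynomial_function (P n)) \<and>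
    (\<forall>x. (\<lambda>n. sin x * P n (cos x)) \<longlonglongrightarrow> sgn (sin x)) \<and> (\<forall>n x. \<bar>sin x * P n (cos x)\<bar> \<le> 2)"
proof -
  define h where "h n t = 1 / max (sqrt (1 - t\<^sup>2)) (inverse (real (Suc n)))" for n and t :: real
  have pos: "max (sqrt (1 - t\<^sup>2)) (inverse (real (Suc n))) > 0" for n t
    by (rule less_le_trans[OF _ max.cobounded2]) simp
  have "continuous_on {-1..1} (h n)" for n
    unfolding h_def using pos[of _ n] by (intro continuous_intros) (metis less_irrefl)
  then obtain P where "\<forall>n. real_polynomial_function (P n) \<and>
    (\<forall>t. \<bar>t\<bar> \<le> 1 \<longrightarrow> \<bar>h n t - P n t\<bar> \<le> inverse (real (Suc n)))"
    using polynomial_approx_seq by blast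
  then have P: "\<And>n. real_polynomial_function (P n)"
    "\<And>n t. \<bar>t\<bar> \<le> 1 \<Longrightarrow> \<bar>h n t - P n t\<bar> \<le> inverse (real (Suc n))" by auto
  have sq: "sqrt (1 - (cos x)\<^sup>2) = \<bar>sin x\<bar>" for x :: real
    by (simp add: sin_squared_eq[symmetric])
  have close: "\<bar>sin x * h n (cos x) - sin x * P n (cos x)\<bar> \<le> inverse (real (Suc n))" for x n
  proof -
    have "\<bar>sin x * h n (cos x) - sin x * P n (cos x)\<bar> = \<bar>sin x\<bar> * \<bar>h n (cos x) - P n (cos x)\<bar>"
      by (simp add: abs_mult[symmetric] right_diff_distrib)
    also have "\<dots> \<le> 1 * inverse (real (Suc n))"
      by (intro mult_mono P(2)) auto
    finally show ?thesis by simp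
  qed
  have hb: "\<bar>sin x * h n (cos x)\<bar> \<le> 1" for x n
  proof -
    have "\<bar>sin x\<bar> \<le> max \<bar>sin x\<bar> (inverse (real (Suc n)))" by simp
    then show ?thesis unfolding h_def sq using pos[of "cos x" n, unfolded sq]
      by (simp add: abs_mult divide_le_eq)
  qed
  have hl: "(\<lambda>n. sin x * h n (cos x)) \<longlonglongrightarrow> sgn (sin x)" for x
  proof (cases "sin x = 0")
    case False
    have "(\<lambda>n. sin x * (1 / max \<bar>sin x\<bar> (inverse (real (Suc n))))) \<longlonglongrightarrow> sin x * (1 / max \<bar>sin x\<bar> 0)"
      using False by (intro tendsto_intros LIMSEQ_inverse_real_of_nat) auto
    then show ?thesis unfolding h_def sq using False by (simp add: real_sgn_eq)
  qed simp
  show ?thesis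
  proof (intro exI[of _ P] conjI allI)
    show "(\<lambda>n. sin x * P n (cos x)) \<longlonglongrightarrow> sgn (sin x)" for x
      by (rule tendsto_of_inverse_Suc[OF close hl])
    show "\<bar>sin x * P n (cos x)\<bar> \<le> 2" for n x
      using close[of x n] hb[of x n] inverse_Suc_le_1[of n] by linarith
  qed (fact P)
qed

lemma bounded_limit_sgn_sin:
  assumes "(\<lambda>p. sin (p $ i)) \<in> trigalg" "(\<lambda>p. cos (p $ i)) \<in> trigalg"
  shows "bounded_limit trigalg (\<lambda>p. sgn (sin (p $ i)))"
proof -
  obtain P where P: "\<And>n::nat. real_polynomial_function (P n)"
    "\<And>x. (\<lambda>n. sin x * P n (cos x)) \<longlonglongrightarrow> sgn (sin x)" "\<And>n x. \<bar>sin x * P n (cos x)\<bar> \<le> 2"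
    using sgn_sin_approx by blast
  show ?thesis
    by (rule bounded_limitI[where v = "\<lambda>n p. sin (p $ i) * P n (cos (p $ i))" and B = 2])
       (intro trigalg.mult assms trigalg_polynomial[OF P(1) assms(2)] P)+
qed

lemma bounded_limit_cong: "bounded_limit A u \<Longrightarrow> (\<And>p. p \<in> Omega \<Longrightarrow> u p = v p) \<Longrightarrow> bounded_limit A v"
  unfolding bounded_limit_def by simp

text \<open>\<open>arccos (cos x)\<close> folds the interval at \<open>pi\<close>, and the sign of
  \<open>sin x\<close> tells the two halves apart. At \<open>x = pi\<close> the sign is 0 and the
  formula still returns \<open>pi\<close>.\<close>

lemma arccos_cos_formula:
  assumes "0 < x" "x < 2 * pi"
  shows "x = pi + (-1) * (sgn (sin x) * (pi + (-1) * arccos (cos x)))"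
proof (cases x pi rule: linorder_cases)
  case less
  then have "sin x > 0" using assms by (simp add: sin_gt_zero)
  then show ?thesis using less assms by (simp add: arccos_cos)
next
  case greater
  have "arccos (cos x) = 2 * pi - x" using arccos_cos[of "2 * pi - x"] greater assms by simp
  moreover have "sin x < 0" using greater assms by (simp add: sin_lt_zero)
  ultimately show ?thesis by simp
qed simp

lemma bounded_limit_coordinate: "bounded_limit trigalg (\<lambda>p. p $ i)"
proof -
  have mult: "bounded_limit trigalg u \<Longrightarrow> bounded_limit trigalg v \<Longrightarrow> bounded_limit trigalg (\<lambda>p. u p * v p)" for u v
    by (rule bounded_limit_mult[OF trigalg.mult])
  have xy: "bounded_limit trigalg (\<lambda>p. p $ i)"
    if "(\<lambda>p. sin (p $ i)) \<in> trigalg" "(\<lambda>p. cos (p $ i)) \<in> trigalg" "side i = 2 * pi" for i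
    by (rule bounded_limit_cong[where u = "\<lambda>p. pi + (-1) * (sgn (sin (p $ i)) * (pi + (-1) * arccos (cos (p $ i))))"],
        intro bounded_limit_add mult bounded_limit_const bounded_limit_sgn_sin bounded_limit_arccos that abs_cos_le_one,
        rule arccos_cos_formula[symmetric]) (use that(3) Omega_iff in metis)+
  have z: "bounded_limit trigalg (\<lambda>p. p $ 3)"
    by (rule bounded_limit_cong[where u = "\<lambda>p. 1 / pi * arccos (cos (pi * p $ 3))"],
        intro mult bounded_limit_const bounded_limit_arccos trigalg.cos3 abs_cos_le_one)
       (auto simp: Omega_def arccos_cos)
  show ?thesis using exhaust_3[of i] xy[OF trigalg.sin1 trigalg.cos1] xy[OF trigalg.sin2 trigalg.cos2] z
    by (auto simp: side_def)
qed

lemma bounded_limit_polynomial: "real_polynomial_function q \<Longrightarrow> bounded_limit trigalg q"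
proof (induction rule: real_polynomial_function.induct)
  case (linear f)
  then have lin: "linear f" by (rule bounded_linear.linear)
  have sum: "f p = (\<Sum>j\<in>UNIV. p $ j * f (axis j 1))" for p
    using arg_cong[OF basis_expansion[of p], of f]
    by (simp add: linear_sum[OF lin] scalar_mult_eq_scaleR linear_scale[OF lin])
  have *: "f = (\<lambda>p. p $ 1 * f (axis 1 1) + p $ 2 * f (axis 2 1) + p $ 3 * f (axis 3 1))"
    by (rule ext) (rule sum[unfolded sum_3])
  show ?case
    by (subst *, intro bounded_limit_add bounded_limit_mult[OF trigalg.mult] bounded_limit_const bounded_limit_coordinate)
qed (auto intro: bounded_limit_const bounded_limit_add bounded_limit_mult[OF trigalg.mult])

lemma smooth_cos: "smooth (\<lambda>p. cos (c * p $ j + d))"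
proof -
  \<comment> \<open>Differentiating a cosine advances its phase by a quarter turn, which gives all
    derivatives in one formula.\<close>
  define D where "D n x = c ^ n * cos (c * x + d + real n * (pi / 2))" for n x
  have "(D n has_real_derivative D (Suc n) x) (at x)" for n x
  proof -
    have s: "cos (c * x + d + real (Suc n) * (pi / 2)) = - sin (c * x + d + real n * (pi / 2))"
    proof -
      have "c * x + d + real (Suc n) * (pi / 2) = (c * x + d + real n * (pi / 2)) + pi / 2"
        by (simp add: field_simps)
      then show ?thesis by (simp only: cos_add) simp
    qed
    have "(D n has_real_derivative c ^ n * (- sin (c * x + d + real n * (pi / 2)) * c)) (at x)"
      unfolding D_def by (auto intro!: derivative_eq_intros)
    then show ?thesis unfolding D_def s by (simp add: mult_ac)
  qed
  from smooth_of_derivs[of D, OF this, of 0 j] show ?thesis by (simp add: D_def)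
qed

lemma smooth_sin: "smooth (\<lambda>p. sin (c * p $ j))"
proof -
  have "(\<lambda>p. sin (c * p $ j)) = (\<lambda>p. cos (c * p $ j + (- (pi / 2))))"
    by (auto simp: cos_diff)
  then show ?thesis using smooth_cos by metis
qed

lemma smooth_Hart: "smooth (\<lambda>p. Hart m (p $ j))"
  unfolding Hart_def using smooth_cos[of _ j 0] by (auto intro!: smooth_add smooth_sin)

text \<open>The vertical derivative of \<open>ebasis\<close> is a multiple of \<open>cbasis\<close>
  and conversely, so vertical derivatives are expanded in this second family.\<close>

definition cbasis :: "int \<times> int \<times> nat \<Rightarrow> real^3 \<Rightarrow> real" where
  "cbasis = (\<lambda>(j, k, l) p. Hart j (p $ 1) * Hart k (p $ 2) * cos (real l * pi * p $ 3))"

lemma smooth_ebasis: "smooth (ebasis \<kappa>)"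
  unfolding ebasis_def by (cases \<kappa>) (simp, intro smooth_mult smooth_Hart smooth_sin)

lemma smooth_cbasis: "smooth (cbasis \<kappa>)"
  unfolding cbasis_def using smooth_cos[of _ 3 0] by (cases \<kappa>) (simp, intro smooth_mult smooth_Hart, simp)

lemma Hart_deriv: "(Hart m has_real_derivative of_int m * Hart (- m) x) (at x)"
  unfolding Hart_def by (auto intro!: derivative_eq_intros simp: algebra_simps)

lemma pd_ebasis:
  "pd 1 (ebasis (j, k, l)) p = of_int j * ebasis (- j, k, l) p"
  "pd 2 (ebasis (j, k, l)) p = of_int k * ebasis (j, - k, l) p"
  "pd 3 (ebasis (j, k, l)) p = (real l * pi) * cbasis (j, k, l) p"
proof -
  have s: "((\<lambda>z. sin (real l * pi * z)) has_real_derivative real l * pi * cos (real l * pi * p $ 3)) (at (p $ 3))"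
    by (auto intro!: derivative_eq_intros)
  have *: "pd i (\<lambda>p. Hart j (p $ 1) * Hart k (p $ 2) * sin (real l * pi * p $ 3)) p =
     Hart j (p $ 1) * Hart k (p $ 2) * (if i = 3 then real l * pi * cos (real l * pi * p $ 3) else 0)
     + (Hart j (p $ 1) * (if i = 2 then of_int k * Hart (- k) (p $ 2) else 0)
        + (if i = 1 then of_int j * Hart (- j) (p $ 1) else 0) * Hart k (p $ 2)) * sin (real l * pi * p $ 3)" for i
    by (subst pd_mult, (rule smooth_differentiable smooth_mult smooth_Hart smooth_sin)+)
       (subst pd_mult, (rule smooth_differentiable smooth_mult smooth_Hart smooth_sin)+,
         simp only: pd_component(2)[OF Hart_deriv] pd_component(2)[OF s])
  show "pd 1 (ebasis (j, k, l)) p = of_int j * ebasis (- j, k, l) p"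
    "pd 2 (ebasis (j, k, l)) p = of_int k * ebasis (j, - k, l) p"
    "pd 3 (ebasis (j, k, l)) p = (real l * pi) * cbasis (j, k, l) p"
    using *[of 1] *[of 2] *[of 3] by (simp_all add: ebasis_def cbasis_def)
qed

lemma espan_subset_L2: "espan \<subseteq> L2 Omega"
proof
  fix u assume "u \<in> espan"
  then show "u \<in> L2 Omega"
    by induction (auto intro: smooth_L2 smooth_ebasis L2_add L2_cmult)
qed

text \<open>Polynomials are bounded limits of \<open>trigalg\<close>, but members of
  \<open>espan\<close> vanish on the horizontal faces. The bridge is that the constant 1 is itself a
  bounded limit of \<open>sin (pi * z) * P n (cos (pi * z))\<close>, since
  \<open>sin (pi * z)\<close> has sign 1 in the open box; multiplication by these functions carries
  \<open>trigalg\<close> into \<open>espan\<close>.\<close>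

lemma espan_dense:
  assumes "u \<in> L2 Omega" shows "approx_by espan u"
proof (rule approx_by_L2[OF espan_subset_L2 _ assms])
  fix q :: "real^3 \<Rightarrow> real" assume q: "real_polynomial_function q"
  obtain P where P: "\<And>n::nat. real_polynomial_function (P n)"
    "\<And>x. (\<lambda>n. sin x * P n (cos x)) \<longlonglongrightarrow> sgn (sin x)" "\<And>n x. \<bar>sin x * P n (cos x)\<bar> \<le> 2"
    using sgn_sin_approx by blast
  have "bounded_limit espan (\<lambda>p. 1)"
  proof (rule bounded_limitI[where v = "\<lambda>n p. sin (pi * p $ 3) * P n (cos (pi * p $ 3))" and B = 2])
    show "(\<lambda>p. sin (pi * p $ 3) * P n (cos (pi * p $ 3))) \<in> espan" for n
    proof -
      have "ebasis (0, 0, 1) = (\<lambda>p. sin (pi * p $ 3))" by (auto simp: ebasis_def Hart_def)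
      then show ?thesis
        using trigalg_espan[OF trigalg_polynomial[OF P(1) trigalg.cos3] espan.base[of 1 0 0], of n]
        by (simp add: mult.commute)
    qed
    show "(\<lambda>n. sin (pi * p $ 3) * P n (cos (pi * p $ 3))) \<longlonglongrightarrow> 1" if "p \<in> Omega" for p
    proof -
      have "sin (pi * p $ 3) > 0" using that by (intro sin_gt_zero) (auto simp: Omega_def)
      then show ?thesis using P(2)[of "pi * p $ 3"] by simp
    qed
  qed (use P(3) in blast)
  from bounded_limit_mult[OF trigalg_espan bounded_limit_polynomial[OF q] this] have "bounded_limit espan q" by simp
  then obtain v B where v: "\<And>n::nat. v n \<in> espan" "\<And>p. p \<in> Omega \<Longrightarrow> (\<lambda>n. v n p) \<longlonglongrightarrow> q p"
    "\<And>n p. p \<in> Omega \<Longrightarrow> \<bar>v n p\<bar> \<le> B" unfolding bounded_limit_def by blast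
  have qc: "continuous_on UNIV q" using smooth_continuous smooth_real_polynomial_function q by blast
  obtain C where C: "C \<ge> 0" "\<And>p. p \<in> Omega \<Longrightarrow> \<bar>q p\<bar> \<le> C"
    using continuous_bounded_on[OF qc bounded_Omega] by blast
  show "approx_by espan q"
  proof (rule approx_by_bounded_seq[where v = v and g = "\<lambda>p. \<bar>B\<bar> + C"])
    show "v n \<in> borel_measurable LO" for n using v(1) espan_subset_L2 L2_measurable by blast
    show "q \<in> borel_measurable LO" by (rule continuous_imp_measurable_lebesgue_on[OF qc])
    show "AE p in LO. (\<lambda>n. v n p) \<longlonglongrightarrow> q p" by (rule AE_LO_I) (rule v(2))
    show "(\<lambda>p. \<bar>B\<bar> + C) \<in> L2 Omega" by (intro smooth_L2 smooth_const)
    show "AE p in LO. \<bar>v n p - q p\<bar> \<le> \<bar>\<bar>B\<bar> + C\<bar>" for n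
    proof (rule AE_LO_I)
      fix p assume "p \<in> Omega"
      then show "\<bar>v n p - q p\<bar> \<le> \<bar>\<bar>B\<bar> + C\<bar>" using v(3)[of p n] C(2)[of p] by linarith
    qed
  qed (fact v(1))
qed

subsection \<open>Weak derivatives of smooth functions\<close>

lemma lebesgue_integral_translation:
  fixes f :: "real^3 \<Rightarrow> real"
  assumes "f \<in> borel_measurable lebesgue"
  shows "(\<integral>p. f (c + p) \<partial>lebesgue) = (\<integral>p. f p \<partial>lebesgue)"
proof -
  have T: "(\<lambda>x. c + (\<Sum>j\<in>Basis. (1 * (x \<bullet> j)) *\<^sub>R j)) = (+) c"
    by (auto simp: euclidean_representation)
  have m: "(+) c \<in> lebesgue \<rightarrow>\<^sub>M lebesgue"
    using lebesgue_affine_measurable[where c = "\<lambda>_. 1" and t = c] unfolding T by simp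
  have "lebesgue = density (distr lebesgue lebesgue ((+) c)) (\<lambda>_. 1)"
    using lebesgue_affine_euclidean[where c = "\<lambda>_. 1" and t = c] unfolding T by simp
  then have "distr lebesgue lebesgue ((+) c) = lebesgue" by (simp add: density_1)
  then have "(\<integral>p. f p \<partial>lebesgue) = (\<integral>p. f p \<partial>distr lebesgue lebesgue ((+) c))" by simp
  also have "\<dots> = (\<integral>p. f (c + p) \<partial>lebesgue)" by (rule integral_distr[OF m assms])
  finally show ?thesis by simp
qed

lemma integral_lebesgue_on_support:
  fixes f :: "real^3 \<Rightarrow> real"
  assumes "open U" "\<And>p. p \<notin> U \<Longrightarrow> f p = 0"
  shows "(\<integral>p. f p \<partial>lebesgue_on U) = (\<integral>p. f p \<partial>lebesgue)"
proof -
  have "(\<integral>p. f p \<partial>lebesgue_on U) = (\<integral>p. indicator U p *\<^sub>R f p \<partial>lebesgue)"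
    using lebesgue_on_open[OF assms(1)] by (intro integral_restrict_space) simp
  also have "(\<lambda>p. indicator U p *\<^sub>R f p) = f" 
  proof
    show "indicator U p *\<^sub>R f p = f p" for p by (cases "p \<in> U") (simp_all add: assms(2))
  qed
  finally show ?thesis by simp
qed

lemma has_derivative_line:
  fixes \<phi> :: "real^3 \<Rightarrow> real"
  assumes "\<phi> differentiable (at (p + t *\<^sub>R axis i 1))"
  shows "((\<lambda>t. \<phi> (p + t *\<^sub>R axis i 1)) has_real_derivative pd i \<phi> (p + t *\<^sub>R axis i 1)) (at t)"
proof -
  define \<phi>' where "\<phi>' = frechet_derivative \<phi> (at (p + t *\<^sub>R axis i 1))"
  have d: "(\<phi> has_derivative \<phi>') (at (p + t *\<^sub>R axis i 1))"
    unfolding \<phi>'_def by (rule differentiable_pd[OF assms])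
  have "((\<lambda>t. p + t *\<^sub>R axis i 1) has_derivative (\<lambda>h. h *\<^sub>R axis i 1)) (at t)"
    by (auto intro!: derivative_eq_intros)
  from has_derivative_compose[OF this d]
  have "((\<lambda>t. \<phi> (p + t *\<^sub>R axis i 1)) has_derivative (\<lambda>h. \<phi>' (h *\<^sub>R axis i 1))) (at t)" .
  moreover have "\<phi>' (h *\<^sub>R axis i 1) = pd i \<phi> (p + t *\<^sub>R axis i 1) * h" for h
    using linear_scale[OF has_derivative_linear[OF d]] unfolding \<phi>'_def pd_def by simp
  ultimately show ?thesis by (simp add: has_field_derivative_def)
qed

lemma pd_eq_0_if_constant:
  assumes "smooth \<phi>" "\<And>t. \<phi> (p + t *\<^sub>R axis i 1) = \<phi> p"
  shows "pd i \<phi> p = 0"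
proof -
  have "((\<lambda>t. \<phi> (p + t *\<^sub>R axis i 1)) has_real_derivative pd i \<phi> (p + 0 *\<^sub>R axis i 1)) (at 0)"
    by (rule has_derivative_line[OF smooth_differentiable[OF assms(1)]])
  then have "((\<lambda>t. \<phi> p) has_real_derivative pd i \<phi> p) (at 0)" unfolding assms(2) by simp
  then show ?thesis using DERIV_unique DERIV_const by blast
qed

lemma pd_support:
  assumes "smooth \<phi>" "p \<notin> closure {p. \<phi> p \<noteq> 0}"
  shows "\<phi> p = 0" "pd i \<phi> p = 0"
proof -
  let ?K = "closure {p. \<phi> p \<noteq> 0}"
  have z: "\<phi> q = 0" if "q \<in> - ?K" for q using closure_subset[of "{p. \<phi> p \<noteq> 0}"] that by auto
  then show "\<phi> p = 0" using assms(2) by blast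
  have "(\<phi> has_derivative (\<lambda>h. 0)) (at p)"
  proof (rule has_derivative_transform_within_open[OF _ open_Compl[OF closed_closure[of "{p. \<phi> p \<noteq> 0}"]]])
    show "((\<lambda>_. 0 :: real) has_derivative (\<lambda>h. 0)) (at p)" by simp
    show "p \<in> - ?K" using assms(2) by simp
    show "0 = \<phi> q" if "q \<in> - ?K" for q using z[OF that] by simp
  qed
  then show "pd i \<phi> p = 0" by (rule pd_eqI)
qed

lemma test_function_support:
  assumes "test_function U \<phi>" "p \<notin> U"
  shows "\<phi> p = 0" "pd i \<phi> p = 0"
  using pd_support[of \<phi> p] assms unfolding test_function_def by blast+

lemma integrable_compact_support:
  fixes f :: "real^3 \<Rightarrow> real"
  assumes "continuous_on UNIV f" "compact K" "\<And>p. p \<notin> K \<Longrightarrow> f p = 0"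
  shows "integrable lebesgue f"
proof -
  have "integrable lborel (\<lambda>p. indicator K p *\<^sub>R f p)"
    using continuous_on_subset[OF assms(1)] assms(2) by (intro borel_integrable_compact) auto
  also have "(\<lambda>p. indicator K p *\<^sub>R f p) = f" 
  proof
    show "indicator K p *\<^sub>R f p = f p" for p by (cases "p \<in> K") (simp_all add: assms(3))
  qed
  finally show ?thesis
    using assms(1) by (subst integrable_completion) (auto simp: borel_measurable_continuous_onI)
qed

text \<open>The integrals of the difference quotients vanish by translation invariance, and the
  quotients converge to the partial derivative. The mean value theorem bounds them uniformly, on a
  ball that contains all their supports.\<close>

lemma integral_pd_compact_support:
  assumes g: "smooth g" and K: "compact K" "\<And>p. p \<notin> K \<Longrightarrow> g p = 0"
  shows "(\<integral>p. pd i g p \<partial>lebesgue) = 0"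
proof -
  define e :: "real^3" where "e = axis i 1"
  obtain R where R: "R > 0" "\<And>p. p \<in> K \<Longrightarrow> norm p \<le> R"
    using compact_imp_bounded[OF K(1)] by (meson bounded_pos)
  have gz: "g p = 0" if "norm p > R" for p using K(2) R(2) that by force
  have gc: "continuous_on UNIV g" "continuous_on UNIV (pd i g)" using g by (auto intro: smooth_continuous)
  \<comment> \<open>The quotients with step at most 1 vanish outside radius \<open>R + 1\<close>,
    and their intermediate points stay within \<open>R + 2\<close>.\<close>
  obtain B where B: "B \<ge> 0" "\<And>p. p \<in> cball 0 (R + 2) \<Longrightarrow> \<bar>pd i g p\<bar> \<le> B"
    using continuous_bounded_on[OF gc(2) bounded_cball] by blast
  have gi: "integrable lebesgue g" by (rule integrable_compact_support[OF gc(1) K])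
  have gm: "g \<in> borel_measurable lebesgue" using gi by auto
  define f where "f n p = real (Suc n) * (g ((1 / real (Suc n)) *\<^sub>R e + p) - g p)" for n p
  have ne: "norm e = 1" by (simp add: e_def)
  have 0: "(\<integral>p. f n p \<partial>lebesgue) = 0" for n
  proof -
    have "integrable lebesgue (\<lambda>p. g ((1 / real (Suc n)) *\<^sub>R e + p))"
    proof (rule integrable_compact_support[where K = "cball 0 (R + 1)"])
      show "continuous_on UNIV (\<lambda>p. g ((1 / real (Suc n)) *\<^sub>R e + p))"
        by (intro continuous_on_compose2[OF gc(1)] continuous_intros) auto
      fix p :: "real^3" assume "p \<notin> cball 0 (R + 1)"
      then have "norm p > R + 1" by simp
      moreover have "norm p \<le> norm ((1 / real (Suc n)) *\<^sub>R e + p) + norm ((1 / real (Suc n)) *\<^sub>R e)"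
        using norm_triangle_ineq4[of "(1 / real (Suc n)) *\<^sub>R e + p" "(1 / real (Suc n)) *\<^sub>R e"] by simp
      moreover have "norm ((1 / real (Suc n)) *\<^sub>R e) \<le> 1" by (simp add: ne)
      ultimately have "norm ((1 / real (Suc n)) *\<^sub>R e + p) > R" by linarith
      then show "g ((1 / real (Suc n)) *\<^sub>R e + p) = 0" by (rule gz)
    qed simp
    then show ?thesis unfolding f_def using gi lebesgue_integral_translation[OF gm] by simp
  qed
  have "(\<lambda>n. \<integral>p. f n p \<partial>lebesgue) \<longlonglongrightarrow> (\<integral>p. pd i g p \<partial>lebesgue)"
  proof (rule integral_dominated_convergence)
    show "pd i g \<in> borel_measurable lebesgue"
      using continuous_imp_measurable_lebesgue_on[OF gc(2), of UNIV] by (simp add: lebesgue_on_UNIV_eq)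
    show "f n \<in> borel_measurable lebesgue" for n
    proof -
      have "continuous_on UNIV (f n)" unfolding f_def
        by (intro continuous_intros continuous_on_compose2[OF gc(1)] gc(1)) auto
      from continuous_imp_measurable_lebesgue_on[OF this, of UNIV]
      show ?thesis by (simp add: lebesgue_on_UNIV_eq)
    qed
    have "integrable lebesgue (indicator (cball (0 :: real^3) (R + 1)) :: _ \<Rightarrow> real)"
      using lmeasurable_cball[of 0 "R + 1"] by (simp add: integrable_indicator_iff fmeasurable_def)
    then show "integrable lebesgue (\<lambda>p :: real^3. B * indicator (cball 0 (R + 1)) p)" by simp
    have line: "((\<lambda>t. g (p + t *\<^sub>R e)) has_real_derivative pd i g (p + t *\<^sub>R e)) (at t)" for p t
      unfolding e_def by (rule has_derivative_line[OF smooth_differentiable[OF g]])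
    show "AE p in lebesgue. (\<lambda>n. f n p) \<longlonglongrightarrow> pd i g p"
    proof (rule AE_I2)
      fix p
      have lim: "(\<lambda>h. (g (p + (0 + h) *\<^sub>R e) - g (p + 0 *\<^sub>R e)) / h) \<midarrow>0\<rightarrow> pd i g p"
        using line[of p 0] by (simp add: DERIV_def)
      have "filterlim (\<lambda>n. inverse (real (Suc n))) (at 0) sequentially"
        by (rule filterlim_atI[OF LIMSEQ_inverse_real_of_nat]) simp
      from filterlim_compose[OF lim this]
      show "(\<lambda>n. f n p) \<longlonglongrightarrow> pd i g p"
        by (simp add: f_def field_simps)
    qed
    show "AE p in lebesgue. norm (f n p) \<le> B * indicator (cball 0 (R + 1)) p" for n
    proof (rule AE_I2)
      fix p
      define h where "h = 1 / real (Suc n)"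
      have h: "0 < h" "h \<le> 1" unfolding h_def by auto
      have hp: "norm p \<le> norm (p + t *\<^sub>R e) + 1" "norm (p + t *\<^sub>R e) \<le> norm p + 1" if "0 \<le> t" "t \<le> h" for t
        using norm_triangle_ineq4[of "p + t *\<^sub>R e" "t *\<^sub>R e"] norm_triangle_ineq[of p "t *\<^sub>R e"] that h ne by auto
      show "norm (f n p) \<le> B * indicator (cball 0 (R + 1)) p"
      proof (cases "norm p \<le> R + 1")
        case True
        obtain t where t: "0 < t" "t < h" "g (p + h *\<^sub>R e) - g (p + 0 *\<^sub>R e) = (h - 0) * pd i g (p + t *\<^sub>R e)"
          using MVT2[OF h(1) line] by blast
        have "f n p = pd i g (p + t *\<^sub>R e)"
          using t(3) h unfolding f_def h_def[symmetric] by (simp add: add.commute) (simp add: h_def)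
        also have "norm \<dots> \<le> B" using B(2)[of "p + t *\<^sub>R e"] hp(2)[of t] t True by simp
        finally show ?thesis using True by (simp add: indicator_def)
      next
        case False
        then have "g p = 0" "g (p + h *\<^sub>R e) = 0" using gz[of p] gz[of "p + h *\<^sub>R e"] hp(1)[of h] h by auto
        then have "f n p = 0" unfolding f_def h_def[symmetric] by (simp add: add.commute)
        then show ?thesis using B(1) by (simp add: indicator_def)
      qed
    qed
  qed
  then show ?thesis unfolding 0 using LIMSEQ_unique tendsto_const by blast
qed

text \<open>The product of \<open>v\<close> with a test function has compact support, so the
  integral of its derivative vanishes; the product rule splits this into the two sides.\<close>

lemma weak_pderiv_smooth:
  assumes "smooth v" "open U"
  shows "weak_pderiv U i v (pd i v)"
  unfolding weak_pderiv_def
proof (intro allI impI)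
  fix \<phi> assume t: "test_function U \<phi>"
  define K where "K = closure {p. \<phi> p \<noteq> 0}"
  have sm: "smooth \<phi>" and K: "compact K" using t by (auto simp: test_function_def K_def)
  note z = test_function_support[OF t]
  have zK: "\<phi> p = 0" "pd i \<phi> p = 0" if "p \<notin> K" for p
    using pd_support[OF sm] that unfolding K_def by blast+
  have i1: "integrable lebesgue (\<lambda>p. v p * pd i \<phi> p)"
    by (rule integrable_compact_support[OF smooth_continuous[OF smooth_mult[OF assms(1) smooth_pd[OF sm]]] K])
       (simp add: zK)
  have i2: "integrable lebesgue (\<lambda>p. pd i v p * \<phi> p)"
    by (rule integrable_compact_support[OF smooth_continuous[OF smooth_mult[OF smooth_pd[OF assms(1)] sm]] K])
       (simp add: zK)
  have "(\<integral>p. pd i (\<lambda>p. v p * \<phi> p) p \<partial>lebesgue) = 0"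
    by (rule integral_pd_compact_support[OF smooth_mult[OF assms(1) sm] K]) (simp add: zK)
  then have "(\<integral>p. v p * pd i \<phi> p + pd i v p * \<phi> p \<partial>lebesgue) = 0"
    by (simp only: smooth_pd_simps(2)[OF assms(1) sm])
  then show "(\<integral>p. v p * pd i \<phi> p \<partial>lebesgue_on U) = - (\<integral>p. pd i v p * \<phi> p \<partial>lebesgue_on U)"
    using integral_lebesgue_on_support[OF assms(2), of "\<lambda>p. v p * pd i \<phi> p"]
      integral_lebesgue_on_support[OF assms(2), of "\<lambda>p. pd i v p * \<phi> p"] i1 i2 by (simp add: z)
qed

lemma weak_pderiv_subset:
  assumes "weak_pderiv V i u g" "U \<subseteq> V" "open U" "open V"
  shows "weak_pderiv U i u g"
  unfolding weak_pderiv_def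
proof (intro allI impI)
  fix \<phi> assume t: "test_function U \<phi>"
  then have "test_function V \<phi>" using assms(2) by (auto simp: test_function_def)
  then have "(\<integral>p. u p * pd i \<phi> p \<partial>lebesgue_on V) = - (\<integral>p. g p * \<phi> p \<partial>lebesgue_on V)"
    using assms(1) by (simp add: weak_pderiv_def)
  moreover have "\<phi> p = 0 \<and> pd i \<phi> p = 0" if "p \<notin> U" for p using test_function_support[OF t that] by blast
  then have "u p * pd i \<phi> p = 0" "g p * \<phi> p = 0" if "p \<notin> U" for p using that by auto
  moreover have "p \<notin> U" if "p \<notin> V" for p using that assms(2) by blast
  ultimately show "(\<integral>p. u p * pd i \<phi> p \<partial>lebesgue_on U) = - (\<integral>p. g p * \<phi> p \<partial>lebesgue_on U)"
    using integral_lebesgue_on_support[OF assms(3)] integral_lebesgue_on_support[OF assms(4)]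
    by (metis (no_types, lifting))
qed

lemma smooth_L2': "smooth v \<Longrightarrow> open U \<Longrightarrow> bounded U \<Longrightarrow> v \<in> L2 U"
  by (intro L2_continuous smooth_continuous)

lemma wpd_smooth:
  assumes "smooth v"
  shows "wpd i v \<in> L2 Omega" "AE p in LO. wpd i v p = pd i v p"
  using wpd_eq[OF smooth_L2[OF smooth_pd[OF assms]] weak_pderiv_smooth[OF assms open_Omega]] by auto

lemma H1p_weak:
  assumes "u \<in> H1p"
  shows "\<exists>g. g \<in> L2 (slab 16) \<and> weak_pderiv (slab 16) i u g"
proof -
  have "u \<in> H1 (slab 16)" using assms by (simp add: H1p_def)
  then show ?thesis unfolding H1_def by blast
qed

lemma H1p_L2:
  assumes "u \<in> H1p" shows "u \<in> L2 (slab 16)" "u \<in> L2 Omega"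
proof -
  have "u \<in> H1 (slab 16)" using assms by (simp add: H1p_def)
  then show "u \<in> L2 (slab 16)" by (simp add: H1_def)
  then show "u \<in> L2 Omega" by (rule L2_subset[OF _ Omega_subset_slab open_Omega open_slab])
qed

lemma H1p_wpd:
  assumes "u \<in> H1p"
  shows "wpd i u \<in> L2 Omega" "weak_pderiv Omega i u (wpd i u)"
proof -
  obtain g where g: "g \<in> L2 (slab 16)" "weak_pderiv (slab 16) i u g" using H1p_weak[OF assms] by blast
  have "g \<in> L2 Omega" "weak_pderiv Omega i u g"
    using L2_subset[OF g(1) Omega_subset_slab open_Omega open_slab]
      weak_pderiv_subset[OF g(2) Omega_subset_slab open_Omega open_slab] by auto
  then show "wpd i u \<in> L2 Omega" "weak_pderiv Omega i u (wpd i u)" using wpd_eq by blast+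
qed

definition periodic :: "3 \<Rightarrow> (real^3 \<Rightarrow> real) \<Rightarrow> bool" where
  "periodic i v \<longleftrightarrow> (\<forall>p. v (axis i (2 * pi) + p) = v p)"

subsection \<open>Integration by parts in the periodic directions\<close>

lemma L2_mult_continuous_integrable:
  fixes u w :: "real^3 \<Rightarrow> real"
  assumes "u \<in> L2 U" "continuous_on UNIV w" "open U" "bounded U"
  shows "integrable (lebesgue_on U) (\<lambda>p. u p * w p)"
  by (rule L2_mult_integrable[OF assms(1) L2_continuous[OF assms(2-4)]])

lemma AE_component_neq: "AE p :: real^3 in lebesgue. p $ i \<noteq> c"
proof -
  have "negligible {p :: real^3. p $ i = c}" 
    using negligible_standard_hyperplane[of "axis i 1 :: real^3" c] by (simp add: inner_axis)
  then have "{p :: real^3. p $ i = c} \<in> null_sets lebesgue" by (simp add: negligible_iff_null_sets)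
  from AE_not_in[OF this] show ?thesis by simp
qed

lemma AE_restrict_lebesgue:
  assumes "open U" "AE p in lebesgue. P p"
  shows "AE p in lebesgue_on U. P p"
  using assms lebesgue_on_open[OF assms(1)]
  by (subst AE_restrict_space_iff) (auto elim: eventually_mono)

lemma axis_component: "(t *\<^sub>R axis i 1 :: real^3) $ j = (if j = i then t else 0)"
  by (simp add: axis_def)

text \<open>\<open>\<sigma>\<close> localises to a layer behind the face \<open>p $ i = 0\<close>,
  its translate to the layer behind the face one period away. The factor \<open>\<xi>\<close> does
  not depend on \<open>p $ i\<close>, and \<open>u\<close> and \<open>v\<close> are periodic, so
  translation by one period carries one integrand to the other. The periodicity of \<open>u\<close>
  is known only almost everywhere on the strip, in which the support of \<open>\<xi>\<close> keeps
  the points.\<close>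

lemma periodic_shift_integral:
  assumes i: "i \<noteq> 3" and u: "u \<in> H1p" and v: "continuous_on UNIV v" "periodic i v"
    and \<xi>: "continuous_on UNIV \<xi>" "\<And>p t. \<xi> (p + t *\<^sub>R axis i 1) = \<xi> p"
      "\<And>p j. \<xi> p \<noteq> 0 \<Longrightarrow> j \<noteq> i \<Longrightarrow> 0 < p $ j \<and> p $ j < side j"
    and \<sigma>: "continuous_on UNIV \<sigma>" "\<And>t. \<sigma> t \<noteq> 0 \<Longrightarrow> 0 < t \<and> t < 1"
  shows "(\<integral>p. u p * (v p * (\<sigma> (p $ i) * \<xi> p)) \<partial>lebesgue_on (slab 16))
    = (\<integral>p. u p * (v p * (\<sigma> (p $ i - 2 * pi) * \<xi> p)) \<partial>lebesgue_on (slab 16))"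
proof -
  define c :: "real^3" where "c = axis i (2 * pi)"
  have c: "c = (2 * pi) *\<^sub>R axis i 1" by (simp add: c_def axis_def vec_eq_iff)
  \<comment> \<open>The layers reach from 0 to 1 and from \<open>2 * pi\<close> to
    \<open>2 * pi + 1\<close>; as \<open>2 * pi < 8\<close>, both lie between the stated bounds,
    well inside the slab.\<close>
  have supp: "p \<in> slab 16" if "\<xi> p \<noteq> 0" "- 8 < p $ i" "p $ i < 10" for p
  proof -
    have "0 < p $ j \<and> p $ j < side j" if "j \<noteq> i" for j using \<xi>(3)[OF \<open>\<xi> p \<noteq> 0\<close> that] .
    from this[of 1] this[of 2] this[of 3] show ?thesis
      using i that pi_less_4 exhaust_3[of i] unfolding slab_iff side_def by auto
  qed
  define A B where "A p = u p * (v p * (\<sigma> (p $ i) * \<xi> p))"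
    and "B p = u p * (v p * (\<sigma> (p $ i - 2 * pi) * \<xi> p))" for p
  have A0: "A p = 0" if "p \<notin> slab 16" for p
  proof (rule ccontr)
    assume "A p \<noteq> 0"
    then have "\<xi> p \<noteq> 0" "\<sigma> (p $ i) \<noteq> 0" by (auto simp: A_def)
    then show False using supp[of p] \<sigma>(2)[of "p $ i"] that by simp
  qed
  have B0: "B p = 0" if "p \<notin> slab 16" for p
  proof (rule ccontr)
    assume "B p \<noteq> 0"
    then have "\<xi> p \<noteq> 0" "\<sigma> (p $ i - 2 * pi) \<noteq> 0" by (auto simp: B_def)
    moreover from this have "0 < p $ i - 2 * pi \<and> p $ i - 2 * pi < 1" by (intro \<sigma>(2))
    then have "- 8 < p $ i" "p $ i < 10" using pi_less_4 pi_gt_zero by linarith+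
    ultimately show False using supp[of p] that by simp
  qed
  have Ac: "continuous_on UNIV (\<lambda>p. v p * (\<sigma> (p $ i) * \<xi> p))"
    by (intro continuous_intros v \<xi> continuous_on_compose2[OF \<sigma>(1)]) auto
  have Bc: "continuous_on UNIV (\<lambda>p. v p * (\<sigma> (p $ i - 2 * pi) * \<xi> p))"
    by (intro continuous_intros v \<xi> continuous_on_compose2[OF \<sigma>(1)]) auto
  have um: "u \<in> borel_measurable (lebesgue_on (slab 16))" by (rule L2_measurable[OF H1p_L2(1)[OF u]])
  \<comment> \<open>\<open>u\<close> is known to be measurable on the slab only; the localised
    product vanishes outside it, so extension by zero gives measurability on the whole space, where
    translations act.\<close>
  have m: "w \<in> borel_measurable lebesgue"
    if w: "\<And>p. p \<notin> slab 16 \<Longrightarrow> w p = 0" "w = (\<lambda>p. u p * g p)" "continuous_on UNIV g" for w g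
  proof -
    have "(\<lambda>p. u p * g p) \<in> borel_measurable (lebesgue_on (slab 16))"
      by (intro borel_measurable_times um continuous_imp_measurable_lebesgue_on w)
    then have "w \<in> borel_measurable (lebesgue_on (slab 16))" unfolding w(2) .
    then have "(\<lambda>p. if p \<in> slab 16 then w p else 0) \<in> borel_measurable lebesgue"
      using lebesgue_on_open[OF open_slab] by (intro borel_measurable_if_I)
    also have "(\<lambda>p. if p \<in> slab 16 then w p else 0) = w" using w(1) by auto
    finally show ?thesis .
  qed
  have Am: "A \<in> borel_measurable lebesgue" by (rule m[OF A0 _ Ac]) (auto simp: A_def)
  have Bm: "B \<in> borel_measurable lebesgue" by (rule m[OF B0 _ Bc]) (auto simp: B_def)
  have per: "AE p in lebesgue. p \<in> strip \<longrightarrow> u (c + p) = u p"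
  proof -
    have "AE p in lebesgue_on strip. u (p + axis 1 (2 * pi)) = u p \<and> u (p + axis 2 (2 * pi)) = u p"
      using u by (simp add: H1p_def periodic_xy_def)
    then have "AE p in lebesgue. p \<in> strip \<longrightarrow> u (p + axis 1 (2 * pi)) = u p \<and> u (p + axis 2 (2 * pi)) = u p"
      using lebesgue_on_open[OF open_strip] by (subst (asm) AE_restrict_space_iff) auto
    then show ?thesis
      by eventually_elim (use i exhaust_3[of i] in \<open>auto simp: c_def add.commute\<close>)
  qed
  have eq: "AE p in lebesgue. B (c + p) = A p"
    using per
  proof eventually_elim
    case (elim p)
    have x: "\<xi> (c + p) = \<xi> p" using \<xi>(2)[of p "2 * pi"] unfolding c by (simp add: add.commute)
    have comp: "(c + p) $ i - 2 * pi = p $ i" unfolding c by (simp add: axis_component)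
    show ?case
    proof (cases "\<xi> p = 0")
      case False
      then have "p \<in> strip" using \<xi>(3)[of p 3] i by (auto simp: strip_def side_def)
      then show ?thesis unfolding A_def B_def x comp using elim v(2)
        by (simp add: periodic_def c_def)
    qed (simp add: A_def B_def x)
  qed
  have "(\<integral>p. A p \<partial>lebesgue_on (slab 16)) = (\<integral>p. A p \<partial>lebesgue)"
    by (rule integral_lebesgue_on_support[OF open_slab A0])
  also have "\<dots> = (\<integral>p. B (c + p) \<partial>lebesgue)"
  proof (rule integral_cong_AE[OF Am])
    show "(\<lambda>p. B (c + p)) \<in> borel_measurable lebesgue"
    proof -
      have T: "(\<lambda>x. c + (\<Sum>j\<in>Basis. (1 * (x \<bullet> j)) *\<^sub>R j)) = (+) c"
        by (auto simp: euclidean_representation)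
      have "(+) c \<in> lebesgue \<rightarrow>\<^sub>M lebesgue"
        using lebesgue_affine_measurable[where c = "\<lambda>_. 1" and t = c] unfolding T by simp
      from measurable_compose[OF this Bm] show ?thesis .
    qed
    show "AE p in lebesgue. A p = B (c + p)" using eq by eventually_elim simp
  qed
  also have "\<dots> = (\<integral>p. B p \<partial>lebesgue)" by (rule lebesgue_integral_translation[OF Bm])
  also have "\<dots> = (\<integral>p. B p \<partial>lebesgue_on (slab 16))"
    by (rule integral_lebesgue_on_support[OF open_slab B0, symmetric])
  finally show ?thesis by (simp add: A_def B_def)
qed

text \<open>The limit of the cutoffs may fail on one hyperplane, which is a null set;
  \<open>\<bar>w p\<bar>\<close> dominates.\<close>

lemma integral_slab_cutoff_tendsto:
  fixes w :: "real^3 \<Rightarrow> real"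
  assumes w: "integrable (lebesgue_on (slab 16)) w"
    and \<zeta>: "\<And>n. \<zeta> n \<in> borel_measurable (lebesgue_on (slab 16))" "\<And>n p. \<bar>\<zeta> n p\<bar> \<le> 1"
      "\<And>p. p $ i \<noteq> 2 * pi \<Longrightarrow> (\<lambda>n. \<zeta> n p) \<longlonglongrightarrow> indicator Omega p"
  shows "(\<lambda>n. \<integral>p. w p * \<zeta> n p \<partial>lebesgue_on (slab 16)) \<longlonglongrightarrow> (\<integral>p. w p \<partial>LO)"
proof -
  have "(\<lambda>n. \<integral>p. w p * \<zeta> n p \<partial>lebesgue_on (slab 16)) \<longlonglongrightarrow> (\<integral>p. w p * indicator Omega p \<partial>lebesgue_on (slab 16))"
  proof (rule integral_dominated_convergence)
    have wm: "w \<in> borel_measurable (lebesgue_on (slab 16))" using w by simp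
    have "Omega \<in> sets (lebesgue_on (slab 16))"
      using lebesgue_on_open[OF open_Omega] lebesgue_on_open[OF open_slab] Omega_subset_slab
      by (auto simp: sets_restrict_space_iff)
    then show "(\<lambda>p. w p * indicator Omega p) \<in> borel_measurable (lebesgue_on (slab 16))"
      using wm by simp
    show "(\<lambda>p. w p * \<zeta> n p) \<in> borel_measurable (lebesgue_on (slab 16))" for n
      by (intro borel_measurable_times wm \<zeta>(1))
    show "integrable (lebesgue_on (slab 16)) (\<lambda>p. \<bar>w p\<bar>)" using w by simp
    show "AE p in lebesgue_on (slab 16). (\<lambda>n. w p * \<zeta> n p) \<longlonglongrightarrow> w p * indicator Omega p"
      using AE_restrict_lebesgue[OF open_slab AE_component_neq[of i "2 * pi"]]
      by eventually_elim (intro tendsto_intros \<zeta>(3))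
    show "AE p in lebesgue_on (slab 16). norm (w p * \<zeta> n p) \<le> \<bar>w p\<bar>" for n
      using \<zeta>(2)[of n] by (intro AE_I2) (simp add: abs_mult mult_left_le)
  qed
  also have "(\<integral>p. w p * indicator Omega p \<partial>lebesgue_on (slab 16)) = (\<integral>p. w p * indicator Omega p \<partial>lebesgue)"
    using Omega_subset_slab by (intro integral_lebesgue_on_support open_slab) (auto simp: indicator_def)
  also have "\<dots> = (\<integral>p. w p \<partial>LO)"
    using lebesgue_on_open[OF open_Omega] by (subst integral_restrict_space) (auto simp: mult.commute)
  finally show ?thesis .
qed

text \<open>The weak derivative on the slab is tested with \<open>v\<close> times a cutoff that
  tends to the indicator of the box. The cutoff rises just inside the face \<open>p $ i = 0\<close>
  and falls just outside the opposite face. Its two layers are exact translates by one period, so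
  their contributions cancel for every \<open>n\<close>, and only the term with
  \<open>pd i v\<close> survives.\<close>

lemma H1p_ibp:
  assumes u: "u \<in> H1p" and i: "i \<noteq> 3" and v: "smooth v" "periodic i v"
  shows "ip (wpd i u) v = - ip u (pd i v)"
proof -
  let ?S = "slab 16"
  obtain g where g: "g \<in> L2 ?S" "weak_pderiv ?S i u g" using H1p_weak[OF u] by blast
  have gO: "g \<in> L2 Omega" "weak_pderiv Omega i u g"
    using L2_subset[OF g(1) Omega_subset_slab open_Omega open_slab]
      weak_pderiv_subset[OF g(2) Omega_subset_slab open_Omega open_slab] by auto
  have wg: "ip (wpd i u) v = ip g v"
    using wpd_eq[OF gO] gO smooth_L2[OF v(1)] by (intro ip_cong_AE) (auto intro: L2_measurable)
  have uS: "u \<in> L2 ?S" by (rule H1p_L2(1)[OF u])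
  obtain S S' where "smooth_transition S S'" using smooth_transition_exists by blast
  note S = smooth_transitionD[OF this]
  have "\<forall>j. \<exists>\<eta>. smooth_cutoff 0 (side j) \<eta>" using smooth_cutoff_exists by blast
  then obtain \<eta> where "\<And>j. smooth_cutoff 0 (side j) (\<eta> j)" by metis
  note \<eta> = smooth_cutoffD[OF this]
  \<comment> \<open>The cutoff in the other directions keeps the test function away from their faces
    and is constant along direction \<open>i\<close>.\<close>
  define \<xi> where "\<xi> n p = (\<Prod>j\<in>UNIV - {i}. \<eta> j n (p $ j))" for n :: nat and p :: "real^3"
  have \<xi>s: "smooth (\<xi> n)" for n unfolding \<xi>_def by (intro smooth_prod \<eta>)
  have \<xi>i: "\<xi> n (p + t *\<^sub>R axis i 1) = \<xi> n p" for n p t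
    unfolding \<xi>_def by (intro prod.cong) (auto simp: axis_def)
  have \<xi>b: "0 \<le> \<xi> n p" "\<xi> n p \<le> 1" for n p
    unfolding \<xi>_def using \<eta>(2,3) by (auto intro!: prod_nonneg prod_le_1)
  have \<eta>0: "0 < t \<and> t < side j" if "\<eta> j n t \<noteq> 0" for j n t
  proof -
    have "1 / real (Suc n) > 0" by simp
    then show ?thesis using \<eta>(4,5)[OF that] by linarith
  qed
  have \<xi>0: "0 < p $ j \<and> p $ j < side j" if "\<xi> n p \<noteq> 0" "j \<noteq> i" for n p j
    using that by (intro \<eta>0[of j n]) (auto simp: \<xi>_def)
  define N where "N n = real (Suc n)" for n
  have N: "N n \<ge> 1" for n by (simp add: N_def)
  \<comment> \<open>A difference of two steps one period apart: the derivative is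
    \<open>\<sigma> n t - \<sigma> n (t - 2 * pi)\<close>, an exact periodic cancellation, which a
    cutoff supported inside the box would not give.\<close>
  define \<theta> where "\<theta> n t = S (N n * t + 0) - S (N n * t + (- 2 * pi * N n))" for n t
  define \<sigma> where "\<sigma> n t = N n * S' (N n * t + 0)" for n t
  have \<theta>s: "smooth (\<lambda>p. \<theta> n (p $ i))" for n unfolding \<theta>_def by (intro smooth_diff S(7))
  have Nd: "((\<lambda>t. S (N n * t + d)) has_real_derivative N n * S' (N n * t + d)) (at t)" for n t d
    by (rule DERIV_cong[OF DERIV_chain2[OF S(5)]]) (auto intro!: derivative_eq_intros)
  have sh: "N n * t + (- 2 * pi * N n) = N n * (t - 2 * pi) + 0" for n t by (simp add: algebra_simps)
  have \<theta>e: "\<theta> n t = S (N n * t + 0) - S (N n * (t - 2 * pi) + 0)" for n t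
    by (simp only: \<theta>_def sh)
  have \<theta>d: "(\<theta> n has_real_derivative \<sigma> n t - \<sigma> n (t - 2 * pi)) (at t)" for n t
    using DERIV_diff[OF Nd[of n 0 t] Nd[of n "- 2 * pi * N n" t]]
    unfolding \<theta>_def \<sigma>_def sh by (simp add: algebra_simps)
  have \<theta>b: "\<bar>\<theta> n t\<bar> \<le> 1" for n t
    using S(3)[of "N n * t + 0"] S(4)[of "N n * t + 0"] S(3)[of "N n * t + (- 2 * pi * N n)"]
      S(4)[of "N n * t + (- 2 * pi * N n)"] unfolding \<theta>_def by linarith
  have \<theta>0: "0 < t \<and> t < 2 * pi + 1" if "\<theta> n t \<noteq> 0" for n t
  proof (rule ccontr)
    assume "\<not> ?thesis"
    then consider "t \<le> 0" | "t \<ge> 2 * pi + 1" by linarith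
    then show False
    proof cases
      case 1
      then have "N n * t + 0 \<le> 0" "N n * (t - 2 * pi) + 0 \<le> 0"
        using mult_nonneg_nonpos[of "N n" t] mult_nonneg_nonpos[of "N n" "t - 2 * pi"]
          N[of n] pi_gt_zero by simp_all
      then show False using that S(1) unfolding \<theta>_def sh by simp
    next
      case 2
      then have "1 \<le> t" "1 \<le> t - 2 * pi" using pi_gt_zero by linarith+
      then have "1 \<le> N n * t" "1 \<le> N n * (t - 2 * pi)"
        using N[of n] mult_mono[of 1 "N n" 1 t] mult_mono[of 1 "N n" 1 "t - 2 * pi"] by simp_all
      then show False using that S(2) unfolding \<theta>_def sh by simp
    qed
  qed
  have \<sigma>0: "0 < t \<and> t < 1" if "\<sigma> n t \<noteq> 0" for n t
  proof -
    have "0 < N n * t" "N n * t < 1" using that S(6)[of "N n * t"] unfolding \<sigma>_def by (auto simp: not_le[symmetric])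
    moreover from this have "0 < t" using N[of n] by (simp add: zero_less_mult_iff)
    moreover from this have "1 * t \<le> N n * t" using N[of n] by (intro mult_right_mono) auto
    ultimately show ?thesis by linarith
  qed
  have \<sigma>c: "continuous_on UNIV (\<sigma> n)" for n
  proof -
    have "continuous_on UNIV (\<lambda>p :: real^3. S' (1 * p $ 1 + 0))" by (rule smooth_continuous[OF S(8)])
    then have "continuous_on UNIV (\<lambda>t :: real. (\<lambda>p :: real^3. S' (1 * p $ 1 + 0)) (\<chi> j. t))"
      by (rule continuous_on_compose2) (auto intro!: continuous_intros)
    then have "continuous_on UNIV S'" by simp
    then show ?thesis unfolding \<sigma>_def by (intro continuous_intros continuous_on_compose2[OF \<open>continuous_on UNIV S'\<close>]) auto
  qed
  define \<zeta> where "\<zeta> n p = \<theta> n (p $ i) * \<xi> n p" for n p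
  have \<zeta>s: "smooth (\<zeta> n)" for n unfolding \<zeta>_def by (intro smooth_mult \<theta>s \<xi>s)
  have \<zeta>d: "pd i (\<zeta> n) p = (\<sigma> n (p $ i) - \<sigma> n (p $ i - 2 * pi)) * \<xi> n p" for n p
  proof -
    have "pd i (\<xi> n) p = 0" by (rule pd_eq_0_if_constant[OF \<xi>s \<xi>i])
    then show ?thesis unfolding \<zeta>_def smooth_pd_simps(2)[OF \<theta>s \<xi>s] pd_component(2)[OF \<theta>d] by simp
  qed
  have \<zeta>b: "\<bar>\<zeta> n p\<bar> \<le> 1" for n p
    unfolding \<zeta>_def abs_mult using \<theta>b[of n "p $ i"] \<xi>b[of n p] by (simp add: mult_le_one)
  have \<zeta>m: "\<zeta> n \<in> borel_measurable (lebesgue_on ?S)" for n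
    by (rule continuous_imp_measurable_lebesgue_on[OF smooth_continuous[OF \<zeta>s]])
  have si: "side i = 2 * pi" using i by (simp add: side_def)
  \<comment> \<open>On the face \<open>p $ i = 2 * pi\<close> the cutoff \<open>\<theta>\<close>
    tends to 1, because its fall begins only there; hence the exclusion.\<close>
  have \<zeta>lim: "(\<lambda>n. \<zeta> n p) \<longlonglongrightarrow> indicator Omega p" if p: "p $ i \<noteq> 2 * pi" for p
  proof -
    have NS: "\<forall>\<^sub>F n in sequentially. S (N n * t + 0) = 1" if "t > 0" for t
    proof -
      obtain M :: nat where M: "real M > 1 / t" using reals_Archimedean2 by blast
      have "S (N n * t + 0) = 1" if "n \<ge> M" for n
      proof (rule S(2))
        have "1 < real M * t" using M \<open>t > 0\<close> by (simp add: pos_divide_less_eq)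
        also have "\<dots> \<le> N n * t" using that \<open>t > 0\<close> unfolding N_def by (intro mult_right_mono) auto
        finally show "1 \<le> N n * t + 0" by simp
      qed
      then show ?thesis by (auto simp: eventually_sequentially)
    qed
    have NS0: "S (N n * t + 0) = 0" if "t \<le> 0" for n t
      using that N[of n] by (intro S(1)) (simp add: mult_nonneg_nonpos)
    show ?thesis
    proof (cases "p \<in> Omega")
      case True
      then have comp: "0 < p $ j" "p $ j < side j" for j by (auto simp: Omega_iff)
      have "(\<lambda>n. \<xi> n p) \<longlonglongrightarrow> (\<Prod>j\<in>UNIV - {i}. 1)"
        unfolding \<xi>_def by (intro tendsto_prod \<eta>(6) comp)
      moreover have "\<forall>\<^sub>F n in sequentially. \<theta> n (p $ i) = 1"
        using NS[OF comp(1)[of i]]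
      proof eventually_elim
        case (elim n)
        have "S (N n * (p $ i - 2 * pi) + 0) = 0" using comp(2)[of i] si by (intro NS0) simp
        with elim show ?case by (simp only: \<theta>e)
      qed
      then have "(\<lambda>n. \<theta> n (p $ i)) \<longlonglongrightarrow> 1" by (rule tendsto_eventually)
      ultimately have "(\<lambda>n. \<zeta> n p) \<longlonglongrightarrow> 1 * (\<Prod>j\<in>UNIV - {i}. 1)" unfolding \<zeta>_def by (intro tendsto_mult)
      then show ?thesis using True by simp
    next
      case False
      then obtain j where j: "\<not> (0 < p $ j \<and> p $ j < side j)" by (auto simp: Omega_iff)
      have "\<forall>\<^sub>F n in sequentially. \<zeta> n p = 0"
      proof (cases "j = i")
        case True
        then consider "p $ i \<le> 0" | "p $ i > 2 * pi" using j si p by fastforce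
        then show ?thesis
        proof cases
          case 1
          then have "\<theta> n (p $ i) = 0" for n using \<theta>0[of n "p $ i"] by linarith
          then show ?thesis by (simp add: \<zeta>_def)
        next
          case 2
          then have "p $ i > 0" "p $ i - 2 * pi > 0" using pi_gt_zero by linarith+
          from NS[OF this(1)] NS[OF this(2)] show ?thesis
            by eventually_elim (simp only: \<zeta>_def \<theta>e, simp)
        qed
      next
        case False
        then have "\<xi> n p = 0" for n using \<xi>0 j by blast
        then show ?thesis by (simp add: \<zeta>_def)
      qed
      then show ?thesis using False by (simp add: tendsto_eventually)
    qed
  qed
  have key: "(\<integral>p. (u p * pd i v p) * \<zeta> n p \<partial>lebesgue_on ?S) = - (\<integral>p. (g p * v p) * \<zeta> n p \<partial>lebesgue_on ?S)" for n
  proof -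
    have "test_function ?S (\<lambda>p. v p * \<zeta> n p)"
    proof (rule test_functionI[where a = "\<chi> j. if j = i then 0 else 1 / real (Suc n)"
          and b = "\<chi> j. if j = i then 2 * pi + 1 else side j - 1 / real (Suc n)"])
      show "smooth (\<lambda>p. v p * \<zeta> n p)" by (intro smooth_mult v \<zeta>s)
      fix p assume "v p * \<zeta> n p \<noteq> 0"
      then have a: "\<theta> n (p $ i) \<noteq> 0" "\<xi> n p \<noteq> 0" by (auto simp: \<zeta>_def)
      then have b: "\<eta> j n (p $ j) \<noteq> 0" if "j \<noteq> i" for j using that by (auto simp: \<xi>_def)
      have "(if j = i then 0 else 1 / real (Suc n)) \<le> p $ j \<and>
          p $ j \<le> (if j = i then 2 * pi + 1 else side j - 1 / real (Suc n))" for j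
        using \<theta>0[OF a(1)] \<eta>(4,5)[OF b[of j]] by (cases "j = i") auto
      then show "p \<in> cbox (\<chi> j. if j = i then 0 else 1 / real (Suc n))
          (\<chi> j. if j = i then 2 * pi + 1 else side j - 1 / real (Suc n))"
        unfolding mem_box_cart by simp
    next
      show "cbox (\<chi> j. if j = i then 0 else 1 / real (Suc n))
          (\<chi> j. if j = i then 2 * pi + 1 else side j - 1 / real (Suc n)) \<subseteq> ?S"
      proof
        fix p assume p: "p \<in> cbox (\<chi> j. if j = i then 0 else 1 / real (Suc n))
          (\<chi> j. if j = i then 2 * pi + 1 else side j - 1 / real (Suc n))"
        define h where "h = 1 / real (Suc n)"
        have c: "(if j = i then 0 else h) \<le> p $ j"
          "p $ j \<le> (if j = i then 2 * pi + 1 else side j - h)" for j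
          using p[unfolded mem_box_cart vec_lambda_beta] unfolding h_def by blast+
        have pos: "h > 0" by (simp add: h_def)
        have s: "side j \<le> 2 * pi + 1" for j using pi_gt_zero by (auto simp: side_def)
        have b: "0 \<le> p $ j" "p $ j \<le> 2 * pi + 1" for j
          using c[of j] s[of j] pos by (auto split: if_splits)
        have "h \<le> p $ 3" "p $ 3 \<le> 1 - h" using c[of 3] i by (auto simp: side_def)
        then have "0 < p $ 3" "p $ 3 < 1" using pos by linarith+
        moreover have "\<bar>p $ j\<bar> < 16" for j using b[of j] pi_less_4 by linarith
        ultimately show "p \<in> ?S" unfolding slab_iff by blast
      qed
    qed
    then have w: "(\<integral>p. u p * pd i (\<lambda>p. v p * \<zeta> n p) p \<partial>lebesgue_on ?S)
        = - (\<integral>p. g p * (v p * \<zeta> n p) \<partial>lebesgue_on ?S)"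
      using g(2) unfolding weak_pderiv_def by blast
    have vc: "continuous_on UNIV v" by (rule smooth_continuous[OF v(1)])
    have \<xi>c: "continuous_on UNIV (\<xi> n)" by (rule smooth_continuous[OF \<xi>s])
    have \<sigma>c2: "continuous_on UNIV (\<lambda>p :: real^3. \<sigma> n (p $ i))" "continuous_on UNIV (\<lambda>p :: real^3. \<sigma> n (p $ i - 2 * pi))"
      by (intro continuous_on_compose2[OF \<sigma>c[of n]] continuous_intros; simp)+
    have I1: "integrable (lebesgue_on ?S) (\<lambda>p. u p * (v p * (\<sigma> n (p $ i) * \<xi> n p)))"
      "integrable (lebesgue_on ?S) (\<lambda>p. u p * (v p * (\<sigma> n (p $ i - 2 * pi) * \<xi> n p)))"
      "integrable (lebesgue_on ?S) (\<lambda>p. u p * (pd i v p * \<zeta> n p))"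
      by (intro L2_mult_continuous_integrable uS open_slab bounded_slab continuous_on_mult vc \<xi>c \<sigma>c2
          smooth_continuous[OF smooth_pd[OF v(1)]] smooth_continuous[OF \<zeta>s])+
    \<comment> \<open>These are the two layer terms produced by the derivative of the
      cutoff.\<close>
    have shift: "(\<integral>p. u p * (v p * (\<sigma> n (p $ i) * \<xi> n p)) \<partial>lebesgue_on ?S)
      = (\<integral>p. u p * (v p * (\<sigma> n (p $ i - 2 * pi) * \<xi> n p)) \<partial>lebesgue_on ?S)"
      by (rule periodic_shift_integral[OF i u vc v(2) \<xi>c \<xi>i \<xi>0 \<sigma>c \<sigma>0])
    have "u p * pd i (\<lambda>p. v p * \<zeta> n p) p = u p * (v p * (\<sigma> n (p $ i) * \<xi> n p))
        - u p * (v p * (\<sigma> n (p $ i - 2 * pi) * \<xi> n p)) + u p * (pd i v p * \<zeta> n p)" for p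
      unfolding smooth_pd_simps(2)[OF v(1) \<zeta>s] \<zeta>d by (simp add: algebra_simps)
    then have "(\<integral>p. u p * pd i (\<lambda>p. v p * \<zeta> n p) p \<partial>lebesgue_on ?S) = (\<integral>p. u p * (pd i v p * \<zeta> n p) \<partial>lebesgue_on ?S)"
      using I1 shift by simp
    then show ?thesis using w by (simp add: mult.assoc)
  qed
  have "(\<lambda>n. \<integral>p. (u p * pd i v p) * \<zeta> n p \<partial>lebesgue_on ?S) \<longlonglongrightarrow> (\<integral>p. u p * pd i v p \<partial>LO)"
    by (rule integral_slab_cutoff_tendsto[OF _ \<zeta>m \<zeta>b \<zeta>lim])
       (intro L2_mult_continuous_integrable uS open_slab bounded_slab smooth_continuous smooth_pd v)
  moreover have "(\<lambda>n. \<integral>p. (g p * v p) * \<zeta> n p \<partial>lebesgue_on ?S) \<longlonglongrightarrow> (\<integral>p. g p * v p \<partial>LO)"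
    by (rule integral_slab_cutoff_tendsto[OF _ \<zeta>m \<zeta>b \<zeta>lim])
       (intro L2_mult_continuous_integrable g open_slab bounded_slab smooth_continuous v)
  ultimately have "(\<integral>p. u p * pd i v p \<partial>LO) = - (\<integral>p. g p * v p \<partial>LO)"
    unfolding key using LIMSEQ_unique tendsto_minus by blast
  then show ?thesis using wg by (simp add: ip_real)
qed

subsection \<open>Integration by parts in the vertical direction\<close>

text \<open>The pair of horizontal coordinates is kept together, as in \<open>has_trace\<close>, so
  that Fubini separates the vertical integral from the integral over a face.\<close>

definition vec3 :: "(real \<times> real) \<times> real \<Rightarrow> real^3" where
  "vec3 = (\<lambda>((x, y), z). vector [x, y, z])"

lemma vec3_component [simp]:
  "vec3 ((x, y), z) $ 1 = x" "vec3 ((x, y), z) $ 2 = y" "vec3 ((x, y), z) $ 3 = z"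
  by (simp_all add: vec3_def)

lemma continuous_vec3: "continuous_on UNIV vec3"
proof -
  have eq: "vec3 = (\<lambda>q. \<chi> j. if j = 1 then fst (fst q) else if j = 2 then snd (fst q) else snd q)"
    by (auto simp: vec3_def vec_eq_iff forall_3)
  show ?thesis
    unfolding eq
  proof (rule continuous_on_vec_lambda)
    show "continuous_on UNIV (\<lambda>q :: (real \<times> real) \<times> real. if j = 1 then fst (fst q) else if j = 2 then snd (fst q) else snd q)"
      for j :: 3
      by (cases "j = 1"; cases "j = 2") (auto intro!: continuous_intros)
  qed
qed

text \<open>Lebesgue measure is characterised by its values on boxes, whose preimages are products
  of three intervals.\<close>

lemma lborel_vec3: "distr lborel borel vec3 = lborel"
proof (rule lborel_eqI[symmetric])
  fix l u :: "real^3" assume lu: "\<And>b. b \<in> Basis \<Longrightarrow> l \<bullet> b \<le> u \<bullet> b"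
  have le: "l $ j \<le> u $ j" for j using lu[of "axis j 1"] by (simp add: inner_axis)
  have m: "vec3 \<in> borel_measurable lborel"
    using borel_measurable_continuous_onI[OF continuous_vec3] by simp
  have v: "vec3 -` box l u \<inter> space lborel =
      (({l $ 1<..<u $ 1} \<times> {l $ 2<..<u $ 2}) \<times> {l $ 3<..<u $ 3})"
    by (auto simp: mem_box_cart forall_3)
  have "emeasure (distr lborel borel vec3) (box l u)
    = emeasure ((lborel \<Otimes>\<^sub>M lborel) \<Otimes>\<^sub>M lborel)
        (({l $ 1<..<u $ 1} \<times> {l $ 2<..<u $ 2}) \<times> {l $ 3<..<u $ 3})"
    using m v by (subst emeasure_distr) (auto simp: lborel_prod)
  also have "\<dots> = ennreal (u $ 1 - l $ 1) * ennreal (u $ 2 - l $ 2) * ennreal (u $ 3 - l $ 3)"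
  proof -
    have "emeasure ((lborel \<Otimes>\<^sub>M lborel) \<Otimes>\<^sub>M lborel)
        (({l $ 1<..<u $ 1} \<times> {l $ 2<..<u $ 2}) \<times> {l $ 3<..<u $ 3})
      = emeasure (lborel \<Otimes>\<^sub>M lborel) ({l $ 1<..<u $ 1} \<times> {l $ 2<..<u $ 2}) * emeasure lborel {l $ 3<..<u $ 3}"
      by (rule lborel.emeasure_pair_measure_Times) auto
    also have "emeasure (lborel \<Otimes>\<^sub>M lborel) ({l $ 1<..<u $ 1} \<times> {l $ 2<..<u $ 2})
      = emeasure lborel {l $ 1<..<u $ 1} * emeasure lborel {l $ 2<..<u $ 2}"
      by (rule lborel.emeasure_pair_measure_Times) auto
    finally show ?thesis using le by simp
  qed
  also have "\<dots> = ennreal ((u $ 1 - l $ 1) * (u $ 2 - l $ 2) * (u $ 3 - l $ 3))"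
    using le by (simp add: ennreal_mult)
  also have "(u $ 1 - l $ 1) * (u $ 2 - l $ 2) * (u $ 3 - l $ 3) = (\<Prod>b\<in>Basis. (u - l) \<bullet> b)"
  proof -
    have B: "(Basis :: (real^3) set) = (\<lambda>j. axis j 1) ` UNIV" by (auto simp: Basis_vec_def)
    have "inj (\<lambda>j. axis j 1 :: real^3)" by (auto intro!: injI simp: axis_eq_axis)
    then have "(\<Prod>b\<in>Basis. (u - l) \<bullet> b) = (\<Prod>j\<in>UNIV. (u - l) \<bullet> axis j 1)"
      unfolding B by (subst prod.reindex) auto
    also have "\<dots> = (\<Prod>j\<in>UNIV. u $ j - l $ j)" by (simp add: inner_axis)
    also have "\<dots> = (u $ 1 - l $ 1) * (u $ 2 - l $ 2) * (u $ 3 - l $ 3)" unfolding UNIV_3 by simp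
    finally show ?thesis by simp
  qed
  finally show "emeasure (distr lborel borel vec3) (box l u) = (\<Prod>b\<in>Basis. (u - l) \<bullet> b)" .
qed simp

abbreviation Qxy :: "(real \<times> real) set" where "Qxy \<equiv> {0..2 * pi} \<times> {0..2 * pi}"

lemma compact_Qxy: "compact Qxy" by (intro compact_Times compact_Icc)

lemma Omega_integral_iterated:
  fixes f :: "real^3 \<Rightarrow> real"
  assumes f: "continuous_on UNIV f"
  shows "(\<integral>p. f p \<partial>LO) = (\<integral>q. indicator Qxy q * (\<integral>z. indicator {0..1} z * f (vec3 (q, z)) \<partial>lborel) \<partial>lborel)"
proof -
  define K where "K = cbox 0 (\<chi> j. side j)"
  have fb: "f \<in> borel_measurable borel" by (rule borel_measurable_continuous_onI[OF f])
  have "(\<integral>p. f p \<partial>LO) = (\<integral>p. indicator Omega p *\<^sub>R f p \<partial>lebesgue)"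
    using lebesgue_on_open[OF open_Omega] by (intro integral_restrict_space) simp
  \<comment> \<open>The faces are null sets; the closed box is used from here on because it is a
    compact product.\<close>
  also have "\<dots> = (\<integral>p. indicator K p * f p \<partial>lebesgue)"
  proof (rule integral_cong_AE)
    have fl: "f \<in> borel_measurable lebesgue" using fb by (intro measurable_completion) simp
    show "(\<lambda>p. indicator Omega p *\<^sub>R f p) \<in> borel_measurable lebesgue"
      using fl lebesgue_on_open[OF open_Omega] by (intro borel_measurable_scaleR borel_measurable_indicator)
    show "(\<lambda>p. indicator K p * f p) \<in> borel_measurable lebesgue"
      using fl unfolding K_def by (intro borel_measurable_times borel_measurable_indicator) auto
    have "AE p :: real^3 in lebesgue. \<forall>j\<in>UNIV. p $ j \<noteq> 0 \<and> p $ j \<noteq> side j"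
      by (rule AE_finite_allI) (auto intro: AE_component_neq AE_conjI)
    then show "AE p in lebesgue. indicator Omega p *\<^sub>R f p = indicator K p * f p"
    proof eventually_elim
      case (elim p)
      have "p \<in> K \<longleftrightarrow> (\<forall>j. 0 \<le> p $ j \<and> p $ j \<le> side j)" by (simp add: K_def mem_box_cart)
      then have "p \<in> Omega \<longleftrightarrow> p \<in> K" using elim unfolding Omega_iff by (metis UNIV_I less_le)
      then show ?case by (simp add: indicator_def)
    qed
  qed
  also have "\<dots> = (\<integral>p. indicator K p * f p \<partial>lborel)"
    using fb unfolding K_def by (intro integral_completion) simp
  also have "\<dots> = (\<integral>p. indicator K p * f p \<partial>distr lborel borel vec3)" by (simp only: lborel_vec3)
  also have "\<dots> = (\<integral>q. indicator K (vec3 q) * f (vec3 q) \<partial>lborel)"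
  proof (rule integral_distr)
    show "vec3 \<in> lborel \<rightarrow>\<^sub>M borel" using borel_measurable_continuous_onI[OF continuous_vec3] by simp
    show "(\<lambda>p. indicator K p * f p) \<in> borel_measurable borel" using fb unfolding K_def by simp
  qed
  also have "\<dots> = (\<integral>q. indicator (Qxy \<times> {0..1}) q *\<^sub>R f (vec3 q) \<partial>(lborel \<Otimes>\<^sub>M lborel))"
  proof -
    have "indicator K (vec3 q) = (indicator (Qxy \<times> {0..1}) q :: real)" for q
    proof -
      obtain x y z where q: "q = ((x, y), z)" by (metis prod.exhaust)
      show ?thesis unfolding q K_def
        by (auto simp: indicator_def mem_box_cart forall_3 side_def)
    qed
    then show ?thesis by (simp add: lborel_prod)
  qed
  also have "\<dots> = (\<integral>q. (\<integral>z. indicator (Qxy \<times> {0..1}) (q, z) *\<^sub>R f (vec3 (q, z)) \<partial>lborel) \<partial>lborel)"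
  proof (rule lborel_pair.integral_fst'[symmetric])
    have "continuous_on (Qxy \<times> {0..1}) (\<lambda>q. f (vec3 q))"
      by (rule continuous_on_compose2[OF f continuous_on_subset[OF continuous_vec3]]) auto
    then show "integrable (lborel \<Otimes>\<^sub>M lborel) (\<lambda>q. indicator (Qxy \<times> {0..1}) q *\<^sub>R f (vec3 q))"
      unfolding lborel_prod by (intro borel_integrable_compact compact_Times compact_Icc)
  qed
  also have "\<dots> = (\<integral>q. indicator Qxy q * (\<integral>z. indicator {0..1} z * f (vec3 (q, z)) \<partial>lborel) \<partial>lborel)"
    by (intro Bochner_Integration.integral_cong refl)
       (simp add: indicator_times mult.assoc)
  finally show ?thesis .
qed

lemma Omega_integral_tensor:
  fixes a b c :: "real \<Rightarrow> real"
  assumes "continuous_on UNIV a" "continuous_on UNIV b" "continuous_on UNIV c"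
  shows "(\<integral>p. a (p $ 1) * b (p $ 2) * c (p $ 3) \<partial>LO) =
    (\<integral>x. indicator {0..2 * pi} x *\<^sub>R a x \<partial>lborel) * (\<integral>y. indicator {0..2 * pi} y *\<^sub>R b y \<partial>lborel) *
    (\<integral>z. indicator {0..1} z *\<^sub>R c z \<partial>lborel)"
proof -
  define C where "C = (\<integral>z. indicator {0..1} z *\<^sub>R c z \<partial>lborel)"
  have "continuous_on UNIV (\<lambda>p :: real^3. a (p $ 1) * b (p $ 2) * c (p $ 3))"
    by (intro continuous_intros continuous_on_compose2[OF assms(1)] continuous_on_compose2[OF assms(2)]
        continuous_on_compose2[OF assms(3)]) auto
  from Omega_integral_iterated[OF this]
  have "(\<integral>p. a (p $ 1) * b (p $ 2) * c (p $ 3) \<partial>LO) =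
    (\<integral>q. indicator Qxy q * (\<integral>z. indicator {0..1} z * (a (vec3 (q, z) $ 1) * b (vec3 (q, z) $ 2) * c (vec3 (q, z) $ 3)) \<partial>lborel) \<partial>lborel)" .
  also have "\<dots> = (\<integral>q. indicator Qxy q * (a (fst q) * b (snd q) * C) \<partial>lborel)"
  proof (intro Bochner_Integration.integral_cong refl)
    fix q :: "real \<times> real"
    have "(\<integral>z. indicator {0..1} z * (a (vec3 (q, z) $ 1) * b (vec3 (q, z) $ 2) * c (vec3 (q, z) $ 3)) \<partial>lborel)
      = (\<integral>z. (a (fst q) * b (snd q)) * (indicator {0..1} z *\<^sub>R c z) \<partial>lborel)"
      by (intro Bochner_Integration.integral_cong refl, cases q) simp
    then show "indicator Qxy q * (\<integral>z. indicator {0..1} z * (a (vec3 (q, z) $ 1) * b (vec3 (q, z) $ 2) * c (vec3 (q, z) $ 3)) \<partial>lborel)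
      = indicator Qxy q * (a (fst q) * b (snd q) * C)" unfolding C_def by simp
  qed
  also have "\<dots> = (\<integral>q. indicator Qxy q *\<^sub>R (a (fst q) * b (snd q)) \<partial>(lborel \<Otimes>\<^sub>M lborel)) * C"
    by (simp add: lborel_prod mult.assoc flip: integral_mult_left_zero)
  also have "(\<integral>q. indicator Qxy q *\<^sub>R (a (fst q) * b (snd q)) \<partial>(lborel \<Otimes>\<^sub>M lborel))
    = (\<integral>x. (\<integral>y. indicator Qxy (x, y) *\<^sub>R (a (fst (x, y)) * b (snd (x, y))) \<partial>lborel) \<partial>lborel)"
  proof (rule lborel_pair.integral_fst'[symmetric])
    have "continuous_on Qxy (\<lambda>q. a (fst q) * b (snd q))"
      by (intro continuous_intros continuous_on_compose2[OF assms(1)] continuous_on_compose2[OF assms(2)]) auto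
    then show "integrable (lborel \<Otimes>\<^sub>M lborel) (\<lambda>q. indicator Qxy q *\<^sub>R (a (fst q) * b (snd q)))"
      unfolding lborel_prod by (intro borel_integrable_compact compact_Qxy)
  qed
  also have "\<dots> = (\<integral>x. (indicator {0..2 * pi} x *\<^sub>R a x) * (\<integral>y. indicator {0..2 * pi} y *\<^sub>R b y \<partial>lborel) \<partial>lborel)"
    by (intro Bochner_Integration.integral_cong refl)
       (simp add: indicator_times mult_ac flip: integral_mult_right_zero)
  also have "\<dots> = (\<integral>x. indicator {0..2 * pi} x *\<^sub>R a x \<partial>lborel) * (\<integral>y. indicator {0..2 * pi} y *\<^sub>R b y \<partial>lborel)"
    by simp
  finally show ?thesis unfolding C_def .
qed

lemma Omega_integral_pd3:
  assumes "smooth w"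
  shows "(\<integral>p. pd 3 w p \<partial>LO) = (\<integral>q. indicator Qxy q * (w (vec3 (q, 1)) - w (vec3 (q, 0))) \<partial>lborel)"
proof -
  have "(\<integral>z. indicator {0..1} z * pd 3 w (vec3 (q, z)) \<partial>lborel) = w (vec3 (q, 1)) - w (vec3 (q, 0))" for q
  proof -
    have eq: "vec3 (q, z) = vec3 (q, 0) + z *\<^sub>R axis 3 1" for z
      by (cases q) (simp add: vec_eq_iff forall_3 axis_def)
    have "(\<integral>z. indicator {0..1} z *\<^sub>R pd 3 w (vec3 (q, z)) \<partial>lborel) = w (vec3 (q, 1)) - w (vec3 (q, 0))"
    proof (rule integral_FTC_atLeastAtMost)
      fix z :: real
      have "((\<lambda>z. w (vec3 (q, 0) + z *\<^sub>R axis 3 1)) has_real_derivative pd 3 w (vec3 (q, 0) + z *\<^sub>R axis 3 1)) (at z)"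
        by (rule has_derivative_line[OF smooth_differentiable[OF assms]])
      then show "((\<lambda>z. w (vec3 (q, z))) has_vector_derivative pd 3 w (vec3 (q, z))) (at z within {0..1})"
        unfolding eq[symmetric] has_real_derivative_iff_has_vector_derivative
        by (rule has_vector_derivative_at_within)
    next
      show "continuous_on {0..1} (\<lambda>z. pd 3 w (vec3 (q, z)))"
        by (intro continuous_on_compose2[OF smooth_continuous[OF smooth_pd[OF assms], of UNIV]]
            continuous_on_compose2[OF continuous_vec3] continuous_intros) auto
    qed simp
    then show ?thesis by simp
  qed
  then show ?thesis using Omega_integral_iterated[OF smooth_continuous[OF smooth_pd[OF assms]]] by simp
qed

lemma integrable_Qxy:
  fixes f :: "real \<times> real \<Rightarrow> real"
  assumes "continuous_on UNIV f"
  shows "integrable lborel (\<lambda>q. indicator Qxy q * f q)"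
  using borel_integrable_compact[OF compact_Qxy continuous_on_subset[OF assms]] by simp

text \<open>Young's inequality with a weight takes the place of Cauchy-Schwarz on the face: the
  small weight falls on the fixed function \<open>v\<close>, the large one on the vanishing
  squares.\<close>

lemma Qxy_integral_tendsto_0:
  fixes f :: "nat \<Rightarrow> real \<times> real \<Rightarrow> real"
  assumes f: "\<And>m. continuous_on UNIV (f m)" and v: "continuous_on UNIV v"
    and lim: "(\<lambda>m. \<integral>q. indicator Qxy q * (f m q)\<^sup>2 \<partial>lborel) \<longlonglongrightarrow> 0"
  shows "(\<lambda>m. \<integral>q. indicator Qxy q * (f m q * v q) \<partial>lborel) \<longlonglongrightarrow> 0"
proof (rule LIMSEQ_I)
  fix r :: real assume r: "r > 0"
  define V where "V = (\<integral>q. indicator Qxy q * (v q)\<^sup>2 \<partial>lborel)"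
  have iv: "integrable lborel (\<lambda>q. indicator Qxy q * (v q)\<^sup>2)"
    by (intro integrable_Qxy continuous_intros v)
  have V: "V \<ge> 0" unfolding V_def by (intro integral_nonneg_AE) auto
  \<comment> \<open>With this weight the term of \<open>v\<close> is less than \<open>r / 2\<close>;
    the index is then taken so large that the other term is less than \<open>r / 2\<close> as
    well.\<close>
  define e where "e = r / (V + 1)"
  have e: "e > 0" "e * V < r" unfolding e_def using r V by (auto simp: field_simps)
  have "\<forall>\<^sub>F m in sequentially. (\<integral>q. indicator Qxy q * (f m q)\<^sup>2 \<partial>lborel) < r * e"
    using order_tendstoD(2)[OF lim, of "r * e"] r e by simp
  then obtain M where M: "\<And>m. m \<ge> M \<Longrightarrow> (\<integral>q. indicator Qxy q * (f m q)\<^sup>2 \<partial>lborel) < r * e"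
    by (auto simp: eventually_sequentially)
  show "\<exists>M. \<forall>m\<ge>M. norm ((\<integral>q. indicator Qxy q * (f m q * v q) \<partial>lborel) - 0) < r"
  proof (intro exI allI impI)
    fix m assume m: "m \<ge> M"
    have i1: "integrable lborel (\<lambda>q. indicator Qxy q * (f m q)\<^sup>2)"
      by (intro integrable_Qxy continuous_intros f)
    have i2: "integrable lborel (\<lambda>q. indicator Qxy q * (f m q * v q))"
      by (intro integrable_Qxy continuous_intros f v)
    have "\<bar>\<integral>q. indicator Qxy q * (f m q * v q) \<partial>lborel\<bar> \<le> (\<integral>q. \<bar>indicator Qxy q * (f m q * v q)\<bar> \<partial>lborel)"
      by (rule integral_abs_bound)
    also have "\<dots> \<le> (\<integral>q. (1 / (2 * e)) * (indicator Qxy q * (f m q)\<^sup>2) + (e / 2) * (indicator Qxy q * (v q)\<^sup>2) \<partial>lborel)"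
    proof (rule integral_mono)
      show "integrable lborel (\<lambda>q. \<bar>indicator Qxy q * (f m q * v q)\<bar>)" using i2 by simp
      show "integrable lborel (\<lambda>q. (1 / (2 * e)) * (indicator Qxy q * (f m q)\<^sup>2) + (e / 2) * (indicator Qxy q * (v q)\<^sup>2))"
        by (intro Bochner_Integration.integrable_add integrable_mult_right i1 iv)
      fix q
      have "\<bar>a * b\<bar> \<le> (1 / (2 * e)) * a\<^sup>2 + (e / 2) * b\<^sup>2" for a b :: real
      proof -
        have "0 \<le> (\<bar>a\<bar> - e * \<bar>b\<bar>)\<^sup>2" by simp
        then have "2 * e * \<bar>a * b\<bar> \<le> a\<^sup>2 + e\<^sup>2 * b\<^sup>2"
          by (simp add: power2_diff power_mult_distrib abs_mult mult_ac)
        also have "\<dots> = 2 * e * ((1 / (2 * e)) * a\<^sup>2 + (e / 2) * b\<^sup>2)"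
          using e by (simp add: field_simps power2_eq_square)
        finally show ?thesis using e by simp
      qed
      then show "\<bar>indicator Qxy q * (f m q * v q)\<bar>
          \<le> (1 / (2 * e)) * (indicator Qxy q * (f m q)\<^sup>2) + (e / 2) * (indicator Qxy q * (v q)\<^sup>2)"
        by (simp add: indicator_def)
    qed
    also have "\<dots> = (1 / (2 * e)) * (\<integral>q. indicator Qxy q * (f m q)\<^sup>2 \<partial>lborel) + (e / 2) * V"
      unfolding V_def using i1 iv by (subst Bochner_Integration.integral_add) auto
    also have "\<dots> < (1 / (2 * e)) * (r * e) + r / 2"
      using M[OF m] e by (intro add_strict_mono mult_strict_left_mono) auto
    also have "\<dots> = r" using e by simp
    finally show "norm ((\<integral>q. indicator Qxy q * (f m q * v q) \<partial>lborel) - 0) < r" by simp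
  qed
qed

text \<open>For the smooth approximants the fundamental theorem of calculus leaves only an integral
  over the face \<open>c\<close>, as \<open>v\<close> vanishes on the opposite one. That integral
  tends to 0 because the approximants tend to 0 in mean square on the face.\<close>

lemma has_trace_ibp:
  assumes tr: "has_trace c u (\<lambda>_. 0)" and c: "c = 0 \<or> c = 1" and u: "u \<in> L2 Omega" "wpd 3 u \<in> L2 Omega"
    and v: "smooth v" "\<And>x y. v (vec3 ((x, y), 1 - c)) = 0"
  shows "ip (wpd 3 u) v = - ip u (pd 3 v)"
proof -
  obtain \<phi> where \<phi>: "\<And>m::nat. smooth (\<phi> m)" "(\<lambda>m. L2norm (\<lambda>p. \<phi> m p - u p)) \<longlonglongrightarrow> 0"
    "(\<lambda>m. L2norm (\<lambda>p. pd 3 (\<phi> m) p - wpd 3 u p)) \<longlonglongrightarrow> 0"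
    and t: "(\<lambda>m. \<integral>(x, y). (\<phi> m (vector [x, y, c]) - 0)\<^sup>2 \<partial>lebesgue_on Qxy) \<longlonglongrightarrow> 0"
    using tr unfolding has_trace_def by blast
  have sq: "(\<lambda>m. ip (a m) (a m)) \<longlonglongrightarrow> 0" if "(\<lambda>m. L2norm (a m)) \<longlonglongrightarrow> 0"
    for a :: "nat \<Rightarrow> real^3 \<Rightarrow> real"
    using tendsto_power[OF that, of 2] by (simp add: L2norm_sq)
  have 1: "(\<lambda>m. ip (pd 3 (\<phi> m)) v) \<longlonglongrightarrow> ip (wpd 3 u) v"
    by (rule ip_tendsto[OF _ u(2) smooth_L2[OF v(1)] sq[OF \<phi>(3)]]) (intro smooth_L2 smooth_pd \<phi>)
  have 2: "(\<lambda>m. ip (\<phi> m) (pd 3 v)) \<longlonglongrightarrow> ip u (pd 3 v)"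
    by (rule ip_tendsto[OF _ u(1) smooth_L2[OF smooth_pd[OF v(1)]] sq[OF \<phi>(2)]]) (intro smooth_L2 \<phi>)
  define f g where "f m q = \<phi> m (vec3 (q, c))" and "g q = v (vec3 (q, c))" for m q
  have fc: "continuous_on UNIV (f m)" for m
    unfolding f_def by (intro continuous_on_compose2[OF smooth_continuous[OF \<phi>(1), of UNIV]]
        continuous_on_compose2[OF continuous_vec3] continuous_intros) auto
  have gc: "continuous_on UNIV g"
    unfolding g_def by (intro continuous_on_compose2[OF smooth_continuous[OF v(1), of UNIV]]
        continuous_on_compose2[OF continuous_vec3] continuous_intros) auto
  have "(\<integral>(x, y). (\<phi> m (vector [x, y, c]) - 0)\<^sup>2 \<partial>lebesgue_on Qxy) = (\<integral>q. indicator Qxy q * (f m q)\<^sup>2 \<partial>lborel)" for m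
  proof -
    have "(\<integral>(x, y). (\<phi> m (vector [x, y, c]) - 0)\<^sup>2 \<partial>lebesgue_on Qxy) = (\<integral>q. (f m q)\<^sup>2 \<partial>lebesgue_on Qxy)"
      by (intro Bochner_Integration.integral_cong refl) (auto simp: f_def vec3_def)
    also have "\<dots> = (\<integral>q. indicator Qxy q *\<^sub>R (f m q)\<^sup>2 \<partial>lebesgue)"
      by (rule integral_restrict_space)
         (use compact_Qxy in \<open>auto intro!: lmeasurable_compact fmeasurableD\<close>)
    also have "\<dots> = (\<integral>q. indicator Qxy q *\<^sub>R (f m q)\<^sup>2 \<partial>lborel)"
    proof (rule integral_completion)
      have "integrable lborel (\<lambda>q. indicator Qxy q * (f m q)\<^sup>2)"
        by (intro integrable_Qxy continuous_intros fc)
      from borel_measurable_integrable[OF this]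
      show "(\<lambda>q. indicator Qxy q *\<^sub>R (f m q)\<^sup>2) \<in> lborel \<rightarrow>\<^sub>M borel" by simp
    qed
    finally show ?thesis by simp
  qed
  with t have t': "(\<lambda>m. \<integral>q. indicator Qxy q * (f m q)\<^sup>2 \<partial>lborel) \<longlonglongrightarrow> 0" by simp
  \<comment> \<open>The sign is that of the outer normal: plus on the upper face, minus on the lower
    one.\<close>
  have "ip (pd 3 (\<phi> m)) v + ip (\<phi> m) (pd 3 v)
    = (if c = 1 then 1 else - 1) * (\<integral>q. indicator Qxy q * (f m q * g q) \<partial>lborel)" for m
  proof -
    have "ip (pd 3 (\<phi> m)) v + ip (\<phi> m) (pd 3 v) = (\<integral>p. pd 3 (\<lambda>p. \<phi> m p * v p) p \<partial>LO)"
      unfolding ip_real smooth_pd_simps(2)[OF \<phi>(1) v(1)]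
      by (subst Bochner_Integration.integral_add)
         (auto intro!: L2_mult_integrable smooth_L2 smooth_pd \<phi> v)
    also have "\<dots> = (\<integral>q. indicator Qxy q * (\<phi> m (vec3 (q, 1)) * v (vec3 (q, 1)) - \<phi> m (vec3 (q, 0)) * v (vec3 (q, 0))) \<partial>lborel)"
      by (rule Omega_integral_pd3[OF smooth_mult[OF \<phi>(1) v(1)]])
    also have "\<dots> = (\<integral>q. (if c = 1 then 1 else - 1) * (indicator Qxy q * (f m q * g q)) \<partial>lborel)"
    proof (intro Bochner_Integration.integral_cong refl)
      fix q :: "real \<times> real"
      have "v (vec3 (q, 1 - c)) = 0" using v(2) by (cases q) simp
      then show "indicator Qxy q * (\<phi> m (vec3 (q, 1)) * v (vec3 (q, 1)) - \<phi> m (vec3 (q, 0)) * v (vec3 (q, 0)))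
        = (if c = 1 then 1 else - 1) * (indicator Qxy q * (f m q * g q))"
        using c by (auto simp: f_def g_def)
    qed
    finally show ?thesis by simp
  qed
  then have "(\<lambda>m. ip (pd 3 (\<phi> m)) v + ip (\<phi> m) (pd 3 v)) \<longlonglongrightarrow> 0"
    using tendsto_mult_right_zero[OF Qxy_integral_tendsto_0[OF fc gc t'], of "if c = 1 then 1 else - 1"] by simp
  with tendsto_add[OF 1 2] have "ip (wpd 3 u) v + ip u (pd 3 v) = 0" by (rule LIMSEQ_unique)
  then show ?thesis by simp
qed

lemma smooth_component: "smooth (\<lambda>p. p $ j)"
  by (intro smooth_real_polynomial_function real_polynomial_function.intros(1) bounded_linear_vec_nth)

text \<open>The traces on the two faces come with approximating sequences that may differ. Splitting
  \<open>v\<close> into \<open>(1 - z) * v\<close> and \<open>z * v\<close> lets each part see only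
  one face and thus only one sequence.\<close>

lemma H1p0_ibp3:
  assumes "u \<in> H1p0" "smooth v"
  shows "ip (wpd 3 u) v = - ip u (pd 3 v)"
proof -
  have u: "u \<in> H1p" "has_trace 0 u (\<lambda>_. 0)" "has_trace 1 u (\<lambda>_. 0)" using assms(1) by (auto simp: H1p0_def)
  note uL = H1p_L2(2)[OF u(1)] H1p_wpd(1)[OF u(1), of 3]
  define a b where "a p = v p * (1 - p $ 3)" and "b p = v p * p $ 3" for p
  have s: "smooth a" "smooth b"
    unfolding a_def b_def by (intro smooth_mult smooth_diff smooth_const smooth_component assms)+
  have A: "ip (wpd 3 u) a = - ip u (pd 3 a)"
    by (rule has_trace_ibp[OF u(2) _ uL s(1)]) (auto simp: a_def)
  have B: "ip (wpd 3 u) b = - ip u (pd 3 b)"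
    by (rule has_trace_ibp[OF u(3) _ uL s(2)]) (auto simp: b_def)
  have v: "v = (\<lambda>p. a p + b p)" by (auto simp: a_def b_def algebra_simps)
  have add: "ip w (\<lambda>p. x p + y p) = ip w x + ip w y" if "w \<in> L2 Omega" "smooth x" "smooth y" for w x y
    using ip_add_left[OF smooth_L2[OF that(2)] smooth_L2[OF that(3)] that(1)]
    by (simp add: ip_commute[of w])
  have pv: "pd 3 v = (\<lambda>p. pd 3 a p + pd 3 b p)" by (subst v) (rule smooth_pd_simps(1)[OF s])
  show ?thesis
    unfolding pv using add[OF uL(2) s] add[OF uL(1) smooth_pd[OF s(1)] smooth_pd[OF s(2)], of 3 3] A B v by simp
qed

subsection \<open>Fourier sums\<close>

lemma Hart_periodic: "Hart m (2 * pi + x) = Hart m x"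
proof -
  have "of_int m * (2 * pi + x) = 2 * pi * of_int m + of_int m * x" by (simp add: algebra_simps)
  then show ?thesis by (simp add: Hart_def cos_add sin_add cos_int_2pin sin_int_2pin)
qed

lemma periodic_ebasis:
  assumes "i \<noteq> 3" shows "periodic i (ebasis \<kappa>)"
proof -
  obtain j k l where \<kappa>: "\<kappa> = (j, k, l)" by (metis prod.exhaust)
  have "i = 1 \<or> i = 2" using exhaust_3[of i] assms by blast
  then show ?thesis
    unfolding periodic_def ebasis_def \<kappa> by (elim disjE) (simp_all add: axis_def Hart_periodic)
qed

lemma smooth_H1:
  assumes "smooth v" shows "v \<in> H1 (slab R)"
proof -
  have "\<exists>g\<in>L2 (slab R). weak_pderiv (slab R) i v g" for i
    by (rule bexI[of _ "pd i v"]) (intro weak_pderiv_smooth smooth_L2' smooth_pd assms open_slab bounded_slab)+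
  then show ?thesis unfolding H1_def using smooth_L2'[OF assms open_slab bounded_slab] by simp
qed

text \<open>Basis functions must be admissible in the weak form of the stream function equation.
  Being smooth and zero on the faces, each serves as its own constant approximating sequence for the
  traces.\<close>

lemma ebasis_H1p0: "ebasis \<kappa> \<in> H1p0"
proof -
  obtain j k l where \<kappa>: "\<kappa> = (j, k, l)" by (metis prod.exhaust)
  have per: "ebasis \<kappa> (p + axis i (2 * pi)) = ebasis \<kappa> p" if "i \<noteq> 3" for i p
    using periodic_ebasis[OF that, of \<kappa>] by (simp add: periodic_def add.commute)
  have "periodic_xy (ebasis \<kappa>)"
    unfolding periodic_xy_def using per by (intro AE_I2) simp
  then have H: "ebasis \<kappa> \<in> H1p" unfolding H1p_def using smooth_H1[OF smooth_ebasis] by blast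
  have tr: "has_trace c (ebasis \<kappa>) (\<lambda>_. 0)" if c: "c = 0 \<or> c = 1" for c
    unfolding has_trace_def
  proof (intro exI[of _ "\<lambda>m. ebasis \<kappa>"] conjI allI)
    show "smooth (ebasis \<kappa>)" by (rule smooth_ebasis)
    have "L2norm (\<lambda>p. ebasis \<kappa> p - ebasis \<kappa> p) = 0" by (simp add: L2norm_def ip_def)
    then show "(\<lambda>m. L2norm (\<lambda>p. ebasis \<kappa> p - ebasis \<kappa> p)) \<longlonglongrightarrow> 0" by simp
    show "(\<lambda>m. L2norm (\<lambda>p. pd i (ebasis \<kappa>) p - wpd i (ebasis \<kappa>) p)) \<longlonglongrightarrow> 0" for i
    proof -
      have m: "(\<lambda>p. pd i (ebasis \<kappa>) p - wpd i (ebasis \<kappa>) p) \<in> borel_measurable LO"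
        by (intro borel_measurable_diff L2_measurable wpd_smooth(1) smooth_L2 smooth_pd smooth_ebasis)
      have ae: "AE p in LO. pd i (ebasis \<kappa>) p - wpd i (ebasis \<kappa>) p = 0"
        using wpd_smooth(2)[OF smooth_ebasis, of i \<kappa>] by eventually_elim simp
      have "ip (\<lambda>p. pd i (ebasis \<kappa>) p - wpd i (ebasis \<kappa>) p) (\<lambda>p. pd i (ebasis \<kappa>) p - wpd i (ebasis \<kappa>) p)
        = ip (\<lambda>p. 0 :: real) (\<lambda>p. 0 :: real)"
        by (rule ip_cong_AE) (rule m ae | simp)+
      then have "L2norm (\<lambda>p. pd i (ebasis \<kappa>) p - wpd i (ebasis \<kappa>) p) = 0" by (simp add: L2norm_def ip_def)
      then show ?thesis by simp
    qed
    have "sin (real l * pi * c) = 0" using c by (auto simp: sin_npi)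
    then have "ebasis \<kappa> (vector [x, y, c]) = 0" for x y by (simp add: \<kappa> ebasis_def)
    then show "(\<lambda>m. \<integral>(x, y). (ebasis \<kappa> (vector [x, y, c]) - 0)\<^sup>2 \<partial>lebesgue_on Qxy) \<longlonglongrightarrow> 0"
      by (simp add: case_prod_unfold)
  qed
  show ?thesis unfolding H1p0_def using H tr by blast
qed

text \<open>The test functions are periodic but need not vanish at \<open>z = 0, 1\<close>; the zero
  trace of \<open>u\<close> is encoded in the absence of a boundary term. The relation is visibly
  linear, so extrapolated fields and increments inherit it without any statement about their traces
  or about the choices made in \<open>wpd\<close>.\<close>

definition has_grad :: "(real^3 \<Rightarrow> real) \<Rightarrow> (3 \<Rightarrow> real^3 \<Rightarrow> real) \<Rightarrow> bool" where
  "has_grad u g \<longleftrightarrow> u \<in> L2 Omega \<and> (\<forall>i. g i \<in> L2 Omega) \<and>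
    (\<forall>i v. smooth v \<longrightarrow> periodic 1 v \<longrightarrow> periodic 2 v \<longrightarrow> ip (g i) v = - ip u (pd i v))"

lemma has_gradD:
  assumes "has_grad u g"
  shows "u \<in> L2 Omega" "g i \<in> L2 Omega"
    "smooth v \<Longrightarrow> periodic 1 v \<Longrightarrow> periodic 2 v \<Longrightarrow> ip (g i) v = - ip u (pd i v)"
  using assms unfolding has_grad_def by blast+

lemma has_grad_H1p0:
  assumes "u \<in> H1p0" shows "has_grad u (\<lambda>i. wpd i u)"
proof -
  have u: "u \<in> H1p" using assms by (simp add: H1p0_def)
  have "ip (wpd i u) v = - ip u (pd i v)" if "smooth v" "periodic 1 v" "periodic 2 v" for i v
    using exhaust_3[of i] H1p_ibp[OF u _ that(1), of i] H1p0_ibp3[OF assms that(1)] that by auto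
  then show ?thesis unfolding has_grad_def using H1p_L2(2)[OF u] H1p_wpd(1)[OF u] by blast
qed

lemma has_grad_lin:
  assumes "has_grad u g" "has_grad u' g'"
  shows "has_grad (\<lambda>p. a * u p + b * u' p) (\<lambda>i p. a * g i p + b * g' i p)"
proof -
  note u = has_gradD[OF assms(1)] and u' = has_gradD[OF assms(2)]
  have lin: "ip (\<lambda>p. a * x p + b * y p) v = a * ip x v + b * ip y v"
    if "x \<in> L2 Omega" "y \<in> L2 Omega" "smooth v" for x y v
    using ip_add_left[OF L2_cmult[OF that(1), of a] L2_cmult[OF that(2), of b] smooth_L2[OF that(3)]]
    by (simp add: ip_cmult_left)
  show ?thesis unfolding has_grad_def
  proof (intro conjI allI impI)
    fix i v assume v: "smooth v" "periodic 1 v" "periodic 2 v"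
    show "ip (\<lambda>p. a * g i p + b * g' i p) v = - ip (\<lambda>p. a * u p + b * u' p) (pd i v)"
      unfolding lin[OF u(2) u'(2) v(1)] lin[OF u(1) u'(1) smooth_pd[OF v(1)]]
      using u(3)[OF v] u'(3)[OF v] by simp
  qed (intro L2_add L2_cmult u u')+
qed

section \<open>Orthogonality relations and Bessel's inequality\<close>

lemma integral_trig:
  fixes m :: int
  shows "(\<integral>x. indicator {0..2 * pi} x *\<^sub>R cos (of_int m * x) \<partial>lborel) = (if m = 0 then 2 * pi else 0)"
    and "(\<integral>x. indicator {0..2 * pi} x *\<^sub>R sin (of_int m * x) \<partial>lborel) = 0"
    and "(\<integral>z. indicator {0..1} z *\<^sub>R cos (of_int m * (pi * z)) \<partial>lborel) = (if m = 0 then 1 else 0)"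
proof -
  note c = has_real_derivative_iff_has_vector_derivative[symmetric]
  have e: "sin (of_int m * (2 * pi)) = 0" "cos (of_int m * (2 * pi)) = 1" "sin (of_int m * pi) = 0"
    using sin_int_2pin[of m] cos_int_2pin[of m] sin_zero_iff_int2[of "of_int m * pi"] by (auto simp: mult_ac)
  show "(\<integral>x. indicator {0..2 * pi} x *\<^sub>R cos (of_int m * x) \<partial>lborel) = (if m = 0 then 2 * pi else 0)"
  proof (cases "m = 0")
    case True
    have "(\<integral>x. indicator {0..2 * pi} x *\<^sub>R (1::real) \<partial>lborel) = 2 * pi - 0"
      by (rule integral_FTC_atLeastAtMost) (auto intro!: derivative_eq_intros simp: c[symmetric])
    then show ?thesis using True by simp
  next
    case False
    have "(\<integral>x. indicator {0..2 * pi} x *\<^sub>R cos (of_int m * x) \<partial>lborel)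
      = sin (of_int m * (2 * pi)) / of_int m - sin (of_int m * 0) / of_int m"
      by (rule integral_FTC_atLeastAtMost)
         (use False in \<open>auto intro!: derivative_eq_intros continuous_intros simp: c\<close>)
    then show ?thesis using False e by simp
  qed
  show "(\<integral>x. indicator {0..2 * pi} x *\<^sub>R sin (of_int m * x) \<partial>lborel) = 0"
  proof (cases "m = 0")
    case False
    have "(\<integral>x. indicator {0..2 * pi} x *\<^sub>R sin (of_int m * x) \<partial>lborel)
      = - cos (of_int m * (2 * pi)) / of_int m - (- cos (of_int m * 0) / of_int m)"
      by (rule integral_FTC_atLeastAtMost)
         (use False in \<open>auto intro!: derivative_eq_intros continuous_intros simp: c\<close>)
    then show ?thesis using False e by simp
  qed simp
  show "(\<integral>z. indicator {0..1} z *\<^sub>R cos (of_int m * (pi * z)) \<partial>lborel) = (if m = 0 then 1 else 0)"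
  proof (cases "m = 0")
    case True
    have "(\<integral>x. indicator {0..1::real} x *\<^sub>R (1::real) \<partial>lborel) = 1 - 0"
      by (rule integral_FTC_atLeastAtMost) (auto intro!: derivative_eq_intros simp: c[symmetric])
    then show ?thesis using True by simp
  next
    case False
    have "(\<integral>z. indicator {0..1} z *\<^sub>R cos (of_int m * (pi * z)) \<partial>lborel)
      = sin (of_int m * (pi * 1)) / (of_int m * pi) - sin (of_int m * (pi * 0)) / (of_int m * pi)"
      by (rule integral_FTC_atLeastAtMost)
         (use False in \<open>auto intro!: derivative_eq_intros continuous_intros simp: c\<close>)
    then show ?thesis using False e by simp
  qed
qed

lemma integrable_Icc: "continuous_on UNIV f \<Longrightarrow> integrable lborel (\<lambda>x. indicator {a..b} x *\<^sub>R f x)" for f :: "real \<Rightarrow> real"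
  by (rule borel_integrable_compact[OF compact_Icc continuous_on_subset[OF _ subset_UNIV]])

text \<open>The product is \<open>cos ((j - k) * x) + sin ((j + k) * x)\<close>; the sine always
  integrates to 0 over a period, the cosine unless \<open>j = k\<close>.\<close>

lemma Hart_orthogonal:
  "(\<integral>x. indicator {0..2 * pi} x *\<^sub>R (Hart j x * Hart k x) \<partial>lborel) = (if j = k then 2 * pi else 0)"
proof -
  have "Hart j x * Hart k x = cos (of_int (j - k) * x) + sin (of_int (j + k) * x)" for x
    unfolding Hart_def of_int_add of_int_diff distrib_right left_diff_distrib
    by (simp add: cos_diff sin_add algebra_simps)
  then have "(\<integral>x. indicator {0..2 * pi} x *\<^sub>R (Hart j x * Hart k x) \<partial>lborel)
    = (\<integral>x. indicator {0..2 * pi} x *\<^sub>R cos (of_int (j - k) * x) + indicator {0..2 * pi} x *\<^sub>R sin (of_int (j + k) * x) \<partial>lborel)"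
    by (simp only: scaleR_add_right)
  also have "\<dots> = (\<integral>x. indicator {0..2 * pi} x *\<^sub>R cos (of_int (j - k) * x) \<partial>lborel)
      + (\<integral>x. indicator {0..2 * pi} x *\<^sub>R sin (of_int (j + k) * x) \<partial>lborel)"
    by (intro Bochner_Integration.integral_add integrable_Icc continuous_intros)
  finally show ?thesis by (simp only: integral_trig) simp
qed

lemma sin_cos_orthogonal:
  fixes l m :: nat assumes lm: "1 \<le> l" "1 \<le> m"
  shows "(\<integral>z. indicator {0..1} z *\<^sub>R (sin (real l * pi * z) * sin (real m * pi * z)) \<partial>lborel) = (if l = m then 1 / 2 else 0)"
    and "(\<integral>z. indicator {0..1} z *\<^sub>R (cos (real l * pi * z) * cos (real m * pi * z)) \<partial>lborel) = (if l = m then 1 / 2 else 0)"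
proof -
  define A B where "A z = cos (of_int (int l - int m) * (pi * z))" and "B z = cos (of_int (int l + int m) * (pi * z))" for z
  have ab: "of_int (int l - int m) * (pi * z) = real l * pi * z - real m * pi * z"
    "of_int (int l + int m) * (pi * z) = real l * pi * z + real m * pi * z" for z
    by (simp_all add: algebra_simps)
  have eq: "indicator {0..1} z *\<^sub>R (sin (real l * pi * z) * sin (real m * pi * z))
      = (1 / 2) * (indicator {0..1} z *\<^sub>R A z - indicator {0..1} z *\<^sub>R B z)"
    "indicator {0..1} z *\<^sub>R (cos (real l * pi * z) * cos (real m * pi * z))
      = (1 / 2) * (indicator {0..1} z *\<^sub>R A z + indicator {0..1} z *\<^sub>R B z)" for z
    unfolding A_def B_def ab by (simp_all add: cos_diff cos_add algebra_simps)
  have i: "integrable lborel (\<lambda>z. indicator {0..1} z *\<^sub>R A z)" "integrable lborel (\<lambda>z. indicator {0..1} z *\<^sub>R B z)"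
    unfolding A_def B_def by (intro integrable_Icc continuous_intros)+
  have v: "(\<integral>z. indicator {0..1} z *\<^sub>R A z \<partial>lborel) = (if l = m then 1 else 0)"
    "(\<integral>z. indicator {0..1} z *\<^sub>R B z \<partial>lborel) = 0"
    unfolding A_def B_def integral_trig(3) using lm by auto
  show "(\<integral>z. indicator {0..1} z *\<^sub>R (sin (real l * pi * z) * sin (real m * pi * z)) \<partial>lborel) = (if l = m then 1 / 2 else 0)"
    unfolding eq integral_mult_right_zero Bochner_Integration.integral_diff[OF i] v by simp
  show "(\<integral>z. indicator {0..1} z *\<^sub>R (cos (real l * pi * z) * cos (real m * pi * z)) \<partial>lborel) = (if l = m then 1 / 2 else 0)"
    unfolding eq integral_mult_right_zero Bochner_Integration.integral_add[OF i] v by simp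
qed

lemma continuous_Hart: "continuous_on UNIV (Hart m)"
  unfolding Hart_def by (intro continuous_intros)

text \<open>The squared norm is \<open>(2 * pi) * (2 * pi) * (1 / 2)\<close>, one factor for each
  coordinate.\<close>

lemma basis_orthogonal:
  assumes "1 \<le> snd (snd \<kappa>)" "1 \<le> snd (snd \<kappa>')"
  shows "ip (ebasis \<kappa>) (ebasis \<kappa>') = (if \<kappa> = \<kappa>' then 2 * pi\<^sup>2 else 0)"
    and "ip (cbasis \<kappa>) (cbasis \<kappa>') = (if \<kappa> = \<kappa>' then 2 * pi\<^sup>2 else 0)"
proof -
  obtain j k l j' k' l' where \<kappa>: "\<kappa> = (j, k, l)" "\<kappa>' = (j', k', l')" by (metis prod.exhaust)
  have l: "1 \<le> l" "1 \<le> l'" using assms by (auto simp: \<kappa>)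
  have "ip (ebasis \<kappa>) (ebasis \<kappa>') = (\<integral>p. (Hart j (p $ 1) * Hart j' (p $ 1)) * (Hart k (p $ 2) * Hart k' (p $ 2))
      * (sin (real l * pi * p $ 3) * sin (real l' * pi * p $ 3)) \<partial>LO)"
    unfolding ip_real \<kappa> ebasis_def by (simp only: case_prod_conv mult_ac)
  also have "\<dots> = (if j = j' then 2 * pi else 0) * (if k = k' then 2 * pi else 0) * (if l = l' then 1 / 2 else 0)"
    by (subst Omega_integral_tensor[where a = "\<lambda>x. Hart j x * Hart j' x" and b = "\<lambda>x. Hart k x * Hart k' x"
          and c = "\<lambda>z. sin (real l * pi * z) * sin (real l' * pi * z)"])
       (intro continuous_intros continuous_Hart, intro continuous_intros continuous_Hart, intro continuous_intros,
        simp only: Hart_orthogonal sin_cos_orthogonal[OF l])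
  finally show "ip (ebasis \<kappa>) (ebasis \<kappa>') = (if \<kappa> = \<kappa>' then 2 * pi\<^sup>2 else 0)"
    by (auto simp: \<kappa> power2_eq_square)
  have "ip (cbasis \<kappa>) (cbasis \<kappa>') = (\<integral>p. (Hart j (p $ 1) * Hart j' (p $ 1)) * (Hart k (p $ 2) * Hart k' (p $ 2))
      * (cos (real l * pi * p $ 3) * cos (real l' * pi * p $ 3)) \<partial>LO)"
    unfolding ip_real \<kappa> cbasis_def by (simp only: case_prod_conv mult_ac)
  also have "\<dots> = (if j = j' then 2 * pi else 0) * (if k = k' then 2 * pi else 0) * (if l = l' then 1 / 2 else 0)"
    by (subst Omega_integral_tensor[where a = "\<lambda>x. Hart j x * Hart j' x" and b = "\<lambda>x. Hart k x * Hart k' x"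
          and c = "\<lambda>z. cos (real l * pi * z) * cos (real l' * pi * z)"])
       (intro continuous_intros continuous_Hart, intro continuous_intros continuous_Hart, intro continuous_intros,
        simp only: Hart_orthogonal sin_cos_orthogonal[OF l])
  finally show "ip (cbasis \<kappa>) (cbasis \<kappa>') = (if \<kappa> = \<kappa>' then 2 * pi\<^sup>2 else 0)"
    by (auto simp: \<kappa> power2_eq_square)
qed

text \<open>Everything follows from \<open>ip u S = ip S S\<close>, that is, from
  \<open>u - S\<close> being orthogonal to all \<open>e a\<close>. The last claim is the best
  approximation property, which turns density of the span into convergence of the truncated
  sums.\<close>

lemma Bessel:
  fixes e :: "'i \<Rightarrow> real^3 \<Rightarrow> real"
  assumes u: "u \<in> L2 Omega" and I: "finite I" and e: "\<And>a. a \<in> I \<Longrightarrow> e a \<in> L2 Omega"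
    and orth: "\<And>a b. a \<in> I \<Longrightarrow> b \<in> I \<Longrightarrow> ip (e a) (e b) = (if a = b then K else 0)" and K: "K > 0"
    and S: "S = (\<lambda>p. \<Sum>a\<in>I. (ip u (e a) / K) * e a p)"
  shows "S \<in> L2 Omega" "ip S S = (\<Sum>a\<in>I. (ip u (e a))\<^sup>2 / K)" "ip S S \<le> ip u u"
    "ip (\<lambda>p. u p - S p) (\<lambda>p. u p - S p) = ip u u - ip S S"
    "ip (\<lambda>p. S p - u p) (\<lambda>p. S p - u p) \<le> ip (\<lambda>p. (\<Sum>a\<in>I. d a * e a p) - u p) (\<lambda>p. (\<Sum>a\<in>I. d a * e a p) - u p)"
proof -
  have L: "(\<lambda>p. \<Sum>a\<in>I. d a * e a p) \<in> L2 Omega" for d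
    using I e
  proof (induction I rule: finite_induct)
    case empty
    show ?case using smooth_L2[OF smooth_const[of 0]] by simp
  next
    case (insert x F)
    then have "(\<lambda>p. d x * e x p + (\<Sum>a\<in>F. d a * e a p)) \<in> L2 Omega" by (intro L2_add L2_cmult) auto
    then show ?case using insert by simp
  qed
  have ipL: "ip (\<lambda>p. \<Sum>a\<in>I. d a * e a p) w = (\<Sum>a\<in>I. d a * ip (e a) w)" if "w \<in> L2 Omega" for d w
    using ip_sum_left[of I "\<lambda>a p. d a * e a p" w] that e L2_cmult by (simp add: ip_cmult_left)
  have ipe: "ip (\<lambda>p. \<Sum>a\<in>I. d a * e a p) (e b) = K * d b" if "b \<in> I" for d b
    unfolding ipL[OF e[OF that]] using that I by (simp add: orth sum.delta if_distrib cong: if_cong)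
  have ipu: "ip u (\<lambda>p. \<Sum>a\<in>I. d a * e a p) = (\<Sum>a\<in>I. d a * ip u (e a))" for d
    using ipL[OF u, of d] by (simp add: ip_commute[of u])
  have ipd: "ip (\<lambda>p. \<Sum>a\<in>I. d a * e a p) (\<lambda>p. \<Sum>a\<in>I. d' a * e a p) = (\<Sum>a\<in>I. K * d a * d' a)" for d d'
    unfolding ipL[OF L] by (intro sum.cong refl) (subst ip_commute, simp add: ipe)
  show SL: "S \<in> L2 Omega" unfolding S by (rule L)
  show SS: "ip S S = (\<Sum>a\<in>I. (ip u (e a))\<^sup>2 / K)"
    unfolding S ipd using K by (intro sum.cong refl) (simp add: power2_eq_square)
  have uS: "ip u S = ip S S"
    unfolding SS unfolding S ipu by (intro sum.cong refl) (simp add: power2_eq_square)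
  show us: "ip (\<lambda>p. u p - S p) (\<lambda>p. u p - S p) = ip u u - ip S S"
    using ip_square_diff[OF u SL] uS by simp
  show "ip S S \<le> ip u u" using us ip_nonneg[of "\<lambda>p. u p - S p"] by simp
  define P where "P = (\<lambda>p. \<Sum>a\<in>I. d a * e a p)"
  have PL: "P \<in> L2 Omega" unfolding P_def by (rule L)
  have up: "ip u P = ip S P" unfolding P_def S ipu ipd using K by (intro sum.cong refl) simp
  have "ip (\<lambda>p. P p - u p) (\<lambda>p. P p - u p) = ip P P - 2 * ip S P + ip u u"
    using ip_square_diff[OF PL u] up ip_commute[of P u] by simp
  moreover have "ip (\<lambda>p. S p - u p) (\<lambda>p. S p - u p) = ip u u - ip S S"
    using ip_square_diff[OF SL u] uS ip_commute[of S u] by simp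
  moreover have "0 \<le> ip P P - 2 * ip P S + ip S S"
    using ip_square_diff[OF PL SL] ip_nonneg[of "\<lambda>p. P p - S p"] by simp
  ultimately have "ip (\<lambda>p. S p - u p) (\<lambda>p. S p - u p) \<le> ip (\<lambda>p. P p - u p) (\<lambda>p. P p - u p)"
    using ip_commute[of P S] by simp
  then show "ip (\<lambda>p. S p - u p) (\<lambda>p. S p - u p)
      \<le> ip (\<lambda>p. (\<Sum>a\<in>I. d a * e a p) - u p) (\<lambda>p. (\<Sum>a\<in>I. d a * e a p) - u p)"
    unfolding P_def .
qed

text \<open>The cubes are symmetric in \<open>j\<close> and \<open>k\<close>. A horizontal
  derivative reverses the sign of one index, so the symmetry makes truncation commute with
  it.\<close>

definition modes :: "nat \<Rightarrow> (int \<times> int \<times> nat) set" where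
  "modes N = {- int N..int N} \<times> {- int N..int N} \<times> {1..N}"

definition fourier_coeff :: "(real^3 \<Rightarrow> real) \<Rightarrow> int \<times> int \<times> nat \<Rightarrow> real" where
  "fourier_coeff u \<kappa> = ip u (ebasis \<kappa>) / (2 * pi\<^sup>2)"

definition fourier_sum :: "nat \<Rightarrow> (real^3 \<Rightarrow> real) \<Rightarrow> real^3 \<Rightarrow> real" where
  "fourier_sum N u p = (\<Sum>\<kappa>\<in>modes N. fourier_coeff u \<kappa> * ebasis \<kappa> p)"

lemma finite_modes: "finite (modes N)" by (simp add: modes_def)

lemma modes_l: "\<kappa> \<in> modes N \<Longrightarrow> 1 \<le> snd (snd \<kappa>)" by (auto simp: modes_def)

lemma Bessel_ebasis:
  assumes "u \<in> L2 Omega"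
  shows "fourier_sum N u \<in> L2 Omega" "ip (fourier_sum N u) (fourier_sum N u) = (\<Sum>\<kappa>\<in>modes N. (ip u (ebasis \<kappa>))\<^sup>2 / (2 * pi\<^sup>2))"
    "ip (fourier_sum N u) (fourier_sum N u) \<le> ip u u"
    "ip (\<lambda>p. u p - fourier_sum N u p) (\<lambda>p. u p - fourier_sum N u p) = ip u u - ip (fourier_sum N u) (fourier_sum N u)"
    "ip (\<lambda>p. fourier_sum N u p - u p) (\<lambda>p. fourier_sum N u p - u p)
      \<le> ip (\<lambda>p. (\<Sum>a\<in>modes N. d a * ebasis a p) - u p) (\<lambda>p. (\<Sum>a\<in>modes N. d a * ebasis a p) - u p)"
proof -
  have S: "fourier_sum N u = (\<lambda>p. \<Sum>\<kappa>\<in>modes N. (ip u (ebasis \<kappa>) / (2 * pi\<^sup>2)) * ebasis \<kappa> p)"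
    by (auto simp: fourier_sum_def fourier_coeff_def)
  have pos: "2 * pi\<^sup>2 > 0" by simp
  note B = Bessel[OF assms finite_modes smooth_L2[OF smooth_ebasis]
      basis_orthogonal(1)[OF modes_l modes_l] pos S]
  show "fourier_sum N u \<in> L2 Omega" "ip (fourier_sum N u) (fourier_sum N u) = (\<Sum>\<kappa>\<in>modes N. (ip u (ebasis \<kappa>))\<^sup>2 / (2 * pi\<^sup>2))"
    "ip (fourier_sum N u) (fourier_sum N u) \<le> ip u u"
    "ip (\<lambda>p. u p - fourier_sum N u p) (\<lambda>p. u p - fourier_sum N u p) = ip u u - ip (fourier_sum N u) (fourier_sum N u)"
    "ip (\<lambda>p. fourier_sum N u p - u p) (\<lambda>p. fourier_sum N u p - u p)
      \<le> ip (\<lambda>p. (\<Sum>a\<in>modes N. d a * ebasis a p) - u p) (\<lambda>p. (\<Sum>a\<in>modes N. d a * ebasis a p) - u p)"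
    by (rule B; assumption)+
qed

lemma Bessel_cbasis:
  assumes "u \<in> L2 Omega"
  shows "(\<Sum>\<kappa>\<in>modes N. (ip u (cbasis \<kappa>))\<^sup>2 / (2 * pi\<^sup>2)) \<le> ip u u"
proof -
  have pos: "2 * pi\<^sup>2 > 0" by simp
  note B = Bessel[OF assms finite_modes smooth_L2[OF smooth_cbasis]
      basis_orthogonal(2)[OF modes_l modes_l] pos refl]
  show ?thesis using B(2)[of N] B(3)[of N] by simp
qed

lemma espan_modes:
  assumes "P \<in> espan"
  shows "\<exists>N. \<forall>n\<ge>N. \<exists>d. P = (\<lambda>p. \<Sum>a\<in>modes n. d a * ebasis a p)"
  using assms
proof induction
  case (base l j k)
  define N where "N = max l (max (nat \<bar>j\<bar>) (nat \<bar>k\<bar>))"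
  have "\<exists>d. ebasis (j, k, l) = (\<lambda>p. \<Sum>a\<in>modes n. d a * ebasis a p)" if "n \<ge> N" for n
  proof (intro exI[of _ "\<lambda>a. if a = (j, k, l) then 1 else 0"] ext)
    fix p
    have "(j, k, l) \<in> modes n" using that base by (auto simp: modes_def N_def)
    then show "ebasis (j, k, l) p = (\<Sum>a\<in>modes n. (if a = (j, k, l) then 1 else 0) * ebasis a p)"
      using finite_modes[of n] by (simp add: if_distrib[of "\<lambda>x. x * _"] sum.delta cong: if_cong)
  qed
  then show ?case by blast
next
  case zero
  have "\<exists>d. (\<lambda>p. 0) = (\<lambda>p. \<Sum>a\<in>modes n. d a * ebasis a p)" for n
    by (intro exI[of _ "\<lambda>a. 0"]) simp
  then show ?case by blast
next
  case (lin u v a b)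
  obtain N where N: "\<And>n. n \<ge> N \<Longrightarrow> \<exists>d. u = (\<lambda>p. \<Sum>a\<in>modes n. d a * ebasis a p)" using lin by blast
  obtain M where M: "\<And>n. n \<ge> M \<Longrightarrow> \<exists>d. v = (\<lambda>p. \<Sum>a\<in>modes n. d a * ebasis a p)" using lin by blast
  have "\<exists>d. (\<lambda>p. a * u p + b * v p) = (\<lambda>p. \<Sum>a\<in>modes n. d a * ebasis a p)" if n: "n \<ge> max N M" for n
  proof -
    obtain d where d: "u = (\<lambda>p. \<Sum>a\<in>modes n. d a * ebasis a p)" using N n by force
    obtain d' where d': "v = (\<lambda>p. \<Sum>a\<in>modes n. d' a * ebasis a p)" using M n by force
    show ?thesis unfolding d d'
      by (intro exI[of _ "\<lambda>x. a * d x + b * d' x"])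
         (simp add: sum_distrib_left sum.distrib distrib_right mult.assoc)
  qed
  then show ?case by blast
qed

text \<open>An approximant from \<open>espan\<close> is a combination of the modes in every large
  cube, and the truncated sum over that cube is at least as close to \<open>u\<close>.\<close>

lemma fourier_sum_tendsto:
  assumes "u \<in> L2 Omega"
  shows "(\<lambda>N. ip (\<lambda>p. fourier_sum N u p - u p) (\<lambda>p. fourier_sum N u p - u p)) \<longlonglongrightarrow> 0"
proof (rule LIMSEQ_I)
  fix r :: real assume "r > 0"
  then obtain P where P: "P \<in> espan" "ip (\<lambda>p. P p - u p) (\<lambda>p. P p - u p) < r"
    using espan_dense[OF assms] unfolding approx_by_def by blast
  obtain N where N: "\<And>n. n \<ge> N \<Longrightarrow> \<exists>d. P = (\<lambda>p. \<Sum>a\<in>modes n. d a * ebasis a p)"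
    using espan_modes[OF P(1)] by blast
  show "\<exists>N. \<forall>n\<ge>N. norm (ip (\<lambda>p. fourier_sum n u p - u p) (\<lambda>p. fourier_sum n u p - u p) - 0) < r"
  proof (intro exI allI impI)
    fix n assume "n \<ge> N"
    then obtain d where d: "P = (\<lambda>p. \<Sum>a\<in>modes n. d a * ebasis a p)" using N by blast
    have "ip (\<lambda>p. fourier_sum n u p - u p) (\<lambda>p. fourier_sum n u p - u p) \<le> ip (\<lambda>p. P p - u p) (\<lambda>p. P p - u p)"
      unfolding d by (rule Bessel_ebasis(5)[OF assms])
    then show "norm (ip (\<lambda>p. fourier_sum n u p - u p) (\<lambda>p. fourier_sum n u p - u p) - 0) < r"
      using P(2) ip_nonneg[of "\<lambda>p. fourier_sum n u p - u p"] by simp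
  qed
qed

subsection \<open>The Poincare inequality and the energy of the modes\<close>

lemma periodic_cbasis:
  assumes "i \<noteq> 3" shows "periodic i (cbasis \<kappa>)"
proof -
  obtain j k l where \<kappa>: "\<kappa> = (j, k, l)" by (metis prod.exhaust)
  have "i = 1 \<or> i = 2" using exhaust_3[of i] assms by blast
  then show ?thesis
    unfolding periodic_def cbasis_def \<kappa> by (elim disjE) (simp_all add: axis_def Hart_periodic)
qed

lemma pd3_cbasis: "pd 3 (cbasis (j, k, l)) = (\<lambda>p. - (real l * pi) * ebasis (j, k, l) p)"
proof
  fix p :: "real^3"
  have s: "((\<lambda>z. cos (real l * pi * z)) has_real_derivative - (real l * pi * sin (real l * pi * p $ 3))) (at (p $ 3))"
    by (auto intro!: derivative_eq_intros)
  have sm: "smooth (\<lambda>p. cos (real l * pi * p $ 3))" using smooth_cos[of "real l * pi" 3 0] by simp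
  have c: "cbasis (j, k, l) = (\<lambda>p. Hart j (p $ 1) * Hart k (p $ 2) * cos (real l * pi * p $ 3))"
    by (auto simp: cbasis_def)
  have "pd 3 (cbasis (j, k, l)) p = Hart j (p $ 1) * Hart k (p $ 2) * (- (real l * pi * sin (real l * pi * p $ 3)))"
    unfolding c
    by (subst pd_mult, (rule smooth_differentiable smooth_mult smooth_Hart sm)+)
       (subst pd_mult, (rule smooth_differentiable smooth_mult smooth_Hart)+,
         simp add: pd_component(2)[OF Hart_deriv] pd_component(2)[OF s])
  then show "pd 3 (cbasis (j, k, l)) p = - (real l * pi) * ebasis (j, k, l) p"
    by (simp add: ebasis_def)
qed

text \<open>The third identity tests with cosines, which do not vanish on the horizontal faces, so
  here the zero trace contained in \<open>has_grad\<close> is used. The first two reverse the sign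
  of an index, as the derivative of \<open>Hart\<close> does.\<close>

lemma has_grad_coefficients:
  assumes "has_grad u g"
  shows "ip (g 1) (ebasis (j, k, l)) = - of_int j * ip u (ebasis (- j, k, l))"
    and "ip (g 2) (ebasis (j, k, l)) = - of_int k * ip u (ebasis (j, - k, l))"
    and "ip (g 3) (cbasis (j, k, l)) = (real l * pi) * ip u (ebasis (j, k, l))"
proof -
  have s: "ip u (\<lambda>p. c * v p) = c * ip u v" for c and v :: "real^3 \<Rightarrow> real"
    using ip_cmult_left[of c v u] by (simp add: ip_commute[of u])
  have 1: "pd 1 (ebasis (j, k, l)) = (\<lambda>p. of_int j * ebasis (- j, k, l) p)"
    "pd 2 (ebasis (j, k, l)) = (\<lambda>p. of_int k * ebasis (j, - k, l) p)"
    by (rule ext, rule pd_ebasis)+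
  note e = has_gradD(3)[OF assms smooth_ebasis periodic_ebasis periodic_ebasis, simplified]
  note c = has_gradD(3)[OF assms smooth_cbasis periodic_cbasis periodic_cbasis, simplified]
  show "ip (g 1) (ebasis (j, k, l)) = - of_int j * ip u (ebasis (- j, k, l))"
    using e[of 1 "(j, k, l)"] by (simp add: 1 s)
  show "ip (g 2) (ebasis (j, k, l)) = - of_int k * ip u (ebasis (j, - k, l))"
    using e[of 2 "(j, k, l)"] by (simp add: 1 s)
  show "ip (g 3) (cbasis (j, k, l)) = (real l * pi) * ip u (ebasis (j, k, l))"
    using c[of 3 "(j, k, l)"] s[of "- (real l * pi)" "ebasis (j, k, l)"] by (simp add: pd3_cbasis)
qed

lemma sum_modes_flip:
  "(\<Sum>\<kappa>\<in>modes N. f (case \<kappa> of (j, k, l) \<Rightarrow> (- j, k, l))) = (\<Sum>\<kappa>\<in>modes N. f \<kappa>)"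
  "(\<Sum>\<kappa>\<in>modes N. f (case \<kappa> of (j, k, l) \<Rightarrow> (j, - k, l))) = (\<Sum>\<kappa>\<in>modes N. f \<kappa>)"
  by (rule sum.reindex_bij_witness[of _ "\<lambda>(j, k, l). (- j, k, l)" "\<lambda>(j, k, l). (- j, k, l)"];
      auto simp: modes_def)
     (rule sum.reindex_bij_witness[of _ "\<lambda>(j, k, l). (j, - k, l)" "\<lambda>(j, k, l). (j, - k, l)"];
      auto simp: modes_def)

lemma smooth_fourier_sum: "smooth (fourier_sum N u)"
  unfolding fourier_sum_def by (intro smooth_sum smooth_mult smooth_const smooth_ebasis)

lemma pd_fourier_sum: "pd i (fourier_sum N u) = (\<lambda>p. \<Sum>\<kappa>\<in>modes N. fourier_coeff u \<kappa> * pd i (ebasis \<kappa>) p)"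
proof -
  have "fourier_sum N u = (\<lambda>p. \<Sum>\<kappa>\<in>modes N. fourier_coeff u \<kappa> * ebasis \<kappa> p)" by (auto simp: fourier_sum_def)
  moreover have "pd i (\<lambda>p. \<Sum>\<kappa>\<in>modes N. fourier_coeff u \<kappa> * ebasis \<kappa> p)
    = (\<lambda>p. \<Sum>\<kappa>\<in>modes N. pd i (\<lambda>p. fourier_coeff u \<kappa> * ebasis \<kappa> p) p)"
    by (intro pd_sum smooth_mult smooth_const smooth_ebasis)
  ultimately show ?thesis by (simp add: pd_cmult[OF smooth_ebasis])
qed

lemma pd_fourier_sum_has_grad:
  assumes "has_grad u g"
  shows "pd 1 (fourier_sum N u) = fourier_sum N (g 1)" "pd 2 (fourier_sum N u) = fourier_sum N (g 2)"
proof -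
  show "pd 1 (fourier_sum N u) = fourier_sum N (g 1)"
  proof
    fix p
    have "pd 1 (fourier_sum N u) p = (\<Sum>\<kappa>\<in>modes N. (\<lambda>\<kappa>. fourier_coeff (g 1) \<kappa> * ebasis \<kappa> p) (case \<kappa> of (j, k, l) \<Rightarrow> (- j, k, l)))"
      unfolding pd_fourier_sum
      by (intro sum.cong refl) (auto simp: pd_ebasis fourier_coeff_def has_grad_coefficients(1)[OF assms])
    also have "\<dots> = fourier_sum N (g 1) p"
      unfolding fourier_sum_def by (rule sum_modes_flip(1)[where f = "\<lambda>\<kappa>. fourier_coeff (g 1) \<kappa> * ebasis \<kappa> p"])
    finally show "pd 1 (fourier_sum N u) p = fourier_sum N (g 1) p" .
  qed
  show "pd 2 (fourier_sum N u) = fourier_sum N (g 2)"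
  proof
    fix p
    have "pd 2 (fourier_sum N u) p = (\<Sum>\<kappa>\<in>modes N. (\<lambda>\<kappa>. fourier_coeff (g 2) \<kappa> * ebasis \<kappa> p) (case \<kappa> of (j, k, l) \<Rightarrow> (j, - k, l)))"
      unfolding pd_fourier_sum
      by (intro sum.cong refl) (auto simp: pd_ebasis fourier_coeff_def has_grad_coefficients(2)[OF assms])
    also have "\<dots> = fourier_sum N (g 2) p"
      unfolding fourier_sum_def by (rule sum_modes_flip(2)[where f = "\<lambda>\<kappa>. fourier_coeff (g 2) \<kappa> * ebasis \<kappa> p"])
    finally show "pd 2 (fourier_sum N u) p = fourier_sum N (g 2) p" .
  qed
qed

text \<open>Symmetry of mixed derivatives is read off the explicit derivatives of the basis
  functions. It expresses that the truncated velocity is free of divergence.\<close>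

lemma pd_commute_fourier_sum: "pd 1 (pd 2 (fourier_sum N u)) = pd 2 (pd 1 (fourier_sum N u))"
proof
  fix p
  have 1: "pd 1 (ebasis (j, k, l)) = (\<lambda>p. of_int j * ebasis (- j, k, l) p)"
    "pd 2 (ebasis (j, k, l)) = (\<lambda>p. of_int k * ebasis (j, - k, l) p)" for j k l
    by (rule ext, rule pd_ebasis)+
  have "pd i (pd i' (fourier_sum N u)) = (\<lambda>p. \<Sum>\<kappa>\<in>modes N. fourier_coeff u \<kappa> * pd i (pd i' (ebasis \<kappa>)) p)" for i i'
    unfolding pd_fourier_sum
    by (subst pd_sum) (auto intro!: smooth_mult smooth_pd smooth_ebasis simp: pd_cmult[OF smooth_pd[OF smooth_ebasis]])
  then show "pd 1 (pd 2 (fourier_sum N u)) p = pd 2 (pd 1 (fourier_sum N u)) p"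
    by (simp, intro sum.cong refl) (auto simp: 1 pd_cmult[OF smooth_ebasis])
qed

lemma ip_fourier_sum_tendsto:
  assumes "u \<in> L2 Omega"
  shows "(\<lambda>N. ip (fourier_sum N u) (fourier_sum N u)) \<longlonglongrightarrow> ip u u"
proof -
  have "ip (\<lambda>p. fourier_sum N u p - u p) (\<lambda>p. fourier_sum N u p - u p) = ip u u - ip (fourier_sum N u) (fourier_sum N u)" for N
    using ip_square_diff[OF Bessel_ebasis(1)[OF assms] assms, of N]
      ip_square_diff[OF assms Bessel_ebasis(1)[OF assms], of N] Bessel_ebasis(4)[OF assms, of N]
      ip_commute[of u "fourier_sum N u"] by simp
  then have "(\<lambda>N. ip u u - ip (fourier_sum N u) (fourier_sum N u)) \<longlonglongrightarrow> 0" using fourier_sum_tendsto[OF assms] by simp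
  from tendsto_diff[OF tendsto_const[of "ip u u"] this] show ?thesis by simp
qed

text \<open>Mode by mode, the vertical derivative multiplies the coefficient by
  \<open>l * pi\<close>, which is at least 1; Bessel's inequality for the cosines does the rest. The
  constant 1 is not sharp.\<close>

lemma Poincare:
  assumes "has_grad u g" shows "ip u u \<le> ip (g 3) (g 3)"
proof (rule LIMSEQ_le_const2[OF ip_fourier_sum_tendsto[OF has_gradD(1)[OF assms]]], intro exI allI impI)
  fix N :: nat
  have "ip (fourier_sum N u) (fourier_sum N u) = (\<Sum>\<kappa>\<in>modes N. (ip u (ebasis \<kappa>))\<^sup>2 / (2 * pi\<^sup>2))"
    by (rule Bessel_ebasis(2)[OF has_gradD(1)[OF assms]])
  also have "\<dots> \<le> (\<Sum>\<kappa>\<in>modes N. (ip (g 3) (cbasis \<kappa>))\<^sup>2 / (2 * pi\<^sup>2))"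
  proof (intro sum_mono divide_right_mono)
    fix \<kappa> assume "\<kappa> \<in> modes N"
    then obtain j k l where \<kappa>: "\<kappa> = (j, k, l)" "l \<ge> 1" by (auto simp: modes_def)
    have "1 * 1 \<le> real l * pi" using \<kappa>(2) pi_ge_two by (intro mult_mono) auto
    then have "1 \<le> (real l * pi)\<^sup>2" by simp
    then have "1 * (ip u (ebasis \<kappa>))\<^sup>2 \<le> (real l * pi)\<^sup>2 * (ip u (ebasis \<kappa>))\<^sup>2"
      by (intro mult_right_mono) auto
    then show "(ip u (ebasis \<kappa>))\<^sup>2 \<le> (ip (g 3) (cbasis \<kappa>))\<^sup>2"
      unfolding \<kappa> has_grad_coefficients(3)[OF assms] by (simp add: power_mult_distrib)
  qed simp
  also have "\<dots> \<le> ip (g 3) (g 3)" by (rule Bessel_cbasis[OF has_gradD(2)[OF assms]])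
  finally show "ip (fourier_sum N u) (fourier_sum N u) \<le> ip (g 3) (g 3)" .
qed

definition dirichlet :: "(3 \<Rightarrow> real^3 \<Rightarrow> real) \<Rightarrow> real" where
  "dirichlet g = (\<Sum>i\<in>UNIV. ip (g i) (g i))"

lemma dirichlet_ge: "ip (g i) (g i) \<le> dirichlet g"
  unfolding dirichlet_def by (rule member_le_sum) (auto intro: ip_nonneg)

lemma dirichlet_nonneg: "0 \<le> dirichlet g" unfolding dirichlet_def by (intro sum_nonneg ip_nonneg)

text \<open>The squared length of the frequency vector, with \<open>pi\<close> dropped from the
  vertical component, which only weakens the lower bounds taken from it.\<close>

definition mode_sq :: "int \<times> int \<times> nat \<Rightarrow> real" where
  "mode_sq = (\<lambda>(j, k, l). (of_int j)\<^sup>2 + (of_int k)\<^sup>2 + (real l)\<^sup>2)"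

text \<open>Each of the three squares in \<open>mode_sq\<close> is paid for by Bessel's inequality
  for one component of the gradient, the third one in the cosine system; the index reversals are
  undone by summing over the symmetric cube.\<close>

lemma spectral_energy:
  assumes "has_grad u g"
  shows "(\<Sum>\<kappa>\<in>modes N. mode_sq \<kappa> * (ip u (ebasis \<kappa>))\<^sup>2) \<le> 2 * pi\<^sup>2 * dirichlet g"
proof -
  have b1: "(\<Sum>\<kappa>\<in>modes N. (ip (g i) (ebasis \<kappa>))\<^sup>2) \<le> 2 * pi\<^sup>2 * ip (g i) (g i)" for i
  proof -
    have "(\<Sum>\<kappa>\<in>modes N. (ip (g i) (ebasis \<kappa>))\<^sup>2) = 2 * pi\<^sup>2 * ip (fourier_sum N (g i)) (fourier_sum N (g i))"
      unfolding Bessel_ebasis(2)[OF has_gradD(2)[OF assms]] by (simp add: sum_divide_distrib[symmetric])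
    also have "\<dots> \<le> 2 * pi\<^sup>2 * ip (g i) (g i)"
      by (intro mult_left_mono Bessel_ebasis(3)[OF has_gradD(2)[OF assms]]) simp
    finally show ?thesis .
  qed
  have b3: "(\<Sum>\<kappa>\<in>modes N. (ip (g 3) (cbasis \<kappa>))\<^sup>2) \<le> 2 * pi\<^sup>2 * ip (g 3) (g 3)"
  proof -
    have "(\<Sum>\<kappa>\<in>modes N. (ip (g 3) (cbasis \<kappa>))\<^sup>2) / (2 * pi\<^sup>2) \<le> ip (g 3) (g 3)"
      using Bessel_cbasis[OF has_gradD(2)[OF assms], of 3 N] by (simp add: sum_divide_distrib[symmetric])
    then show ?thesis by (simp add: pos_divide_le_eq mult.commute)
  qed
  let ?G1 = "\<lambda>\<kappa>. (ip (g 1) (ebasis \<kappa>))\<^sup>2" and ?G2 = "\<lambda>\<kappa>. (ip (g 2) (ebasis \<kappa>))\<^sup>2"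
  have "(\<Sum>\<kappa>\<in>modes N. mode_sq \<kappa> * (ip u (ebasis \<kappa>))\<^sup>2) \<le>
    (\<Sum>\<kappa>\<in>modes N. ?G1 (case \<kappa> of (j, k, l) \<Rightarrow> (- j, k, l)) + ?G2 (case \<kappa> of (j, k, l) \<Rightarrow> (j, - k, l))
       + (ip (g 3) (cbasis \<kappa>))\<^sup>2)"
  proof (rule sum_mono)
    fix \<kappa> assume "\<kappa> \<in> modes N"
    obtain j k l where \<kappa>: "\<kappa> = (j, k, l)" by (metis prod.exhaust)
    have "real l * 1 \<le> real l * pi" using pi_ge_two by (intro mult_left_mono) auto
    then have "(real l)\<^sup>2 \<le> (real l * pi)\<^sup>2" by (intro power_mono) auto
    then have "(real l)\<^sup>2 * (ip u (ebasis \<kappa>))\<^sup>2 \<le> (real l * pi)\<^sup>2 * (ip u (ebasis \<kappa>))\<^sup>2"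
      by (intro mult_right_mono) auto
    then show "mode_sq \<kappa> * (ip u (ebasis \<kappa>))\<^sup>2 \<le> ?G1 (case \<kappa> of (j, k, l) \<Rightarrow> (- j, k, l))
       + ?G2 (case \<kappa> of (j, k, l) \<Rightarrow> (j, - k, l)) + (ip (g 3) (cbasis \<kappa>))\<^sup>2"
      unfolding \<kappa> case_prod_conv has_grad_coefficients[OF assms]
      by (simp add: mode_sq_def power_mult_distrib distrib_right)
  qed
  also have "\<dots> = (\<Sum>\<kappa>\<in>modes N. ?G1 \<kappa>) + (\<Sum>\<kappa>\<in>modes N. ?G2 \<kappa>) + (\<Sum>\<kappa>\<in>modes N. (ip (g 3) (cbasis \<kappa>))\<^sup>2)"
    unfolding sum.distrib sum_modes_flip(1)[where f = ?G1] sum_modes_flip(2)[where f = ?G2] ..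
  also have "\<dots> \<le> 2 * pi\<^sup>2 * ip (g 1) (g 1) + 2 * pi\<^sup>2 * ip (g 2) (g 2) + 2 * pi\<^sup>2 * ip (g 3) (g 3)"
    by (intro add_mono b1 b3)
  also have "\<dots> = 2 * pi\<^sup>2 * dirichlet g" by (simp add: dirichlet_def sum_3 distrib_left)
  finally show ?thesis .
qed

text \<open>The sum factorises because \<open>mode_sq\<close> dominates each of the three squares, and hence also their
  geometric mean (each square replaced by 1 if it vanishes).\<close>

lemma lattice_sum_bounded: "\<exists>Z\<ge>0. \<forall>N. (\<Sum>\<kappa>\<in>modes N. (1 / mode_sq \<kappa>)\<^sup>2) \<le> Z"
proof -
  \<comment> \<open>If \<open>s\<close> dominates the squares of \<open>X\<close>, \<open>Y\<close>
    and \<open>W\<close>, then \<open>s^3\<close> is at least \<open>(X * Y * W)^2\<close>, so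
    \<open>s^(-2)\<close> is at most \<open>(X * Y * W)^(-4/3)\<close>. The exponent exceeds 1, so
    each of the three sums converges.\<close>
  define A where "A n = (max 1 (real n)) powr (- 4 / 3)" for n
  have Ap: "A n \<ge> 0" for n by (simp add: A_def)
  have "summable (\<lambda>n. real n powr (- 4 / 3))" by (simp add: summable_real_powr_iff)
  then have "summable (\<lambda>n. real (Suc n) powr (- 4 / 3))" by (subst summable_Suc_iff)
  then have "summable (\<lambda>n. A (Suc n))" by (simp add: A_def)
  then have sA: "summable A" by (subst (asm) summable_Suc_iff)
  define Z1 where "Z1 = suminf A"
  have Z1: "(\<Sum>n\<in>I. A n) \<le> Z1" if "finite I" for I
    unfolding Z1_def using sum_le_suminf[OF sA that] Ap by blast
  have Z10: "Z1 \<ge> 0" using Z1[of "{}"] by simp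
  \<comment> \<open>The index 0 is counted twice, which only enlarges the bound.\<close>
  have int: "(\<Sum>j\<in>{- int N..int N}. A (nat \<bar>j\<bar>)) \<le> 2 * Z1" for N
  proof -
    have "(\<Sum>j\<in>{- int N..int N}. A (nat \<bar>j\<bar>)) \<le> (\<Sum>j\<in>int ` {0..N} \<union> (\<lambda>n. - int n) ` {0..N}. A (nat \<bar>j\<bar>))"
    proof (rule sum_mono2)
      show "{- int N..int N} \<subseteq> int ` {0..N} \<union> (\<lambda>n. - int n) ` {0..N}"
      proof
        fix j assume j: "j \<in> {- int N..int N}"
        then have "nat \<bar>j\<bar> \<in> {0..N}" "j = int (nat \<bar>j\<bar>) \<or> j = - int (nat \<bar>j\<bar>)" by auto
        then show "j \<in> int ` {0..N} \<union> (\<lambda>n. - int n) ` {0..N}" by blast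
      qed
    qed (auto intro: Ap)
    also have "\<dots> \<le> (\<Sum>j\<in>int ` {0..N}. A (nat \<bar>j\<bar>)) + (\<Sum>j\<in>(\<lambda>n. - int n) ` {0..N}. A (nat \<bar>j\<bar>))"
      by (subst sum.union_inter[symmetric]) (auto intro!: sum_nonneg Ap)
    also have "(\<Sum>j\<in>int ` {0..N}. A (nat \<bar>j\<bar>)) = (\<Sum>n\<in>{0..N}. A n)"
      by (subst sum.reindex) (auto intro!: inj_onI)
    also have "(\<Sum>j\<in>(\<lambda>n. - int n) ` {0..N}. A (nat \<bar>j\<bar>)) = (\<Sum>n\<in>{0..N}. A n)"
      by (subst sum.reindex) (auto intro!: inj_onI)
    finally show ?thesis using Z1[of "{0..N}"] by simp
  qed
  have term_le: "(1 / mode_sq \<kappa>)\<^sup>2 \<le> (case \<kappa> of (j, k, l) \<Rightarrow> A (nat \<bar>j\<bar>) * (A (nat \<bar>k\<bar>) * A l))"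
    if "\<kappa> \<in> modes N" for \<kappa> N
  proof -
    obtain j k l where \<kappa>: "\<kappa> = (j, k, l)" "l \<ge> 1" using \<open>\<kappa> \<in> modes N\<close> by (auto simp: modes_def)
    define s where "s = mode_sq \<kappa>"
    have l1: "1 \<le> (real l)\<^sup>2" using \<kappa>(2) by simp
    have s1: "1 \<le> s" unfolding s_def \<kappa> mode_sq_def using l1 by (simp add: add_increasing)
    define X Y W where "X = max 1 (real (nat \<bar>j\<bar>))" and "Y = max 1 (real (nat \<bar>k\<bar>))" and "W = max 1 (real l)"
    have pos: "X \<ge> 1" "Y \<ge> 1" "W \<ge> 1" by (auto simp: X_def Y_def W_def)
    have sq: "(max 1 x)\<^sup>2 \<le> s" if "0 \<le> x" "x\<^sup>2 \<le> s" for x using that s1 by (simp add: max_def)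
    have "X\<^sup>2 \<le> s" "Y\<^sup>2 \<le> s" "W\<^sup>2 \<le> s"
      unfolding X_def Y_def W_def
      by (rule sq; simp add: s_def \<kappa> mode_sq_def)+
    then have "X\<^sup>2 * Y\<^sup>2 * W\<^sup>2 \<le> s * s * s" using s1 by (intro mult_mono) auto
    then have "(X * Y * W)\<^sup>2 \<le> s ^ 3" by (simp add: power_mult_distrib power3_eq_cube)
    then have "((X * Y * W)\<^sup>2) powr (2 / 3) \<le> (s ^ 3) powr (2 / 3)" by (intro powr_mono2) auto
    also have "(s ^ 3) powr (2 / 3) = s\<^sup>2"
    proof -
      have "s ^ 3 = s powr 3" "s\<^sup>2 = s powr 2" using s1 powr_realpow[of s 3] powr_realpow[of s 2] by simp_all
      then show ?thesis by (simp add: powr_powr)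
    qed
    also have "((X * Y * W)\<^sup>2) powr (2 / 3) = (X * Y * W) powr (4 / 3)"
    proof -
      have "X * Y * W > 0" using pos by simp
      then have "(X * Y * W)\<^sup>2 = (X * Y * W) powr 2" using powr_realpow[of "X * Y * W" 2] by simp
      then show ?thesis by (simp only: powr_powr) simp
    qed
    finally have "(X * Y * W) powr (4 / 3) \<le> s\<^sup>2" .
    moreover have "(X * Y * W) powr (4 / 3) > 0" using pos by simp
    ultimately have "1 / s\<^sup>2 \<le> 1 / (X * Y * W) powr (4 / 3)" by (intro divide_left_mono) (use s1 in auto)
    also have "\<dots> = (X * Y * W) powr (- (4 / 3))" by (simp add: powr_minus_divide)
    also have "\<dots> = X powr (- (4 / 3)) * (Y powr (- (4 / 3)) * W powr (- (4 / 3)))"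
      using pos by (simp add: powr_mult)
    finally show ?thesis by (simp add: \<kappa> A_def X_def Y_def W_def s_def power_divide)
  qed
  have "(\<Sum>\<kappa>\<in>modes N. (1 / mode_sq \<kappa>)\<^sup>2) \<le> (2 * Z1) * ((2 * Z1) * Z1)" for N
  proof -
    have "(\<Sum>\<kappa>\<in>modes N. (1 / mode_sq \<kappa>)\<^sup>2) \<le> (\<Sum>\<kappa>\<in>modes N. case \<kappa> of (j, k, l) \<Rightarrow> A (nat \<bar>j\<bar>) * (A (nat \<bar>k\<bar>) * A l))"
      by (rule sum_mono) (rule term_le)
    also have "\<dots> = (\<Sum>j\<in>{- int N..int N}. \<Sum>k\<in>{- int N..int N}. \<Sum>l\<in>{1..N}. A (nat \<bar>j\<bar>) * (A (nat \<bar>k\<bar>) * A l))"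
      unfolding modes_def sum.cartesian_product by (simp add: case_prod_unfold)
    also have "\<dots> = (\<Sum>j\<in>{- int N..int N}. A (nat \<bar>j\<bar>)) * ((\<Sum>k\<in>{- int N..int N}. A (nat \<bar>k\<bar>)) * (\<Sum>l\<in>{1..N}. A l))"
      by (simp only: sum_distrib_left[symmetric] sum_distrib_right[symmetric])
    also have "\<dots> \<le> (2 * Z1) * ((2 * Z1) * Z1)"
      using int[of N] Z1[of "{1..N}"] Z10 Ap by (intro mult_mono) (auto intro!: sum_nonneg mult_nonneg_nonneg)
    finally show ?thesis .
  qed
  moreover have "(2 * Z1) * ((2 * Z1) * Z1) \<ge> 0" using Z10 by simp
  ultimately show ?thesis by blast
qed

subsection \<open>The stream function and the Jacobian\<close>

text \<open>The symbol of the operator that maps the stream function to the vorticity, on the mode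
  \<open>\<kappa>\<close>.\<close>

definition stream_eigenvalue :: "real \<Rightarrow> int \<times> int \<times> nat \<Rightarrow> real" where
  "stream_eigenvalue F = (\<lambda>(j, k, l). (of_int j)\<^sup>2 + (of_int k)\<^sup>2 + F\<^sup>2 * (real l * pi)\<^sup>2)"

text \<open>The elliptic equation tested only with the basis functions. In this form it passes to
  linear combinations, in particular to the extrapolated fields.\<close>

definition spectral_stream :: "real \<Rightarrow> (real^3 \<Rightarrow> real) \<Rightarrow> (real^3 \<Rightarrow> real) \<Rightarrow> bool" where
  "spectral_stream F w \<psi> \<longleftrightarrow> (\<forall>\<kappa>. 1 \<le> snd (snd \<kappa>) \<longrightarrow> ip w (ebasis \<kappa>) = stream_eigenvalue F \<kappa> * ip \<psi> (ebasis \<kappa>))"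

lemma abs_Hart_le: "\<bar>Hart m x\<bar> \<le> 2"
  unfolding Hart_def using abs_cos_le_one[of "of_int m * x"] abs_sin_le_one[of "of_int m * x"] by linarith

lemma abs_ebasis_le: "\<bar>ebasis \<kappa> p\<bar> \<le> 4"
proof -
  obtain j k l where \<kappa>: "\<kappa> = (j, k, l)" by (metis prod.exhaust)
  have "\<bar>Hart j (p $ 1)\<bar> * \<bar>Hart k (p $ 2)\<bar> * \<bar>sin (real l * pi * p $ 3)\<bar> \<le> 2 * 2 * 1"
    by (intro mult_mono abs_Hart_le) auto
  then show ?thesis by (simp add: \<kappa> ebasis_def abs_mult)
qed

lemma stream_eigenvalue_ge:
  assumes "F > 0" "1 \<le> snd (snd \<kappa>)"
  shows "min 1 (F\<^sup>2) * mode_sq \<kappa> \<le> stream_eigenvalue F \<kappa>" "mode_sq \<kappa> \<ge> 1"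
proof -
  obtain j k l where \<kappa>: "\<kappa> = (j, k, l)" by (metis prod.exhaust)
  define m where "m = min 1 (F\<^sup>2)"
  have m: "m \<ge> 0" "m \<le> 1" "m \<le> F\<^sup>2" by (auto simp: m_def)
  have "real l * 1 \<le> real l * pi" using pi_ge_two by (intro mult_left_mono) auto
  then have "(real l)\<^sup>2 \<le> (real l * pi)\<^sup>2" by (intro power_mono) auto
  then have "m * (real l)\<^sup>2 \<le> F\<^sup>2 * (real l * pi)\<^sup>2" using m by (intro mult_mono) auto
  moreover have "m * (of_int j)\<^sup>2 \<le> 1 * (of_int j)\<^sup>2" "m * (of_int k)\<^sup>2 \<le> 1 * (of_int k)\<^sup>2"
    using m by (intro mult_right_mono; simp)+
  ultimately show "min 1 (F\<^sup>2) * mode_sq \<kappa> \<le> stream_eigenvalue F \<kappa>"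
    unfolding m_def[symmetric] by (simp add: \<kappa> mode_sq_def stream_eigenvalue_def distrib_left)
  have "1 \<le> (real l)\<^sup>2" using assms(2) by (simp add: \<kappa>)
  then show "mode_sq \<kappa> \<ge> 1" by (simp add: \<kappa> mode_sq_def add_increasing)
qed

text \<open>With \<open>s = mode_sq \<kappa>\<close>, a velocity coefficient is at most
  \<open>sqrt s\<close> times that of \<open>\<psi>\<close>, and hence at most
  \<open>sqrt s / (m * s)\<close> times that of \<open>\<omega>\<close>. Cauchy-Schwarz pairs
  \<open>sqrt s\<close> times the coefficient of \<open>\<omega>\<close>, which is controlled by the
  gradient energy, with \<open>1 / s\<close>, which is square summable. The bound concerns the
  truncated sums, uniformly in \<open>N\<close>, since these have values at every point.\<close>

lemma stream_sup_bound:
  assumes F: "F > 0"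
  shows "\<exists>B\<ge>0. \<forall>\<omega> g \<psi> h. has_grad \<omega> g \<and> has_grad \<psi> h \<and> spectral_stream F \<omega> \<psi> \<longrightarrow>
    (\<forall>N p. \<bar>fourier_sum N (h 1) p\<bar> \<le> B * sqrt (dirichlet g) \<and> \<bar>fourier_sum N (h 2) p\<bar> \<le> B * sqrt (dirichlet g))"
proof -
  obtain Z where Z: "Z \<ge> 0" "\<And>N. (\<Sum>\<kappa>\<in>modes N. (1 / mode_sq \<kappa>)\<^sup>2) \<le> Z" using lattice_sum_bounded by blast
  define m where "m = min 1 (F\<^sup>2)"
  have m: "m > 0" unfolding m_def using F by simp
  define K where "K = 2 * pi\<^sup>2"
  have K: "K > 0" unfolding K_def by simp
  \<comment> \<open>Here 4 bounds the basis functions, \<open>1 / K\<close> comes from the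
    normalisation of the coefficients, \<open>1 / m\<close> from ellipticity and the root from
    Cauchy-Schwarz.\<close>
  define B where "B = 4 / (K * m) * sqrt (K * Z)"
  have B: "B \<ge> 0" unfolding B_def using K m Z by simp
  have "\<bar>fourier_sum N (h 1) p\<bar> \<le> B * sqrt (dirichlet g) \<and> \<bar>fourier_sum N (h 2) p\<bar> \<le> B * sqrt (dirichlet g)"
    if "has_grad \<omega> g" "has_grad \<psi> h" and S: "spectral_stream F \<omega> \<psi>" for \<omega> g \<psi> h N p
  proof -
    \<comment> \<open>This majorises the coefficients of both velocity components, up to a reversal
      of one index.\<close>
    define a where "a \<kappa> = sqrt (mode_sq \<kappa>) * \<bar>ip \<psi> (ebasis \<kappa>)\<bar>" for \<kappa>
    have a_le: "a \<kappa> \<le> (1 / m) * ((sqrt (mode_sq \<kappa>) * \<bar>ip \<omega> (ebasis \<kappa>)\<bar>) * (1 / mode_sq \<kappa>))" if "\<kappa> \<in> modes N" for \<kappa>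
    proof -
      note l = modes_l[OF that]
      note ml = stream_eigenvalue_ge[OF F l, folded m_def]
      have lp: "m * mode_sq \<kappa> > 0" using m ml(2) by simp
      have "(m * mode_sq \<kappa>) * \<bar>ip \<psi> (ebasis \<kappa>)\<bar> \<le> stream_eigenvalue F \<kappa> * \<bar>ip \<psi> (ebasis \<kappa>)\<bar>"
        using ml(1) by (intro mult_right_mono) auto
      also have "\<dots> = \<bar>ip \<omega> (ebasis \<kappa>)\<bar>"
      proof -
        have "ip \<omega> (ebasis \<kappa>) = stream_eigenvalue F \<kappa> * ip \<psi> (ebasis \<kappa>)"
          using S[unfolded spectral_stream_def, rule_format, OF l] .
        moreover have "stream_eigenvalue F \<kappa> \<ge> 0" using ml(1) lp by simp
        ultimately show ?thesis by (simp add: abs_mult)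
      qed
      finally have "\<bar>ip \<psi> (ebasis \<kappa>)\<bar> \<le> \<bar>ip \<omega> (ebasis \<kappa>)\<bar> / (m * mode_sq \<kappa>)"
        using lp by (simp add: pos_le_divide_eq mult.commute)
      then have "a \<kappa> \<le> sqrt (mode_sq \<kappa>) * (\<bar>ip \<omega> (ebasis \<kappa>)\<bar> / (m * mode_sq \<kappa>))"
        unfolding a_def using ml(2) by (intro mult_left_mono) auto
      then show ?thesis by (simp add: mult_ac)
    qed
    have "(\<Sum>\<kappa>\<in>modes N. (sqrt (mode_sq \<kappa>) * \<bar>ip \<omega> (ebasis \<kappa>)\<bar>) * (1 / mode_sq \<kappa>))\<^sup>2
      \<le> (\<Sum>\<kappa>\<in>modes N. (sqrt (mode_sq \<kappa>) * \<bar>ip \<omega> (ebasis \<kappa>)\<bar>)\<^sup>2) * (\<Sum>\<kappa>\<in>modes N. (1 / mode_sq \<kappa>)\<^sup>2)"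
      by (rule Cauchy_Schwarz_ineq_sum)
    also have "(\<Sum>\<kappa>\<in>modes N. (sqrt (mode_sq \<kappa>) * \<bar>ip \<omega> (ebasis \<kappa>)\<bar>)\<^sup>2) = (\<Sum>\<kappa>\<in>modes N. mode_sq \<kappa> * (ip \<omega> (ebasis \<kappa>))\<^sup>2)"
      by (intro sum.cong refl) (auto simp: power_mult_distrib mode_sq_def)
    also have "\<dots> * (\<Sum>\<kappa>\<in>modes N. (1 / mode_sq \<kappa>)\<^sup>2) \<le> (K * dirichlet g) * Z"
      using spectral_energy[OF that(1), of N, folded K_def] Z(2)[of N] K dirichlet_nonneg[of g]
      by (intro mult_mono) (auto intro: sum_nonneg)
    finally have sq: "(\<Sum>\<kappa>\<in>modes N. (sqrt (mode_sq \<kappa>) * \<bar>ip \<omega> (ebasis \<kappa>)\<bar>) * (1 / mode_sq \<kappa>)) \<le> sqrt (K * Z * dirichlet g)"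
      by (intro real_le_rsqrt) (simp add: mult_ac)
    have "(\<Sum>\<kappa>\<in>modes N. a \<kappa>) \<le> (\<Sum>\<kappa>\<in>modes N. (1 / m) * ((sqrt (mode_sq \<kappa>) * \<bar>ip \<omega> (ebasis \<kappa>)\<bar>) * (1 / mode_sq \<kappa>)))"
      by (intro sum_mono a_le)
    also have "\<dots> = (1 / m) * (\<Sum>\<kappa>\<in>modes N. (sqrt (mode_sq \<kappa>) * \<bar>ip \<omega> (ebasis \<kappa>)\<bar>) * (1 / mode_sq \<kappa>))"
      by (simp only: sum_distrib_left)
    also have "\<dots> \<le> (1 / m) * sqrt (K * Z * dirichlet g)" using sq m by (intro mult_left_mono) auto
    finally have sa: "(\<Sum>\<kappa>\<in>modes N. a \<kappa>) \<le> (1 / m) * sqrt (K * Z * dirichlet g)" .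
    \<comment> \<open>The map \<open>r\<close> stands for the index reversal; it leaves the sum over
      the cube unchanged.\<close>
    have fin: "\<bar>fourier_sum N u p\<bar> \<le> B * sqrt (dirichlet g)"
      if u: "\<And>\<kappa>. \<bar>ip u (ebasis \<kappa>)\<bar> \<le> a (r \<kappa>)" and r: "(\<Sum>\<kappa>\<in>modes N. a (r \<kappa>)) = (\<Sum>\<kappa>\<in>modes N. a \<kappa>)" for u r
    proof -
      have "\<bar>fourier_sum N u p\<bar> \<le> (\<Sum>\<kappa>\<in>modes N. \<bar>fourier_coeff u \<kappa> * ebasis \<kappa> p\<bar>)" unfolding fourier_sum_def by (rule sum_abs)
      also have "\<dots> \<le> (\<Sum>\<kappa>\<in>modes N. (4 / K) * a (r \<kappa>))"
      proof (rule sum_mono)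
        fix \<kappa>
        have "\<bar>fourier_coeff u \<kappa> * ebasis \<kappa> p\<bar> = \<bar>ip u (ebasis \<kappa>)\<bar> / K * \<bar>ebasis \<kappa> p\<bar>"
          unfolding fourier_coeff_def K_def[symmetric] using K by (simp add: abs_mult)
        also have "\<dots> \<le> a (r \<kappa>) / K * 4"
          using K abs_ebasis_le u order_trans[OF abs_ge_zero u] by (intro mult_mono divide_right_mono) auto
        finally show "\<bar>fourier_coeff u \<kappa> * ebasis \<kappa> p\<bar> \<le> (4 / K) * a (r \<kappa>)" by (simp add: mult.commute)
      qed
      also have "\<dots> = (4 / K) * (\<Sum>\<kappa>\<in>modes N. a \<kappa>)" by (simp only: sum_distrib_left[symmetric] r)
      also have "\<dots> \<le> (4 / K) * ((1 / m) * sqrt (K * Z * dirichlet g))" using sa K by (intro mult_left_mono) auto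
      also have "\<dots> = B * sqrt (dirichlet g)" unfolding B_def by (simp add: real_sqrt_mult)
      finally show ?thesis .
    qed
    have c1: "\<bar>ip (h 1) (ebasis \<kappa>)\<bar> \<le> a (case \<kappa> of (j, k, l) \<Rightarrow> (- j, k, l))" for \<kappa>
    proof -
      obtain j k l where \<kappa>: "\<kappa> = (j, k, l)" by (metis prod.exhaust)
      have "sqrt ((of_int j)\<^sup>2) \<le> sqrt (mode_sq (- j, k, l))" unfolding mode_sq_def by (intro real_sqrt_le_mono) simp
      then have "\<bar>of_int j\<bar> \<le> sqrt (mode_sq (- j, k, l))" by simp
      then show ?thesis unfolding \<kappa> case_prod_conv has_grad_coefficients(1)[OF that(2)] a_def abs_mult abs_minus_cancel
        by (intro mult_right_mono) auto
    qed
    have c2: "\<bar>ip (h 2) (ebasis \<kappa>)\<bar> \<le> a (case \<kappa> of (j, k, l) \<Rightarrow> (j, - k, l))" for \<kappa>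
    proof -
      obtain j k l where \<kappa>: "\<kappa> = (j, k, l)" by (metis prod.exhaust)
      have "sqrt ((of_int k)\<^sup>2) \<le> sqrt (mode_sq (j, - k, l))" unfolding mode_sq_def by (intro real_sqrt_le_mono) simp
      then have "\<bar>of_int k\<bar> \<le> sqrt (mode_sq (j, - k, l))" by simp
      then show ?thesis unfolding \<kappa> case_prod_conv has_grad_coefficients(2)[OF that(2)] a_def abs_mult abs_minus_cancel
        by (intro mult_right_mono) auto
    qed
    show ?thesis using fin[OF c1 sum_modes_flip(1)] fin[OF c2 sum_modes_flip(2)] by blast
  qed
  then show ?thesis using B by blast
qed

section \<open>Limits of products and the bound of the Jacobian\<close>

lemma L2norm_mult_le:
  fixes u v :: "real^3 \<Rightarrow> real"
  assumes "u \<in> L2 Omega" "v \<in> borel_measurable LO" "\<And>p. \<bar>v p\<bar> \<le> B"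
  shows "(\<lambda>p. v p * u p) \<in> L2 Omega" "L2norm (\<lambda>p. v p * u p) \<le> B * L2norm u"
proof -
  have B: "B \<ge> 0" using assms(3)[of 0] by (meson abs_ge_zero order_trans)
  show L: "(\<lambda>p. v p * u p) \<in> L2 Omega"
    by (rule L2_bounded_mult[OF assms(1,2), of B]) (use assms(3) in simp)
  have "ip (\<lambda>p. v p * u p) (\<lambda>p. v p * u p) \<le> (\<integral>p. B\<^sup>2 * (u p * u p) \<partial>LO)"
    unfolding ip_real
  proof (rule integral_mono)
    show "integrable LO (\<lambda>p. v p * u p * (v p * u p))" by (rule L2_mult_integrable[OF L L])
    show "integrable LO (\<lambda>p. B\<^sup>2 * (u p * u p))" by (intro integrable_mult_right L2_mult_integrable assms)
    fix p
    have "(v p)\<^sup>2 \<le> B\<^sup>2" using assms(3)[of p] B by (simp add: abs_le_square_iff[symmetric])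
    then have "(v p)\<^sup>2 * (u p * u p) \<le> B\<^sup>2 * (u p * u p)" by (intro mult_right_mono) auto
    then show "v p * u p * (v p * u p) \<le> B\<^sup>2 * (u p * u p)" by (simp add: power2_eq_square mult_ac)
  qed
  also have "\<dots> = B\<^sup>2 * ip u u" by (simp add: ip_real)
  finally have "sqrt (ip (\<lambda>p. v p * u p) (\<lambda>p. v p * u p)) \<le> sqrt (B\<^sup>2 * ip u u)" by (rule real_sqrt_le_mono)
  then show "L2norm (\<lambda>p. v p * u p) \<le> B * L2norm u" using B by (simp add: L2norm_def real_sqrt_mult)
qed

text \<open>The product is split as \<open>a n * (u n - w) * k\<close> plus
  \<open>a n * w * k\<close>: the first part vanishes by Cauchy-Schwarz and the uniform bound, the
  second converges by dominated convergence. Neither kind of convergence alone would do, as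
  \<open>u n\<close> is not bounded.\<close>

lemma triple_product_tendsto:
  fixes u :: "nat \<Rightarrow> real^3 \<Rightarrow> real"
  assumes u: "\<And>n. u n \<in> L2 Omega" "w \<in> L2 Omega" "(\<lambda>n. ip (\<lambda>p. u n p - w p) (\<lambda>p. u n p - w p)) \<longlonglongrightarrow> 0"
    and a: "\<And>n. a n \<in> borel_measurable LO" "b \<in> borel_measurable LO" "\<And>n p. \<bar>a n p\<bar> \<le> B"
      "AE p in LO. (\<lambda>n. a n p) \<longlonglongrightarrow> b p"
    and k: "k \<in> L2 Omega"
  shows "(\<lambda>n. ip (\<lambda>p. a n p * u n p) k) \<longlonglongrightarrow> (\<integral>p. b p * w p * k p \<partial>LO)"
proof -
  have ak: "(\<lambda>p. a n p * k p) \<in> L2 Omega" "L2norm (\<lambda>p. a n p * k p) \<le> B * L2norm k" for n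
    by (rule L2norm_mult_le[OF k a(1) a(3)])+
  have "(\<lambda>n. L2norm (\<lambda>p. u n p - w p) * (B * L2norm k)) \<longlonglongrightarrow> sqrt 0 * (B * L2norm k)"
    unfolding L2norm_def by (intro tendsto_intros u(3))
  then have z: "(\<lambda>n. L2norm (\<lambda>p. u n p - w p) * (B * L2norm k)) \<longlonglongrightarrow> 0" by simp
  have 1: "(\<lambda>n. ip (\<lambda>p. u n p - w p) (\<lambda>p. a n p * k p)) \<longlonglongrightarrow> 0"
  proof (rule Lim_null_comparison[OF always_eventually z], rule allI)
    fix n
    have "\<bar>ip (\<lambda>p. u n p - w p) (\<lambda>p. a n p * k p)\<bar> \<le> L2norm (\<lambda>p. u n p - w p) * L2norm (\<lambda>p. a n p * k p)"
      by (rule ip_Cauchy_Schwarz[OF L2_diff[OF u(1,2)] ak(1)])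
    also have "\<dots> \<le> L2norm (\<lambda>p. u n p - w p) * (B * L2norm k)"
      by (intro mult_left_mono ak(2) L2norm_nonneg)
    finally show "norm (ip (\<lambda>p. u n p - w p) (\<lambda>p. a n p * k p)) \<le> L2norm (\<lambda>p. u n p - w p) * (B * L2norm k)" by simp
  qed
  have 2: "(\<lambda>n. \<integral>p. a n p * (w p * k p) \<partial>LO) \<longlonglongrightarrow> (\<integral>p. b p * (w p * k p) \<partial>LO)"
  proof (rule integral_dominated_convergence)
    have wk: "integrable LO (\<lambda>p. w p * k p)" by (rule L2_mult_integrable[OF u(2) k])
    then have wm: "(\<lambda>p. w p * k p) \<in> borel_measurable LO" by simp
    show "(\<lambda>p. b p * (w p * k p)) \<in> borel_measurable LO" "\<And>n. (\<lambda>p. a n p * (w p * k p)) \<in> borel_measurable LO"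
      by (intro borel_measurable_times a wm)+
    show "integrable LO (\<lambda>p. B * \<bar>w p * k p\<bar>)" using wk by simp
    show "AE p in LO. (\<lambda>n. a n p * (w p * k p)) \<longlonglongrightarrow> b p * (w p * k p)"
      using a(4) by eventually_elim (intro tendsto_intros)
    show "AE p in LO. norm (a n p * (w p * k p)) \<le> B * \<bar>w p * k p\<bar>" for n
      by (intro AE_I2) (simp add: abs_mult[of "a n _"] mult_right_mono a(3))
  qed
  have "ip (\<lambda>p. a n p * u n p) k = ip (\<lambda>p. u n p - w p) (\<lambda>p. a n p * k p) + (\<integral>p. a n p * (w p * k p) \<partial>LO)" for n
  proof -
    have "ip (\<lambda>p. a n p * u n p) k = ip (u n) (\<lambda>p. a n p * k p)" unfolding ip_real by (simp add: mult_ac)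
    moreover have "(\<integral>p. a n p * (w p * k p) \<partial>LO) = ip w (\<lambda>p. a n p * k p)" unfolding ip_real by (simp add: mult_ac)
    ultimately show ?thesis using ip_diff_left[OF u(1)[of n] u(2) ak(1)[of n]] by simp
  qed
  then show ?thesis using tendsto_add[OF 1 2] by (simp add: mult.assoc)
qed

text \<open>Mean convergence yields an almost everywhere convergent subsequence. Applied to the sum
  of the two squared errors, it gives one subsequence for both velocity components.\<close>

lemma fourier_sum_AE_subseq:
  assumes "u \<in> L2 Omega" "v \<in> L2 Omega"
  shows "\<exists>r :: nat \<Rightarrow> nat. strict_mono r \<and> (AE p in LO. (\<lambda>n. fourier_sum (r n) u p) \<longlonglongrightarrow> u p) \<and>
    (AE p in LO. (\<lambda>n. fourier_sum (r n) v p) \<longlonglongrightarrow> v p)"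
proof -
  define d where "d n p = (fourier_sum n u p - u p) * (fourier_sum n u p - u p) + (fourier_sum n v p - v p) * (fourier_sum n v p - v p)" for n p
  have dL: "(\<lambda>p. fourier_sum n u p - u p) \<in> L2 Omega" "(\<lambda>p. fourier_sum n v p - v p) \<in> L2 Omega" for n
    by (intro L2_diff Bessel_ebasis(1) assms)+
  have di: "integrable LO (d n)" for n
    unfolding d_def by (intro Bochner_Integration.integrable_add L2_mult_integrable dL)
  have "(\<integral>p. norm (d n p) \<partial>LO) = ip (\<lambda>p. fourier_sum n u p - u p) (\<lambda>p. fourier_sum n u p - u p)
      + ip (\<lambda>p. fourier_sum n v p - v p) (\<lambda>p. fourier_sum n v p - v p)" for n
  proof -
    have "(\<integral>p. norm (d n p) \<partial>LO) = (\<integral>p. d n p \<partial>LO)"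
      by (intro Bochner_Integration.integral_cong refl) (simp add: d_def)
    then show ?thesis unfolding d_def ip_real
      by (simp add: Bochner_Integration.integral_add[OF L2_mult_integrable[OF dL(1) dL(1)] L2_mult_integrable[OF dL(2) dL(2)]])
  qed
  then have "(\<lambda>n. \<integral>p. norm (d n p) \<partial>LO) \<longlonglongrightarrow> 0"
    using tendsto_add[OF fourier_sum_tendsto[OF assms(1)] fourier_sum_tendsto[OF assms(2)]] by simp
  from tendsto_L1_AE_subseq[OF di this] obtain r where r: "strict_mono r" "AE p in LO. (\<lambda>n. d (r n) p) \<longlonglongrightarrow> 0" by blast
  have conv: "x \<longlonglongrightarrow> (c :: real)" if "(\<lambda>n. e n) \<longlonglongrightarrow> 0" "\<And>n. (x n - c) * (x n - c) \<le> e n" for x e c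
  proof -
    have "(\<lambda>n. (x n - c)\<^sup>2) \<longlonglongrightarrow> 0"
      by (rule tendsto_sandwich[OF _ _ tendsto_const that(1)]) (use that(2) in \<open>auto simp: power2_eq_square\<close>)
    then have "(\<lambda>n. x n - c) \<longlonglongrightarrow> 0" by simp
    then show ?thesis by (rule LIM_zero_cancel)
  qed
  show ?thesis
  proof (intro exI[of _ r] conjI r(1))
    show "AE p in LO. (\<lambda>n. fourier_sum (r n) u p) \<longlonglongrightarrow> u p"
      using r(2) by eventually_elim (erule conv, simp add: d_def)
    show "AE p in LO. (\<lambda>n. fourier_sum (r n) v p) \<longlonglongrightarrow> v p"
      using r(2) by eventually_elim (erule conv, simp add: d_def)
  qed
qed

lemma periodic_mult: "periodic i u \<Longrightarrow> periodic i v \<Longrightarrow> periodic i (\<lambda>p. u p * v p)"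
  by (simp add: periodic_def)

lemma periodic_fourier_sum: "i \<noteq> 3 \<Longrightarrow> periodic i (fourier_sum N u)"
  using periodic_ebasis unfolding periodic_def fourier_sum_def by simp

text \<open>For truncated Fourier series the Jacobian is integrated by parts classically; the truncations
  of the velocity are bounded uniformly, which makes the passage to the limit possible.\<close>

lemma jacobian_bound:
  assumes F: "F > 0"
  shows "\<exists>C\<ge>0. \<forall>\<omega> g \<psi> h \<phi> k. has_grad \<omega> g \<and> has_grad \<psi> h \<and> spectral_stream F \<omega> \<psi> \<and> has_grad \<phi> k \<longrightarrow>
    integrable LO (\<lambda>p. h 2 p * \<omega> p * k 1 p) \<and> integrable LO (\<lambda>p. h 1 p * \<omega> p * k 2 p) \<and>
    \<bar>(\<integral>p. h 2 p * \<omega> p * k 1 p \<partial>LO) - (\<integral>p. h 1 p * \<omega> p * k 2 p \<partial>LO)\<bar> \<le> C * dirichlet g * L2norm \<phi> \<and>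
    \<bar>ip (h 1) \<phi>\<bar> \<le> C * sqrt (dirichlet g) * L2norm \<phi>"
proof -
  obtain B where B: "B \<ge> 0" "\<And>\<omega> g \<psi> h N p. has_grad \<omega> g \<Longrightarrow> has_grad \<psi> h \<Longrightarrow> spectral_stream F \<omega> \<psi> \<Longrightarrow>
    \<bar>fourier_sum N (h 1) p\<bar> \<le> B * sqrt (dirichlet g) \<and> \<bar>fourier_sum N (h 2) p\<bar> \<le> B * sqrt (dirichlet g)"
    using stream_sup_bound[OF F] by blast
  define V where "V = L2norm (\<lambda>p. 1 :: real)"
  \<comment> \<open>The first summand serves the two products in the Jacobian, the second the zonal
    term; \<open>V\<close> is the root of the volume of the box.\<close>
  define C where "C = 2 * B + B * V"
  have V: "V \<ge> 0" unfolding V_def by (rule L2norm_nonneg)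
  have C: "C \<ge> 0" unfolding C_def using B V by simp
  have "integrable LO (\<lambda>p. h 2 p * \<omega> p * k 1 p) \<and> integrable LO (\<lambda>p. h 1 p * \<omega> p * k 2 p) \<and>
    \<bar>(\<integral>p. h 2 p * \<omega> p * k 1 p \<partial>LO) - (\<integral>p. h 1 p * \<omega> p * k 2 p \<partial>LO)\<bar> \<le> C * dirichlet g * L2norm \<phi> \<and>
    \<bar>ip (h 1) \<phi>\<bar> \<le> C * sqrt (dirichlet g) * L2norm \<phi>"
    if w: "has_grad \<omega> g" and s: "has_grad \<psi> h" and S: "spectral_stream F \<omega> \<psi>" and f: "has_grad \<phi> k" for \<omega> g \<psi> h \<phi> k
  proof -
    define b where "b = B * sqrt (dirichlet g)"
    have b: "\<bar>fourier_sum N (h 1) p\<bar> \<le> b" "\<bar>fourier_sum N (h 2) p\<bar> \<le> b" for N p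
      using B(2)[OF w s S] unfolding b_def by blast+
    have b0: "b \<ge> 0" unfolding b_def using B(1) dirichlet_nonneg by simp
    note wL = has_gradD(1)[OF w] and hL = has_gradD(2)[OF s] and kL = has_gradD(2)[OF f] and fL = has_gradD(1)[OF f]
    obtain r where r: "strict_mono r" "AE p in LO. (\<lambda>n. fourier_sum (r n) (h 1) p) \<longlonglongrightarrow> h 1 p"
      "AE p in LO. (\<lambda>n. fourier_sum (r n) (h 2) p) \<longlonglongrightarrow> h 2 p"
      using fourier_sum_AE_subseq[OF hL[of 1] hL[of 2]] by blast
    \<comment> \<open>The uniform bound of the truncations passes to the velocity itself along the
      convergent subsequence.\<close>
    have hb: "AE p in LO. \<bar>h i p\<bar> \<le> b" if "AE p in LO. (\<lambda>n. fourier_sum (r n) (h i) p) \<longlonglongrightarrow> h i p" "\<And>N p. \<bar>fourier_sum N (h i) p\<bar> \<le> b" for i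
      using that(1)
    proof eventually_elim
      case (elim p)
      have "(\<lambda>n. \<bar>fourier_sum (r n) (h i) p\<bar>) \<longlonglongrightarrow> \<bar>h i p\<bar>" by (intro tendsto_intros elim)
      then show ?case by (rule LIMSEQ_le_const2) (use that(2) in blast)
    qed
    have h1b: "AE p in LO. \<bar>h 1 p\<bar> \<le> b" and h2b: "AE p in LO. \<bar>h 2 p\<bar> \<le> b"
      using hb[OF r(2) b(1)] hb[OF r(3) b(2)] by auto
    have int: "integrable LO (\<lambda>p. h i p * \<omega> p * k j p)" if "AE p in LO. \<bar>h i p\<bar> \<le> b" for i j
      by (rule L2_mult_integrable[OF L2_bounded_mult[OF wL L2_measurable[OF hL] that] kL])
    have i12: "integrable LO (\<lambda>p. h 2 p * \<omega> p * k 1 p)" "integrable LO (\<lambda>p. h 1 p * \<omega> p * k 2 p)"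
      by (rule int[OF h2b], rule int[OF h1b])
    have fm: "fourier_sum N u \<in> borel_measurable LO" for N u
      by (rule L2_measurable[OF smooth_L2[OF smooth_fourier_sum]])
    have sub: "(\<lambda>n. ip (\<lambda>p. fourier_sum (r n) \<omega> p - \<omega> p) (\<lambda>p. fourier_sum (r n) \<omega> p - \<omega> p)) \<longlonglongrightarrow> 0"
      using LIMSEQ_subseq_LIMSEQ[OF fourier_sum_tendsto[OF wL] r(1)] by (simp add: o_def)
    have lim: "(\<lambda>n. ip (\<lambda>p. fourier_sum (r n) (h 2) p * fourier_sum (r n) \<omega> p) (k 1) - ip (\<lambda>p. fourier_sum (r n) (h 1) p * fourier_sum (r n) \<omega> p) (k 2))
      \<longlonglongrightarrow> (\<integral>p. h 2 p * \<omega> p * k 1 p \<partial>LO) - (\<integral>p. h 1 p * \<omega> p * k 2 p \<partial>LO)"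
      by (intro tendsto_diff
          triple_product_tendsto[OF smooth_L2[OF smooth_fourier_sum] wL sub fm L2_measurable[OF hL] b(2) r(3) kL]
          triple_product_tendsto[OF smooth_L2[OF smooth_fourier_sum] wL sub fm L2_measurable[OF hL] b(1) r(2) kL])
    have bound: "\<bar>ip (\<lambda>p. fourier_sum N (h 2) p * fourier_sum N \<omega> p) (k 1) - ip (\<lambda>p. fourier_sum N (h 1) p * fourier_sum N \<omega> p) (k 2)\<bar>
      \<le> (2 * B) * dirichlet g * L2norm \<phi>" for N
    proof -
      have per: "periodic i (\<lambda>p. fourier_sum N u p * fourier_sum N v p)" if "i = 1 \<or> i = 2" for i u v
        using that by (intro periodic_mult periodic_fourier_sum) auto
      have sm: "smooth (\<lambda>p. fourier_sum N u p * fourier_sum N v p)" for u v by (intro smooth_mult smooth_fourier_sum)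
      have P: "pd 1 (\<lambda>p. fourier_sum N (h 2) p * fourier_sum N \<omega> p) = (\<lambda>p. fourier_sum N (h 2) p * fourier_sum N (g 1) p + pd 1 (fourier_sum N (h 2)) p * fourier_sum N \<omega> p)"
        "pd 2 (\<lambda>p. fourier_sum N (h 1) p * fourier_sum N \<omega> p) = (\<lambda>p. fourier_sum N (h 1) p * fourier_sum N (g 2) p + pd 2 (fourier_sum N (h 1)) p * fourier_sum N \<omega> p)"
        unfolding smooth_pd_simps(2)[OF smooth_fourier_sum smooth_fourier_sum] pd_fourier_sum_has_grad[OF w] by auto
      \<comment> \<open>The velocity has no divergence: after integration by parts the terms with
        second derivatives of the stream function, called \<open>e3\<close> below, are equal and
        cancel.\<close>
      have comm: "pd 1 (fourier_sum N (h 2)) = pd 2 (fourier_sum N (h 1))"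
        unfolding pd_fourier_sum_has_grad[OF s, symmetric] by (rule pd_commute_fourier_sum)
      define e1 e2 e3 where "e1 p = fourier_sum N (h 2) p * fourier_sum N (g 1) p" and "e2 p = fourier_sum N (h 1) p * fourier_sum N (g 2) p"
        and "e3 p = pd 1 (fourier_sum N (h 2)) p * fourier_sum N \<omega> p" for p
      have eL: "e1 \<in> L2 Omega" "e2 \<in> L2 Omega" "e3 \<in> L2 Omega"
        unfolding e1_def e2_def e3_def by (intro smooth_L2 smooth_mult smooth_pd smooth_fourier_sum)+
      have "ip (\<lambda>p. fourier_sum N (h 2) p * fourier_sum N \<omega> p) (k 1) = - (ip e1 \<phi> + ip e3 \<phi>)"
        using has_gradD(3)[OF f sm[of "h 2" \<omega>] per per, of 1] ip_add_left[OF eL(1,3) fL]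
        unfolding P e1_def e3_def by (simp add: ip_commute[of _ "k 1"] ip_commute[of _ \<phi>])
      moreover have "ip (\<lambda>p. fourier_sum N (h 1) p * fourier_sum N \<omega> p) (k 2) = - (ip e2 \<phi> + ip e3 \<phi>)"
        using has_gradD(3)[OF f sm[of "h 1" \<omega>] per per, of 2] ip_add_left[OF eL(2,3) fL]
        unfolding P e2_def e3_def comm by (simp add: ip_commute[of _ "k 2"] ip_commute[of _ \<phi>])
      ultimately have "\<bar>ip (\<lambda>p. fourier_sum N (h 2) p * fourier_sum N \<omega> p) (k 1) - ip (\<lambda>p. fourier_sum N (h 1) p * fourier_sum N \<omega> p) (k 2)\<bar>
        \<le> \<bar>ip e1 \<phi>\<bar> + \<bar>ip e2 \<phi>\<bar>" by linarith
      also have "\<dots> \<le> L2norm e1 * L2norm \<phi> + L2norm e2 * L2norm \<phi>"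
        by (intro add_mono ip_Cauchy_Schwarz eL fL)
      also have "\<dots> \<le> (b * sqrt (dirichlet g)) * L2norm \<phi> + (b * sqrt (dirichlet g)) * L2norm \<phi>"
      proof -
        have G: "L2norm (fourier_sum N (g i)) \<le> sqrt (dirichlet g)" for i
          unfolding L2norm_def using order_trans[OF Bessel_ebasis(3)[OF has_gradD(2)[OF w]] dirichlet_ge] by (rule real_sqrt_le_mono)
        have "L2norm e1 \<le> b * L2norm (fourier_sum N (g 1))" "L2norm e2 \<le> b * L2norm (fourier_sum N (g 2))"
          unfolding e1_def e2_def
          by (rule L2norm_mult_le(2)[OF smooth_L2[OF smooth_fourier_sum] fm b(2)], rule L2norm_mult_le(2)[OF smooth_L2[OF smooth_fourier_sum] fm b(1)])
        then have "L2norm e1 \<le> b * sqrt (dirichlet g)" "L2norm e2 \<le> b * sqrt (dirichlet g)"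
          using mult_left_mono[OF G b0] order_trans by blast+
        then show ?thesis by (intro add_mono mult_right_mono L2norm_nonneg)
      qed
      also have "\<dots> = (2 * B) * dirichlet g * L2norm \<phi>"
        unfolding b_def using real_sqrt_mult_self[of "dirichlet g"] dirichlet_nonneg[of g] by (simp add: mult.assoc)
      finally show ?thesis .
    qed
    have "\<bar>(\<integral>p. h 2 p * \<omega> p * k 1 p \<partial>LO) - (\<integral>p. h 1 p * \<omega> p * k 2 p \<partial>LO)\<bar> \<le> (2 * B) * dirichlet g * L2norm \<phi>"
      by (rule LIMSEQ_le_const2[OF tendsto_rabs[OF lim]]) (use bound in blast)
    also have "\<dots> \<le> C * dirichlet g * L2norm \<phi>"
      unfolding C_def using B(1) V dirichlet_nonneg by (intro mult_right_mono L2norm_nonneg) auto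
    finally have r1: "\<bar>(\<integral>p. h 2 p * \<omega> p * k 1 p \<partial>LO) - (\<integral>p. h 1 p * \<omega> p * k 2 p \<partial>LO)\<bar> \<le> C * dirichlet g * L2norm \<phi>" .
    \<comment> \<open>The zonal term needs \<open>h 1\<close> only in mean square, where the
      supremum bound costs the volume of the box.\<close>
    have "ip (h 1) (h 1) \<le> (\<integral>p. b\<^sup>2 * (1 * 1) \<partial>LO)"
      unfolding ip_real
    proof (rule integral_mono_AE)
      show "integrable LO (\<lambda>p. h 1 p * h 1 p)" by (rule L2_mult_integrable[OF hL hL])
      show "integrable LO (\<lambda>p. b\<^sup>2 * (1 * 1))"
        by (intro integrable_mult_right L2_mult_integrable L2_one open_Omega bounded_Omega)
      show "AE p in LO. h 1 p * h 1 p \<le> b\<^sup>2 * (1 * 1)"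
        using h1b by eventually_elim (simp add: power2_eq_square[symmetric] abs_le_square_iff[symmetric] b0)
    qed
    also have "\<dots> = b\<^sup>2 * ip (\<lambda>p. 1 :: real) (\<lambda>p. 1 :: real)" unfolding ip_real by (rule integral_mult_right_zero)
    finally have "sqrt (ip (h 1) (h 1)) \<le> sqrt (b\<^sup>2 * ip (\<lambda>p. 1 :: real) (\<lambda>p. 1 :: real))" by (rule real_sqrt_le_mono)
    then have "L2norm (h 1) \<le> b * V" unfolding V_def L2norm_def using b0 by (simp add: real_sqrt_mult)
    then have "L2norm (h 1) * L2norm \<phi> \<le> (b * V) * L2norm \<phi>" by (intro mult_right_mono L2norm_nonneg)
    moreover have "(b * V) * L2norm \<phi> \<le> C * sqrt (dirichlet g) * L2norm \<phi>"
      unfolding b_def C_def using B(1) dirichlet_nonneg[of g]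
      by (intro mult_right_mono L2norm_nonneg) (simp add: distrib_right)
    ultimately have r2: "\<bar>ip (h 1) \<phi>\<bar> \<le> C * sqrt (dirichlet g) * L2norm \<phi>"
      using ip_Cauchy_Schwarz[OF hL fL, of 1] by linarith
    show ?thesis using i12 r1 r2 by blast
  qed
  then show ?thesis using C by blast
qed

subsection \<open>Discrete Gronwall estimates\<close>

text \<open>\<open>c / r\<close> is the fixed point of the map that sends \<open>a\<close> to
  \<open>(a + c) / (1 + r)\<close>, and each step contracts towards it by the factor
  \<open>1 / (1 + r)\<close>.\<close>

lemma geometric_absorb:
  fixes a :: "nat \<Rightarrow> real"
  assumes r: "r > 0" and step: "\<And>n. n \<ge> 1 \<Longrightarrow> a (Suc n) * (1 + r) \<le> a n + c"
    and c: "c \<ge> 0" and a1: "a 1 \<le> A" and A: "A \<ge> 0" and n: "n \<ge> 1"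
  shows "a n \<le> A / (1 + r) ^ (n - 1) + c / r"
  using n
proof (induction n rule: nat_induct_at_least)
  case base
  then show ?case using a1 c r by (simp add: add_increasing2)
next
  case (Suc n)
  have "a (Suc n) \<le> (a n + c) / (1 + r)"
    using step[OF Suc(1)] r by (simp add: pos_le_divide_eq)
  also have "\<dots> \<le> (A / (1 + r) ^ (n - 1) + c / r + c) / (1 + r)"
    using Suc(2) r by (intro divide_right_mono) auto
  also have "\<dots> = A / ((1 + r) ^ (n - 1) * (1 + r)) + (c / r + c) / (1 + r)"
    by (simp add: add_divide_distrib)
  also have "(1 + r) ^ (n - 1) * (1 + r) = (1 + r) ^ n"
    using Suc(1) by (metis One_nat_def Suc_le_D diff_Suc_Suc minus_nat.diff_0 power_Suc2)
  also have "(c / r + c) / (1 + r) = c / r"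
    using r by (simp add: divide_eq_eq) (simp add: field_simps)
  finally show ?case by simp
qed

text \<open>Only the newest level is damped, whereas \<open>E\<close> involves two levels. Half of
  the damping is therefore saved for the next step by adding \<open>(k * m / 2) * x n\<close> to
  \<open>E n\<close>, and this sum contracts. The threshold is chosen before \<open>E\<close> and
  \<open>x\<close>, from \<open>k\<close> and \<open>e\<close> alone, while \<open>B\<close> has to
  serve every \<open>k\<close>.\<close>

lemma energy_absorb:
  fixes m C :: real
  assumes m: "m > 0" and C: "C \<ge> 0"
  shows "\<exists>B>0. \<forall>k>0. \<forall>e. \<exists>N::nat\<ge>1. \<forall>E x.
    (\<forall>n\<ge>1. E (Suc n) + k * m * x (Suc n) \<le> E n + k * C) \<longrightarrow>
    (\<forall>n\<ge>1. x n \<le> E n \<and> E n \<le> 7 * (x n + x (n - 1))) \<longrightarrow> (\<forall>n. 0 \<le> x n) \<longrightarrow> E 1 \<le> e \<longrightarrow>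
    (\<forall>n\<ge>N. E n \<le> (B::real))"
proof -
  define P where "P = 1 + 14 * C / m + C"
  have P: "P \<ge> 1" unfolding P_def using m C by simp
  define B where "B = 2 * P + 56 * P / m"
  have B: "B > 0" unfolding B_def using P m by (simp add: add_pos_nonneg)
  have "\<exists>N::nat\<ge>1. \<forall>E x.
    (\<forall>n\<ge>1. E (Suc n) + k * m * x (Suc n) \<le> E n + k * C) \<longrightarrow>
    (\<forall>n\<ge>1. x n \<le> E n \<and> E n \<le> 7 * (x n + x (n - 1))) \<longrightarrow> (\<forall>n. 0 \<le> x n) \<longrightarrow> E 1 \<le> e \<longrightarrow>
    (\<forall>n\<ge>N. E n \<le> B)" if k: "k > 0" for k e :: real
  proof -
    \<comment> \<open>The saved and the remaining half damp \<open>x (Suc n) + x n\<close> with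
      weight \<open>k * m / 2\<close>, and the contracting quantity is at most
      \<open>7 + k * m / 2\<close> times this sum; \<open>r\<close> is the quotient.\<close>
    define r where "r = (k * m / 2) / (7 + k * m / 2)"
    have km: "k * m > 0" using k m by simp
    have r: "r > 0" unfolding r_def using km by simp
    define A where "A = (1 + k * m / 2) * max e 0"
    have A: "A \<ge> 0" unfolding A_def using km by simp
    have "(\<lambda>n. A / (1 + r) ^ n) \<longlonglongrightarrow> 0"
      using LIMSEQ_divide_realpow_zero[of "1 + r" A] r by simp
    then have "\<forall>\<^sub>F n in sequentially. A / (1 + r) ^ n < 1"
      by (rule order_tendstoD) simp
    then obtain N0 where N0: "\<And>n. n \<ge> N0 \<Longrightarrow> A / (1 + r) ^ n < 1"
      unfolding eventually_sequentially by blast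
    show ?thesis
    proof (intro exI[of _ "N0 + 2"] conjI allI impI)
      show "N0 + 2 \<ge> 1" by simp
      fix E x :: "nat \<Rightarrow> real" and n :: nat
      assume h1: "\<forall>n\<ge>1. E (Suc n) + k * m * x (Suc n) \<le> E n + k * C"
        and h2: "\<forall>n\<ge>1. x n \<le> E n \<and> E n \<le> 7 * (x n + x (n - 1))"
        and h3: "\<forall>n. 0 \<le> x n" and h4: "E 1 \<le> e" and n: "n \<ge> N0 + 2"
      define \<Phi> where "\<Phi> n = E n + (k * m / 2) * x n" for n
      have step: "\<Phi> (Suc n) * (1 + r) \<le> \<Phi> n + k * C" if "n \<ge> 1" for n
      proof -
        have a: "\<Phi> (Suc n) + (k * m / 2) * (x (Suc n) + x n) \<le> \<Phi> n + k * C"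
          using h1[rule_format, OF that] unfolding \<Phi>_def by (simp add: field_simps)
        have "\<Phi> (Suc n) \<le> 7 * (x (Suc n) + x n) + (k * m / 2) * x (Suc n)"
          unfolding \<Phi>_def using h2[rule_format, of "Suc n"] by simp
        also have "\<dots> \<le> (7 + k * m / 2) * (x (Suc n) + x n)"
          using mult_nonneg_nonneg[OF less_imp_le[OF km] h3[rule_format, of n]]
          by (simp add: algebra_simps)
        finally have "\<Phi> (Suc n) * r \<le> (7 + k * m / 2) * (x (Suc n) + x n) * r"
          using r by (intro mult_right_mono) auto
        also have "\<dots> = (k * m / 2) * (x (Suc n) + x n)"
          unfolding r_def using km by (simp add: field_simps)
        finally have "\<Phi> (Suc n) * r \<le> (k * m / 2) * (x (Suc n) + x n)" .
        then show ?thesis using a by (simp only: distrib_left mult_1_right)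
      qed
      have "x 1 \<le> max e 0" using h2 h4 by (metis le_max_iff_disj order.refl order_trans)
      then have "(k * m / 2) * x 1 \<le> (k * m / 2) * max e 0"
        using km by (intro mult_left_mono) auto
      then have P1: "\<Phi> 1 \<le> A" unfolding \<Phi>_def A_def using h4 by (simp add: algebra_simps)
      have n1: "n \<ge> 1" using n by simp
      have bound: "\<Phi> i \<le> P + k * C" if "i \<ge> N0 + 1" for i
      proof -
        have i1: "i \<ge> 1" using that by simp
        have "\<Phi> i \<le> A / (1 + r) ^ (i - 1) + k * C / r"
          by (rule geometric_absorb[OF r step _ P1 A i1]) (use k C in auto)
        also have "A / (1 + r) ^ (i - 1) \<le> 1" by (rule less_imp_le[OF N0]) (use that in simp)
        also have "k * C / r = 14 * C / m + k * C"
          unfolding r_def using k m by (simp add: field_simps)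
        finally show ?thesis unfolding P_def using C by simp
      qed
      show "E n \<le> B"
      proof (cases "k \<le> 1")
        case True
        have "E n \<le> \<Phi> n" unfolding \<Phi>_def using h3 km by simp
        also have "\<dots> \<le> P + k * C" using bound n by simp
        also have "k * C \<le> 1 * C" using True C by (intro mult_right_mono) auto
        also have "1 * C \<le> P" unfolding P_def using m C by simp
        also have "P + P \<le> B" unfolding B_def using P m by simp
        finally show ?thesis by simp
      next
        \<comment> \<open>For large steps the source \<open>k * C\<close> is not bounded. It is
          weighed against the damping of the same order in \<open>k\<close>, which bounds
          \<open>x\<close> at two consecutive levels and through them \<open>E\<close>.\<close>
        case False
        have xb: "x i \<le> 4 * P / m" if "i \<ge> N0 + 1" for i
        proof -
          have "E i \<ge> 0" using h2[rule_format, of i] h3[rule_format, of i] that by simp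
          then have "(k * m / 2) * x i \<le> P + k * C"
            using bound[OF that] unfolding \<Phi>_def by simp
          also have "P \<le> k * P" using False P by simp
          also have "k * C \<le> k * P"
            unfolding P_def using k m C by (intro mult_left_mono) auto
          finally have "k * (m * x i) \<le> k * (4 * P)" by (simp add: algebra_simps)
          then have "m * x i \<le> 4 * P" using k by simp
          then show ?thesis using m by (simp add: pos_le_divide_eq mult.commute)
        qed
        have "E n \<le> 7 * (x n + x (n - 1))" using h2 n1 by blast
        also have "\<dots> \<le> 7 * (4 * P / m + 4 * P / m)"
          by (intro mult_left_mono add_mono xb) (use n in auto)
        also have "\<dots> \<le> B" unfolding B_def using P by simp
        finally show ?thesis .
      qed
    qed
  qed
  then show ?thesis using B by blast
qed

lemma discrete_gronwall:
  fixes M s :: "nat \<Rightarrow> real"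
  assumes "\<And>i. i \<in> {j..<n} \<Longrightarrow> M (Suc i) \<le> M i * (1 + s i)"
    and "\<And>i. i \<in> {j..<n} \<Longrightarrow> s i \<ge> 0" and "\<And>i. i \<in> {j..n} \<Longrightarrow> M i \<ge> 0" and "j \<le> n"
  shows "M n \<le> M j * exp (\<Sum>i=j..<n. s i)"
  using assms(4,1-3)
proof (induction n rule: dec_induct)
  case base
  then show ?case by simp
next
  case (step n)
  have "M (Suc n) \<le> M n * (1 + s n)" using step by simp
  also have "\<dots> \<le> M n * exp (s n)"
    using step by (intro mult_left_mono exp_ge_add_one_self) auto
  also have "\<dots> \<le> (M j * exp (\<Sum>i=j..<n. s i)) * exp (s n)"
    using step by (intro mult_right_mono) auto
  also have "\<dots> = M j * exp (\<Sum>i=j..<Suc n. s i)"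
    using step by (simp add: exp_add mult.assoc)
  finally show ?case .
qed

lemma telescope_le:
  fixes a b :: "nat \<Rightarrow> real"
  assumes "\<And>i. i \<in> {j..<n} \<Longrightarrow> a (Suc i) + b i \<le> a i" and "j \<le> n"
  shows "a n + (\<Sum>i=j..<n. b i) \<le> a j"
  using assms(2,1)
proof (induction n rule: dec_induct)
  case (step n)
  then have "a (Suc n) + b n \<le> a n" "a n + (\<Sum>i=j..<n. b i) \<le> a j" by auto
  then show ?case using step(1) by simp
qed simp

text \<open>A uniform Gronwall argument on the last \<open>L\<close> levels, a time between 1 and 2.
  \<open>B2\<close> bounds \<open>k * y\<close> at one level and \<open>B3\<close> its sum over the
  window; \<open>S1\<close> bounds the sum of the growth rates \<open>k * s\<close>,
  \<open>B4\<close> that of the increments, \<open>B6\<close> the least value of \<open>M\<close> in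
  the window, and \<open>c\<close> is the rate in Gronwall's inequality. The formulas for these
  constants do not contain \<open>k\<close>, which is the point of the lemma.\<close>

lemma window_bound:
  fixes \<nu> C B k :: real and L n :: nat
  assumes pos: "\<nu> > 0" "C \<ge> 0" "B \<ge> 0" and k: "0 < k" "k < 1"
    and L: "1 \<le> k * L" "k * L \<le> 2" and n: "n \<ge> L + 3 + N" and N: "N \<ge> 1"
    and h1: "\<And>i. i \<ge> N \<Longrightarrow> E (Suc i) + k * \<nu> * y (Suc i) \<le> E i + k * C"
    and E: "\<And>i. i \<ge> N \<Longrightarrow> E i \<le> B" "\<And>i. i \<ge> N \<Longrightarrow> 0 \<le> E i"
    and xb: "\<And>i. i \<ge> N \<Longrightarrow> x i \<le> B" "\<And>i. i \<ge> N \<Longrightarrow> 0 \<le> (x i::real)"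
    and y: "\<And>i. 0 \<le> (y i::real)" and D: "\<And>i. 0 \<le> (D i::real)"
    and h3: "\<And>i. i \<ge> 3 \<Longrightarrow> 3 * D (Suc i) - D i + 2 * \<nu> * k * (y (Suc i) - y i)
      \<le> k\<^sup>2 * C * (1 + x (Suc i) * (1 + y i + y (i - 1))\<^sup>2)"
    and DB: "\<And>i. i \<ge> 1 \<Longrightarrow> D i \<le> 2 * (x i + x (i - 1))"
    and B2: "B2 = (B + C) / \<nu>" and B3: "B3 = (B + 2 * C) / \<nu>"
    and S1: "S1 = 2 + 2 * B3 + 3 * B2"
    and B4: "B4 = 4 * B + 2 * \<nu> * B2 + C * (2 + B * (1 + 2 * B2) * S1)"
    and B6: "B6 = S1 + B4 / \<nu> + 6 * B / \<nu>"
    and c: "c = (C / \<nu>) * (1 + B)"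
  shows "y n \<le> B6 * exp (c * (2 + S1))"
proof -
  define j where "j = n - L"
  have jL: "j \<le> n" "j \<ge> N + 3" "n - j = L" unfolding j_def using n by auto
  have B2p: "B2 \<ge> 0" "B3 \<ge> 0" unfolding B2 B3 using pos by auto
  have S1p: "S1 \<ge> 0" unfolding S1 using B2p by simp
  \<comment> \<open>The dissipation of one step cannot exceed the energy available in it;
    \<open>k < 1\<close> turns \<open>k * C\<close> into \<open>C\<close>.\<close>
  have ky: "k * y i \<le> B2" if "i \<ge> Suc N" for i
  proof -
    define i' where "i' = i - 1"
    have i': "i = Suc i'" "i' \<ge> N" using that unfolding i'_def by auto
    have "k * C \<le> C" using pos k by (simp add: mult_left_le_one_le)
    then have "k * \<nu> * y i \<le> B + C"
      using h1[OF i'(2)] E(1)[OF i'(2)] E(2)[of "Suc i'"] i' by simp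
    then show ?thesis unfolding B2 using pos by (simp add: pos_le_divide_eq mult_ac)
  qed
  have sumy: "(\<Sum>i=j..<n. k * y (Suc i)) \<le> B3"
  proof -
    have "E n + (\<Sum>i=j..<n. k * \<nu> * y (Suc i) - k * C) \<le> E j"
      by (rule telescope_le) (use h1 jL in \<open>auto simp: algebra_simps\<close>)
    moreover have "(\<Sum>i=j..<n. k * \<nu> * y (Suc i) - k * C) = \<nu> * (\<Sum>i=j..<n. k * y (Suc i)) - (k * L) * C"
      using jL by (simp add: sum_subtractf sum_distrib_left mult_ac)
    moreover have "(k * L) * C \<le> 2 * C" using L pos by (intro mult_right_mono) auto
    ultimately have "\<nu> * (\<Sum>i=j..<n. k * y (Suc i)) \<le> B + 2 * C"
      using E(1)[of j] E(2)[of n] jL by simp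
    then show ?thesis unfolding B3 using pos by (simp add: pos_le_divide_eq mult_ac)
  qed
  have jm: "Suc N \<le> j - 1" "N \<le> j - 1" "N \<le> j - 1 - 1" using jL by auto
  \<comment> \<open>Shifting the index of a sum over the window costs one term at its lower end;
    this is where the extra multiples of \<open>B2\<close> and \<open>B\<close> in the constants
    come from.\<close>
  have kD: "(\<Sum>i=j..<n. g i) \<le> g j + (\<Sum>i=j..<n. g (Suc i))" if "\<And>i. g i \<ge> 0" for g :: "nat \<Rightarrow> real"
  proof -
    have "(\<Sum>i=j..<n. g i) \<le> (\<Sum>i=j..<Suc n. g i)" using that by (intro sum_mono2) auto
    also have "\<dots> = g j + (\<Sum>i=j..<n. g (Suc i))"
      using sum.atLeast_Suc_lessThan[of j "Suc n" g] sum.shift_bounds_Suc_ivl[of g j n] jL by simp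
    finally show ?thesis .
  qed
  have sy0: "(\<Sum>i=j..<n. k * y i) \<le> B2 + B3"
    using kD[of "\<lambda>i. k * y i"] y k sumy ky[of j] jL by simp
  have sy1: "(\<Sum>i=j..<n. k * y (i - 1)) \<le> 2 * B2 + B3"
    using kD[of "\<lambda>i. k * y (i - 1)"] y k sy0 ky[of "j - 1", OF jm(1)] by simp
  define s where "s i = 1 + y i + y (i - 1)" for i
  have s1: "s i \<ge> 1" for i unfolding s_def using y[of i] y[of "i - 1"] by simp
  have ss: "(\<Sum>i=j..<n. k * s i) \<le> S1"
  proof -
    have "(\<Sum>i=j..<n. k * s i) = k * L + (\<Sum>i=j..<n. k * y i) + (\<Sum>i=j..<n. k * y (i - 1))"
      unfolding s_def using jL by (simp add: sum.distrib algebra_simps)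
    then show ?thesis using sy0 sy1 L unfolding S1 by simp
  qed
  have ks: "k * s i \<le> 1 + 2 * B2" if "i \<ge> j" for i
  proof -
    have "Suc N \<le> i" "Suc N \<le> i - 1" using that jL by auto
    then have "k * y i \<le> B2" "k * y (i - 1) \<le> B2" using ky by blast+
    then show ?thesis using k unfolding s_def by (simp add: algebra_simps)
  qed
  have h3': "3 * D (Suc i) - D i + 2 * \<nu> * k * (y (Suc i) - y i) \<le> k\<^sup>2 * C * (1 + B * (s i)\<^sup>2)"
    if "i \<ge> j" for i
  proof -
    have "x (Suc i) * (s i)\<^sup>2 \<le> B * (s i)\<^sup>2"
      using xb(1)[of "Suc i"] that jL by (intro mult_right_mono) auto
    then have "k\<^sup>2 * C * (1 + x (Suc i) * (s i)\<^sup>2) \<le> k\<^sup>2 * C * (1 + B * (s i)\<^sup>2)"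
      using pos by (intro mult_left_mono) auto
    then show ?thesis using h3[of i] that jL unfolding s_def by simp
  qed
  have D4: "D i \<le> 4 * B" if "i \<ge> j" for i
  proof -
    have "N \<le> i" "N \<le> i - 1" "1 \<le> i" using that jL by auto
    then have "x i \<le> B" "x (i - 1) \<le> B" "D i \<le> 2 * (x i + x (i - 1))" using xb DB by blast+
    then show ?thesis by simp
  qed
  \<comment> \<open>Of the three copies of \<open>D (Suc i)\<close> one telescopes together with
    \<open>2 * \<nu> * k * y\<close>, and two remain as gain.\<close>
  have sumD: "(\<Sum>i=j..<n. 2 * D (Suc i)) \<le> B4"
  proof -
    have "(D n + 2 * \<nu> * k * y n) + (\<Sum>i=j..<n. 2 * D (Suc i) - C * (k + B * (1 + 2 * B2) * (k * s i)))
      \<le> D j + 2 * \<nu> * k * y j"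
    proof (rule telescope_le)
      fix i assume i: "i \<in> {j..<n}"
      \<comment> \<open>One of the two factors \<open>k * s i\<close> is replaced by its pointwise
        bound. What remains is linear in \<open>k\<close> and \<open>k * s i\<close>, so its sum
        over the window is bounded uniformly in \<open>k\<close>.\<close>
      have "k\<^sup>2 * C * (1 + B * (s i)\<^sup>2) = C * (k * k + B * ((k * s i) * (k * s i)))"
        by (simp add: power2_eq_square algebra_simps)
      also have "\<dots> \<le> C * (k + B * ((1 + 2 * B2) * (k * s i)))"
        using pos k ks[of i] i s1[of i]
        by (intro mult_left_mono add_mono mult_right_mono) auto
      finally have "3 * D (Suc i) - D i + 2 * \<nu> * k * (y (Suc i) - y i)
          \<le> C * (k + B * ((1 + 2 * B2) * (k * s i)))" using h3'[of i] i by simp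
      then show "D (Suc i) + 2 * \<nu> * k * y (Suc i)
         + (2 * D (Suc i) - C * (k + B * (1 + 2 * B2) * (k * s i))) \<le> D i + 2 * \<nu> * k * y i"
        by (simp add: algebra_simps)
    qed (use jL in auto)
    moreover have "(\<Sum>i=j..<n. 2 * D (Suc i) - C * (k + B * (1 + 2 * B2) * (k * s i)))
       = (\<Sum>i=j..<n. 2 * D (Suc i)) - C * (k * L + B * (1 + 2 * B2) * (\<Sum>i=j..<n. k * s i))"
      using jL by (simp add: sum_subtractf sum.distrib sum_distrib_left mult_ac distrib_left)
    moreover have "C * (k * L + B * (1 + 2 * B2) * (\<Sum>i=j..<n. k * s i))
       \<le> C * (2 + B * (1 + 2 * B2) * S1)"
      using pos L ss B2p by (intro mult_left_mono add_mono) auto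
    moreover have "2 * \<nu> * k * y j \<le> 2 * \<nu> * B2"
      using ky[of j] jL pos by (simp add: mult.assoc)
    moreover have "0 \<le> 2 * \<nu> * k * y n" using y pos k by simp
    ultimately show ?thesis using D4[of j] D[of n] unfolding B4 by simp
  qed
  \<comment> \<open>The multiple of \<open>D\<close> that makes the left side of \<open>h3\<close>,
    without the surplus \<open>2 * D (Suc i)\<close>, a multiple of the difference of
    \<open>Z\<close>.\<close>
  define Z where "Z i = y i + D i / (2 * \<nu> * k)" for i
  have Zp: "Z i \<ge> 0" for i unfolding Z_def using y D pos k by simp
  \<comment> \<open>The growth rate refers to two levels, so the maximum over two levels is
    propagated; the summand 1 makes \<open>s i\<close> at most \<open>2 * M i\<close>.\<close>
  define M where "M i = 1 + max (Z i) (Z (i - 1))" for i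
  have sM: "s i \<le> 2 * M i" for i
  proof -
    have "y i \<le> Z i" "y (i - 1) \<le> Z (i - 1)" unfolding Z_def using D pos k by simp_all
    moreover have "Z i \<le> max (Z i) (Z (i - 1))" "Z (i - 1) \<le> max (Z i) (Z (i - 1))" by auto
    ultimately show ?thesis unfolding s_def M_def distrib_left by linarith
  qed
  have Mstep: "M (Suc i) \<le> M i * (1 + c * k * (1 + s i))" if "i \<ge> j" for i
  proof -
    have "Z (Suc i) - Z i = (D (Suc i) - D i + 2 * \<nu> * k * (y (Suc i) - y i)) / (2 * \<nu> * k)"
      unfolding Z_def using pos k by (simp add: field_simps)
    also have "\<dots> \<le> (k\<^sup>2 * C * (1 + B * (s i)\<^sup>2)) / (2 * \<nu> * k)"
      using h3'[OF that] D[of "Suc i"] pos k by (intro divide_right_mono) auto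
    also have "\<dots> = (k * C / (2 * \<nu>)) * (1 + B * (s i)\<^sup>2)"
      using pos k by (simp add: power2_eq_square)
    also have "\<dots> \<le> (k * C / (2 * \<nu>)) * (2 * M i * ((1 + B) * (1 + s i)))"
    proof (intro mult_left_mono)
      \<comment> \<open>Here the square is shared out: one factor \<open>s i\<close> becomes
        \<open>M i\<close>, the other stays as the Gronwall weight, whose sum is at most
        \<open>S1\<close>.\<close>
      have "B * (s i)\<^sup>2 \<le> B * ((2 * M i) * s i)"
        using sM[of i] s1[of i] pos by (auto intro!: mult_left_mono mult_right_mono simp: power2_eq_square)
      moreover have "1 \<le> 2 * M i" using s1[of i] sM[of i] by simp
      moreover have "B * (2 * M i) \<ge> 0" "s i * (2 * M i) \<ge> 0"
        using pos s1[of i] sM[of i] by auto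
      ultimately show "1 + B * (s i)\<^sup>2 \<le> 2 * M i * ((1 + B) * (1 + s i))"
        by (simp add: algebra_simps)
    qed (use pos k in auto)
    also have "\<dots> = M i * (c * k * (1 + s i))"
      unfolding c using pos by (simp add: field_simps)
    finally have "Z (Suc i) \<le> Z i + M i * (c * k * (1 + s i))" by simp
    moreover have "M i * (c * k * (1 + s i)) \<ge> 0"
      using sM[of i] s1[of i] pos k unfolding c by simp
    moreover have "1 + Z i \<le> M i" unfolding M_def by simp
    ultimately have "M (Suc i) \<le> M i + M i * (c * k * (1 + s i))"
      unfolding M_def[of "Suc i"] by simp
    then show ?thesis by (simp only: distrib_left[of "M i"] mult_1_right)
  qed
  have cp: "c \<ge> 0" unfolding c using pos by simp
  \<comment> \<open>Averaging: the sum of \<open>k * M i\<close> over the window is at most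
    \<open>B6\<close>, while the weights \<open>k\<close> add up to at least 1, so \<open>M\<close>
    cannot exceed \<open>B6\<close> throughout.\<close>
  have "\<exists>i\<in>{j..<n}. M i \<le> B6"
  proof (rule ccontr)
    assume "\<not> ?thesis"
    then have gt: "\<And>i. i \<in> {j..<n} \<Longrightarrow> B6 < M i" by force
    have Lp: "L > 0" using L by (cases L) auto
    have "k * L * B6 = (\<Sum>i=j..<n. k * B6)" using jL by simp
    also have "\<dots> < (\<Sum>i=j..<n. k * M i)"
      using gt k Lp jL by (intro sum_strict_mono) auto
    also have "\<dots> \<le> (\<Sum>i=j..<n. k * s i + (D i + D (i - 1)) / (2 * \<nu>))"
    proof (rule sum_mono)
      fix i assume "i \<in> {j..<n}"
      have "k * M i \<le> k * (1 + Z i + Z (i - 1))"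
        using k Zp[of i] Zp[of "i - 1"] unfolding M_def by (intro mult_left_mono) auto
      also have "\<dots> = k * s i + (D i + D (i - 1)) / (2 * \<nu>)"
        unfolding Z_def s_def using k pos by (simp add: field_simps)
      finally show "k * M i \<le> k * s i + (D i + D (i - 1)) / (2 * \<nu>)" .
    qed
    also have "\<dots> = (\<Sum>i=j..<n. k * s i) + ((\<Sum>i=j..<n. D i) + (\<Sum>i=j..<n. D (i - 1))) / (2 * \<nu>)"
      by (simp add: sum.distrib sum_divide_distrib add_divide_distrib)
    also have "\<dots> \<le> S1 + (2 * B4 + 12 * B) / (2 * \<nu>)"
    proof -
      have d0: "(\<Sum>i=j..<n. D (Suc i)) \<le> B4 / 2" using sumD by (simp add: sum_distrib_left[symmetric])
      have d1: "(\<Sum>i=j..<n. D i) \<le> 4 * B + B4 / 2" using kD[of D] D d0 D4[of j] by simp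
      have "D (j - 1) \<le> 4 * B" using DB[of "j - 1", OF order_trans[OF N jm(2)]] xb(1)[OF jm(2)] xb(1)[OF jm(3)] jL by simp
      then have d2: "(\<Sum>i=j..<n. D (i - 1)) \<le> 8 * B + B4 / 2"
        using kD[of "\<lambda>i. D (i - 1)"] D d1 by simp
      have "B4 \<ge> 0" using sum_nonneg[of "{j..<n}" "\<lambda>i. 2 * D (Suc i)"] sumD D by force
      then have "(\<Sum>i=j..<n. D i) + (\<Sum>i=j..<n. D (i - 1)) \<le> 2 * B4 + 12 * B"
        using d1 d2 by simp
      then show ?thesis by (rule add_mono[OF ss divide_right_mono]) (use pos in simp)
    qed
    also have "\<dots> = B6" unfolding B6 by (simp add: add_divide_distrib)
    finally have "k * L * B6 < B6" .
    moreover have "B6 \<ge> 0"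
      unfolding B6 B4 using pos S1p B2p by simp
    ultimately show False using L(1) mult_right_mono[of 1 "k * L" B6] by simp
  qed
  then obtain i where i: "i \<in> {j..<n}" "M i \<le> B6" by blast
  have "y n \<le> M n"
  proof -
    have "y n \<le> Z n" unfolding Z_def using D[of n] pos k by simp
    moreover have "Z n \<le> max (Z n) (Z (n - 1))" by simp
    ultimately show ?thesis unfolding M_def by linarith
  qed
  also have "M n \<le> M i * exp (\<Sum>l=i..<n. c * k * (1 + s l))"
  proof (rule discrete_gronwall)
    fix l assume "l \<in> {i..<n}"
    then show "M (Suc l) \<le> M l * (1 + c * k * (1 + s l))" using Mstep i by simp
    show "0 \<le> c * k * (1 + s l)" using cp k s1[of l] by simp
  next
    fix l show "M l \<ge> 0" using s1[of l] sM[of l] by simp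
  qed (use i in simp)
  also have "(\<Sum>l=i..<n. c * k * (1 + s l)) \<le> (\<Sum>l=j..<n. c * k * (1 + s l))"
    using i cp k order_trans[OF zero_le_one s1] by (intro sum_mono2) auto
  also have "\<dots> = c * (k * L + (\<Sum>l=j..<n. k * s l))"
    using jL by (simp add: sum_distrib_left sum.distrib algebra_simps)
  also have "\<dots> \<le> c * (2 + S1)" using cp ss L by (intro mult_left_mono) auto
  also have "M i * exp (c * (2 + S1)) \<le> B6 * exp (c * (2 + S1))"
    using i by (intro mult_right_mono) auto
  finally show ?thesis using s1[of i] sM[of i] by simp
qed

text \<open>Large steps are handled by the energy inequality alone,
  small ones by averaging over a window of unit length.\<close>

lemma eventual_gradient_bound:
  fixes \<nu> m C :: real
  assumes "\<nu> > 0" "m > 0" "C \<ge> 0"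
  shows "\<exists>B>0. \<forall>k>0. \<forall>e. \<exists>N::nat\<ge>1. \<forall>E x y D.
    (\<forall>n\<ge>1. E (Suc n) + k * \<nu> * y (Suc n) + k * m * x (Suc n) \<le> E n + k * C) \<longrightarrow>
    (\<forall>n\<ge>1. x n \<le> E n \<and> E n \<le> 7 * (x n + x (n - 1))) \<longrightarrow> E 1 \<le> e \<longrightarrow>
    (\<forall>n. 0 \<le> x n \<and> 0 \<le> y n \<and> 0 \<le> D n) \<longrightarrow>
    (\<forall>n\<ge>3. 3 * D (Suc n) - D n + 2 * \<nu> * k * (y (Suc n) - y n)
      \<le> k\<^sup>2 * C * (1 + x (Suc n) * (1 + y n + y (n - 1))\<^sup>2)) \<longrightarrow>
    (\<forall>n\<ge>1. D n \<le> 2 * (x n + x (n - 1))) \<longrightarrow>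
    (\<forall>n\<ge>N. y n \<le> (B::real))"
proof -
  obtain B where B: "B > 0" and eb: "\<forall>k>0. \<forall>e. \<exists>N::nat\<ge>1. \<forall>E x.
    (\<forall>n\<ge>1. E (Suc n) + k * m * x (Suc n) \<le> E n + k * C) \<longrightarrow>
    (\<forall>n\<ge>1. x n \<le> E n \<and> E n \<le> 7 * (x n + x (n - 1))) \<longrightarrow> (\<forall>n. 0 \<le> x n) \<longrightarrow> E 1 \<le> e \<longrightarrow>
    (\<forall>n\<ge>N. E n \<le> B)" using energy_absorb[OF assms(2,3)] by blast
  define B2 where "B2 = (B + C) / \<nu>"
  define B3 where "B3 = (B + 2 * C) / \<nu>"
  define S1 where "S1 = 2 + 2 * B3 + 3 * B2"
  define B4 where "B4 = 4 * B + 2 * \<nu> * B2 + C * (2 + B * (1 + 2 * B2) * S1)"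
  define B6 where "B6 = S1 + B4 / \<nu> + 6 * B / \<nu>"
  define c where "c = (C / \<nu>) * (1 + B)"
  \<comment> \<open>One bound for both regimes: \<open>B2\<close> for large steps, the Gronwall
    bound for small ones.\<close>
  define Q where "Q = B2 + B6 * exp (c * (2 + S1)) + 1"
  have B2p: "B2 \<ge> 0" unfolding B2_def using assms B by simp
  have B3p: "B3 \<ge> 0" unfolding B3_def using assms B by simp
  have S1p: "S1 \<ge> 0" unfolding S1_def using B2p B3p by simp
  have B6p: "B6 \<ge> 0" unfolding B6_def B4_def using assms B B2p S1p by simp
  have Q: "Q > 0" "Q \<ge> B2" "Q \<ge> B6 * exp (c * (2 + S1))"
    unfolding Q_def using B2p B6p by (auto simp: add_nonneg_pos)
  have "\<exists>N::nat\<ge>1. \<forall>E x y D.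
    (\<forall>n\<ge>1. E (Suc n) + k * \<nu> * y (Suc n) + k * m * x (Suc n) \<le> E n + k * C) \<longrightarrow>
    (\<forall>n\<ge>1. x n \<le> E n \<and> E n \<le> 7 * (x n + x (n - 1))) \<longrightarrow> E 1 \<le> e \<longrightarrow>
    (\<forall>n. 0 \<le> x n \<and> 0 \<le> y n \<and> 0 \<le> D n) \<longrightarrow>
    (\<forall>n\<ge>3. 3 * D (Suc n) - D n + 2 * \<nu> * k * (y (Suc n) - y n)
      \<le> k\<^sup>2 * C * (1 + x (Suc n) * (1 + y n + y (n - 1))\<^sup>2)) \<longrightarrow>
    (\<forall>n\<ge>1. D n \<le> 2 * (x n + x (n - 1))) \<longrightarrow>
    (\<forall>n\<ge>N. y n \<le> Q)" if k: "k > 0" for k e :: real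
  proof -
    obtain N :: nat where N: "N \<ge> 1" and NB: "\<forall>E x.
      (\<forall>n\<ge>1. E (Suc n) + k * m * x (Suc n) \<le> E n + k * C) \<longrightarrow>
      (\<forall>n\<ge>1. x n \<le> E n \<and> E n \<le> 7 * (x n + x (n - 1))) \<longrightarrow> (\<forall>n. 0 \<le> x n) \<longrightarrow> E 1 \<le> e \<longrightarrow>
      (\<forall>n\<ge>N. E n \<le> B)" using eb k by blast
    \<comment> \<open>The least number of steps that covers unit time; for \<open>k < 1\<close>
      rounding up adds less than another unit.\<close>
    define L where "L = nat \<lceil>1 / k\<rceil>"
    show ?thesis
    proof (intro exI[of _ "N + L + 4"] conjI allI impI)
      show "N + L + 4 \<ge> 1" by simp
      fix E x y D :: "nat \<Rightarrow> real" and n :: nat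
      assume h1: "\<forall>n\<ge>1. E (Suc n) + k * \<nu> * y (Suc n) + k * m * x (Suc n) \<le> E n + k * C"
        and h2: "\<forall>n\<ge>1. x n \<le> E n \<and> E n \<le> 7 * (x n + x (n - 1))" and E1: "E 1 \<le> e"
        and nonneg: "\<forall>n. 0 \<le> x n \<and> 0 \<le> y n \<and> 0 \<le> D n"
        and h3: "\<forall>n\<ge>3. 3 * D (Suc n) - D n + 2 * \<nu> * k * (y (Suc n) - y n)
          \<le> k\<^sup>2 * C * (1 + x (Suc n) * (1 + y n + y (n - 1))\<^sup>2)"
        and h4: "\<forall>n\<ge>1. D n \<le> 2 * (x n + x (n - 1))" and n: "n \<ge> N + L + 4"
      have h1x: "\<forall>n\<ge>1. E (Suc n) + k * m * x (Suc n) \<le> E n + k * C"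
      proof (intro allI impI)
        fix i :: nat assume "i \<ge> 1"
        moreover have "0 \<le> k * \<nu> * y (Suc i)" using nonneg k assms by simp
        ultimately show "E (Suc i) + k * m * x (Suc i) \<le> E i + k * C" using h1 by fastforce
      qed
      have h1y: "E (Suc i) + k * \<nu> * y (Suc i) \<le> E i + k * C" if "i \<ge> 1" for i
      proof -
        have "0 \<le> k * m * x (Suc i)" using nonneg k assms by simp
        then show ?thesis using h1[rule_format, OF that] by linarith
      qed
      have EB: "E i \<le> B" if "i \<ge> N" for i using NB h1x h2 nonneg E1 that by blast
      have xE: "x i \<le> E i" if "i \<ge> N" for i using h2 N that by simp
      show "y n \<le> Q"
      proof (cases "k < 1")
        case True
        have "1 / k \<le> L" unfolding L_def by (rule real_nat_ceiling_ge)
        then have L1: "1 \<le> k * L" using k by (simp add: divide_le_eq mult.commute)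
        have "real L \<le> 1 / k + 1" unfolding L_def using k by (simp add: of_nat_ceiling)
        then have "k * L \<le> k * (1 / k + 1)" using k by (intro mult_left_mono) auto
        then have L2: "k * L \<le> 2" using k True by (simp add: distrib_left)
        have "y n \<le> B6 * exp (c * (2 + S1))"
        proof (rule window_bound[where E = E and x = x and y = y and D = D and L = L and N = N,
              OF assms(1,3) less_imp_le[OF B] k True L1 L2 _ N _ EB _ _ _ _ _ _ _
                B2_def B3_def S1_def B4_def B6_def c_def])
          show "x i \<le> B" if "i \<ge> N" for i using xE[OF that] EB[OF that] by simp
          show "0 \<le> E i" if "i \<ge> N" for i using xE[OF that] nonneg[rule_format, of i] by simp
        qed (use n h1y h3 h4 nonneg N in auto)
        then show ?thesis using Q by simp
      next
        case False
        \<comment> \<open>For \<open>k \<ge> 1\<close> the dissipation of the last step alone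
          suffices: it is at most \<open>B + k * C\<close>, hence at most
          \<open>k * (B + C)\<close>, and \<open>k\<close> cancels.\<close>
        define i where "i = n - 1"
        have i: "n = Suc i" "i \<ge> N" "i \<ge> 1" unfolding i_def using n N by auto
        have "E n \<ge> 0" using xE[of n] nonneg[rule_format, of n] i by simp
        then have "k * \<nu> * y n \<le> B + k * C" using h1y[OF i(3)] EB[OF i(2)] i by simp
        also have "\<dots> \<le> k * (B + C)" using False B by (simp add: distrib_left)
        finally have "k * (\<nu> * y n) \<le> k * (B + C)" by simp
        then have "\<nu> * y n \<le> B + C" using k by simp
        then have "y n \<le> B2" unfolding B2_def using assms by (simp add: pos_le_divide_eq mult.commute)
        then show ?thesis using Q by simp
      qed
    qed
  qed
  then show ?thesis using Q(1) by blast
qed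

subsection \<open>The scheme\<close>

lemma weak_pderiv_lin:
  assumes u: "u \<in> L2 Omega" "g \<in> L2 Omega" "weak_pderiv Omega i u g"
    and u': "u' \<in> L2 Omega" "g' \<in> L2 Omega" "weak_pderiv Omega i u' g'"
  shows "weak_pderiv Omega i (\<lambda>p. a * u p + b * u' p) (\<lambda>p. a * g p + b * g' p)"
  unfolding weak_pderiv_def
proof (intro allI impI)
  fix \<phi> assume t: "test_function Omega \<phi>"
  then have s: "smooth \<phi>" by (simp add: test_function_def)
  have lin: "(\<integral>p. (a * x p + b * y p) * v p \<partial>LO) = a * (\<integral>p. x p * v p \<partial>LO) + b * (\<integral>p. y p * v p \<partial>LO)"
    if "x \<in> L2 Omega" "y \<in> L2 Omega" "smooth v" for x y v
    using ip_add_left[OF L2_cmult[OF that(1), of a] L2_cmult[OF that(2), of b] smooth_L2[OF that(3)]]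
    by (simp add: ip_cmult_left ip_real[symmetric])
  show "(\<integral>p. (a * u p + b * u' p) * pd i \<phi> p \<partial>LO) = - (\<integral>p. (a * g p + b * g' p) * \<phi> p \<partial>LO)"
    unfolding lin[OF u(1) u'(1) smooth_pd[OF s]] lin[OF u(2) u'(2) s]
    using u(3) u'(3) t unfolding weak_pderiv_def by simp
qed

text \<open>Because \<open>wpd\<close> is a choice, it is linear only up to null sets; uniqueness of
  weak derivatives supplies that much.\<close>

lemma wpd_lin:
  assumes "u \<in> H1p" "u' \<in> H1p"
  shows "wpd i (\<lambda>p. a * u p + b * u' p) \<in> L2 Omega"
    and "AE p in LO. wpd i (\<lambda>p. a * u p + b * u' p) p = a * wpd i u p + b * wpd i u' p"
proof -
  note w = weak_pderiv_lin[OF H1p_L2(2)[OF assms(1)] H1p_wpd[OF assms(1), of i] H1p_L2(2)[OF assms(2)] H1p_wpd[OF assms(2), of i]]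
  have "(\<lambda>p. a * wpd i u p + b * wpd i u' p) \<in> L2 Omega"
    by (intro L2_add L2_cmult H1p_wpd(1) assms)
  from wpd_eq(1,3)[OF this w]
  show "wpd i (\<lambda>p. a * u p + b * u' p) \<in> L2 Omega"
    and "AE p in LO. wpd i (\<lambda>p. a * u p + b * u' p) p = a * wpd i u p + b * wpd i u' p" by auto
qed

lemma ip_gradH:
  assumes "u \<in> H1p" "v \<in> H1p"
  shows "ip (gradH u) (gradH v) = ip (wpd 1 u) (wpd 1 v) + ip (wpd 2 u) (wpd 2 v)"
proof -
  have "ip (gradH u) (gradH v) = (\<integral>p. wpd 1 u p * wpd 1 v p + wpd 2 u p * wpd 2 v p \<partial>LO)"
    unfolding ip_def gradH_def by (simp add: inner_vec_def sum_2)
  also have "\<dots> = ip (wpd 1 u) (wpd 1 v) + ip (wpd 2 u) (wpd 2 v)"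
    unfolding ip_real by (intro Bochner_Integration.integral_add L2_mult_integrable H1p_wpd assms)
  finally show ?thesis .
qed

lemma ip_grad:
  assumes "u \<in> H1p" "v \<in> H1p"
  shows "ip (grad u) (grad v) = (\<Sum>i\<in>UNIV. ip (wpd i u) (wpd i v))"
proof -
  have "ip (grad u) (grad v) = (\<integral>p. (\<Sum>i\<in>UNIV. wpd i u p * wpd i v p) \<partial>LO)"
    unfolding ip_def grad_def by (simp add: inner_vec_def)
  also have "\<dots> = (\<Sum>i\<in>UNIV. ip (wpd i u) (wpd i v))"
    unfolding ip_real by (intro Bochner_Integration.integral_sum L2_mult_integrable H1p_wpd assms)
  finally show ?thesis .
qed

lemma ip_grad_dirichlet: "u \<in> H1p \<Longrightarrow> ip (grad u) (grad u) = dirichlet (\<lambda>i. wpd i u)"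
  by (simp add: ip_grad dirichlet_def)

lemma H1p0_H1p: "u \<in> H1p0 \<Longrightarrow> u \<in> H1p" by (simp add: H1p0_def)

text \<open>Testing the elliptic problem with a basis function moves each derivative twice, from
  \<open>\<psi>\<close> to the basis function and back, which multiplies the coefficient by the
  squared frequency.\<close>

lemma stream_function_spectral:
  assumes "stream_function F w \<psi>"
  shows "spectral_stream F w \<psi>"
  unfolding spectral_stream_def
proof (intro allI impI)
  fix \<kappa> :: "int \<times> int \<times> nat"
  obtain j k l where \<kappa>: "\<kappa> = (j, k, l)" by (metis prod.exhaust)
  have p: "\<psi> \<in> H1p0" using assms by (simp add: stream_function_def)
  note pH = H1p0_H1p[OF p] and eH = H1p0_H1p[OF ebasis_H1p0]
  note c = has_grad_coefficients[OF has_grad_H1p0[OF p]]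
  have e: "ip (wpd i \<psi>) (wpd i (ebasis \<kappa>)) = ip (wpd i \<psi>) (pd i (ebasis \<kappa>))" for i
    by (rule ip_cong_AE)
      (rule L2_measurable H1p_wpd(1)[OF pH] wpd_smooth[OF smooth_ebasis] smooth_L2[OF smooth_pd[OF smooth_ebasis]] | simp)+
  have s: "ip u (\<lambda>p. c * v p) = c * ip u v" for c and u v :: "real^3 \<Rightarrow> real"
    using ip_cmult_left[of c v u] by (simp add: ip_commute[of u])
  have pe: "pd 1 (ebasis (j, k, l)) = (\<lambda>p. of_int j * ebasis (- j, k, l) p)"
    "pd 2 (ebasis (j, k, l)) = (\<lambda>p. of_int k * ebasis (j, - k, l) p)"
    "pd 3 (ebasis (j, k, l)) = (\<lambda>p. (real l * pi) * cbasis (j, k, l) p)"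
    by (rule ext, rule pd_ebasis)+
  have "ip w (ebasis \<kappa>) = ip (gradH \<psi>) (gradH (ebasis \<kappa>)) + F\<^sup>2 * ip (wpd 3 \<psi>) (wpd 3 (ebasis \<kappa>))"
    using assms ebasis_H1p0 by (simp add: stream_function_def)
  also have "\<dots> = ip (wpd 1 \<psi>) (pd 1 (ebasis \<kappa>)) + ip (wpd 2 \<psi>) (pd 2 (ebasis \<kappa>)) + F\<^sup>2 * ip (wpd 3 \<psi>) (pd 3 (ebasis \<kappa>))"
    unfolding ip_gradH[OF pH eH] e ..
  also have "\<dots> = stream_eigenvalue F \<kappa> * ip \<psi> (ebasis \<kappa>)"
    unfolding \<kappa> pe s c stream_eigenvalue_def by (simp add: power2_eq_square algebra_simps)
  finally show "ip w (ebasis \<kappa>) = stream_eigenvalue F \<kappa> * ip \<psi> (ebasis \<kappa>)" .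
qed

lemma spectral_stream_lin:
  assumes "spectral_stream F w \<psi>" "spectral_stream F w' \<psi>'"
    and L: "w \<in> L2 Omega" "w' \<in> L2 Omega" "\<psi> \<in> L2 Omega" "\<psi>' \<in> L2 Omega"
  shows "spectral_stream F (\<lambda>p. a * w p + b * w' p) (\<lambda>p. a * \<psi> p + b * \<psi>' p)"
  unfolding spectral_stream_def
proof (intro allI impI)
  fix \<kappa> :: "int \<times> int \<times> nat" assume l: "1 \<le> snd (snd \<kappa>)"
  have lin: "ip (\<lambda>p. a * x p + b * y p) v = a * ip x v + b * ip y v"
    if "x \<in> L2 Omega" "y \<in> L2 Omega" "smooth v" for x y v
    using ip_add_left[OF L2_cmult[OF that(1), of a] L2_cmult[OF that(2), of b] smooth_L2[OF that(3)]]
    by (simp add: ip_cmult_left)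
  show "ip (\<lambda>p. a * w p + b * w' p) (ebasis \<kappa>) = stream_eigenvalue F \<kappa> * ip (\<lambda>p. a * \<psi> p + b * \<psi>' p) (ebasis \<kappa>)"
    unfolding lin[OF L(1,2) smooth_ebasis] lin[OF L(3,4) smooth_ebasis]
      assms(1)[unfolded spectral_stream_def, rule_format, OF l] assms(2)[unfolded spectral_stream_def, rule_format, OF l]
    by (simp add: algebra_simps)
qed

text \<open>Stated for a difference of two values because the scheme is tested separately with two
  consecutive iterates and the results are subtracted. Their difference is handled through
  \<open>has_grad\<close>, so no closure of \<open>H1p0\<close> under subtraction is
  involved.\<close>

lemma advection_difference_bound:
  assumes F: "F > 0"
  shows "\<exists>C\<ge>0. \<forall>\<beta> \<omega> \<psi> n \<phi> \<phi>'. n \<ge> 1 \<and> \<omega> n \<in> H1p0 \<and> \<omega> (n - 1) \<in> H1p0 \<and>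
    (\<forall>i. stream_function F (\<omega> i) (\<psi> i)) \<and> \<phi> \<in> H1p0 \<and> \<phi>' \<in> H1p0 \<longrightarrow>
    \<bar>advection \<beta> (extrap \<psi> n) (extrap \<omega> n) \<phi> - advection \<beta> (extrap \<psi> n) (extrap \<omega> n) \<phi>'\<bar>
      \<le> C * (1 + \<bar>\<beta>\<bar>) * (1 + ip (grad (\<omega> n)) (grad (\<omega> n)) + ip (grad (\<omega> (n - 1))) (grad (\<omega> (n - 1))))
         * L2norm (\<lambda>p. \<phi> p - \<phi>' p)"
proof -
  obtain C where C: "C \<ge> 0" and J: "\<forall>\<omega> g \<psi> h \<phi> k. has_grad \<omega> g \<and> has_grad \<psi> h \<and> spectral_stream F \<omega> \<psi> \<and> has_grad \<phi> k \<longrightarrow>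
    integrable LO (\<lambda>p. h 2 p * \<omega> p * k 1 p) \<and> integrable LO (\<lambda>p. h 1 p * \<omega> p * k 2 p) \<and>
    \<bar>(\<integral>p. h 2 p * \<omega> p * k 1 p \<partial>LO) - (\<integral>p. h 1 p * \<omega> p * k 2 p \<partial>LO)\<bar> \<le> C * dirichlet g * L2norm \<phi> \<and>
    \<bar>ip (h 1) \<phi>\<bar> \<le> C * sqrt (dirichlet g) * L2norm \<phi>"
    using jacobian_bound[OF F] by blast
  have "\<bar>advection \<beta> (extrap \<psi> n) (extrap \<omega> n) \<phi> - advection \<beta> (extrap \<psi> n) (extrap \<omega> n) \<phi>'\<bar>
      \<le> (16 * C) * (1 + \<bar>\<beta>\<bar>) * (1 + ip (grad (\<omega> n)) (grad (\<omega> n)) + ip (grad (\<omega> (n - 1))) (grad (\<omega> (n - 1))))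
         * L2norm (\<lambda>p. \<phi> p - \<phi>' p)"
    if n: "n \<ge> 1" and w: "\<omega> n \<in> H1p0" "\<omega> (n - 1) \<in> H1p0" and S: "\<And>i. stream_function F (\<omega> i) (\<psi> i)"
      and f: "\<phi> \<in> H1p0" "\<phi>' \<in> H1p0" for \<beta> \<omega> \<psi> n \<phi> \<phi>'
  proof -
    define W where "W = extrap \<omega> n"
    define P where "P = extrap \<psi> n"
    \<comment> \<open>These combinations of chosen derivatives serve as gradients of the
      extrapolated fields; \<open>advection\<close> itself refers to \<open>wpd\<close> of the
      extrapolation, which agrees with \<open>h\<close> almost everywhere.\<close>
    define g h where "g i p = 2 * wpd i (\<omega> n) p + (- 1) * wpd i (\<omega> (n - 1)) p"
      and "h i p = 2 * wpd i (\<psi> n) p + (- 1) * wpd i (\<psi> (n - 1)) p" for i p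
    have We: "W = (\<lambda>p. 2 * \<omega> n p + (- 1) * \<omega> (n - 1) p)" and Pe: "P = (\<lambda>p. 2 * \<psi> n p + (- 1) * \<psi> (n - 1) p)"
      by (auto simp: W_def P_def extrap_def)
    have p: "\<psi> i \<in> H1p0" for i using S by (simp add: stream_function_def)
    have FW: "has_grad W g" unfolding We g_def by (rule has_grad_lin[OF has_grad_H1p0[OF w(1)] has_grad_H1p0[OF w(2)]])
    have FP: "has_grad P h" unfolding Pe h_def by (rule has_grad_lin[OF has_grad_H1p0[OF p] has_grad_H1p0[OF p]])
    have SS: "spectral_stream F W P" unfolding We Pe
      by (intro spectral_stream_lin stream_function_spectral S H1p_L2(2) H1p0_H1p p w)
    have hw: "wpd i P \<in> L2 Omega" "AE q in LO. wpd i P q = h i q" for i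
      unfolding Pe h_def by (rule wpd_lin[OF H1p0_H1p[OF p] H1p0_H1p[OF p]])+
    define T where "T k = (\<integral>q. h 2 q * W q * k 1 q \<partial>LO) - (\<integral>q. h 1 q * W q * k 2 q \<partial>LO)" for k :: "3 \<Rightarrow> real^3 \<Rightarrow> real"
    have adv: "advection \<beta> P W \<theta> = - T (\<lambda>i. wpd i \<theta>) + \<beta> * ip (h 1) \<theta>" if t: "\<theta> \<in> H1p0" for \<theta>
    proof -
      have Ft: "has_grad \<theta> (\<lambda>i. wpd i \<theta>)" by (rule has_grad_H1p0[OF t])
      have i: "integrable LO (\<lambda>q. h 2 q * W q * wpd 1 \<theta> q)" "integrable LO (\<lambda>q. h 1 q * W q * wpd 2 \<theta> q)"
        using J[rule_format, of W g P h \<theta> "\<lambda>i. wpd i \<theta>"] FW FP SS Ft by blast+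
      note m = L2_measurable[OF has_gradD(1)[OF FW]] L2_measurable[OF has_gradD(2)[OF Ft]] L2_measurable[OF hw(1)] L2_measurable[OF has_gradD(2)[OF FP]]
      have "ip (\<lambda>q. W q *\<^sub>R gradH_perp P q) (gradH \<theta>)
        = (\<integral>q. wpd 2 P q * W q * wpd 1 \<theta> q - wpd 1 P q * W q * wpd 2 \<theta> q \<partial>LO)"
        unfolding ip_def gradH_def gradH_perp_def by (simp add: inner_vec_def sum_2 algebra_simps)
      also have "\<dots> = (\<integral>q. h 2 q * W q * wpd 1 \<theta> q - h 1 q * W q * wpd 2 \<theta> q \<partial>LO)"
      proof (rule integral_cong_AE)
        show "AE q in LO. wpd 2 P q * W q * wpd 1 \<theta> q - wpd 1 P q * W q * wpd 2 \<theta> q =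
          h 2 q * W q * wpd 1 \<theta> q - h 1 q * W q * wpd 2 \<theta> q"
          using hw(2)[of 1] hw(2)[of 2] by eventually_elim simp
      qed (intro borel_measurable_diff borel_measurable_times m)+
      also have "\<dots> = T (\<lambda>i. wpd i \<theta>)" unfolding T_def by (rule Bochner_Integration.integral_diff[OF i])
      finally have 1: "divH (\<lambda>q. W q *\<^sub>R gradH_perp P q) \<theta> = - T (\<lambda>i. wpd i \<theta>)" by (simp add: divH_def)
      have 2: "ip (wpd 1 P) \<theta> = ip (h 1) \<theta>"
        by (rule ip_cong_AE[OF m(3) L2_measurable[OF has_gradD(1)[OF Ft]] m(4) L2_measurable[OF has_gradD(1)[OF Ft]] hw(2)]) simp
      show ?thesis by (simp add: advection_def 1 2)
    qed
    define \<delta> where "\<delta> p = \<phi> p - \<phi>' p" for p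
    define k where "k i p = 1 * wpd i \<phi> p + (- 1) * wpd i \<phi>' p" for i p
    have Fd: "has_grad \<delta> k" using has_grad_lin[OF has_grad_H1p0[OF f(1)] has_grad_H1p0[OF f(2)], of 1 "- 1"]
      unfolding k_def by (simp add: \<delta>_def[abs_def])
    have Td: "T (\<lambda>i. wpd i \<phi>) - T (\<lambda>i. wpd i \<phi>') = T k"
    proof -
      have i: "integrable LO (\<lambda>q. h 2 q * W q * wpd 1 \<theta> q)" "integrable LO (\<lambda>q. h 1 q * W q * wpd 2 \<theta> q)" if "\<theta> \<in> H1p0" for \<theta>
        using J[rule_format, of W g P h \<theta> "\<lambda>i. wpd i \<theta>"] FW FP SS has_grad_H1p0[OF that] by blast+
      have "(\<integral>q. h 2 q * W q * k 1 q \<partial>LO) = (\<integral>q. h 2 q * W q * wpd 1 \<phi> q \<partial>LO) - (\<integral>q. h 2 q * W q * wpd 1 \<phi>' q \<partial>LO)"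
        unfolding k_def by (subst Bochner_Integration.integral_diff[OF i(1)[OF f(1)] i(1)[OF f(2)], symmetric]) (simp add: algebra_simps)
      moreover have "(\<integral>q. h 1 q * W q * k 2 q \<partial>LO) = (\<integral>q. h 1 q * W q * wpd 2 \<phi> q \<partial>LO) - (\<integral>q. h 1 q * W q * wpd 2 \<phi>' q \<partial>LO)"
        unfolding k_def by (subst Bochner_Integration.integral_diff[OF i(2)[OF f(1)] i(2)[OF f(2)], symmetric]) (simp add: algebra_simps)
      ultimately show ?thesis unfolding T_def by simp
    qed
    have hd: "ip (h 1) \<phi> - ip (h 1) \<phi>' = ip (h 1) \<delta>"
      using ip_diff_left[OF H1p_L2(2)[OF H1p0_H1p[OF f(1)]] H1p_L2(2)[OF H1p0_H1p[OF f(2)]] has_gradD(2)[OF FP, of 1]]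
      unfolding \<delta>_def by (simp add: ip_commute[of "h 1"])
    have b: "\<bar>T k\<bar> \<le> C * dirichlet g * L2norm \<delta>" "\<bar>ip (h 1) \<delta>\<bar> \<le> C * sqrt (dirichlet g) * L2norm \<delta>"
      using J[rule_format, of W g P h \<delta> k] FW FP SS Fd unfolding T_def by blast+
    define s where "s = 1 + ip (grad (\<omega> n)) (grad (\<omega> n)) + ip (grad (\<omega> (n - 1))) (grad (\<omega> (n - 1)))"
    \<comment> \<open>In each component \<open>(2 a - b)^2\<close> is at most
      \<open>8 a^2 + 2 b^2\<close>.\<close>
    have D: "dirichlet g \<le> 8 * s"
    proof -
      have "ip (g i) (g i) \<le> 8 * ip (wpd i (\<omega> n)) (wpd i (\<omega> n)) + 2 * ip (wpd i (\<omega> (n - 1))) (wpd i (\<omega> (n - 1)))" for i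
      proof -
        note L = H1p_wpd(1)[OF H1p0_H1p[OF w(1)], of i] H1p_wpd(1)[OF H1p0_H1p[OF w(2)], of i]
        have "ip (g i) (g i) \<le> 2 * ip (\<lambda>p. 2 * wpd i (\<omega> n) p) (\<lambda>p. 2 * wpd i (\<omega> n) p)
          + 2 * ip (\<lambda>p. (- 1) * wpd i (\<omega> (n - 1)) p) (\<lambda>p. (- 1) * wpd i (\<omega> (n - 1)) p)"
          unfolding g_def by (intro ip_add_bound L2_cmult L)
        then show ?thesis
          unfolding ip_cmult_left ip_commute[of "wpd i (\<omega> n)" "\<lambda>p. 2 * wpd i (\<omega> n) p"]
            ip_commute[of "wpd i (\<omega> (n - 1))" "\<lambda>p. (- 1) * wpd i (\<omega> (n - 1)) p"] by simp
      qed
      then have "dirichlet g \<le> (\<Sum>i\<in>UNIV. 8 * ip (wpd i (\<omega> n)) (wpd i (\<omega> n)) + 2 * ip (wpd i (\<omega> (n - 1))) (wpd i (\<omega> (n - 1))))"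
        unfolding dirichlet_def by (intro sum_mono)
      also have "\<dots> = 8 * ip (grad (\<omega> n)) (grad (\<omega> n)) + 2 * ip (grad (\<omega> (n - 1))) (grad (\<omega> (n - 1)))"
        using w by (simp add: ip_grad H1p0_H1p sum.distrib sum_distrib_left)
      also have "\<dots> \<le> 8 * s" unfolding s_def using ip_nonneg[of "grad (\<omega> (n - 1))"] by simp
      finally show ?thesis .
    qed
    have s1: "s \<ge> 1" unfolding s_def using ip_nonneg[of "grad (\<omega> n)"] ip_nonneg[of "grad (\<omega> (n - 1))"] by simp
    \<comment> \<open>As \<open>8 * s\<close> is at least 1, its root is below it, and the zonal
      term, which is linear in the gradient, joins the quadratic bound.\<close>
    have sq: "sqrt (dirichlet g) \<le> 8 * s"
    proof -
      have "dirichlet g \<le> (8 * s)\<^sup>2" using D s1 self_le_power[of "8 * s" 2] by simp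
      then show ?thesis using s1 dirichlet_nonneg[of g] by (intro real_le_lsqrt) auto
    qed
    have "\<bar>advection \<beta> P W \<phi> - advection \<beta> P W \<phi>'\<bar> = \<bar>- T k + \<beta> * ip (h 1) \<delta>\<bar>"
      unfolding adv[OF f(1)] adv[OF f(2)] using Td hd by (simp add: algebra_simps)
    also have "\<dots> \<le> \<bar>T k\<bar> + \<bar>\<beta>\<bar> * \<bar>ip (h 1) \<delta>\<bar>"
      using abs_triangle_ineq[of "- T k" "\<beta> * ip (h 1) \<delta>"] by (simp add: abs_mult)
    also have "\<dots> \<le> C * (8 * s) * L2norm \<delta> + \<bar>\<beta>\<bar> * (C * (8 * s) * L2norm \<delta>)"
    proof (intro add_mono mult_left_mono)
      show "\<bar>T k\<bar> \<le> C * (8 * s) * L2norm \<delta>"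
        using b(1) mult_right_mono[OF mult_left_mono[OF D C] L2norm_nonneg[of \<delta>]] by linarith
      show "\<bar>ip (h 1) \<delta>\<bar> \<le> C * (8 * s) * L2norm \<delta>"
        using b(2) mult_right_mono[OF mult_left_mono[OF sq C] L2norm_nonneg[of \<delta>]] by linarith
    qed simp
    also have "\<dots> = (8 * C) * (1 + \<bar>\<beta>\<bar>) * s * L2norm \<delta>" by (simp add: algebra_simps)
    also have "\<dots> \<le> (16 * C) * (1 + \<bar>\<beta>\<bar>) * s * L2norm \<delta>"
      using C s1 by (intro mult_right_mono L2norm_nonneg) auto
    finally show ?thesis unfolding W_def P_def s_def \<delta>_def .
  qed
  moreover have "16 * C \<ge> 0" using C by simp
  ultimately show ?thesis by blast
qed

lemma ip_bdf2:
  assumes "\<And>m. \<omega> m \<in> L2 Omega" "v \<in> L2 Omega"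
  shows "ip (\<lambda>p. bdf2 k (\<lambda>m. \<omega> m p) n) v = (3 * ip (\<omega> (n + 1)) v - 4 * ip (\<omega> n) v + ip (\<omega> (n - 1)) v) / (2 * k)"
proof -
  have e: "(\<lambda>p. bdf2 k (\<lambda>m. \<omega> m p) n) = (\<lambda>p. (1 / (2 * k)) * ((3 * \<omega> (n + 1) p - 4 * \<omega> n p) + \<omega> (n - 1) p))"
    by (auto simp: bdf2_def)
  have "ip (\<lambda>p. (3 * \<omega> (n + 1) p - 4 * \<omega> n p) + \<omega> (n - 1) p) v
    = ip (\<lambda>p. 3 * \<omega> (n + 1) p - 4 * \<omega> n p) v + ip (\<omega> (n - 1)) v"
    by (intro ip_add_left L2_diff L2_cmult assms)
  moreover have "ip (\<lambda>p. 3 * \<omega> (n + 1) p - 4 * \<omega> n p) v = ip (\<lambda>p. 3 * \<omega> (n + 1) p) v - ip (\<lambda>p. 4 * \<omega> n p) v"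
    by (intro ip_diff_left L2_cmult assms)
  ultimately show ?thesis unfolding e ip_cmult_left by simp
qed

text \<open>Up to the factor 4 this is the \<open>G\<close>-norm of two consecutive iterates.\<close>

definition Gform :: "real \<Rightarrow> real \<Rightarrow> real \<Rightarrow> real" where
  "Gform aa ab bb = 5 * aa - 4 * ab + bb"

lemma ip_grad_le:
  assumes "u \<in> H1p" "v \<in> H1p"
  shows "2 * \<bar>ip (grad u) (grad v)\<bar> \<le> ip (grad u) (grad u) + ip (grad v) (grad v)"
proof -
  have "2 * \<bar>ip (wpd i u) (wpd i v)\<bar> \<le> ip (wpd i u) (wpd i u) + ip (wpd i v) (wpd i v)" for i
    using ip_square_diff[OF H1p_wpd(1)[OF assms(1), of i] H1p_wpd(1)[OF assms(2), of i]]
      ip_square_add[OF H1p_wpd(1)[OF assms(1), of i] H1p_wpd(1)[OF assms(2), of i], of 1]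
      ip_nonneg[of "\<lambda>p. wpd i u p - wpd i v p"] ip_nonneg[of "\<lambda>p. wpd i u p + 1 * wpd i v p"] by simp
  then have "(\<Sum>i\<in>UNIV. 2 * \<bar>ip (wpd i u) (wpd i v)\<bar>) \<le> (\<Sum>i\<in>UNIV. ip (wpd i u) (wpd i u) + ip (wpd i v) (wpd i v))"
    by (intro sum_mono)
  moreover have "\<bar>\<Sum>i\<in>UNIV. ip (wpd i u) (wpd i v)\<bar> \<le> (\<Sum>i\<in>UNIV. \<bar>ip (wpd i u) (wpd i v)\<bar>)" by (rule sum_abs)
  ultimately show ?thesis
    unfolding ip_grad[OF assms] ip_grad[OF assms(1,1)] ip_grad[OF assms(2,2)] sum.distrib sum_distrib_left[symmetric]
    by linarith
qed

lemma Hp_L2: "w \<in> Hp s \<Longrightarrow> w \<in> L2 Omega"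
proof -
  assume "w \<in> Hp s"
  then have "w \<in> Hfrac s (slab 16)" by (simp add: Hp_def)
  then have "w \<in> L2 (slab 16)" by (simp add: Hfrac_def)
  then show ?thesis by (rule L2_subset[OF _ Omega_subset_slab open_Omega open_slab])
qed

theorem theorem4p2:
  fixes \<nu> \<gamma> F \<beta> \<alpha> :: real and f :: "real^3 \<Rightarrow> real"
  assumes "\<nu> > 0" and "\<gamma> > 0" and "F > 0"
    and "f \<in> L2 Omega"
    and "1 / 4 \<le> \<alpha>" and "\<alpha> < 1"
  shows "\<exists>M\<^sub>g>0. \<forall>k>0. \<forall>\<omega>\<^sub>0 \<in> Hp \<alpha>. \<forall>\<omega>\<^sub>1 \<in> Hp \<alpha>. \<forall>q\<^sub>0 q\<^sub>1 :: real.
           \<exists>N\<^sub>1\<ge>1. \<forall>\<omega> \<psi> q.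
             mr_SAV_BDF2 \<nu> \<gamma> F \<beta> f k \<omega> \<psi> q
             \<and> \<omega> 0 = \<omega>\<^sub>0 \<and> \<omega> 1 = \<omega>\<^sub>1 \<and> q 0 = q\<^sub>0 \<and> q 1 = q\<^sub>1 \<longrightarrow>
             (\<forall>n\<ge>N\<^sub>1. Gnorm_sq (grad (\<omega> n)) (grad (\<omega> (n - 1)))
                        \<le> M\<^sub>g * ((R0 \<nu> \<gamma> f) ^ 18 + (L2norm f)\<^sup>2 + 1))"
proof -
  obtain C0 where C0: "C0 \<ge> 0" and adv: "\<forall>\<beta> \<omega> \<psi> n \<phi> \<phi>'. n \<ge> 1 \<and> \<omega> n \<in> H1p0 \<and> \<omega> (n - 1) \<in> H1p0 \<and>
    (\<forall>i. stream_function F (\<omega> i) (\<psi> i)) \<and> \<phi> \<in> H1p0 \<and> \<phi>' \<in> H1p0 \<longrightarrow>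
    \<bar>advection \<beta> (extrap \<psi> n) (extrap \<omega> n) \<phi> - advection \<beta> (extrap \<psi> n) (extrap \<omega> n) \<phi>'\<bar>
      \<le> C0 * (1 + \<bar>\<beta>\<bar>) * (1 + ip (grad (\<omega> n)) (grad (\<omega> n)) + ip (grad (\<omega> (n - 1))) (grad (\<omega> (n - 1))))
         * L2norm (\<lambda>p. \<phi> p - \<phi>' p)"
    using advection_difference_bound[OF assms(3)] by blast
  define M where "M = C0 * (1 + \<bar>\<beta>\<bar>)"
  define m where "m = min \<nu> (2 * \<gamma>)"
  \<comment> \<open>The first two summands are the sources in the energy inequality, the last one is
    that of the inequality for the increments.\<close>
  define C where "C = 2 * ip f f / \<nu> + 2 * \<gamma> + 4 * (ip f f + M\<^sup>2)"
  have M: "M \<ge> 0" unfolding M_def using C0 by simp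
  have m: "m > 0" "m \<le> \<nu>" "m \<le> 2 * \<gamma>" unfolding m_def using assms by auto
  have ff: "ip f f \<ge> 0" by (rule ip_nonneg)
  have C: "C \<ge> 0" "2 * ip f f / \<nu> + 2 * \<gamma> \<le> C" "4 * (ip f f + M\<^sup>2) \<le> C"
    unfolding C_def using ff assms(1,2) by auto
  obtain B where B: "B > 0" and grad: "\<forall>k>0. \<forall>e. \<exists>N::nat\<ge>1. \<forall>E x y D.
    (\<forall>n\<ge>1. E (Suc n) + k * \<nu> * y (Suc n) + k * m * x (Suc n) \<le> E n + k * C) \<longrightarrow>
    (\<forall>n\<ge>1. x n \<le> E n \<and> E n \<le> 7 * (x n + x (n - 1))) \<longrightarrow> E 1 \<le> e \<longrightarrow>
    (\<forall>n. 0 \<le> x n \<and> 0 \<le> y n \<and> 0 \<le> D n) \<longrightarrow>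
    (\<forall>n\<ge>3. 3 * D (Suc n) - D n + 2 * \<nu> * k * (y (Suc n) - y n)
      \<le> k\<^sup>2 * C * (1 + x (Suc n) * (1 + y n + y (n - 1))\<^sup>2)) \<longrightarrow>
    (\<forall>n\<ge>1. D n \<le> 2 * (x n + x (n - 1))) \<longrightarrow>
    (\<forall>n\<ge>N. y n \<le> B)" using eventual_gradient_bound[OF assms(1) m(1) C(1)] by blast
  show ?thesis
  proof (intro exI[of _ "3 * B"] conjI allI impI ballI)
    show "3 * B > 0" using B by simp
    fix k :: real and \<omega>\<^sub>0 \<omega>\<^sub>1 and q\<^sub>0 q\<^sub>1 :: real
    assume k: "k > 0" and w0: "\<omega>\<^sub>0 \<in> Hp \<alpha>" and w1: "\<omega>\<^sub>1 \<in> Hp \<alpha>"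
    \<comment> \<open>This is \<open>E 1\<close> expressed by the data alone, so that
      \<open>N\<close> is fixed before any solution is considered.\<close>
    define e where "e = Gform (ip \<omega>\<^sub>1 \<omega>\<^sub>1) (ip \<omega>\<^sub>1 \<omega>\<^sub>0) (ip \<omega>\<^sub>0 \<omega>\<^sub>0) + Gform (q\<^sub>1 * q\<^sub>1) (q\<^sub>1 * q\<^sub>0) (q\<^sub>0 * q\<^sub>0)"
    obtain N :: nat where N: "N \<ge> 1" and NB: "\<forall>E x y D.
      (\<forall>n\<ge>1. E (Suc n) + k * \<nu> * y (Suc n) + k * m * x (Suc n) \<le> E n + k * C) \<longrightarrow>
      (\<forall>n\<ge>1. x n \<le> E n \<and> E n \<le> 7 * (x n + x (n - 1))) \<longrightarrow> E 1 \<le> e \<longrightarrow>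
      (\<forall>n. 0 \<le> x n \<and> 0 \<le> y n \<and> 0 \<le> D n) \<longrightarrow>
      (\<forall>n\<ge>3. 3 * D (Suc n) - D n + 2 * \<nu> * k * (y (Suc n) - y n)
        \<le> k\<^sup>2 * C * (1 + x (Suc n) * (1 + y n + y (n - 1))\<^sup>2)) \<longrightarrow>
      (\<forall>n\<ge>1. D n \<le> 2 * (x n + x (n - 1))) \<longrightarrow>
      (\<forall>n\<ge>N. y n \<le> B)" using grad k by blast
    show "\<exists>N\<^sub>1\<ge>1. \<forall>\<omega> \<psi> q. mr_SAV_BDF2 \<nu> \<gamma> F \<beta> f k \<omega> \<psi> q
             \<and> \<omega> 0 = \<omega>\<^sub>0 \<and> \<omega> 1 = \<omega>\<^sub>1 \<and> q 0 = q\<^sub>0 \<and> q 1 = q\<^sub>1 \<longrightarrow>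
             (\<forall>n\<ge>N\<^sub>1. Gnorm_sq (grad (\<omega> n)) (grad (\<omega> (n - 1)))
                        \<le> 3 * B * ((R0 \<nu> \<gamma> f) ^ 18 + (L2norm f)\<^sup>2 + 1))"
    proof (intro exI[of _ "N + 3"] conjI allI impI)
      show "N + 3 \<ge> 1" by simp
      fix \<omega> \<psi> q n
      assume "mr_SAV_BDF2 \<nu> \<gamma> F \<beta> f k \<omega> \<psi> q
             \<and> \<omega> 0 = \<omega>\<^sub>0 \<and> \<omega> 1 = \<omega>\<^sub>1 \<and> q 0 = q\<^sub>0 \<and> q 1 = q\<^sub>1" and n: "n \<ge> N + 3"
      then have sch: "mr_SAV_BDF2 \<nu> \<gamma> F \<beta> f k \<omega> \<psi> q" and init: "\<omega> 0 = \<omega>\<^sub>0" "\<omega> 1 = \<omega>\<^sub>1" "q 0 = q\<^sub>0" "q 1 = q\<^sub>1"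
        by auto
      define A where "A n = advection \<beta> (extrap \<psi> n) (extrap \<omega> n)" for n
      have st: "stream_function F (\<omega> i) (\<psi> i)" for i using sch unfolding mr_SAV_BDF2_def by blast
      have eqw: "ip (\<lambda>p. bdf2 k (\<lambda>m. \<omega> m p) n) \<phi> + \<nu> * ip (grad (\<omega> (n + 1))) (grad \<phi>) + q (n + 1) * A n \<phi> = ip f \<phi>"
        and eqq: "bdf2 k q n + \<gamma> * q (n + 1) - A n (\<omega> (n + 1)) = \<gamma>"
        and reg: "\<omega> (n + 1) \<in> H1p0" if "n \<ge> 1" "\<phi> \<in> H1p0" for n \<phi>
        using sch that unfolding mr_SAV_BDF2_def A_def by blast+
      \<comment> \<open>The basis function merely provides an element of \<open>H1p0\<close> for the
        premise of \<open>reg\<close>. The initial levels 0 and 1 are excluded, since they are given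
        only in \<open>Hp \<alpha>\<close>.\<close>
      have H: "\<omega> n \<in> H1p0" if "n \<ge> 2" for n
        using reg[of "n - 1" "ebasis (0, 0, 1)"] ebasis_H1p0 that by simp
      have L: "\<omega> n \<in> L2 Omega" for n
      proof (cases "n \<ge> 2")
        case True
        then show ?thesis using H1p_L2(2)[OF H1p0_H1p[OF H]] by blast
      next
        case False
        then have "n = 0 \<or> n = 1" by linarith
        then show ?thesis using Hp_L2[OF w0] Hp_L2[OF w1] init by auto
      qed
      define x where "x n = ip (\<omega> n) (\<omega> n) + q n * q n" for n
      define y where "y n = ip (grad (\<omega> n)) (grad (\<omega> n))" for n
      define D where "D n = ip (\<lambda>p. \<omega> n p - \<omega> (n - 1) p) (\<lambda>p. \<omega> n p - \<omega> (n - 1) p)" for n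
      define E where "E n = Gform (ip (\<omega> n) (\<omega> n)) (ip (\<omega> n) (\<omega> (n - 1))) (ip (\<omega> (n - 1)) (\<omega> (n - 1)))
        + Gform (q n * q n) (q n * q (n - 1)) (q (n - 1) * q (n - 1))" for n
      have nonneg: "0 \<le> x n \<and> 0 \<le> y n \<and> 0 \<le> D n" for n
        unfolding x_def y_def D_def by (simp add: ip_nonneg)
      have poin: "ip (\<omega> n) (\<omega> n) \<le> y n" if "n \<ge> 2" for n
        using Poincare[OF has_grad_H1p0[OF H[OF that]]] dirichlet_ge[of "\<lambda>i. wpd i (\<omega> n)" 3] ip_grad_dirichlet[OF H1p0_H1p[OF H[OF that]]]
        unfolding y_def by simp
      have pos: "0 \<le> a * a" for a :: real by simp
      have h1: "\<forall>n\<ge>1. E (Suc n) + k * \<nu> * y (Suc n) + k * m * x (Suc n) \<le> E n + k * C"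
      proof (intro allI impI)
        fix n :: nat assume n: "1 \<le> n"
        define a b c where "a = \<omega> (n + 1)" and "b = \<omega> n" and "c = \<omega> (n - 1)"
        define r s t where "r = q (n + 1)" and "s = q n" and "t = q (n - 1)"
        have aL: "a \<in> L2 Omega" "b \<in> L2 Omega" "c \<in> L2 Omega" unfolding a_def b_def c_def by (rule L)+
        have aH: "a \<in> H1p0" unfolding a_def using H n by simp
        have w: "(3 * ip a a - 4 * ip b a + ip c a) / (2 * k) + \<nu> * y (n + 1) + r * A n a = ip f a"
          using eqw[OF n aH] ip_bdf2[where \<omega> = \<omega> and v = a and k = k and n = n, OF L aL(1)] unfolding a_def b_def c_def r_def y_def by simp
        have qe: "(3 * r - 4 * s + t) / (2 * k) + \<gamma> * r - A n a = \<gamma>"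
          using eqq[OF n aH] unfolding bdf2_def r_def s_def t_def a_def .
        \<comment> \<open>The squared norm of the second difference \<open>a - 2 b + c\<close>. It
          is exactly the amount by which the tested two-step quotient exceeds the increment of the
          \<open>G\<close>-form.\<close>
        have sqp: "0 \<le> ip a a + 4 * ip b b + ip c c - 4 * ip a b + 2 * ip a c - 4 * ip b c"
        proof -
          have "0 \<le> ip (\<lambda>p. (a p + (- 2) * b p) + 1 * c p) (\<lambda>p. (a p + (- 2) * b p) + 1 * c p)" by (rule ip_nonneg)
          also have "\<dots> = ip (\<lambda>p. a p + (- 2) * b p) (\<lambda>p. a p + (- 2) * b p) + 2 * 1 * ip (\<lambda>p. a p + (- 2) * b p) c + 1\<^sup>2 * ip c c"
            by (rule ip_square_add[OF L2_add[OF aL(1) L2_cmult[OF aL(2)]] aL(3)])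
          also have "ip (\<lambda>p. a p + (- 2) * b p) c = ip a c + ip (\<lambda>p. (- 2) * b p) c"
            by (rule ip_add_left[OF aL(1) L2_cmult[OF aL(2)] aL(3)])
          also have "ip (\<lambda>p. (- 2) * b p) c = (- 2) * ip b c" by (rule ip_cmult_left)
          also have "ip (\<lambda>p. a p + (- 2) * b p) (\<lambda>p. a p + (- 2) * b p) = ip a a + 2 * (- 2) * ip a b + (- 2)\<^sup>2 * ip b b"
            by (rule ip_square_add[OF aL(1,2)])
          finally show ?thesis by simp
        qed
        have sqq: "0 \<le> r * r + 4 * (s * s) + t * t - 4 * (r * s) + 2 * (r * t) - 4 * (s * t)"
          using pos[of "r - 2 * s + t"] by (simp add: algebra_simps)
        have w4: "2 * (3 * ip a a - 4 * ip b a + ip c a) = 4 * k * (ip f a - \<nu> * y (n + 1) - r * A n a)"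
          using w k by (simp add: field_simps)
        have q4: "2 * (3 * r - 4 * s + t) * r = 4 * k * (\<gamma> - \<gamma> * r + A n a) * r"
        proof -
          have "2 * (3 * r - 4 * s + t) = 4 * k * (\<gamma> - \<gamma> * r + A n a)" using qe k by (simp add: field_simps)
          then show ?thesis by simp
        qed
        have "E (Suc n) - E n \<le> 2 * (3 * ip a a - 4 * ip b a + ip c a) + 2 * (3 * r - 4 * s + t) * r"
        proof -
          have "E (Suc n) = Gform (ip a a) (ip a b) (ip b b) + Gform (r * r) (r * s) (s * s)"
            "E n = Gform (ip b b) (ip b c) (ip c c) + Gform (s * s) (s * t) (t * t)"
            unfolding E_def a_def b_def c_def r_def s_def t_def by simp_all
          moreover have "ip b a = ip a b" "ip c a = ip a c" by (rule ip_commute)+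
          ultimately show ?thesis using sqp sqq unfolding Gform_def by (simp add: algebra_simps)
        qed
        also have "\<dots> = 4 * k * (ip f a - \<nu> * y (n + 1) + \<gamma> * r - \<gamma> * (r * r))"
          unfolding w4 q4 by (simp add: algebra_simps)
        \<comment> \<open>Young's inequality with weights \<open>\<nu>\<close> and
          \<open>\<gamma>\<close>, followed by the Poincare inequality, spends half of each
          dissipation on the sources.\<close>
        also have "\<dots> \<le> 4 * k * ((ip f f / (2 * \<nu>) + (\<nu> / 2) * y (n + 1)) - \<nu> * y (n + 1) + (\<gamma> / 2 + (\<gamma> / 2) * (r * r)) - \<gamma> * (r * r))"
        proof -
          have "0 \<le> ip (\<lambda>p. f p + (- \<nu>) * a p) (\<lambda>p. f p + (- \<nu>) * a p)" by (rule ip_nonneg)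
          then have "2 * \<nu> * ip f a \<le> ip f f + \<nu>\<^sup>2 * ip a a"
            unfolding ip_square_add[OF assms(4) aL(1)] by simp
          also have "\<dots> \<le> ip f f + \<nu>\<^sup>2 * y (n + 1)"
            using poin[of "n + 1"] n unfolding a_def by (intro add_left_mono mult_left_mono) auto
          also have "\<dots> = 2 * \<nu> * (ip f f / (2 * \<nu>) + (\<nu> / 2) * y (n + 1))"
            using assms(1) by (simp add: field_simps power2_eq_square)
          finally have U: "ip f a \<le> ip f f / (2 * \<nu>) + (\<nu> / 2) * y (n + 1)" using assms(1) by simp
          have "0 \<le> \<gamma> * ((1 - r) * (1 - r))" using assms(2) pos[of "1 - r"] by simp
          then have V: "\<gamma> * r \<le> \<gamma> / 2 + (\<gamma> / 2) * (r * r)" by (simp add: algebra_simps)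
          show ?thesis by (rule mult_left_mono) (use U V k in linarith)+
        qed
        also have "\<dots> = k * (2 * ip f f / \<nu> + 2 * \<gamma>) - k * (2 * \<nu> * y (n + 1) + 2 * \<gamma> * (r * r))"
          using assms(1) by (simp add: field_simps)
        \<comment> \<open>Of the remaining \<open>2 * \<nu> * y\<close>, one half is kept; the other
          half pays, by the Poincare inequality, for the damping of the vorticity in
          \<open>x\<close>.\<close>
        also have "\<dots> \<le> k * C - k * (\<nu> * y (n + 1) + m * x (n + 1))"
        proof (intro diff_mono mult_left_mono C(2))
          have "m * ip a a \<le> \<nu> * y (n + 1)"
            using m poin[of "n + 1"] n ip_nonneg[of a] assms(1) unfolding a_def by (intro mult_mono) auto
          moreover have "m * (r * r) \<le> 2 * \<gamma> * (r * r)" using m by (intro mult_right_mono) auto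
          ultimately show "\<nu> * y (n + 1) + m * x (n + 1) \<le> 2 * \<nu> * y (n + 1) + 2 * \<gamma> * (r * r)"
            unfolding x_def a_def r_def distrib_left by linarith
        qed (use k in auto)
        finally show "E (Suc n) + k * \<nu> * y (Suc n) + k * m * x (Suc n) \<le> E n + k * C"
          by (simp add: algebra_simps)
      qed
      have ab: "2 * \<bar>ip (\<omega> i) (\<omega> j)\<bar> \<le> ip (\<omega> i) (\<omega> i) + ip (\<omega> j) (\<omega> j)" for i j
        using ip_square_diff[OF L[of i] L[of j]] ip_square_add[OF L[of i] L[of j], of 1]
          ip_nonneg[of "\<lambda>p. \<omega> i p - \<omega> j p"] ip_nonneg[of "\<lambda>p. \<omega> i p + 1 * \<omega> j p"] by simp
      have abq: "2 * \<bar>s * t\<bar> \<le> s * s + t * t" for s t :: real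
        using pos[of "s - t"] pos[of "s + t"] by (simp add: algebra_simps abs_le_iff)
      \<comment> \<open>\<open>E n - x n\<close> is the square of twice the current minus the
        previous level, for the vorticity and for \<open>q\<close>. The 7 is the coefficient 5 plus
        2 from Young's inequality for the mixed term.\<close>
      have h2: "\<forall>n\<ge>1. x n \<le> E n \<and> E n \<le> 7 * (x n + x (n - 1))"
      proof (intro allI impI conjI)
        fix n :: nat
        have "0 \<le> ip (\<lambda>p. \<omega> (n - 1) p + (- 2) * \<omega> n p) (\<lambda>p. \<omega> (n - 1) p + (- 2) * \<omega> n p)" by (rule ip_nonneg)
        then have 1: "0 \<le> ip (\<omega> (n - 1)) (\<omega> (n - 1)) - 4 * ip (\<omega> n) (\<omega> (n - 1)) + 4 * ip (\<omega> n) (\<omega> n)"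
          unfolding ip_square_add[OF L L] using ip_commute[of "\<omega> n" "\<omega> (n - 1)"] by simp
        have 2: "0 \<le> q (n - 1) * q (n - 1) - 4 * (q n * q (n - 1)) + 4 * (q n * q n)"
          using pos[of "q (n - 1) - 2 * q n"] by (simp add: algebra_simps)
        show "x n \<le> E n" unfolding x_def E_def Gform_def using 1 2 by linarith
        show "E n \<le> 7 * (x n + x (n - 1))"
          unfolding x_def E_def Gform_def distrib_left
          using ab[of n "n - 1"] abq[of "q n" "q (n - 1)"] ip_nonneg[of "\<omega> n"] ip_nonneg[of "\<omega> (n - 1)"]
            pos[of "q n"] pos[of "q (n - 1)"] by linarith
      qed
      have h4: "\<forall>n\<ge>1. D n \<le> 2 * (x n + x (n - 1))"
      proof (intro allI impI)
        fix n :: nat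
        show "D n \<le> 2 * (x n + x (n - 1))"
          unfolding D_def x_def ip_square_diff[OF L L] distrib_left
          using ab[of n "n - 1"] pos[of "q n"] pos[of "q (n - 1)"] by linarith
      qed
      have E1: "E 1 \<le> e" unfolding E_def e_def using init by simp
      \<comment> \<open>From \<open>n = 3\<close> on the levels \<open>n - 1\<close>,
        \<open>n\<close> and \<open>n + 1\<close> all lie in \<open>H1p0\<close>: level
        \<open>n\<close> is then admissible as a test function, and the advection bound needs
        \<open>n\<close> and \<open>n - 1\<close>.\<close>
      have h3: "\<forall>n\<ge>3. 3 * D (Suc n) - D n + 2 * \<nu> * k * (y (Suc n) - y n)
        \<le> k\<^sup>2 * C * (1 + x (Suc n) * (1 + y n + y (n - 1))\<^sup>2)"
      proof (intro allI impI)
        fix n :: nat assume n: "3 \<le> n"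
        define a b c where "a = \<omega> (n + 1)" and "b = \<omega> n" and "c = \<omega> (n - 1)"
        define r where "r = q (n + 1)"
        define s where "s = 1 + y n + y (n - 1)"
        have aL: "a \<in> L2 Omega" "b \<in> L2 Omega" "c \<in> L2 Omega" unfolding a_def b_def c_def by (rule L)+
        have aH: "a \<in> H1p0" "b \<in> H1p0" "c \<in> H1p0" unfolding a_def b_def c_def using H n by auto
        have n1: "n \<ge> 1" using n by simp
        have wa: "(3 * ip a a - 4 * ip b a + ip c a) / (2 * k) + \<nu> * y (n + 1) + r * A n a = ip f a"
          using eqw[OF n1 aH(1)] ip_bdf2[where \<omega> = \<omega> and v = a and k = k and n = n, OF L aL(1)] unfolding a_def b_def c_def r_def y_def by simp
        have wb: "(3 * ip a b - 4 * ip b b + ip c b) / (2 * k) + \<nu> * ip (grad a) (grad b) + r * A n b = ip f b"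
          using eqw[OF n1 aH(2)] ip_bdf2[where \<omega> = \<omega> and v = b and k = k and n = n, OF L aL(2)] unfolding a_def b_def c_def r_def by simp
        define D' where "D' = D (n + 1)"
        have D': "D' = ip a a - 2 * ip a b + ip b b"
          unfolding D'_def D_def a_def b_def using ip_square_diff[OF L L] by simp
        have Dn: "D n = ip b b - 2 * ip b c + ip c c"
          unfolding D_def b_def c_def by (rule ip_square_diff[OF L L])
        \<comment> \<open>The inner product of two consecutive increments:
          \<open>3 a - 4 b + c\<close> equals \<open>3 (a - b) - (b - c)\<close>, so testing with
          \<open>a - b\<close> gives \<open>3 * D' - I\<close>.\<close>
        define I where "I = ip a b - ip b b - ip a c + ip b c"
        have I: "2 * I \<le> D' + D n"
        proof -
          define d d' where "d p = b p - c p" and "d' p = a p - b p" for p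
          have dL: "d \<in> L2 Omega" "d' \<in> L2 Omega" unfolding d_def d'_def by (intro L2_diff aL)+
          have "ip d' d = ip a d - ip b d" unfolding d'_def by (rule ip_diff_left[OF aL(1,2) dL(1)])
          moreover have "ip a d = ip a b - ip a c" "ip b d = ip b b - ip b c"
            using ip_diff_left[OF aL(2,3,1)] ip_diff_left[OF aL(2,3,2)] unfolding d_def[symmetric, abs_def]
            by (simp_all add: d_def[abs_def] ip_commute[of a] ip_commute[of b "\<lambda>p. b p - c p"] ip_commute[of c b])
          ultimately have "ip d' d = I" unfolding I_def by simp
          moreover have "0 \<le> ip d' d' - 2 * ip d' d + ip d d"
            using ip_square_diff[OF dL(2,1)] ip_nonneg[of "\<lambda>p. d' p - d p"] by simp
          moreover have "ip d' d' = D'" "ip d d = D n"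
            unfolding D'_def D_def d_def d'_def a_def b_def c_def by simp_all
          ultimately show ?thesis by simp
        qed
        have D'p: "D' \<ge> 0" using nonneg[of "n + 1"] unfolding D'_def by simp
        have sD: "L2norm (\<lambda>p. a p - b p) = sqrt D'" unfolding L2norm_def D'_def D_def a_def b_def by simp
        have Aab: "\<bar>A n a - A n b\<bar> \<le> M * s * sqrt D'"
          using adv[rule_format, of n \<omega> \<psi> a b \<beta>] n1 st aH unfolding A_def M_def s_def y_def sD[symmetric] b_def c_def by simp
        have fab: "\<bar>ip f a - ip f b\<bar> \<le> L2norm f * sqrt D'"
        proof -
          have "ip f a - ip f b = ip f (\<lambda>p. a p - b p)"
            using ip_diff_left[OF aL(1,2) assms(4)] by (simp add: ip_commute[of f])
          then show ?thesis using ip_Cauchy_Schwarz[OF assms(4) L2_diff[OF aL(1,2)]] unfolding sD by simp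
        qed
        have "(3 * ip a a - 4 * ip b a + ip c a) - (3 * ip a b - 4 * ip b b + ip c b) = 3 * D' - I"
          unfolding D' I_def using ip_commute[of a b] ip_commute[of a c] ip_commute[of b c] by simp
        then have eq: "(3 * D' - I) + 2 * k * \<nu> * (y (n + 1) - ip (grad a) (grad b)) = 2 * k * ((ip f a - ip f b) - r * (A n a - A n b))"
          using wa wb k by (simp add: field_simps)
        \<comment> \<open>Twice the gradient term exceeds the increment of \<open>y\<close> by the
          squared gradient of \<open>a - b\<close>.\<close>
        have ygrad: "y (n + 1) - y n \<le> 2 * (y (n + 1) - ip (grad a) (grad b))"
        proof -
          have "2 * ip (grad a) (grad b) \<le> y (n + 1) + y n"
            using ip_grad_le[OF H1p0_H1p[OF aH(1)] H1p0_H1p[OF aH(2)]] abs_ge_self[of "ip (grad a) (grad b)"]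
            unfolding y_def a_def[symmetric] b_def[symmetric] by simp
          then show ?thesis by simp
        qed
        have "k * \<nu> * (y (n + 1) - y n) \<le> k * \<nu> * (2 * (y (n + 1) - ip (grad a) (grad b)))"
          using k assms(1) by (intro mult_left_mono ygrad) auto
        then have "(5 / 2 * D' - D n / 2) + k * \<nu> * (y (n + 1) - y n) \<le> 2 * k * ((ip f a - ip f b) - r * (A n a - A n b))"
          using eq I by (simp add: algebra_simps)
        also have "\<dots> \<le> 2 * k * (L2norm f * sqrt D' + \<bar>r\<bar> * (M * s * sqrt D'))"
        proof (intro mult_left_mono)
          have "\<bar>r * (A n a - A n b)\<bar> \<le> \<bar>r\<bar> * (M * s * sqrt D')"
            unfolding abs_mult by (intro mult_left_mono Aab) simp
          then show "(ip f a - ip f b) - r * (A n a - A n b) \<le> L2norm f * sqrt D' + \<bar>r\<bar> * (M * s * sqrt D')"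
            using fab by linarith
        qed (use k in simp)
        also have "\<dots> = 2 * ((k * (L2norm f + \<bar>r\<bar> * M * s)) * sqrt D')" by (simp add: algebra_simps)
        \<comment> \<open>Young's inequality gives up one of the \<open>5 / 2\<close> copies of
          \<open>D'\<close>; doubling what remains produces the coefficients 3 and 1 of the
          claim.\<close>
        also have "\<dots> \<le> (k * (L2norm f + \<bar>r\<bar> * M * s))\<^sup>2 + D'"
          using sum_squares_bound[of "k * (L2norm f + \<bar>r\<bar> * M * s)" "sqrt D'"] D'p by (simp add: mult.assoc)
        also have "(k * (L2norm f + \<bar>r\<bar> * M * s))\<^sup>2 \<le> k\<^sup>2 * (2 * (ip f f + (r * r) * M\<^sup>2 * s\<^sup>2))"
        proof -
          have "(u + v)\<^sup>2 \<le> 2 * (u\<^sup>2 + v\<^sup>2)" for u v :: real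
            using pos[of "u - v"] by (simp add: power2_eq_square algebra_simps)
          from this[of "L2norm f" "\<bar>r\<bar> * M * s"]
          have "(L2norm f + \<bar>r\<bar> * M * s)\<^sup>2 \<le> 2 * (ip f f + (r * r) * M\<^sup>2 * s\<^sup>2)"
            by (simp add: L2norm_sq power_mult_distrib power2_eq_square[of r])
          then show ?thesis unfolding power_mult_distrib by (intro mult_left_mono) auto
        qed
        finally have *: "3 * D' - D n + 2 * \<nu> * k * (y (n + 1) - y n) \<le> k\<^sup>2 * (4 * (ip f f + (r * r) * M\<^sup>2 * s\<^sup>2))"
          by (simp add: algebra_simps)
        have "4 * (ip f f + (r * r) * M\<^sup>2 * s\<^sup>2) \<le> C * (1 + x (n + 1) * s\<^sup>2)"
        proof -
          \<comment> \<open>The scalar multiplies the nonlinear term, and the energy controls its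
            square; this is why \<open>x\<close> enters the growth inequality.\<close>
          have "r * r \<le> x (n + 1)" unfolding x_def r_def using ip_nonneg[of "\<omega> (n + 1)"] by simp
          then have rs: "(r * r) * s\<^sup>2 \<le> x (n + 1) * s\<^sup>2" by (intro mult_right_mono) auto
          have "4 * M\<^sup>2 * ((r * r) * s\<^sup>2) \<le> C * (x (n + 1) * s\<^sup>2)"
            by (rule mult_mono) (use rs C ff in auto)
          moreover have "4 * ip f f \<le> C" by (rule order_trans[OF _ C(3)]) simp
          ultimately show ?thesis by (simp add: algebra_simps)
        qed
        then have "k\<^sup>2 * (4 * (ip f f + (r * r) * M\<^sup>2 * s\<^sup>2)) \<le> k\<^sup>2 * (C * (1 + x (n + 1) * s\<^sup>2))"
          by (intro mult_left_mono) auto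
        with * show "3 * D (Suc n) - D n + 2 * \<nu> * k * (y (Suc n) - y n)
          \<le> k\<^sup>2 * C * (1 + x (Suc n) * (1 + y n + y (n - 1))\<^sup>2)"
          unfolding D'_def s_def by (simp add: mult.assoc)
      qed
      have yB: "y n \<le> B" if "n \<ge> N" for n
        using NB[rule_format, of E y x D n] h1 h2 h3 h4 E1 nonneg that by blast
      have Hn: "\<omega> n \<in> H1p" "\<omega> (n - 1) \<in> H1p" using H H1p0_H1p n N by auto
      have "Gnorm_sq (grad (\<omega> n)) (grad (\<omega> (n - 1))) = 5 / 4 * y n - ip (grad (\<omega> n)) (grad (\<omega> (n - 1))) + 1 / 4 * y (n - 1)"
        unfolding Gnorm_sq_def L2norm_sq y_def ..
      \<comment> \<open>Young's inequality for the mixed term gives \<open>7 / 4\<close> of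
        \<open>y n\<close> plus \<open>3 / 4\<close> of \<open>y (n - 1)\<close>, which is at most
        \<open>5 / 2 * B\<close>.\<close>
      also have "\<dots> \<le> 3 * B"
        using ip_grad_le[OF Hn] yB[of n] yB[of "n - 1"] n unfolding y_def[symmetric] by linarith
      also have "\<dots> \<le> 3 * B * ((R0 \<nu> \<gamma> f) ^ 18 + (L2norm f)\<^sup>2 + 1)"
      proof -
        \<comment> \<open>The even power is a square, so the bracket is at least 1.\<close>
        have "0 \<le> ((R0 \<nu> \<gamma> f) ^ 9)\<^sup>2" by simp
        then have "0 \<le> (R0 \<nu> \<gamma> f) ^ 18" by (simp flip: power_mult)
        then have "1 \<le> (R0 \<nu> \<gamma> f) ^ 18 + (L2norm f)\<^sup>2 + 1" by simp
        then show ?thesis using B mult_left_mono[of 1 _ "3 * B"] by simp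
      qed
      finally show "Gnorm_sq (grad (\<omega> n)) (grad (\<omega> (n - 1))) \<le> 3 * B * ((R0 \<nu> \<gamma> f) ^ 18 + (L2norm f)\<^sup>2 + 1)" .
    qed
  qed
qed

end
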